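(* Let $\mathbb{F}$ be $\mathbb{R}$ or $\mathbb{C}$, and let $E=(\mathbb{F}^\infty,\mathsf m)$ be a normed space such that $\mathrm{Age}(E)$ has the (SARP$^+$) and $\mathrm{Age}(\widehat E)_{\mathsf m}$ is an amalgamation class. Let $k,m\in\mathbb{N}$, $\varepsilon>0$, $\lambda>1$, and let $(K,d_K)$ be a compact metric space. Then there is $X\in\mathrm{Age}(\widehat E)_{\mathsf m}$ such that: (1) for every $1$-Lipschitz $c:\mathcal{L}^k_\lambda(E_k,X)\to K$ there is $R\in\mathrm{Emb}(E_m,X)$ such that the quotient map $\pi:\mathcal{L}^k_{<\lambda}(E_k,\widehat E)\to\mathcal{L}^k_{<\lambda}(E_k,\widehat E)/\!/\mathrm{Iso}(\widehat E)$ is an $\varepsilon$-factor of $c$ in $R\circ\mathcal{L}^k_{<\lambda}(E_k,E_m)$; (2) for every $1$-Lipschitz $c:(\mathrm{Gr}(k,X),\Lambda_X)\to K$ there is $V\in\mathrm{Gr}(m,X)\cap\mathrm{Age}(\widehat E)_{\mathsf m}$ such that the quotient map $\pi:\mathrm{Gr}(k,\widehat E)\to\mathrm{Gr}(k,\widehat E)/\!/\mathrm{Iso}(\widehat E)$ is an $\varepsilon$-factor of $c$ in $\mathrm{Gr}(k,V)$; (3) for every $1$-Lipschitz $c:\mathcal{L}^{k,\mathrm{w}^*}_\lambda(X^*,X)\to K$ there are $R_0,R_1\in\mathrm{Emb}(E_m,X)$ such that the quotient map $\pi:\mathcal{L}^{k,\mathrm{w}^*}_{<\lambda}(\widehat E^*,\widehat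 E)\to\mathcal{L}^{k,\mathrm{w}^*}_{<\lambda}(\widehat E^*,\widehat E)/\!/\mathrm{Iso}(\widehat E)^2$ is an $\varepsilon$-factor of $c$ in $R_0\circ\mathcal{L}^{k,\mathrm{w}^*}_{<\lambda}(E_m^*,E_m)\circ R_1^*$.
   Context: $\mathbb{F}^\infty$ is the space of eventually zero sequences in $\mathbb{F}$ with unit basis $(u_n)_n$. $E_n=(\langle u_j\rangle_{j<n},\mathsf m)$. $\mathrm{Age}(F)$ is the family of finite-dimensional subspaces of a normed space $F$; $\mathrm{Age}(F)_{\mathsf m}$ is the family of subspaces of $F$ isometric to some $E_n$. $\mathrm{Emb}(X,Y)$: linear isometric embeddings; $\mathrm{Emb}_\delta(X,Y)$ ($\delta\ge0$): linear $T:X\to Y$ with $(1+\delta)^{-1}\|x\|\le\|Tx\|\le(1+\delta)\|x\|$ for all $x$; both carry the operator norm distance. $\mathrm{Iso}(F)$ is the group of linear surjective isometries of $F$. A family $\mathcal G$ of finite-dimensional normed spaces has the Steady Approximate Ramsey Property$^+$ (SARP$^+$) if for every $k\in\mathbb{N}$ and $\varepsilon>0$ there is $\delta>0$ such that if $X,Y\in\mathcal G$ and $\dim X=k$ then there is $Z\in\mathcal G$ such that for every $1$-Lipschitz $c:\mathrm{Emb}_\delta(X,Z)\to[0,1]$ there is $\gamma\in\mathrm{Emb}(Y,Z)$ such that $|c(S)-c(S')|\le\varepsilon$ for all $S,S'\in\gamma\circ\mathrm{Emb}_\delta(X,Y)$. $\mathcal G$ is an amalgamation class if $\{0\}\in\mathcal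 G$ and for every $\varepsilon>0$, $k\in\mathbb{N}$ there is $\delta>0$ such that if $X\in\mathcal G$ has dimension $k$, $Y,Z\in\mathcal G$, $\gamma\in\mathrm{Emb}_\delta(X,Y)$, $\eta\in\mathrm{Emb}_\delta(X,Z)$, then there are $V\in\mathcal G$, $i\in\mathrm{Emb}(Y,V)$, $j\in\mathrm{Emb}(Z,V)$ with $\|i\circ\gamma-j\circ\eta\|\le\varepsilon$; the (SARP$^+$) implies this. A Banach space $F$ is Fraïssé if for every $\varepsilon>0$ and $k$ there is $\delta>0$ such that for every $k$-dimensional $X\in\mathrm{Age}(F)$ and all $\gamma,\eta\in\mathrm{Emb}_\delta(X,F)$ there is $g\in\mathrm{Iso}(F)$ with $\|g\circ\eta-\gamma\|\le\varepsilon$. When $\mathrm{Age}(E)$ is an amalgamation class, $\widehat E$ denotes its Fraïssé limit: the unique (existing by the known Fraïssé correspondence) separable Fraïssé Banach space such that the family of subspaces of $\widehat E$ isometric to some element of $\mathrm{Age}(E)$ is dense in $\mathrm{Age}(\widehat E)$ for the Hausdorff distance between unit balls. For a finite-rank operator $T:X\to Y$, $\|T^{-1}\|=\min\{a\ge0:\mathrm{Ball}(T(X))\subseteq a\,T(\mathrm{Ball}(X))\}$. $\mathcal{L}^k_\lambda(X,Y)$ (resp. $\mathcal{L}^k_{<\lambda}(X,Y)$) is the set of bounded linear $T:X\to Y$ of rank $k$ with $\|T\|,\|T^{-1}\|\le\lambda$ (resp. $<\lambda$), with the operator norm distance. $\mathcal{L}^{k,\mathrm w^*}(X^*,X)$ is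 the set of rank-$k$ operators $T:X^*\to X$ of the form $T=T_0\circ T_1^*$ with $T_0,T_1$ linear of rank $k$ from $\mathbb{F}^k$ (identified with its dual) to $X$; subscripts $\lambda$, $<\lambda$ have the same meaning. $\mathrm{Gr}(k,F)$ is the set of $k$-dimensional subspaces of $F$ and $\Lambda_F(U,W)$ is the Hausdorff distance in $F$ between the unit balls of $U,W$. When $X\subseteq\widehat E$ with inclusion $\iota$, an operator $T$ into $X$ is viewed as an operator into $\widehat E$, and $T\in\mathcal{L}^{k,\mathrm w^*}(X^*,X)$ is viewed as $\iota\circ T\circ\iota^*\in\mathcal{L}^{k,\mathrm w^*}(\widehat E^*,\widehat E)$. Actions by isometries: $\mathrm{Iso}(\widehat E)$ acts on operators $E_k\to\widehat E$ by $g\cdot T=g\circ T$ and on $\mathrm{Gr}(k,\widehat E)$ by $g\cdot V=g(V)$; $\mathrm{Iso}(\widehat E)^2$ acts on $\mathcal{L}^{k,\mathrm w^*}(\widehat E^*,\widehat E)$ by $(g,h)\cdot T=g\circ T\circ h^*$. For a group $G$ acting by isometries on a metric space $(M,d)$, $M/\!/G$ is the set of closures $[p]$ of $G$-orbits with metric $\widetilde d([p],[q])=\inf\{d(p_0,q_0):p_0\in[p],q_0\in[q]\}$. If $c$ is a map to $K$ defined on a set containing $M_0\subseteq M$, a $1$-Lipschitz map $\pi:M\to P$ is an $\varepsilon$-factor of $c$ in $M_0$ if there is a $1$-Lipschitz $\widetilde c:P\to K$ with $d_K(c(x),\widetilde c(\pi(x)))\le\varepsilon$ for all $x\in M_0$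.
   Formalization: The Fraïssé limit of Age(E) is additionally required to contain an isometric copy of every member of Age(E); the density condition alone also holds for the space {0}, so uniqueness fails and the claim is false there. *)

theory Defs
  imports "HOL-Analysis.Analysis" "HOL-Library.Poly_Mapping" "HOL-Library.FuncSet"
begin

section \<open>The scalar field\<close>

text \<open>The real or the complex numbers, up to isometric isomorphism: either every scalar is a real
  multiple of 1, or there is an imaginary unit and the norm is the usual modulus.\<close>

class real_or_complex = real_normed_field +
  assumes real_or_complex:
    "(\<forall>z. \<exists>x. z = x *\<^sub>R 1) \<or>
     (\<exists>i. i * i = - 1 \<and> (\<forall>z. \<exists>x y. z = x *\<^sub>R 1 + y *\<^sub>R i) \<and>
          (\<forall>x y. norm (x *\<^sub>R 1 + y *\<^sub>R i) = sqrt (x\<^sup>2 + y\<^sup>2)))"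

instance real :: real_or_complex
  by standard simp

instance complex :: real_or_complex
proof
  have "\<i> * \<i> = - 1 \<and> (\<forall>z. \<exists>x y. z = x *\<^sub>R 1 + y *\<^sub>R \<i>) \<and>
      (\<forall>x y. norm (x *\<^sub>R 1 + y *\<^sub>R \<i>) = sqrt (x\<^sup>2 + y\<^sup>2))"
  proof (intro conjI allI)
    fix z :: complex
    show "\<exists>x y. z = x *\<^sub>R 1 + y *\<^sub>R \<i>"
      by (intro exI[of _ "Re z"] exI[of _ "Im z"]) (simp add: complex_eq_iff)
  qed (simp_all add: cmod_def)
  then show "(\<forall>z::complex. \<exists>x. z = x *\<^sub>R 1) \<or>
     (\<exists>i::complex. i * i = - 1 \<and> (\<forall>z. \<exists>x y. z = x *\<^sub>R 1 + y *\<^sub>R i) \<and>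
          (\<forall>x y. norm (x *\<^sub>R 1 + y *\<^sub>R i) = sqrt (x\<^sup>2 + y\<^sup>2)))"
    by blast
qed


section \<open>Normed spaces\<close>

text \<open>A normed space is carried by a subspace of an ambient vector space. Several norms live on the
  same ambient space, so the norm is a field of the record instead of the one of a type class.\<close>

record ('f, 'v) nspace =
  vecs :: "'v set"
  smul :: "'f \<Rightarrow> 'v \<Rightarrow> 'v"
  nrm :: "'v \<Rightarrow> real"

definition normed_space :: "('f::real_or_complex, 'v::ab_group_add) nspace \<Rightarrow> bool" where
  "normed_space X \<longleftrightarrow>
     vector_space (smul X) \<and> module.subspace (smul X) (vecs X) \<and>
     (\<forall>x\<in>vecs X. 0 \<le> nrm X x) \<and>
     (\<forall>x\<in>vecs X. nrm X x = 0 \<longleftrightarrow> x = 0) \<and>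
     (\<forall>x\<in>vecs X. \<forall>y\<in>vecs X. nrm X (x + y) \<le> nrm X x + nrm X y) \<and>
     (\<forall>a. \<forall>x\<in>vecs X. nrm X (smul X a x) = norm a * nrm X x)"

definition sub :: "('f, 'v) nspace \<Rightarrow> 'v set \<Rightarrow> ('f, 'v) nspace" where
  "sub F U = F\<lparr>vecs := U\<rparr>"

definition ndim :: "('f::real_or_complex, 'v::ab_group_add) nspace \<Rightarrow> nat" where
  "ndim X = vector_space.dim (smul X) (vecs X)"

definition unit_ball :: "('f, 'v) nspace \<Rightarrow> 'v set" where
  "unit_ball X = {x \<in> vecs X. nrm X x \<le> 1}"

text \<open>The finite generating set is demanded because the library's dimension of an
  infinite-dimensional space is 0.\<close>

definition Gr :: "nat \<Rightarrow> ('f::real_or_complex, 'v::ab_group_add) nspace \<Rightarrow> 'v set set" where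
  "Gr k F = {U. U \<subseteq> vecs F \<and> module.subspace (smul F) U \<and>
                (\<exists>B. finite B \<and> U = module.span (smul F) B) \<and> vector_space.dim (smul F) U = k}"

definition Age :: "('f::real_or_complex, 'v::ab_group_add) nspace \<Rightarrow> ('f, 'v) nspace set" where
  "Age F = (\<Union>k. sub F ` Gr k F)"

text \<open>Hausdorff distance between the unit balls of two subspaces.\<close>

definition ball_dist :: "('f, 'v::ab_group_add) nspace \<Rightarrow> 'v set \<Rightarrow> 'v set \<Rightarrow> real" where
  "ball_dist F U W =
     max (SUP x\<in>unit_ball (sub F U). INF y\<in>unit_ball (sub F W). nrm F (x - y))
         (SUP y\<in>unit_ball (sub F W). INF x\<in>unit_ball (sub F U). nrm F (x - y))"


section \<open>Operators\<close>

text \<open>Operators are extensional: they are \<open>undefined\<close> off their domain, so that each operator is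
  represented by exactly one function. As the target is not part of the function, an operator into a
  subspace is literally an operator into the whole space.\<close>

definition lin_maps ::
  "('f \<Rightarrow> 'v::ab_group_add \<Rightarrow> 'v) \<Rightarrow> 'v set \<Rightarrow> ('f \<Rightarrow> 'w::ab_group_add \<Rightarrow> 'w) \<Rightarrow> 'w set \<Rightarrow> ('v \<Rightarrow> 'w) set"
  where
  "lin_maps s U s' W = {T \<in> U \<rightarrow>\<^sub>E W.
     (\<forall>x\<in>U. \<forall>y\<in>U. T (x + y) = T x + T y) \<and> (\<forall>a. \<forall>x\<in>U. T (s a x) = s' a (T x))}"

definition lin :: "('f, 'v::ab_group_add) nspace \<Rightarrow> ('f, 'w::ab_group_add) nspace \<Rightarrow> ('v \<Rightarrow> 'w) set" where
  "lin X Y = lin_maps (smul X) (vecs X) (smul Y) (vecs Y)"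

definition bounded_on :: "('f, 'v) nspace \<Rightarrow> ('f, 'w) nspace \<Rightarrow> ('v \<Rightarrow> 'w) \<Rightarrow> bool" where
  "bounded_on X Y T \<longleftrightarrow> (\<exists>a. \<forall>x\<in>vecs X. nrm Y (T x) \<le> a * nrm X x)"

definition op_norm :: "('f, 'v) nspace \<Rightarrow> ('f, 'w) nspace \<Rightarrow> ('v \<Rightarrow> 'w) \<Rightarrow> real" where
  "op_norm X Y T = Inf {a. 0 \<le> a \<and> (\<forall>x\<in>vecs X. nrm Y (T x) \<le> a * nrm X x)}"

definition op_dist ::
  "('f, 'v) nspace \<Rightarrow> ('f, 'w::ab_group_add) nspace \<Rightarrow> ('v \<Rightarrow> 'w) \<Rightarrow> ('v \<Rightarrow> 'w) \<Rightarrow> real" where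
  "op_dist X Y S T = op_norm X Y (\<lambda>x. S x - T x)"

text \<open>The quantity \<open>\<parallel>T\<^sup>-\<^sup>1\<parallel>\<close> of a finite-rank operator \<open>T\<close>, which need not be injective:
  the least \<open>a \<ge> 0\<close> with \<open>Ball (T(X)) \<subseteq> a T(Ball X)\<close>.\<close>

definition inv_norm ::
  "('f::real_or_complex, 'v) nspace \<Rightarrow> ('f, 'w) nspace \<Rightarrow> ('v \<Rightarrow> 'w) \<Rightarrow> real" where
  "inv_norm X Y T = Inf {a. 0 \<le> a \<and>
     unit_ball (sub Y (T ` vecs X)) \<subseteq> (\<lambda>x. smul Y (of_real a) (T x)) ` unit_ball X}"

definition Emb :: "('f, 'v::ab_group_add) nspace \<Rightarrow> ('f, 'w::ab_group_add) nspace \<Rightarrow> ('v \<Rightarrow> 'w) set" where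
  "Emb X Y = {T \<in> lin X Y. \<forall>x\<in>vecs X. nrm Y (T x) = nrm X x}"

definition Emb_delta ::
  "real \<Rightarrow> ('f, 'v::ab_group_add) nspace \<Rightarrow> ('f, 'w::ab_group_add) nspace \<Rightarrow> ('v \<Rightarrow> 'w) set" where
  "Emb_delta \<delta> X Y = {T \<in> lin X Y. \<forall>x\<in>vecs X.
     nrm X x / (1 + \<delta>) \<le> nrm Y (T x) \<and> nrm Y (T x) \<le> (1 + \<delta>) * nrm X x}"

definition Iso :: "('f, 'v::ab_group_add) nspace \<Rightarrow> ('v \<Rightarrow> 'v) set" where
  "Iso F = {g \<in> Emb F F. g ` vecs F = vecs F}"

definition isometric :: "('f, 'v::ab_group_add) nspace \<Rightarrow> ('f, 'w::ab_group_add) nspace \<Rightarrow> bool" where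
  "isometric X Y \<longleftrightarrow> (\<exists>T\<in>Emb X Y. T ` vecs X = vecs Y)"

text \<open>The bounded linear operators of rank \<open>k\<close>, and those among them with
  \<open>\<parallel>T\<parallel>, \<parallel>T\<^sup>-\<^sup>1\<parallel> \<le> l\<close> (\<open>< l\<close>, respectively).\<close>

definition Lk :: "nat \<Rightarrow> ('f::real_or_complex, 'v::ab_group_add) nspace \<Rightarrow>
    ('f, 'w::ab_group_add) nspace \<Rightarrow> ('v \<Rightarrow> 'w) set" where
  "Lk k X Y = {T \<in> lin X Y. bounded_on X Y T \<and> T ` vecs X \<in> Gr k Y}"

definition Lk_le :: "nat \<Rightarrow> real \<Rightarrow> ('f::real_or_complex, 'v::ab_group_add) nspace \<Rightarrow>
    ('f, 'w::ab_group_add) nspace \<Rightarrow> ('v \<Rightarrow> 'w) set" where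
  "Lk_le k l X Y = {T \<in> Lk k X Y. op_norm X Y T \<le> l \<and> inv_norm X Y T \<le> l}"

definition Lk_less :: "nat \<Rightarrow> real \<Rightarrow> ('f::real_or_complex, 'v::ab_group_add) nspace \<Rightarrow>
    ('f, 'w::ab_group_add) nspace \<Rightarrow> ('v \<Rightarrow> 'w) set" where
  "Lk_less k l X Y = {T \<in> Lk k X Y. op_norm X Y T < l \<and> inv_norm X Y T < l}"


section \<open>Eventually zero sequences\<close>

definition fs_scale :: "'f::real_or_complex \<Rightarrow> (nat \<Rightarrow>\<^sub>0 'f) \<Rightarrow> (nat \<Rightarrow>\<^sub>0 'f)" where
  "fs_scale a = Poly_Mapping.map ((*) a)"

abbreviation unit_vec :: "nat \<Rightarrow> (nat \<Rightarrow>\<^sub>0 'f::real_or_complex)" where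
  "unit_vec j \<equiv> Poly_Mapping.single j 1"

text \<open>The span of the first \<open>k\<close> unit vectors; it also serves as \<open>\<bbbF>\<^sup>k\<close>.\<close>

definition coord_space :: "nat \<Rightarrow> (nat \<Rightarrow>\<^sub>0 'f::real_or_complex) set" where
  "coord_space k = module.span fs_scale (unit_vec ` {..<k})"

definition seq_space :: "((nat \<Rightarrow>\<^sub>0 'f::real_or_complex) \<Rightarrow> real) \<Rightarrow> ('f, nat \<Rightarrow>\<^sub>0 'f) nspace" where
  "seq_space \<mu> = \<lparr>vecs = UNIV, smul = fs_scale, nrm = \<mu>\<rparr>"

definition fin_seq_space ::
  "((nat \<Rightarrow>\<^sub>0 'f::real_or_complex) \<Rightarrow> real) \<Rightarrow> nat \<Rightarrow> ('f, nat \<Rightarrow>\<^sub>0 'f) nspace" where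
  "fin_seq_space \<mu> n = sub (seq_space \<mu>) (coord_space n)"

definition Age_std :: "((nat \<Rightarrow>\<^sub>0 'f::real_or_complex) \<Rightarrow> real) \<Rightarrow>
    ('f, 'v::ab_group_add) nspace \<Rightarrow> ('f, 'v) nspace set" where
  "Age_std \<mu> F = {X \<in> Age F. \<exists>n. isometric (fin_seq_space \<mu> n) X}"


section \<open>Duals and weak-star operators of finite rank\<close>

definition dual :: "('f::real_or_complex, 'v::ab_group_add) nspace \<Rightarrow> ('f, 'v \<Rightarrow> 'f) nspace" where
  "dual X =
     \<lparr>vecs = {f \<in> lin_maps (smul X) (vecs X) (*) UNIV. \<exists>a. \<forall>x\<in>vecs X. norm (f x) \<le> a * nrm X x},
      smul = (\<lambda>a f. \<lambda>x\<in>vecs X. a * f x),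
      nrm = (\<lambda>f. Inf {a. 0 \<le> a \<and> (\<forall>x\<in>vecs X. norm (f x) \<le> a * nrm X x)})\<rparr>"

text \<open>The adjoint \<open>X\<^sup>* \<rightarrow> \<bbbF>\<^sup>k\<close> of \<open>T : \<bbbF>\<^sup>k \<rightarrow> X\<close>, where a functional \<open>\<phi>\<close> on \<open>\<bbbF>\<^sup>k\<close> is
  identified with the vector \<open>(\<phi>(u\<^sub>j))\<^sub>j\<close>; the identification is bilinear also over the
  complex numbers.\<close>

definition coord_adjoint ::
  "nat \<Rightarrow> ((nat \<Rightarrow>\<^sub>0 'f::real_or_complex) \<Rightarrow> 'v) \<Rightarrow> ('v \<Rightarrow> 'f) \<Rightarrow> (nat \<Rightarrow>\<^sub>0 'f)" where
  "coord_adjoint k T f = (\<Sum>j<k. Poly_Mapping.single j (f (T (unit_vec j))))"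

definition rank_from_coord ::
  "nat \<Rightarrow> ('f::real_or_complex, 'v::ab_group_add) nspace \<Rightarrow> ((nat \<Rightarrow>\<^sub>0 'f) \<Rightarrow> 'v) set" where
  "rank_from_coord k X =
     {T \<in> lin_maps fs_scale (coord_space k) (smul X) (vecs X). T ` coord_space k \<in> Gr k X}"

definition Lkw :: "nat \<Rightarrow> ('f::real_or_complex, 'v::ab_group_add) nspace \<Rightarrow> (('v \<Rightarrow> 'f) \<Rightarrow> 'v) set" where
  "Lkw k X = {T. T ` vecs (dual X) \<in> Gr k X \<and>
     (\<exists>T\<^sub>0\<in>rank_from_coord k X. \<exists>T\<^sub>1\<in>rank_from_coord k X.
        T = (\<lambda>f\<in>vecs (dual X). T\<^sub>0 (coord_adjoint k T\<^sub>1 f)))}"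

definition Lkw_le ::
  "nat \<Rightarrow> real \<Rightarrow> ('f::real_or_complex, 'v::ab_group_add) nspace \<Rightarrow> (('v \<Rightarrow> 'f) \<Rightarrow> 'v) set" where
  "Lkw_le k l X = {T \<in> Lkw k X. op_norm (dual X) X T \<le> l \<and> inv_norm (dual X) X T \<le> l}"

definition Lkw_less ::
  "nat \<Rightarrow> real \<Rightarrow> ('f::real_or_complex, 'v::ab_group_add) nspace \<Rightarrow> (('v \<Rightarrow> 'f) \<Rightarrow> 'v) set" where
  "Lkw_less k l X = {T \<in> Lkw k X. op_norm (dual X) X T < l \<and> inv_norm (dual X) X T < l}"

text \<open>For \<open>R\<^sub>0, R\<^sub>1 : X \<rightarrow> Y\<close> and \<open>T : X\<^sup>* \<rightarrow> X\<close>, the operator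
  \<open>R\<^sub>0 \<circ> T \<circ> R\<^sub>1\<^sup>* : Y\<^sup>* \<rightarrow> Y\<close>; here \<open>R\<^sub>1\<^sup>* f = f \<circ> R\<^sub>1\<close>.\<close>

definition conj_op :: "('f::real_or_complex, 'v::ab_group_add) nspace \<Rightarrow> ('f, 'w::ab_group_add) nspace \<Rightarrow>
    ('v \<Rightarrow> 'w) \<Rightarrow> ('v \<Rightarrow> 'w) \<Rightarrow> (('v \<Rightarrow> 'f) \<Rightarrow> 'v) \<Rightarrow> (('w \<Rightarrow> 'f) \<Rightarrow> 'w)" where
  "conj_op X Y R\<^sub>0 R\<^sub>1 T = (\<lambda>f\<in>vecs (dual Y). R\<^sub>0 (T (compose (vecs X) f R\<^sub>1)))"


section \<open>Quotients and factors\<close>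

text \<open>In the following, metric spaces are given by a carrier and a distance function.\<close>

definition lip1 :: "'a set \<Rightarrow> ('a \<Rightarrow> 'a \<Rightarrow> real) \<Rightarrow> 'b set \<Rightarrow> ('b \<Rightarrow> 'b \<Rightarrow> real) \<Rightarrow> ('a \<Rightarrow> 'b) \<Rightarrow> bool" where
  "lip1 M d N d' f \<longleftrightarrow> f \<in> M \<rightarrow> N \<and> (\<forall>x\<in>M. \<forall>y\<in>M. d' (f x) (f y) \<le> d x y)"

definition orbit_closure ::
  "'a set \<Rightarrow> ('a \<Rightarrow> 'a \<Rightarrow> real) \<Rightarrow> 'g set \<Rightarrow> ('g \<Rightarrow> 'a \<Rightarrow> 'a) \<Rightarrow> 'a \<Rightarrow> 'a set" where
  "orbit_closure M d G act p = {q \<in> M. \<forall>e>0. \<exists>g\<in>G. d (act g p) q < e}"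

definition quot :: "'a set \<Rightarrow> ('a \<Rightarrow> 'a \<Rightarrow> real) \<Rightarrow> 'g set \<Rightarrow> ('g \<Rightarrow> 'a \<Rightarrow> 'a) \<Rightarrow> 'a set set" where
  "quot M d G act = orbit_closure M d G act ` M"

definition quot_dist :: "('a \<Rightarrow> 'a \<Rightarrow> real) \<Rightarrow> 'a set \<Rightarrow> 'a set \<Rightarrow> real" where
  "quot_dist d A B = Inf {d p q |p q. p \<in> A \<and> q \<in> B}"

text \<open>The map \<open>\<pi> : M \<rightarrow> P\<close> is an \<open>\<epsilon>\<close>-factor of the \<open>K\<close>-valued \<open>c\<close> in \<open>M\<^sub>0\<close>. The map
  \<open>j\<close> is the identification through which \<open>M\<^sub>0\<close> is viewed as a subset of \<open>M\<close>.\<close>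

definition eps_factor :: "real \<Rightarrow> 'a set \<Rightarrow> ('a \<Rightarrow> 'a \<Rightarrow> real) \<Rightarrow> 'p set \<Rightarrow> ('p \<Rightarrow> 'p \<Rightarrow> real) \<Rightarrow> ('a \<Rightarrow> 'p) \<Rightarrow>
    'k::metric_space set \<Rightarrow> ('b \<Rightarrow> 'k) \<Rightarrow> 'b set \<Rightarrow> ('b \<Rightarrow> 'a) \<Rightarrow> bool" where
  "eps_factor \<epsilon> M d P d\<^sub>P \<pi> K c M\<^sub>0 j \<longleftrightarrow>
     j ` M\<^sub>0 \<subseteq> M \<and> lip1 M d P d\<^sub>P \<pi> \<and>
     (\<exists>c'. lip1 P d\<^sub>P K dist c' \<and> (\<forall>x\<in>M\<^sub>0. dist (c x) (c' (\<pi> (j x))) \<le> \<epsilon>))"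

text \<open>The case of the quotient map \<open>\<pi> : M \<rightarrow> M // G\<close>.\<close>

definition quot_eps_factor :: "real \<Rightarrow> 'a set \<Rightarrow> ('a \<Rightarrow> 'a \<Rightarrow> real) \<Rightarrow> 'g set \<Rightarrow> ('g \<Rightarrow> 'a \<Rightarrow> 'a) \<Rightarrow>
    'k::metric_space set \<Rightarrow> ('b \<Rightarrow> 'k) \<Rightarrow> 'b set \<Rightarrow> ('b \<Rightarrow> 'a) \<Rightarrow> bool" where
  "quot_eps_factor \<epsilon> M d G act K c M\<^sub>0 j \<longleftrightarrow>
     eps_factor \<epsilon> M d (quot M d G act) (quot_dist d) (orbit_closure M d G act) K c M\<^sub>0 j"


section \<open>Ramsey property, amalgamation and Fraisse limits\<close>

definition SARP_plus :: "('f::real_or_complex, 'v::ab_group_add) nspace set \<Rightarrow> bool" where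
  "SARP_plus \<G> \<longleftrightarrow> (\<forall>k::nat. \<forall>\<epsilon>>0. \<exists>\<delta>>0. \<forall>X\<in>\<G>. \<forall>Y\<in>\<G>. ndim X = k \<longrightarrow>
     (\<exists>Z\<in>\<G>. \<forall>c::('v \<Rightarrow> 'v) \<Rightarrow> real. lip1 (Emb_delta \<delta> X Z) (op_dist X Z) {0..1} dist c \<longrightarrow>
        (\<exists>\<gamma>\<in>Emb Y Z. \<forall>S\<in>compose (vecs X) \<gamma> ` Emb_delta \<delta> X Y.
           \<forall>S'\<in>compose (vecs X) \<gamma> ` Emb_delta \<delta> X Y. \<bar>c S - c S'\<bar> \<le> \<epsilon>)))"

definition amalgamation_class :: "('f::real_or_complex, 'v::ab_group_add) nspace set \<Rightarrow> bool" where
  "amalgamation_class \<G> \<longleftrightarrow> (\<exists>X\<in>\<G>. vecs X = {0}) \<and>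
     (\<forall>\<epsilon>>0. \<forall>k::nat. \<exists>\<delta>>0. \<forall>X\<in>\<G>. \<forall>Y\<in>\<G>. \<forall>Z\<in>\<G>. ndim X = k \<longrightarrow>
        (\<forall>\<gamma>\<in>Emb_delta \<delta> X Y. \<forall>\<eta>\<in>Emb_delta \<delta> X Z.
           \<exists>V\<in>\<G>. \<exists>i\<in>Emb Y V. \<exists>j\<in>Emb Z V.
             op_dist X V (compose (vecs X) i \<gamma>) (compose (vecs X) j \<eta>) \<le> \<epsilon>))"

definition fraisse :: "('f::real_or_complex, 'v::ab_group_add) nspace \<Rightarrow> bool" where
  "fraisse F \<longleftrightarrow> (\<forall>\<epsilon>>0. \<forall>k::nat. \<exists>\<delta>>0. \<forall>X\<in>Age F. ndim X = k \<longrightarrow>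
     (\<forall>\<gamma>\<in>Emb_delta \<delta> X F. \<forall>\<eta>\<in>Emb_delta \<delta> X F.
        \<exists>g\<in>Iso F. op_dist X F (compose (vecs X) g \<eta>) \<gamma> \<le> \<epsilon>))"

text \<open>If this is a normed space, then \<open>s (of_real r) x = r *\<^sub>R x\<close>: both sides are additive and
  continuous in \<open>r\<close> and agree for \<open>r = 1\<close>.\<close>

definition banach_nspace :: "('f \<Rightarrow> 'b::banach \<Rightarrow> 'b) \<Rightarrow> ('f, 'b) nspace" where
  "banach_nspace s = \<lparr>vecs = UNIV, smul = s, nrm = norm\<rparr>"

text \<open>The predicate holds for \<open>s\<close> if the Banach space \<open>'b\<close> with scalar multiplication \<open>s\<close> is the
  Fraisse limit of \<open>Age E\<close>. The limit contains an isometric copy of each member of \<open>Age E\<close>. This has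
  to be required: the density condition alone also holds for the trivial space.\<close>

definition fraisse_limit ::
  "('f::real_or_complex, 'v::ab_group_add) nspace \<Rightarrow> ('f \<Rightarrow> 'b::banach \<Rightarrow> 'b) \<Rightarrow> bool" where
  "fraisse_limit E s \<longleftrightarrow> (let F = banach_nspace s in
     normed_space F \<and> separable_space (euclidean :: 'b topology) \<and> fraisse F \<and>
     (\<forall>X\<in>Age E. Emb X F \<noteq> {}) \<and>
     (\<forall>U\<in>Age F. \<forall>\<epsilon>>0. \<exists>U'\<in>Age F. (\<exists>X\<in>Age E. isometric X U') \<and>
        ball_dist F (vecs U) (vecs U') < \<epsilon>))"

end

theory Submission
  imports Defs
begin

text \<open>Write \<open>F\<close> for the Fraisse limit. The objects of all three kinds are described by tuples of \<open>k\<close>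
  vectors: an operator on \<open>E\<^sub>k\<close> by the images of the unit vectors, a \<open>k\<close>-dimensional subspace by a
  basis, and a weak-star operator by two tuples \<open>v\<close> and \<open>w\<close>, as \<open>f \<mapsto> \<Sum>\<^sub>j f(w\<^sub>j) v\<^sub>j\<close>. Up to
  isometry, a tuple \<open>v\<close> is the norm \<open>x \<mapsto> \<parallel>\<Sum>\<^sub>j x\<^sub>j v\<^sub>j\<parallel>\<close> on \<open>\<bbbF>\<^sup>k\<close> (\<open>tnorm\<close>), and operators of small
  distortion on the span of \<open>v\<close> are tuples whose norm is close to that of \<open>v\<close> (\<open>near\<close>).

  The Ramsey property then says that a Lipschitz function of the tuples in \<open>E\<^sub>n\<close> that are near a
  given independent tuple is almost constant on a copy of \<open>E\<^sub>N\<close> (\<open>ramsey_tuple\<close>). By iteration over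
  a finite net the same holds for pairs of tuples and independent embeddings
  (\<open>ramsey_tuple_pair\<close>), and for finitely many pairs and functions at once (\<open>ramsey_tests\<close>).

  In \<open>F\<close> tuples with equal norms are almost moved to each other by isometries. Hence the orbit
  closure of an object in a copy of \<open>E\<^sub>n\<close> only depends on its tuples in \<open>E\<^sub>n\<close>
  (\<open>oc_independent\<close>), and a colouring that is almost constant near each pair of tuples is almost a
  function of the orbit closure. For the Lipschitz constant 1, two orbit closures at distance
  \<open>r\<close> are realised by tuples that lie in one \<open>E\<^sub>n\<close> and describe objects at distance almost
  \<open>r\<close> in every embedding (\<open>close_representatives\<close>).

  The radius of almost constancy depends on the tuples, so the conclusion is reached through
  compactness (\<open>ramsey_factor\<close>). If there were bad colourings on arbitrarily large \<open>E\<^sub>n\<close>, then for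
  every finite set of tests a bad colouring, composed with embeddings, would pass these tests. A
  cluster point of these colourings is exactly a 1-Lipschitz function on the quotient. On a finite
  net of the objects in \<open>E\<^sub>m\<close> it approximates one of the bad colourings, which thus is
  not bad. As this argument works for all large \<open>n\<close>, one copy of \<open>E\<^sub>n\<close> in \<open>F\<close> serves the three
  kinds of objects (\<open>common_copy\<close>).\<close>


section \<open>Scalars\<close>

text \<open>Compactness of balls follows from two bounded real coordinates. They exist over both fields, with
  \<open>e = 0\<close> over the reals.\<close>

lemma scalar_two_generated:
  "\<exists>e::'f::real_or_complex. \<forall>z. \<exists>x y. z = x *\<^sub>R 1 + y *\<^sub>R e \<and> \<bar>x\<bar> \<le> norm z \<and> \<bar>y\<bar> \<le> norm z"
  using real_or_complex[where 'a = 'f]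
proof (elim disjE exE conjE)
  assume *: "\<forall>z::'f. \<exists>x. z = x *\<^sub>R 1"
  show ?thesis
  proof (rule exI[of _ 0], rule allI)
    fix z :: 'f
    from * obtain x where "z = x *\<^sub>R 1" by blast
    then show "\<exists>x y. z = x *\<^sub>R 1 + y *\<^sub>R 0 \<and> \<bar>x\<bar> \<le> norm z \<and> \<bar>y\<bar> \<le> norm z"
      by (intro exI[of _ x] exI[of _ 0]) simp
  qed
next
  fix i :: 'f
  assume "i * i = - 1" and rep: "\<forall>z. \<exists>x y. z = x *\<^sub>R 1 + y *\<^sub>R i"
    and nrm: "\<forall>x y. norm (x *\<^sub>R 1 + y *\<^sub>R i) = sqrt (x\<^sup>2 + y\<^sup>2)"
  show ?thesis
  proof (rule exI[of _ i], rule allI)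
    fix z :: 'f
    from rep obtain x y where z: "z = x *\<^sub>R 1 + y *\<^sub>R i" by blast
    have "norm z = sqrt (x\<^sup>2 + y\<^sup>2)"
      unfolding z using nrm by blast
    then have "\<bar>x\<bar> \<le> norm z" "\<bar>y\<bar> \<le> norm z"
      by (simp_all add: real_le_rsqrt)
    with z show "\<exists>x y. z = x *\<^sub>R 1 + y *\<^sub>R i \<and> \<bar>x\<bar> \<le> norm z \<and> \<bar>y\<bar> \<le> norm z"
      by blast
  qed
qed

lemma compact_cball_scalar: "compact (cball (0::'f::real_or_complex) r)"
proof -
  obtain e :: 'f where e: "\<And>z. \<exists>x y. z = x *\<^sub>R 1 + y *\<^sub>R e \<and> \<bar>x\<bar> \<le> norm z \<and> \<bar>y\<bar> \<le> norm z"
    using scalar_two_generated by blast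
  let ?h = "\<lambda>(x, y). x *\<^sub>R 1 + y *\<^sub>R e"
  have "compact (?h ` ({- r..r} \<times> {- r..r}))"
    by (intro compact_continuous_image compact_Times)
      (auto intro!: continuous_intros simp: case_prod_beta)
  moreover have "cball 0 r \<subseteq> ?h ` ({- r..r} \<times> {- r..r})"
  proof
    fix z :: 'f assume "z \<in> cball 0 r"
    then have "norm z \<le> r" by simp
    obtain x y where "z = x *\<^sub>R 1 + y *\<^sub>R e" "\<bar>x\<bar> \<le> norm z" "\<bar>y\<bar> \<le> norm z" using e by blast
    with \<open>norm z \<le> r\<close> show "z \<in> ?h ` ({- r..r} \<times> {- r..r})"
      by (auto intro!: image_eqI[of _ _ "(x, y)"])
  qed
  ultimately have "compact (?h ` ({- r..r} \<times> {- r..r}) \<inter> cball 0 r)"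
    by (intro compact_Int_closed) auto
  with \<open>cball 0 r \<subseteq> _\<close> show ?thesis by (simp add: Int_absorb1)
qed

lemma Cauchy_convergent_scalar:
  fixes X :: "nat \<Rightarrow> 'f::real_or_complex"
  assumes "Cauchy X"
  shows "\<exists>L. X \<longlonglongrightarrow> L"
proof -
  from cauchy_imp_bounded[OF assms] obtain r where "\<forall>x\<in>range X. norm x \<le> r"
    by (auto simp: bounded_iff)
  then have "\<forall>n. X n \<in> cball 0 r" by auto
  with compact_imp_complete[OF compact_cball_scalar[of r]] assms show ?thesis
    unfolding complete_def by blast
qed

lemma finite_code_representatives:
  assumes "finite (code ` A)"
  shows "\<exists>B\<subseteq>A. finite B \<and> (\<forall>a\<in>A. \<exists>b\<in>B. code a = code b)"
proof -
  from assms obtain B where "B \<subseteq> A" "finite B" "code ` A = code ` B"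
    by (metis finite_subset_image order_refl)
  then show ?thesis by (intro exI[of _ B]) (metis imageE imageI)
qed

text \<open>The points of the net belong to \<open>A\<close>: later the members of a net have to be admissible
  themselves.\<close>

lemma finite_net_of_bounded_scalars:
  fixes \<phi> :: "'a \<Rightarrow> 'i \<Rightarrow> 'f::real_or_complex"
  assumes "finite I" and bd: "\<And>a i. a \<in> A \<Longrightarrow> i \<in> I \<Longrightarrow> norm (\<phi> a i) \<le> r" and "0 < \<eta>"
  shows "\<exists>B\<subseteq>A. finite B \<and> (\<forall>a\<in>A. \<exists>b\<in>B. \<forall>i\<in>I. norm (\<phi> a i - \<phi> b i) < \<eta>)"
proof -
  have "0 < \<eta> / 2" using \<open>0 < \<eta>\<close> by simp
  moreover have "compact (cball (0::'f) r)" by (rule compact_cball_scalar)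
  ultimately obtain Z :: "'f set" where Z: "finite Z"
    "cball 0 r \<subseteq> (\<Union>z\<in>Z. ball z (\<eta> / 2))"
    unfolding compact_eq_totally_bounded by blast
  define cd where "cd z = (SOME z'. z' \<in> Z \<and> dist z' z < \<eta> / 2)" for z :: 'f
  have cd: "cd z \<in> Z \<and> dist (cd z) z < \<eta> / 2" if "norm z \<le> r" for z
  proof -
    from that Z(2) have "\<exists>z'. z' \<in> Z \<and> dist z' z < \<eta> / 2" by force
    then show ?thesis unfolding cd_def by (rule someI_ex)
  qed
  define code where "code a = (\<lambda>i\<in>I. cd (\<phi> a i))" for a
  have "code ` A \<subseteq> I \<rightarrow>\<^sub>E Z"
    unfolding code_def using cd bd by auto
  moreover have "finite (I \<rightarrow>\<^sub>E Z)" using \<open>finite I\<close> Z(1) by (intro finite_PiE)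
  ultimately have "finite (code ` A)" by (rule finite_subset)
  from finite_code_representatives[OF this] obtain B where B: "B \<subseteq> A" "finite B"
    "\<And>a. a \<in> A \<Longrightarrow> \<exists>b\<in>B. code a = code b" by blast
  have "\<exists>b\<in>B. \<forall>i\<in>I. norm (\<phi> a i - \<phi> b i) < \<eta>" if "a \<in> A" for a
  proof -
    from B(3)[OF that] obtain b where b: "b \<in> B" "code a = code b" by blast
    have "norm (\<phi> a i - \<phi> b i) < \<eta>" if "i \<in> I" for i
    proof -
      have "cd (\<phi> a i) = cd (\<phi> b i)"
        using b(2) that unfolding code_def by (metis restrict_apply')
      moreover have "dist (cd (\<phi> a i)) (\<phi> a i) < \<eta> / 2" "dist (cd (\<phi> b i)) (\<phi> b i) < \<eta> / 2"
        using cd bd \<open>a \<in> A\<close> b(1) B(1) that by blast+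
      ultimately have "dist (\<phi> a i) (\<phi> b i) < \<eta>"
        by (metis dist_commute dist_triangle_half_r)
      then show ?thesis by (simp add: dist_norm)
    qed
    with b(1) show ?thesis by blast
  qed
  with B(1,2) show ?thesis by blast
qed


section \<open>Tuples and their norms\<close>

definition comb :: "('f::real_or_complex \<Rightarrow> 'v::ab_group_add \<Rightarrow> 'v) \<Rightarrow> nat \<Rightarrow> (nat \<Rightarrow> 'v) \<Rightarrow> (nat \<Rightarrow> 'f) \<Rightarrow> 'v"
  where "comb s k v x = (\<Sum>j<k. s (x j) (v j))"

definition tuple :: "('f::real_or_complex, 'v::ab_group_add) nspace \<Rightarrow> nat \<Rightarrow> (nat \<Rightarrow> 'v) \<Rightarrow> bool"
  where "tuple X k v \<longleftrightarrow> (\<forall>j<k. v j \<in> vecs X)"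

text \<open>The norm that \<open>v\<close> induces on the coefficients; equality of these norms is isometry of tuples.\<close>

definition tnorm :: "('f::real_or_complex, 'v::ab_group_add) nspace \<Rightarrow> nat \<Rightarrow> (nat \<Rightarrow> 'v) \<Rightarrow> (nat \<Rightarrow> 'f) \<Rightarrow> real"
  where "tnorm X k v x = nrm X (comb (smul X) k v x)"

definition near :: "real \<Rightarrow> ((nat \<Rightarrow> 'f) \<Rightarrow> real) \<Rightarrow> ((nat \<Rightarrow> 'f) \<Rightarrow> real) \<Rightarrow> bool"
  where "near \<delta> N N' \<longleftrightarrow> (\<forall>x. N x \<le> (1 + \<delta>) * N' x \<and> N' x \<le> (1 + \<delta>) * N x)"

text \<open>For \<open>N = tnorm X k v\<close> this is linear independence of \<open>v\<close>. It is a condition on \<open>N\<close> because the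
  tuples will only be known through their norms.\<close>

definition nondeg :: "nat \<Rightarrow> ((nat \<Rightarrow> 'f::real_or_complex) \<Rightarrow> real) \<Rightarrow> bool"
  where "nondeg k N \<longleftrightarrow> (\<exists>c>0. \<forall>x. \<forall>j<k. norm (x j) \<le> c * N x)"

definition tdist :: "('f, 'v::ab_group_add) nspace \<Rightarrow> nat \<Rightarrow> (nat \<Rightarrow> 'v) \<Rightarrow> (nat \<Rightarrow> 'v) \<Rightarrow> real"
  where "tdist X k v w = (\<Sum>j<k. nrm X (v j - w j))"

lemma near_sym: "near \<delta> N N' \<longleftrightarrow> near \<delta> N' N"
  by (auto simp: near_def)

lemma near_refl: "0 \<le> \<delta> \<Longrightarrow> (\<And>x. 0 \<le> N x) \<Longrightarrow> near \<delta> N N"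
  unfolding near_def
  using mult_right_mono[of 1 "1 + \<delta>" "N _"] by auto

lemma near_mono:
  assumes "near \<delta> N N'" "\<delta> \<le> \<delta>'" "\<And>x. 0 \<le> N x" "\<And>x. 0 \<le> N' x"
  shows "near \<delta>' N N'"
  unfolding near_def
proof (intro allI conjI)
  fix x
  have "N x \<le> (1 + \<delta>) * N' x" "N' x \<le> (1 + \<delta>) * N x" using assms(1) by (auto simp: near_def)
  moreover have "(1 + \<delta>) * N' x \<le> (1 + \<delta>') * N' x" "(1 + \<delta>) * N x \<le> (1 + \<delta>') * N x"
    using assms by (auto intro!: mult_right_mono)
  ultimately show "N x \<le> (1 + \<delta>') * N' x" "N' x \<le> (1 + \<delta>') * N x" by linarith+
qed

lemma near_trans:
  assumes "near \<delta> N N'" "near \<delta>' N' N''" "0 \<le> \<delta>" "0 \<le> \<delta>'"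
  shows "near (\<delta> + \<delta>' + \<delta> * \<delta>') N N''"
  unfolding near_def
proof (intro allI conjI)
  fix x
  have e: "1 + (\<delta> + \<delta>' + \<delta> * \<delta>') = (1 + \<delta>) * (1 + \<delta>')" by (simp add: algebra_simps)
  have "N x \<le> (1 + \<delta>) * N' x" "N' x \<le> (1 + \<delta>') * N'' x"
    using assms by (auto simp: near_def)
  then show "N x \<le> (1 + (\<delta> + \<delta>' + \<delta> * \<delta>')) * N'' x"
    unfolding e mult.assoc using assms(3) by (meson add_nonneg_nonneg mult_left_mono order_trans zero_le_one)
  have "N'' x \<le> (1 + \<delta>') * N' x" "N' x \<le> (1 + \<delta>) * N x"
    using assms by (auto simp: near_def)
  then show "N'' x \<le> (1 + (\<delta> + \<delta>' + \<delta> * \<delta>')) * N x"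
    unfolding e mult.assoc mult.left_commute[of "1 + \<delta>"]
    using assms(4) by (meson add_nonneg_nonneg mult_left_mono order_trans zero_le_one)
qed

lemma nondeg_le:
  assumes "nondeg k N" "0 < a" "\<And>x. N x \<le> a * N' x"
  shows "nondeg k N'"
proof -
  from assms(1) obtain c where c: "0 < c" "\<And>x j. j < k \<Longrightarrow> norm (x j) \<le> c * N x"
    unfolding nondeg_def by blast
  have "norm (x j) \<le> (c * a) * N' x" if "j < k" for x j
    using c(2)[OF that, of x] assms(3)[of x] c(1)
    by (metis mult.assoc mult_left_mono less_imp_le order_trans)
  moreover have "0 < c * a" using c(1) assms(2) by simp
  ultimately show ?thesis unfolding nondeg_def by blast
qed

lemma nondeg_near: "nondeg k N \<Longrightarrow> near \<delta> N N' \<Longrightarrow> 0 \<le> \<delta> \<Longrightarrow> nondeg k N'"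
  by (rule nondeg_le[of k N "1 + \<delta>"]) (auto simp: near_def)

lemma comb_cong:
  "(\<And>j. j < k \<Longrightarrow> v j = v' j) \<Longrightarrow> (\<And>j. j < k \<Longrightarrow> x j = x' j) \<Longrightarrow> comb s k v x = comb s k v' x'"
  by (simp add: comb_def)


section \<open>Normed spaces\<close>

locale normed_nspace =
  fixes X :: "('f::real_or_complex, 'v::ab_group_add) nspace"
  assumes normed: "normed_space X"
begin

sublocale vector_space "smul X"
  using normed by (simp add: normed_space_def)

lemma subspace_vecs: "subspace (vecs X)"
  using normed by (simp add: normed_space_def)

lemmas vecs_0 [simp] = subspace_0[OF subspace_vecs]
lemmas vecs_add [simp] = subspace_add[OF subspace_vecs]
lemmas vecs_diff [simp] = subspace_diff[OF subspace_vecs]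
lemmas vecs_neg [simp] = subspace_neg[OF subspace_vecs]
lemmas vecs_scale [simp] = subspace_scale[OF subspace_vecs]

lemma vecs_sum: "(\<And>i. i \<in> I \<Longrightarrow> f i \<in> vecs X) \<Longrightarrow> sum f I \<in> vecs X"
  by (rule subspace_sum[OF subspace_vecs])

lemma nrm_nonneg [simp]: "x \<in> vecs X \<Longrightarrow> 0 \<le> nrm X x"
  using normed by (simp add: normed_space_def)

lemma nrm_eq_0 [simp]: "x \<in> vecs X \<Longrightarrow> nrm X x = 0 \<longleftrightarrow> x = 0"
  using normed by (simp add: normed_space_def)

lemma nrm_0 [simp]: "nrm X 0 = 0"
  by simp

lemma nrm_triangle: "x \<in> vecs X \<Longrightarrow> y \<in> vecs X \<Longrightarrow> nrm X (x + y) \<le> nrm X x + nrm X y"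
  using normed by (simp add: normed_space_def)

lemma nrm_scale [simp]: "x \<in> vecs X \<Longrightarrow> nrm X (smul X a x) = norm a * nrm X x"
  using normed by (simp add: normed_space_def)

lemma nrm_minus: "x \<in> vecs X \<Longrightarrow> nrm X (- x) = nrm X x"
  using nrm_scale[of x "- 1"] by simp

lemma nrm_diff_commute: "x \<in> vecs X \<Longrightarrow> y \<in> vecs X \<Longrightarrow> nrm X (x - y) = nrm X (y - x)"
  using nrm_minus[of "x - y"] by simp

lemma nrm_triangle_diff: "x \<in> vecs X \<Longrightarrow> y \<in> vecs X \<Longrightarrow> z \<in> vecs X \<Longrightarrow>
    nrm X (x - z) \<le> nrm X (x - y) + nrm X (y - z)"
  using nrm_triangle[of "x - y" "y - z"] by simp

lemma nrm_le_add_diff: "x \<in> vecs X \<Longrightarrow> y \<in> vecs X \<Longrightarrow> nrm X x \<le> nrm X y + nrm X (x - y)"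
  using nrm_triangle[of y "x - y"] by simp

lemma nrm_sum: "(\<And>i. i \<in> I \<Longrightarrow> f i \<in> vecs X) \<Longrightarrow> nrm X (sum f I) \<le> (\<Sum>i\<in>I. nrm X (f i))"
proof (induction I rule: infinite_finite_induct)
  case (insert i I)
  then have "nrm X (f i + sum f I) \<le> nrm X (f i) + nrm X (sum f I)"
    by (intro nrm_triangle vecs_sum) auto
  with insert show ?case by fastforce
qed auto

abbreviation "lcomb \<equiv> comb (smul X)"

lemma comb_vecs [simp]: "tuple X k v \<Longrightarrow> lcomb k v x \<in> vecs X"
  unfolding comb_def tuple_def by (intro vecs_sum) auto

lemma comb_add: "lcomb k v (\<lambda>j. x j + y j) = lcomb k v x + lcomb k v y"
  by (simp add: comb_def scale_left_distrib sum.distrib)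

lemma comb_diff: "lcomb k v (\<lambda>j. x j - y j) = lcomb k v x - lcomb k v y"
  by (simp add: comb_def scale_left_diff_distrib sum_subtractf)

lemma comb_scale: "lcomb k v (\<lambda>j. a * x j) = smul X a (lcomb k v x)"
  by (simp add: comb_def scale_sum_right)

lemma comb_tuple_diff: "lcomb k (\<lambda>j. v j - w j) x = lcomb k v x - lcomb k w x"
  by (simp add: comb_def scale_right_diff_distrib sum_subtractf)

lemma comb_Suc: "lcomb (Suc k) v x = lcomb k v x + smul X (x k) (v k)"
  by (simp add: comb_def)

lemma comb_unit: "i < k \<Longrightarrow> lcomb k v (\<lambda>j. if j = i then 1 else 0) = v i"
  by (simp add: comb_def if_distrib[of "\<lambda>a. smul X a _"] sum.delta cong: if_cong)

lemma nrm_comb_le: "tuple X k v \<Longrightarrow> nrm X (lcomb k v x) \<le> (\<Sum>j<k. norm (x j) * nrm X (v j))"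
  unfolding comb_def
  by (rule order_trans[OF nrm_sum]) (auto simp: tuple_def intro!: sum_mono)

lemma nrm_comb_diff_le:
  assumes "tuple X k v" "tuple X k w" "\<And>j. j < k \<Longrightarrow> norm (x j) \<le> b" "0 \<le> b"
  shows "nrm X (lcomb k v x - lcomb k w x) \<le> b * tdist X k v w"
proof -
  have t: "tuple X k (\<lambda>j. v j - w j)" using assms(1,2) by (simp add: tuple_def)
  have "nrm X (lcomb k v x - lcomb k w x) \<le> (\<Sum>j<k. norm (x j) * nrm X (v j - w j))"
    using nrm_comb_le[OF t] by (simp add: comb_tuple_diff)
  also have "\<dots> \<le> (\<Sum>j<k. b * nrm X (v j - w j))"
    using assms by (intro sum_mono mult_right_mono) (auto simp: tuple_def)
  finally show ?thesis by (simp add: tdist_def sum_distrib_left)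
qed

lemma tnorm_nonneg: "tuple X k v \<Longrightarrow> 0 \<le> tnorm X k v x"
  by (simp add: tnorm_def)

lemma tdist_nonneg: "tuple X k v \<Longrightarrow> tuple X k w \<Longrightarrow> 0 \<le> tdist X k v w"
  unfolding tdist_def by (intro sum_nonneg) (auto simp: tuple_def)

lemma tdist_commute: "tuple X k v \<Longrightarrow> tuple X k w \<Longrightarrow> tdist X k v w = tdist X k w v"
  unfolding tdist_def by (intro sum.cong) (auto simp: tuple_def nrm_diff_commute)

text \<open>The coefficients of a combination of independent vectors are bounded by its norm. Moving the
  vectors therefore changes the norm of each combination by a small multiple of itself.\<close>

lemma near_if_close:
  assumes "tuple X k v" "nondeg k (tnorm X k v)" "0 < \<delta>"
  shows "\<exists>\<eta>>0. \<forall>w. tuple X k w \<longrightarrow> tdist X k v w \<le> \<eta> \<longrightarrow> near \<delta> (tnorm X k v) (tnorm X k w)"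
proof -
  from assms(2) obtain c where c: "0 < c" "\<And>x j. j < k \<Longrightarrow> norm (x j) \<le> c * tnorm X k v x"
    unfolding nondeg_def by blast
  define \<eta> where "\<eta> = \<delta> / (c * (1 + \<delta>))"
  have "0 < \<eta>" using c(1) assms(3) by (simp add: \<eta>_def)
  moreover have "near \<delta> (tnorm X k v) (tnorm X k w)"
    if w: "tuple X k w" "tdist X k v w \<le> \<eta>" for w
    unfolding near_def
  proof (intro allI conjI)
    fix x
    let ?a = "tnorm X k v x" and ?b = "tnorm X k w x"
    have a0: "0 \<le> ?a" by (rule tnorm_nonneg[OF assms(1)])
    have "nrm X (lcomb k v x - lcomb k w x) \<le> (c * ?a) * tdist X k v w"
      using c a0 by (intro nrm_comb_diff_le assms w(1)) auto
    also have "\<dots> \<le> (c * ?a) * \<eta>"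
      using w(2) c(1) a0 by (intro mult_left_mono) auto
    also have "\<dots> = ?a * (\<delta> / (1 + \<delta>))" using c(1) by (simp add: \<eta>_def)
    finally have d: "nrm X (lcomb k v x - lcomb k w x) \<le> ?a * (\<delta> / (1 + \<delta>))" .
    have "?a \<le> ?b + ?a * (\<delta> / (1 + \<delta>))"
      using nrm_le_add_diff[OF comb_vecs[OF assms(1)] comb_vecs[OF w(1)], of x x] d
      by (simp add: tnorm_def)
    then have "(1 + \<delta>) * ?a \<le> (1 + \<delta>) * (?b + ?a * (\<delta> / (1 + \<delta>)))"
      using assms(3) by (intro mult_left_mono) auto
    also have "\<dots> = (1 + \<delta>) * ?b + ?a * \<delta>" using assms(3) by (simp add: field_simps)
    finally show "?a \<le> (1 + \<delta>) * ?b" by (simp add: algebra_simps)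
    have "?b \<le> ?a + ?a * (\<delta> / (1 + \<delta>))"
      using nrm_le_add_diff[OF comb_vecs[OF w(1)] comb_vecs[OF assms(1)], of x x] d
        nrm_diff_commute[OF comb_vecs[OF w(1)] comb_vecs[OF assms(1)], of x x]
      by (simp add: tnorm_def)
    also have "?a * (\<delta> / (1 + \<delta>)) \<le> ?a * \<delta>"
      using a0 assms(3) by (intro mult_left_mono) (auto simp: field_simps)
    finally show "?b \<le> (1 + \<delta>) * ?a" by (simp add: algebra_simps)
  qed
  ultimately show ?thesis by blast
qed

text \<open>By induction the span of the first \<open>k\<close> entries is complete, since coefficients are bounded by the
  norm; so the last entry has positive distance from it.\<close>

lemma independent_tuple_nondeg:
  assumes "tuple X k v" "\<And>x. lcomb k v x = 0 \<Longrightarrow> \<forall>j<k. x j = 0"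
  shows "nondeg k (tnorm X k v)"
  using assms
proof (induction k)
  case 0
  then show ?case by (auto simp: nondeg_def intro!: exI[of _ 1])
next
  case (Suc k)
  have tv: "tuple X k v" and vk: "v k \<in> vecs X" using Suc.prems(1) by (auto simp: tuple_def)
  have "\<forall>j<k. x j = 0" if "lcomb k v x = 0" for x
  proof -
    have "lcomb k v (x(k := 0)) = lcomb k v x" by (rule comb_cong) auto
    then have "lcomb (Suc k) v (x(k := 0)) = 0"
      using that by (simp add: comb_Suc)
    from Suc.prems(2)[OF this] show ?thesis by (metis fun_upd_other less_SucI less_irrefl)
  qed
  from Suc.IH[OF tv this] obtain c where c: "0 < c"
    "\<And>x j. j < k \<Longrightarrow> norm (x j) \<le> c * nrm X (lcomb k v x)"
    unfolding nondeg_def tnorm_def by blast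
  have "\<exists>e>0. \<forall>y. e \<le> nrm X (lcomb k v y + v k)"
  proof (rule ccontr)
    assume "\<not> ?thesis"
    then have "\<forall>i. \<exists>y. nrm X (lcomb k v y + v k) < inverse (real (Suc i))"
      by (meson inverse_positive_iff_positive not_le of_nat_0_less_iff zero_less_Suc)
    then obtain y where y: "\<And>i. nrm X (lcomb k v (y i) + v k) < inverse (real (Suc i))" by metis
    have yd: "norm (y i l - y j l) \<le> c * (inverse (real (Suc i)) + inverse (real (Suc j)))"
      if "l < k" for i j l
    proof -
      have "nrm X (lcomb k v (\<lambda>l. y i l - y j l)) =
          nrm X ((lcomb k v (y i) + v k) - (lcomb k v (y j) + v k))"
        by (simp add: comb_diff)
      also have "\<dots> \<le> nrm X (lcomb k v (y i) + v k) + nrm X (- (lcomb k v (y j) + v k))"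
        using nrm_triangle[of "lcomb k v (y i) + v k" "- (lcomb k v (y j) + v k)"] tv vk
        by (simp del: minus_add_distrib)
      also have "\<dots> \<le> inverse (real (Suc i)) + inverse (real (Suc j))"
        using y[of i] y[of j] nrm_minus[of "lcomb k v (y j) + v k"] tv vk
        by (simp del: minus_add_distrib)
      finally show ?thesis
        using c(2)[OF that, of "\<lambda>l. y i l - y j l"] c(1)
        by (meson less_imp_le mult_left_mono order_trans)
    qed
    have "\<exists>L. (\<lambda>i. y i l) \<longlonglongrightarrow> L" if "l < k" for l
    proof (rule Cauchy_convergent_scalar, rule metric_CauchyI)
      fix e :: real assume "0 < e"
      then have "0 < e / (2 * c)" using c(1) by simp
      then obtain n where n: "inverse (real (Suc n)) < e / (2 * c)"
        using reals_Archimedean by blast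
      have "dist (y i l) (y j l) < e" if "n \<le> i" "n \<le> j" for i j
      proof -
        have "inverse (real (Suc i)) \<le> inverse (real (Suc n))"
             "inverse (real (Suc j)) \<le> inverse (real (Suc n))"
          using that by (simp_all add: le_imp_inverse_le)
        then have "inverse (real (Suc i)) + inverse (real (Suc j)) < e / (2 * c) + e / (2 * c)"
          using n by linarith
        also have "\<dots> = e / c" by (simp add: field_simps)
        finally have "inverse (real (Suc i)) + inverse (real (Suc j)) < e / c" .
        then have "c * (inverse (real (Suc i)) + inverse (real (Suc j))) < e"
          using c(1) by (simp add: field_simps)
        with yd[OF \<open>l < k\<close>, of i j] show ?thesis by (simp add: dist_norm)
      qed
      then show "\<exists>M. \<forall>m\<ge>M. \<forall>n\<ge>M. dist (y m l) (y n l) < e" by blast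
    qed
    then obtain z where z: "\<And>l. l < k \<Longrightarrow> (\<lambda>i. y i l) \<longlonglongrightarrow> z l" by metis
    let ?w = "lcomb k v z + v k"
    have wv: "?w \<in> vecs X" using tv vk by simp
    have b: "nrm X ?w \<le> (\<Sum>l<k. norm (z l - y i l) * nrm X (v l)) + inverse (real (Suc i))" for i
    proof -
      have "nrm X ?w = nrm X (lcomb k v (\<lambda>l. z l - y i l) + (lcomb k v (y i) + v k))"
        by (simp add: comb_diff)
      also have "\<dots> \<le> nrm X (lcomb k v (\<lambda>l. z l - y i l)) + nrm X (lcomb k v (y i) + v k)"
        by (rule nrm_triangle) (use tv vk in simp_all)
      finally show ?thesis using nrm_comb_le[OF tv, of "\<lambda>l. z l - y i l"] y[of i] by linarith
    qed
    have "(\<lambda>i. (\<Sum>l<k. norm (z l - y i l) * nrm X (v l)) + inverse (real (Suc i)))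
        \<longlonglongrightarrow> (\<Sum>l<k. norm (z l - z l) * nrm X (v l)) + 0"
      by (intro tendsto_intros z LIMSEQ_inverse_real_of_nat) auto
    then have "nrm X ?w \<le> (\<Sum>l<k. norm (z l - z l) * nrm X (v l)) + 0"
      using b by (intro LIMSEQ_le_const) auto
    then have "?w = 0" using nrm_nonneg[OF wv] nrm_eq_0[OF wv] by simp
    moreover have "lcomb k v (z(k := 1)) = lcomb k v z" by (rule comb_cong) auto
    ultimately have "lcomb (Suc k) v (z(k := 1)) = 0" by (simp add: comb_Suc)
    from Suc.prems(2)[OF this] show False by auto
  qed
  then obtain e where e: "0 < e" "\<And>y. e \<le> nrm X (lcomb k v y + v k)" by blast
  have top: "norm (x k) \<le> nrm X (lcomb (Suc k) v x) / e" for x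
  proof (cases "x k = 0")
    case True
    then show ?thesis using e(1) comb_vecs[OF Suc.prems(1)] by simp
  next
    case False
    have "lcomb (Suc k) v x = smul X (x k) (lcomb k v (\<lambda>j. inverse (x k) * x j) + v k)"
      using False by (simp add: comb_Suc comb_scale scale_right_distrib)
    then have "nrm X (lcomb (Suc k) v x) = norm (x k) * nrm X (lcomb k v (\<lambda>j. inverse (x k) * x j) + v k)"
      using tv vk by simp
    also have "\<dots> \<ge> norm (x k) * e" using e(2) by (intro mult_left_mono) auto
    finally show ?thesis using e(1) by (simp add: field_simps)
  qed
  define C where "C = max (1 / e) (c * (1 + nrm X (v k) / e))"
  have "norm (x j) \<le> C * nrm X (lcomb (Suc k) v x)" if "j < Suc k" for x j
  proof (cases "j = k")
    case True
    have "norm (x k) \<le> (1 / e) * nrm X (lcomb (Suc k) v x)" using top[of x] by simp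
    also have "\<dots> \<le> C * nrm X (lcomb (Suc k) v x)"
      using comb_vecs[OF Suc.prems(1)] by (intro mult_right_mono) (auto simp: C_def)
    finally show ?thesis using True by simp
  next
    case False
    with that have "j < k" by simp
    have "lcomb k v x = lcomb (Suc k) v x - smul X (x k) (v k)" by (simp add: comb_Suc)
    then have "nrm X (lcomb k v x) \<le> nrm X (lcomb (Suc k) v x) + nrm X (- smul X (x k) (v k))"
      using nrm_triangle[of "lcomb (Suc k) v x" "- smul X (x k) (v k)"] comb_vecs[OF Suc.prems(1)] vk
      by simp
    also have "\<dots> = nrm X (lcomb (Suc k) v x) + norm (x k) * nrm X (v k)"
      using vk by (simp add: nrm_minus)
    also have "\<dots> \<le> nrm X (lcomb (Suc k) v x) + nrm X (lcomb (Suc k) v x) / e * nrm X (v k)"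
      using top[of x] vk by (intro add_left_mono mult_right_mono) auto
    also have "\<dots> = (1 + nrm X (v k) / e) * nrm X (lcomb (Suc k) v x)" by (simp add: algebra_simps)
    finally have "norm (x j) \<le> c * ((1 + nrm X (v k) / e) * nrm X (lcomb (Suc k) v x))"
      using c(2)[OF \<open>j < k\<close>, of x] c(1) by (meson less_imp_le mult_left_mono order_trans)
    also have "\<dots> \<le> C * nrm X (lcomb (Suc k) v x)"
      unfolding mult.assoc[symmetric] using comb_vecs[OF Suc.prems(1)]
      by (intro mult_right_mono) (auto simp: C_def)
    finally show ?thesis .
  qed
  moreover have "0 < C" using e(1) by (simp add: C_def less_max_iff_disj)
  ultimately show ?case unfolding nondeg_def tnorm_def by blast
qed

lemma span_tuple: "span (v ` {..<k}) = range (lcomb k v)"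
proof
  show "span (v ` {..<k}) \<subseteq> range (lcomb k v)"
  proof (rule span_minimal)
    show "v ` {..<k} \<subseteq> range (lcomb k v)"
      using comb_unit[symmetric] by blast
    show "subspace (range (lcomb k v))"
      unfolding subspace_def
    proof (intro conjI ballI allI)
      have "lcomb k v (\<lambda>_. 0) = 0" by (simp add: comb_def)
      then show "0 \<in> range (lcomb k v)" by (metis rangeI)
    next
      fix a b :: 'v assume "a \<in> range (lcomb k v)" "b \<in> range (lcomb k v)"
      then obtain x y where "a = lcomb k v x" "b = lcomb k v y" by blast
      then have "a + b = lcomb k v (\<lambda>j. x j + y j)" by (simp add: comb_add)
      then show "a + b \<in> range (lcomb k v)" by simp
    next
      fix c a assume "a \<in> range (lcomb k v)"
      then obtain x where "a = lcomb k v x" by blast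
      then have "smul X c a = lcomb k v (\<lambda>j. c * x j)" by (simp add: comb_scale)
      then show "smul X c a \<in> range (lcomb k v)" by simp
    qed
  qed
  show "range (lcomb k v) \<subseteq> span (v ` {..<k})"
  proof
    fix y assume "y \<in> range (lcomb k v)"
    then obtain x where "y = (\<Sum>j<k. smul X (x j) (v j))" unfolding comb_def by blast
    then show "y \<in> span (v ` {..<k})"
      by (auto intro!: span_sum span_scale intro: span_base)
  qed
qed

lemma nondeg_tuple_zero:
  assumes "nondeg k (tnorm X k v)" "lcomb k v x = 0" "j < k"
  shows "x j = 0"
proof -
  from assms(1) obtain c where "norm (x j) \<le> c * tnorm X k v x"
    unfolding nondeg_def using assms(3) by blast
  with assms(2) show ?thesis by (simp add: tnorm_def)
qed

lemma nondeg_tuple_inj: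
  assumes "nondeg k (tnorm X k v)" "lcomb k v x = lcomb k v y" "j < k"
  shows "x j = y j"
  using nondeg_tuple_zero[OF assms(1) _ assms(3), of "\<lambda>j. x j - y j"] assms(2)
  by (simp add: comb_diff)

lemma nondeg_basis:
  assumes "nondeg k (tnorm X k v)"
  shows "inj_on v {..<k}" "independent (v ` {..<k})"
proof -
  show inj: "inj_on v {..<k}"
  proof (rule inj_onI, rule ccontr)
    fix i j assume ij: "i \<in> {..<k}" "j \<in> {..<k}" "v i = v j" "i \<noteq> j"
    have "lcomb k v (\<lambda>l. if l = i then 1 else 0) = lcomb k v (\<lambda>l. if l = j then 1 else 0)"
      using ij by (simp add: comb_unit)
    from nondeg_tuple_inj[OF assms this, of i] ij show False by simp
  qed
  show "independent (v ` {..<k})"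
  proof (rule independent_if_scalars_zero)
    fix f x assume s: "(\<Sum>x\<in>v ` {..<k}. smul X (f x) x) = 0" and "x \<in> v ` {..<k}"
    then obtain j where j: "j < k" "x = v j" by blast
    have "lcomb k v (\<lambda>l. f (v l)) = 0"
      using s by (simp add: comb_def sum.reindex[OF inj])
    from nondeg_tuple_zero[OF assms this j(1)] j(2) show "f x = 0" by simp
  qed simp
qed

lemma Gr_tuple:
  assumes "tuple X k v" "nondeg k (tnorm X k v)"
  shows "range (lcomb k v) \<in> Gr k X"
proof -
  have "dim (range (lcomb k v)) = k"
    unfolding span_tuple[symmetric] dim_span
    using nondeg_basis[OF assms(2)] by (simp add: dim_eq_card_independent card_image)
  moreover have "subspace (range (lcomb k v))"
    unfolding span_tuple[symmetric] by (rule subspace_span)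
  moreover have "range (lcomb k v) \<subseteq> vecs X" using assms(1) by auto
  moreover have "\<exists>B. finite B \<and> range (lcomb k v) = span B"
    unfolding span_tuple[symmetric] by blast
  ultimately show ?thesis unfolding Gr_def by blast
qed

lemma basis_nondeg:
  assumes tv: "tuple X k v" and inj: "inj_on v {..<k}" and ind: "independent (v ` {..<k})"
  shows "nondeg k (tnorm X k v)"
proof (rule independent_tuple_nondeg[OF tv], intro allI impI)
  fix x j assume z: "lcomb k v x = 0" and "j < k"
  define u where "u b = x (the_inv_into {..<k} v b)" for b
  have uv: "u (v l) = x l" if "l < k" for l
    unfolding u_def using the_inv_into_f_f[OF inj] that by simp
  have "(\<Sum>b\<in>v ` {..<k}. smul X (u b) b) = (\<Sum>l<k. smul X (u (v l)) (v l))"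
    by (simp add: sum.reindex[OF inj])
  also have "\<dots> = 0" using z uv by (simp add: comb_def)
  finally have "u (v j) = 0"
    using independentD[OF ind _ order_refl, of u "v j"] \<open>j < k\<close> by blast
  then show "x j = 0" using uv \<open>j < k\<close> by simp
qed

text \<open>A spanning tuple of as many vectors as the dimension is a basis.\<close>

lemma Gr_nondeg:
  assumes tv: "tuple X k v" and Gr: "range (lcomb k v) \<in> Gr k X"
  shows "nondeg k (tnorm X k v)"
proof -
  let ?V = "v ` {..<k}"
  have dim: "dim ?V = k" using Gr unfolding Gr_def span_tuple[symmetric] by simp
  obtain B where B: "B \<subseteq> ?V" "independent B" "?V \<subseteq> span B" "card B = dim ?V"
    using basis_exists by blast
  have cle: "card ?V \<le> k" using card_image_le[of "{..<k}" v] by simp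
  have "card B \<le> card ?V" using B(1) by (intro card_mono) auto
  then have cV: "card ?V = k" using cle B(4) dim by simp
  then have "B = ?V" using B(1,4) dim by (intro card_subset_eq) auto
  then have "independent ?V" using B(2) by simp
  moreover have "inj_on v {..<k}" using cV by (intro eq_card_imp_inj_on) auto
  ultimately show ?thesis using basis_nondeg[OF tv] by blast
qed

lemma Gr_obtain_tuple:
  assumes "U \<in> Gr k X"
  obtains v where "tuple X k v" "nondeg k (tnorm X k v)" "U = range (lcomb k v)"
proof -
  from assms obtain B where U: "U \<subseteq> vecs X" "subspace U" "finite B" "U = span B" "dim U = k"
    unfolding Gr_def by blast
  obtain B0 where B0: "B0 \<subseteq> U" "independent B0" "U \<subseteq> span B0" "card B0 = dim U"
    using basis_exists by blast
  have fB0: "finite B0"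
    using independent_span_bound[OF U(3) B0(2)] B0(1) U(4) by auto
  have spU: "U = span B0" using B0(1,3) U(2) span_minimal by blast
  from fB0 B0(4) U(5) obtain v where v: "bij_betw v {..<k} B0"
    by (metis lessThan_atLeast0 ex_bij_betw_nat_finite)
  have im: "v ` {..<k} = B0" and inj: "inj_on v {..<k}" using v by (auto simp: bij_betw_def)
  have tv: "tuple X k v" using im B0(1) U(1) by (auto simp: tuple_def)
  have "nondeg k (tnorm X k v)" using basis_nondeg[OF tv inj] B0(2) im by simp
  with tv show thesis using that spU im span_tuple[of v k] by simp
qed

lemma normed_sub:
  assumes "subspace U" "U \<subseteq> vecs X"
  shows "normed_space (sub X U)"
  unfolding normed_space_def sub_def
  using assms vector_space_axioms nrm_eq_0 nrm_nonneg nrm_triangle nrm_scale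
  by (simp add: subset_iff)

lemma Gr_subspace: "U \<in> Gr k X \<Longrightarrow> subspace U \<and> U \<subseteq> vecs X"
  by (simp add: Gr_def)

end

lemma Age_normed:
  assumes "normed_space X" "Y \<in> Age X"
  shows "normed_space Y"
proof -
  interpret normed_nspace X using assms(1) by unfold_locales
  from assms(2) obtain k U where "Y = sub X U" "U \<in> Gr k X" unfolding Age_def by auto
  then show ?thesis using Gr_subspace normed_sub by simp
qed

lemma sub_simps [simp]: "vecs (sub X U) = U" "smul (sub X U) = smul X" "nrm (sub X U) = nrm X"
  by (simp_all add: sub_def)

lemma sub_sub [simp]: "sub (sub X U) V = sub X V"
  by (simp add: sub_def)

lemma tnorm_sub [simp]: "tnorm (sub X U) = tnorm X"
  by (intro ext) (simp add: tnorm_def)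

lemma tdist_sub [simp]: "tdist (sub X U) = tdist X"
  by (intro ext) (simp add: tdist_def)

lemma ball_dist_sub [simp]: "ball_dist (sub X U) = ball_dist X"
  by (intro ext) (simp add: ball_dist_def)

lemma Gr_sub: "U \<subseteq> vecs X \<Longrightarrow> V \<in> Gr k (sub X U) \<longleftrightarrow> V \<in> Gr k X \<and> V \<subseteq> U"
  by (auto simp: Gr_def)


section \<open>Operator norms and dual norms\<close>

text \<open>The infimum that defines an operator norm is itself a bound.\<close>

lemma Inf_bound_attained:
  fixes \<phi> \<psi> :: "'a \<Rightarrow> real"
  assumes "\<exists>a. \<forall>x\<in>S. \<phi> x \<le> a * \<psi> x" "\<And>x. x \<in> S \<Longrightarrow> 0 \<le> \<psi> x"
  defines "m \<equiv> Inf {a. 0 \<le> a \<and> (\<forall>x\<in>S. \<phi> x \<le> a * \<psi> x)}"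
  shows "0 \<le> m" "x \<in> S \<Longrightarrow> \<phi> x \<le> m * \<psi> x"
proof -
  let ?A = "{a. 0 \<le> a \<and> (\<forall>x\<in>S. \<phi> x \<le> a * \<psi> x)}"
  from assms(1) obtain a where a: "\<And>x. x \<in> S \<Longrightarrow> \<phi> x \<le> a * \<psi> x" by blast
  have "\<phi> x \<le> \<bar>a\<bar> * \<psi> x" if "x \<in> S" for x
    using a[OF that] assms(2)[OF that] by (meson abs_ge_self mult_right_mono order_trans)
  then have "\<bar>a\<bar> \<in> ?A" by simp
  then have ne: "?A \<noteq> {}" by blast
  show "0 \<le> m" unfolding m_def by (rule cInf_greatest[OF ne]) simp
  show "\<phi> x \<le> m * \<psi> x" if "x \<in> S"
  proof (cases "\<psi> x = 0")
    case True
    then show ?thesis using a[OF that] by simp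
  next
    case False
    then have pos: "0 < \<psi> x" using assms(2)[OF that] by simp
    have "\<phi> x / \<psi> x \<le> m"
      unfolding m_def
      by (rule cInf_greatest[OF ne]) (use that pos in \<open>auto simp: pos_divide_le_eq\<close>)
    then show ?thesis using pos by (simp add: pos_divide_le_eq)
  qed
qed

lemma Inf_bound_le:
  fixes \<phi> \<psi> :: "'a \<Rightarrow> real"
  assumes "0 \<le> a" "\<And>x. x \<in> S \<Longrightarrow> \<phi> x \<le> a * \<psi> x"
  shows "Inf {a. 0 \<le> a \<and> (\<forall>x\<in>S. \<phi> x \<le> a * \<psi> x)} \<le> a"
  by (rule cInf_lower) (use assms in \<open>auto simp: bdd_below_def\<close>)

lemma op_norm_le:
  "0 \<le> a \<Longrightarrow> (\<And>x. x \<in> vecs X \<Longrightarrow> nrm Y (T x) \<le> a * nrm X x) \<Longrightarrow> op_norm X Y T \<le> a"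
  unfolding op_norm_def by (rule Inf_bound_le)

lemma op_norm_bound:
  assumes "\<exists>a. \<forall>x\<in>vecs X. nrm Y (T x) \<le> a * nrm X x" "\<And>x. x \<in> vecs X \<Longrightarrow> 0 \<le> nrm X x"
  shows "0 \<le> op_norm X Y T" "x \<in> vecs X \<Longrightarrow> nrm Y (T x) \<le> op_norm X Y T * nrm X x"
  using Inf_bound_attained[of "vecs X" "\<lambda>x. nrm Y (T x)" "nrm X", OF assms]
  unfolding op_norm_def by auto

text \<open>The definition of \<open>inv_norm\<close> with balls says that every value of \<open>T\<close> has a preimage
  that is at most \<open>a\<close> times longer; this is the form in which it is used.\<close>

lemma inv_norm_bound_in:
  assumes "0 < a"
    and sc: "\<And>r x. x \<in> vecs X \<Longrightarrow> smul X (of_real r) x \<in> vecs X \<and>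
        nrm X (smul X (of_real r) x) = \<bar>r\<bar> * nrm X x \<and>
        T (smul X (of_real r) x) = smul Y (of_real r) (T x)"
    and Y: "normed_space Y"
    and pre: "\<And>x. x \<in> vecs X \<Longrightarrow> \<exists>x'\<in>vecs X. T x' = T x \<and> nrm X x' \<le> a * nrm Y (T x)"
  shows "a \<in> {a. 0 \<le> a \<and>
    unit_ball (sub Y (T ` vecs X)) \<subseteq> (\<lambda>x. smul Y (of_real a) (T x)) ` unit_ball X}"
proof -
  interpret Y: normed_nspace Y using Y by unfold_locales
  show ?thesis
  proof (intro CollectI conjI subsetI)
    show "0 \<le> a" using assms(1) by simp
    fix y assume "y \<in> unit_ball (sub Y (T ` vecs X))"
    then obtain x where x: "x \<in> vecs X" "y = T x" "nrm Y (T x) \<le> 1"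
      by (auto simp: unit_ball_def)
    obtain x' where x': "x' \<in> vecs X" "T x' = T x" "nrm X x' \<le> a * nrm Y (T x)"
      using pre[OF x(1)] by blast
    have "a * nrm Y (T x) \<le> a" using x(3) assms(1) by simp
    then have le: "nrm X x' \<le> a" using x'(3) by simp
    let ?z = "smul X (of_real (1 / a)) x'"
    have z: "?z \<in> vecs X" "nrm X ?z = \<bar>1 / a\<bar> * nrm X x'" "T ?z = smul Y (of_real (1 / a)) (T x')"
      using sc[OF x'(1), of "1 / a"] by auto
    have "nrm X ?z \<le> 1" unfolding z(2) using le assms(1) by (simp add: field_simps)
    then have "?z \<in> unit_ball X" using z(1) by (simp add: unit_ball_def)
    moreover have "smul Y (of_real a) (T ?z) = y"
      unfolding z(3) Y.scale_scale of_real_mult[symmetric] using assms(1) x(2) x'(2) by simp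
    ultimately show "y \<in> (\<lambda>x. smul Y (of_real a) (T x)) ` unit_ball X" by force
  qed
qed

lemma inv_norm_le:
  assumes "0 < a"
    and sc: "\<And>r x. x \<in> vecs X \<Longrightarrow> smul X (of_real r) x \<in> vecs X \<and>
        nrm X (smul X (of_real r) x) = \<bar>r\<bar> * nrm X x \<and>
        T (smul X (of_real r) x) = smul Y (of_real r) (T x)"
    and Y: "normed_space Y"
    and pre: "\<And>x. x \<in> vecs X \<Longrightarrow> \<exists>x'\<in>vecs X. T x' = T x \<and> nrm X x' \<le> a * nrm Y (T x)"
  shows "inv_norm X Y T \<le> a"
  unfolding inv_norm_def
  by (rule cInf_lower[OF inv_norm_bound_in[OF assms]]) (auto simp: bdd_below_def)

lemma inv_norm_less:
  assumes "inv_norm X Y T < l"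
    and sc: "\<And>r x. x \<in> vecs X \<Longrightarrow> smul X (of_real r) x \<in> vecs X \<and>
        nrm X (smul X (of_real r) x) = \<bar>r\<bar> * nrm X x \<and>
        T (smul X (of_real r) x) = smul Y (of_real r) (T x)"
    and Y: "normed_space Y" "T ` vecs X \<subseteq> vecs Y"
    and pre: "0 < a0" "\<And>x. x \<in> vecs X \<Longrightarrow> \<exists>x'\<in>vecs X. T x' = T x \<and> nrm X x' \<le> a0 * nrm Y (T x)"
  shows "\<exists>a\<ge>0. a < l \<and> (\<forall>x\<in>vecs X. \<exists>x'\<in>vecs X. T x' = T x \<and> nrm X x' \<le> a * nrm Y (T x))"
proof -
  interpret Y: normed_nspace Y using Y(1) by unfold_locales
  let ?A = "{a. 0 \<le> a \<and> unit_ball (sub Y (T ` vecs X)) \<subseteq> (\<lambda>x. smul Y (of_real a) (T x)) ` unit_ball X}"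
  have "a0 \<in> ?A" by (rule inv_norm_bound_in[OF pre(1) sc Y(1) pre(2)])
  then have "?A \<noteq> {}" by blast
  from cInf_lessD[OF this assms(1)[unfolded inv_norm_def]] obtain a where a: "0 \<le> a" "a < l"
    "unit_ball (sub Y (T ` vecs X)) \<subseteq> (\<lambda>x. smul Y (of_real a) (T x)) ` unit_ball X"
    by blast
  have "\<exists>x'\<in>vecs X. T x' = T x \<and> nrm X x' \<le> a * nrm Y (T x)" if x: "x \<in> vecs X" for x
  proof -
    have Tx: "T x \<in> vecs Y" using Y(2) x by blast
    let ?n = "nrm Y (T x)"
    show ?thesis
    proof (cases "?n = 0")
      case True
      then have "T x = 0" using Tx by simp
      with sc[OF x, of 0] True show ?thesis
        by (intro bexI[of _ "smul X (of_real 0) x"]) simp_all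
    next
      case False
      then have n: "0 < ?n" using Y.nrm_nonneg[OF Tx] by linarith
      let ?y = "T (smul X (of_real (1 / ?n)) x)"
      have y: "?y = smul Y (of_real (1 / ?n)) (T x)" using sc[OF x] by blast
      have "nrm Y ?y = 1" unfolding y using Tx n by (auto simp: norm_divide)
      moreover have "?y \<in> T ` vecs X" using sc[OF x] by blast
      ultimately have "?y \<in> unit_ball (sub Y (T ` vecs X))" by (simp add: unit_ball_def)
      with a(3) obtain x1 where x1: "x1 \<in> unit_ball X" "?y = smul Y (of_real a) (T x1)" by blast
      have x1v: "x1 \<in> vecs X" "nrm X x1 \<le> 1" using x1(1) by (auto simp: unit_ball_def)
      let ?x' = "smul X (of_real (?n * a)) x1"
      have "T ?x' = smul Y (of_real (?n * a)) (T x1)" using sc[OF x1v(1)] by blast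
      also have "\<dots> = smul Y (of_real ?n) (smul Y (of_real a) (T x1))" by simp
      also have "\<dots> = T x" unfolding x1(2)[symmetric] y using n by simp
      finally have "T ?x' = T x" .
      moreover have "nrm X ?x' \<le> a * ?n"
      proof -
        have "nrm X ?x' = \<bar>?n * a\<bar> * nrm X x1" using sc[OF x1v(1)] by blast
        also have "\<dots> \<le> \<bar>?n * a\<bar> * 1" using x1v(2) by (intro mult_left_mono) auto
        finally show ?thesis using a(1) n by (simp add: mult.commute)
      qed
      moreover have "?x' \<in> vecs X" using sc[OF x1v(1)] by blast
      ultimately show ?thesis by blast
    qed
  qed
  with a(1,2) show ?thesis by blast
qed


section \<open>The Hahn--Banach theorem\<close>

context normed_nspace
begin

abbreviation "rsc r \<equiv> smul X (of_real r)"

text \<open>A real-linear functional dominated by a multiple of the norm is, through its graph, a real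
  subspace of \<open>X \<times> \<real>\<close> on which the second coordinate is dominated by the first one.
  Conversely such a subspace is automatically a graph, so that Zorn's lemma can be applied to
  subspaces and well-definedness needs no attention.\<close>

lemma real_hahn_banach:
  assumes W: "W \<subseteq> vecs X" "0 \<in> W"
    and g: "\<And>x y. x \<in> W \<Longrightarrow> y \<in> W \<Longrightarrow> x + y \<in> W \<and> g (x + y) = g x + g y"
      "\<And>r x. x \<in> W \<Longrightarrow> rsc r x \<in> W \<and> g (rsc r x) = r * g x"
      "\<And>x. x \<in> W \<Longrightarrow> g x \<le> b * nrm X x"
    and "0 \<le> b"
  shows "\<exists>G. (\<forall>x\<in>vecs X. \<forall>y\<in>vecs X. G (x + y) = G x + G y) \<and>
    (\<forall>r. \<forall>x\<in>vecs X. G (rsc r x) = r * G x) \<and> (\<forall>x\<in>W. G x = g x) \<and>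
    (\<forall>x\<in>vecs X. G x \<le> b * nrm X x)"
proof -
  define good where "good H \<longleftrightarrow> (\<forall>x\<in>W. (x, g x) \<in> H) \<and>
     (\<forall>x t y u. (x, t) \<in> H \<longrightarrow> (y, u) \<in> H \<longrightarrow> (x + y, t + u) \<in> H) \<and>
     (\<forall>r x t. (x, t) \<in> H \<longrightarrow> (rsc r x, r * t) \<in> H) \<and>
     (\<forall>x t. (x, t) \<in> H \<longrightarrow> x \<in> vecs X \<and> t \<le> b * nrm X x)" for H
  have "good ((\<lambda>x. (x, g x)) ` W)"
    unfolding good_def using g W(1) by (auto simp: image_iff)
  then have ne: "Collect good \<noteq> {}" by blast
  have "\<exists>M\<in>Collect good. \<forall>H\<in>Collect good. M \<subseteq> H \<longrightarrow> H = M"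
  proof (rule subset_Zorn_nonempty[OF ne])
    fix C assume C: "C \<noteq> {}" "subset.chain (Collect good) C"
    then obtain H0 where H0: "H0 \<in> C" by blast
    have gC: "good H" if "H \<in> C" for H using C(2) that unfolding subset.chain_def by blast
    have "\<exists>H\<in>C. p \<in> H \<and> q \<in> H" if pq: "p \<in> \<Union> C" "q \<in> \<Union> C" for p q
    proof -
      from pq obtain H1 H2 where "H1 \<in> C" "p \<in> H1" "H2 \<in> C" "q \<in> H2" by blast
      moreover from this have "H1 \<subseteq> H2 \<or> H2 \<subseteq> H1"
        using C(2) unfolding subset.chain_def by blast
      ultimately show ?thesis by blast
    qed
    then have "(x + y, t + u) \<in> \<Union> C" if "(x, t) \<in> \<Union> C" "(y, u) \<in> \<Union> C" for x t y u
      using that gC unfolding good_def by (meson UnionI)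
    moreover have "(x, g x) \<in> \<Union> C" if "x \<in> W" for x
      using gC[OF H0] H0 that unfolding good_def by blast
    moreover have "(rsc r x, r * t) \<in> \<Union> C" if "(x, t) \<in> \<Union> C" for r x t
      using gC that unfolding good_def by (meson UnionE UnionI)
    moreover have "x \<in> vecs X \<and> t \<le> b * nrm X x" if "(x, t) \<in> \<Union> C" for x t
      using gC that unfolding good_def by (meson UnionE)
    ultimately show "\<Union> C \<in> Collect good" unfolding good_def by simp
  qed
  then obtain M where M: "good M" and max: "\<And>H. good H \<Longrightarrow> M \<subseteq> H \<Longrightarrow> H = M" by blast
  have MW: "\<And>x. x \<in> W \<Longrightarrow> (x, g x) \<in> M"
    and Madd: "\<And>x t y u. (x, t) \<in> M \<Longrightarrow> (y, u) \<in> M \<Longrightarrow> (x + y, t + u) \<in> M"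
    and Msc: "\<And>r x t. (x, t) \<in> M \<Longrightarrow> (rsc r x, r * t) \<in> M"
    and Mv: "\<And>x t. (x, t) \<in> M \<Longrightarrow> x \<in> vecs X"
    and Mle: "\<And>x t. (x, t) \<in> M \<Longrightarrow> t \<le> b * nrm X x"
    using M unfolding good_def by blast+
  have M0: "(0, 0) \<in> M" using Msc[OF MW[OF W(2)], of 0] by simp
  have total: "\<exists>t. (x0, t) \<in> M" if x0: "x0 \<in> vecs X" for x0
  proof -
    have key: "t - b * nrm X (x - x0) \<le> b * nrm X (y + x0) - u" if "(x, t) \<in> M" "(y, u) \<in> M" for x t y u
    proof -
      have "t + u \<le> b * nrm X (x + y)" using Mle[OF Madd[OF that]] .
      also have "\<dots> \<le> b * (nrm X (x - x0) + nrm X (y + x0))"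
        using nrm_triangle[of "x - x0" "y + x0"] Mv[OF that(1)] Mv[OF that(2)] x0 \<open>0 \<le> b\<close>
        by (intro mult_left_mono) auto
      finally show ?thesis by (simp add: algebra_simps)
    qed
    define S where "S = {t - b * nrm X (x - x0) | x t. (x, t) \<in> M}"
    have Sne: "S \<noteq> {}" using M0 unfolding S_def by blast
    have Sub: "bdd_above S" using key[OF _ M0] unfolding S_def bdd_above_def by blast
    define t0 where "t0 = Sup S"
    have t0a: "t - t0 \<le> b * nrm X (x - x0)" if "(x, t) \<in> M" for x t
      using cSup_upper[OF _ Sub, of "t - b * nrm X (x - x0)"] that unfolding t0_def S_def by force
    have t0b: "t + t0 \<le> b * nrm X (x + x0)" if "(x, t) \<in> M" for x t
    proof -
      have "t0 \<le> b * nrm X (x + x0) - t"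
        unfolding t0_def by (rule cSup_least[OF Sne]) (use key[OF _ that] in \<open>auto simp: S_def\<close>)
      then show ?thesis by simp
    qed
    define H where "H = {(x + rsc r x0, t + r * t0) | x t r. (x, t) \<in> M}"
    have HI: "(x + rsc r x0, t + r * t0) \<in> H" if "(x, t) \<in> M" for x t r
      unfolding H_def using that by blast
    have MH: "M \<subseteq> H"
      using HI[of _ _ 0] by auto
    have bound: "t + r * t0 \<le> b * nrm X (x + rsc r x0)" if m: "(x, t) \<in> M" for x t r
    proof -
      consider "r = 0" | "0 < r" | "r < 0" by linarith
      then show ?thesis
      proof cases
        case 1
        then show ?thesis using Mle[OF m] by simp
      next
        case 2
        have "1 / r * t + t0 \<le> b * nrm X (rsc (1 / r) x + x0)" using t0b[OF Msc[OF m]] .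
        then have "r * (1 / r * t + t0) \<le> r * (b * nrm X (rsc (1 / r) x + x0))"
          using 2 by (intro mult_left_mono) auto
        also have "\<dots> = b * nrm X (rsc r (rsc (1 / r) x + x0))"
          using 2 Mv[OF m] x0 by simp
        also have "rsc r (rsc (1 / r) x + x0) = x + rsc r x0"
          unfolding scale_right_distrib scale_scale of_real_mult[symmetric] using 2 by simp
        finally show ?thesis using 2 by (simp add: algebra_simps)
      next
        case 3
        define q where "q = - r"
        have q: "0 < q" "r = - q" using 3 by (auto simp: q_def)
        have "1 / q * t - t0 \<le> b * nrm X (rsc (1 / q) x - x0)" using t0a[OF Msc[OF m]] .
        then have "q * (1 / q * t - t0) \<le> q * (b * nrm X (rsc (1 / q) x - x0))"
          using q by (intro mult_left_mono) auto
        also have "\<dots> = b * nrm X (rsc q (rsc (1 / q) x - x0))"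
          using q(1) Mv[OF m] x0 by simp
        also have "rsc q (rsc (1 / q) x - x0) = x + rsc r x0"
          unfolding scale_right_diff_distrib scale_scale of_real_mult[symmetric] q(2) using q(1) by simp
        finally show ?thesis using q by (simp add: algebra_simps)
      qed
    qed
    have "good H"
      unfolding good_def
    proof (intro conjI ballI allI impI)
      fix x assume "x \<in> W" then show "(x, g x) \<in> H" using MW MH by blast
    next
      fix x t y u assume "(x, t) \<in> H" "(y, u) \<in> H"
      then obtain x1 t1 r1 y1 u1 r2 where e: "x = x1 + rsc r1 x0" "t = t1 + r1 * t0" "(x1, t1) \<in> M"
        "y = y1 + rsc r2 x0" "u = u1 + r2 * t0" "(y1, u1) \<in> M" unfolding H_def by blast
      have "x + y = (x1 + y1) + rsc (r1 + r2) x0" "t + u = (t1 + u1) + (r1 + r2) * t0"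
        unfolding e by (simp_all add: scale_left_distrib algebra_simps)
      then show "(x + y, t + u) \<in> H" using HI[OF Madd[OF e(3,6)], of "r1 + r2"] by simp
    next
      fix r x t assume "(x, t) \<in> H"
      then obtain x1 t1 r1 where e: "x = x1 + rsc r1 x0" "t = t1 + r1 * t0" "(x1, t1) \<in> M"
        unfolding H_def by blast
      have "rsc r x = rsc r x1 + rsc (r * r1) x0" "r * t = r * t1 + (r * r1) * t0"
        unfolding e by (simp_all add: scale_right_distrib algebra_simps)
      then show "(rsc r x, r * t) \<in> H" using HI[OF Msc[OF e(3)]] by (simp only:)
    next
      fix x t assume "(x, t) \<in> H"
      then obtain x1 t1 r1 where e: "x = x1 + rsc r1 x0" "t = t1 + r1 * t0" "(x1, t1) \<in> M"
        unfolding H_def by blast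
      show "x \<in> vecs X" unfolding e using Mv[OF e(3)] x0 by simp
      show "t \<le> b * nrm X x" unfolding e using bound[OF e(3)] .
    qed
    from max[OF this MH] have "H = M" .
    moreover have "(x0, t0) \<in> H" using HI[OF M0, of 1] by simp
    ultimately show ?thesis by blast
  qed
  have uniq: "t = u" if "(x, t) \<in> M" "(x, u) \<in> M" for x t u
  proof -
    have "p \<le> q" if "(x, p) \<in> M" "(x, q) \<in> M" for p q
      using Mle[OF Madd[OF that(1) Msc[OF that(2), of "- 1"]]] by simp
    with that show ?thesis by (meson order_antisym)
  qed
  define G where "G x = (THE t. (x, t) \<in> M)" for x
  have GM: "G x = t" if "(x, t) \<in> M" for x t
    unfolding G_def using that uniq by blast
  have MG: "(x, G x) \<in> M" if "x \<in> vecs X" for x using total[OF that] GM by blast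
  show ?thesis
  proof (intro exI[of _ G] conjI ballI allI)
    fix x y assume "x \<in> vecs X" "y \<in> vecs X"
    then show "G (x + y) = G x + G y" using GM Madd MG by blast
  next
    fix r x assume "x \<in> vecs X" then show "G (rsc r x) = r * G x" using GM Msc MG by blast
  next
    fix x assume "x \<in> W" then show "G x = g x" using GM MW by blast
  next
    fix x assume "x \<in> vecs X" then show "G x \<le> b * nrm X x" using Mle MG by blast
  qed
qed

lemma dualI:
  assumes "\<And>x y. x \<in> vecs X \<Longrightarrow> y \<in> vecs X \<Longrightarrow> f (x + y) = f x + f y"
    "\<And>a x. x \<in> vecs X \<Longrightarrow> f (smul X a x) = a * f x"
    "\<And>x. x \<in> vecs X \<Longrightarrow> norm (f x) \<le> b * nrm X x"
  shows "restrict f (vecs X) \<in> vecs (dual X)"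
proof -
  have "\<exists>a. \<forall>x\<in>vecs X. norm (f x) \<le> a * nrm X x" using assms(3) by blast
  then show ?thesis using assms(1,2) unfolding dual_def lin_maps_def by simp
qed

lemma dualD:
  assumes "f \<in> vecs (dual X)"
  shows "\<And>x y. x \<in> vecs X \<Longrightarrow> y \<in> vecs X \<Longrightarrow> f (x + y) = f x + f y"
    "\<And>a x. x \<in> vecs X \<Longrightarrow> f (smul X a x) = a * f x"
    "f \<in> extensional (vecs X)"
    "0 \<le> nrm (dual X) f"
    "\<And>x. x \<in> vecs X \<Longrightarrow> norm (f x) \<le> nrm (dual X) f * nrm X x"
proof -
  have ex: "\<exists>a. \<forall>x\<in>vecs X. norm (f x) \<le> a * nrm X x"
    using assms by (simp add: dual_def)
  show "0 \<le> nrm (dual X) f" "\<And>x. x \<in> vecs X \<Longrightarrow> norm (f x) \<le> nrm (dual X) f * nrm X x"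
    using Inf_bound_attained[of "vecs X" "\<lambda>x. norm (f x)" "nrm X", OF ex]
    unfolding dual_def by simp_all
qed (use assms in \<open>auto simp: dual_def lin_maps_def PiE_def\<close>)

lemma dual_norm_le:
  assumes "0 \<le> b" "\<And>x. x \<in> vecs X \<Longrightarrow> norm (f x) \<le> b * nrm X x"
  shows "nrm (dual X) f \<le> b"
  unfolding dual_def using Inf_bound_le[of b "vecs X" "\<lambda>x. norm (f x)" "nrm X"] assms by simp

lemma dual_sum:
  assumes "f \<in> vecs (dual X)"
  shows "(\<And>i. i \<in> I \<Longrightarrow> h i \<in> vecs X) \<Longrightarrow> f (sum h I) = (\<Sum>i\<in>I. f (h i))"
proof (induction I rule: infinite_finite_induct)
  case (insert i I)
  then show ?case by (simp add: dualD(1)[OF assms] vecs_sum)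
qed (use dualD(2)[OF assms, of 0 0] in simp_all)

lemma dual_comb:
  assumes "f \<in> vecs (dual X)" "tuple X k v"
  shows "f (lcomb k v x) = (\<Sum>j<k. x j * f (v j))"
proof -
  have "f (lcomb k v x) = (\<Sum>j<k. f (smul X (x j) (v j)))"
    unfolding comb_def using assms(2) by (intro dual_sum[OF assms(1)]) (auto simp: tuple_def)
  also have "\<dots> = (\<Sum>j<k. x j * f (v j))"
    using assms by (intro sum.cong) (auto simp: dualD(2) tuple_def)
  finally show ?thesis .
qed

text \<open>The complex extension is \<open>G x - i G (i x)\<close> for a real extension \<open>G\<close> of the real part, and has the
  same bound because its values can be rotated to the reals.\<close>

lemma hahn_banach:
  assumes W: "subspace W" "W \<subseteq> vecs X"
    and f: "\<And>x y. x \<in> W \<Longrightarrow> y \<in> W \<Longrightarrow> f (x + y) = f x + f y"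
      "\<And>a x. x \<in> W \<Longrightarrow> f (smul X a x) = a * f x"
      "\<And>x. x \<in> W \<Longrightarrow> norm (f x) \<le> b * nrm X x"
    and "0 \<le> b"
  shows "\<exists>h\<in>vecs (dual X). (\<forall>x\<in>W. h x = f x) \<and> (\<forall>x\<in>vecs X. norm (h x) \<le> b * nrm X x)"
proof -
  have Wadd: "\<And>x y. x \<in> W \<Longrightarrow> y \<in> W \<Longrightarrow> x + y \<in> W" and W0: "0 \<in> W"
    and Wsc: "\<And>a x. x \<in> W \<Longrightarrow> smul X a x \<in> W"
    using W(1) by (auto simp: subspace_def)
  show ?thesis
    using real_or_complex[where 'a = 'f]
  proof (elim disjE)
    assume "\<forall>z::'f. \<exists>x. z = x *\<^sub>R 1"
    then obtain re :: "'f \<Rightarrow> real" where re: "\<And>z. of_real (re z) = z"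
      unfolding of_real_def by metis
    have re_add: "re (z + w) = re z + re w" for z w
      using re by (metis of_real_add of_real_eq_iff)
    have re_mult: "re (of_real r * z) = r * re z" for r z
      using re by (metis of_real_mult of_real_eq_iff)
    have re_abs: "\<bar>re z\<bar> = norm z" for z
      using re by (metis norm_of_real)
    have "re (f x) \<le> b * nrm X x" if "x \<in> W" for x
      using f(3)[OF that] re_abs[of "f x"] by linarith
    then have "\<exists>G. (\<forall>x\<in>vecs X. \<forall>y\<in>vecs X. G (x + y) = G x + G y) \<and>
        (\<forall>r. \<forall>x\<in>vecs X. G (rsc r x) = r * G x) \<and> (\<forall>x\<in>W. G x = re (f x)) \<and>
        (\<forall>x\<in>vecs X. G x \<le> b * nrm X x)"
      by (intro real_hahn_banach[OF W(2) W0]) (use Wadd Wsc f \<open>0 \<le> b\<close> re_add re_mult in auto)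
    then obtain G where
      G: "\<And>x y. x \<in> vecs X \<Longrightarrow> y \<in> vecs X \<Longrightarrow> G (x + y) = G x + G y"
        "\<And>r x. x \<in> vecs X \<Longrightarrow> G (rsc r x) = r * G x"
        "\<And>x. x \<in> W \<Longrightarrow> G x = re (f x)" "\<And>x. x \<in> vecs X \<Longrightarrow> G x \<le> b * nrm X x"
      by blast
    have Gle: "norm (of_real (G x) :: 'f) \<le> b * nrm X x" if "x \<in> vecs X" for x
      using G(4)[OF that] G(4)[of "- x"] G(2)[OF that, of "- 1"] nrm_minus[OF that] that
      by (simp add: abs_le_iff)
    let ?h = "restrict (\<lambda>x. of_real (G x)) (vecs X)"
    have "?h \<in> vecs (dual X)"
    proof (rule dualI)
      fix a x assume "x \<in> vecs X"
      then show "of_real (G (smul X a x)) = a * of_real (G x)"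
        using G(2)[of x "re a"] by (simp add: re)
    qed (use G(1) Gle in auto)
    moreover have "?h x = f x" if "x \<in> W" for x using G(3) W(2) that re by auto
    ultimately show ?thesis using Gle by (intro bexI[of _ ?h]) auto
  next
    assume "\<exists>i::'f. i * i = - 1 \<and> (\<forall>z. \<exists>x y. z = x *\<^sub>R 1 + y *\<^sub>R i) \<and>
          (\<forall>x y. norm (x *\<^sub>R 1 + y *\<^sub>R i) = sqrt (x\<^sup>2 + y\<^sup>2))"
    then obtain i :: 'f where ii: "i * i = - 1"
      and rep0: "\<forall>z. \<exists>x y. z = x *\<^sub>R 1 + y *\<^sub>R i"
      and nm0: "\<And>x y. norm (x *\<^sub>R 1 + y *\<^sub>R i) = sqrt (x\<^sup>2 + y\<^sup>2)" by blast
    from rep0 obtain re im :: "'f \<Rightarrow> real" where "\<And>z. z = re z *\<^sub>R 1 + im z *\<^sub>R i" by metis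
    then have rep: "z = of_real (re z) + of_real (im z) * i" for z
      by (metis of_real_def scaleR_conv_of_real)
    have nm: "norm (of_real x + of_real y * i) = sqrt (x\<^sup>2 + y\<^sup>2)" for x y
      using nm0[of x y] by (simp add: of_real_def[symmetric] scaleR_conv_of_real[of y])
    have uniq: "re (of_real x + of_real y * i) = x \<and> im (of_real x + of_real y * i) = y" for x y
    proof -
      let ?z = "of_real x + of_real y * i"
      have "of_real (re ?z - x) + of_real (im ?z - y) * i = 0"
        using rep[of ?z] by (simp add: algebra_simps)
      then have "sqrt ((re ?z - x)\<^sup>2 + (im ?z - y)\<^sup>2) = 0" using nm by (metis norm_zero)
      then show ?thesis by (simp add: sum_power2_eq_zero_iff)
    qed
    have re_eq: "re z = x" if "z = of_real x + of_real y * i" for z x y using uniq that by simp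
    have re_add: "re (z + w) = re z + re w" for z w
      by (rule re_eq[of _ _ "im z + im w"]) (subst rep[of z], subst rep[of w], simp add: algebra_simps)
    have re_mult: "re (of_real r * z) = r * re z" for r z
      by (rule re_eq[of _ _ "r * im z"]) (subst rep[of z], simp add: algebra_simps)
    have re_i: "re (i * z) = - im z" for z
    proof (rule re_eq[of _ _ "re z"])
      have "i * z = i * (of_real (re z) + of_real (im z) * i)" using rep[of z] by simp
      also have "\<dots> = of_real (re z) * i + of_real (im z) * (i * i)" by (simp add: algebra_simps)
      finally show "i * z = of_real (- im z) + of_real (re z) * i" by (simp add: ii)
    qed
    have re_le: "re z \<le> norm z" for z
    proof -
      have "norm z = sqrt ((re z)\<^sup>2 + (im z)\<^sup>2)" using nm rep by metis
      then show ?thesis by (simp add: real_le_rsqrt)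
    qed
    have "re (f x) \<le> b * nrm X x" if "x \<in> W" for x
      using f(3)[OF that] re_le[of "f x"] by linarith
    then have "\<exists>G. (\<forall>x\<in>vecs X. \<forall>y\<in>vecs X. G (x + y) = G x + G y) \<and>
        (\<forall>r. \<forall>x\<in>vecs X. G (rsc r x) = r * G x) \<and> (\<forall>x\<in>W. G x = re (f x)) \<and>
        (\<forall>x\<in>vecs X. G x \<le> b * nrm X x)"
      by (intro real_hahn_banach[OF W(2) W0]) (use Wadd Wsc f \<open>0 \<le> b\<close> re_add re_mult in auto)
    then obtain G where
      G: "\<And>x y. x \<in> vecs X \<Longrightarrow> y \<in> vecs X \<Longrightarrow> G (x + y) = G x + G y"
        "\<And>r x. x \<in> vecs X \<Longrightarrow> G (rsc r x) = r * G x"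
        "\<And>x. x \<in> W \<Longrightarrow> G x = re (f x)" "\<And>x. x \<in> vecs X \<Longrightarrow> G x \<le> b * nrm X x"
      by blast
    define h where "h x = of_real (G x) + of_real (- G (smul X i x)) * i" for x
    have h_add: "h (x + y) = h x + h y" if "x \<in> vecs X" "y \<in> vecs X" for x y
      unfolding h_def using that by (simp add: scale_right_distrib G(1) algebra_simps)
    have h_sc: "h (smul X a x) = a * h x" if x: "x \<in> vecs X" for a x
    proof -
      let ?p = "re a" and ?q = "im a"
      have a: "a = of_real ?p + of_real ?q * i" by (rule rep)
      have "smul X a x = rsc ?p x + rsc ?q (smul X i x)"
        by (subst a) (simp add: scale_left_distrib)
      then have 1: "G (smul X a x) = ?p * G x + ?q * G (smul X i x)"
        using x by (simp only: G(1,2) vecs_scale)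
      have "i * a = of_real ?p * i + of_real ?q * (i * i)" by (subst a) (simp add: algebra_simps)
      then have "i * a = of_real ?p * i + of_real (- ?q)" by (simp add: ii)
      then have "smul X i (smul X a x) = rsc ?p (smul X i x) + rsc (- ?q) x"
        by (simp only: scale_scale scale_left_distrib)
      then have 2: "G (smul X i (smul X a x)) = ?p * G (smul X i x) + (- ?q) * G x"
        using x by (simp only: G(1,2) vecs_scale)
      have "a * h x = of_real (?p * G x) + of_real ?q * of_real (- G (smul X i x)) * (i * i)
          + (of_real ?p * of_real (- G (smul X i x)) + of_real ?q * of_real (G x)) * i"
        unfolding h_def by (subst a) (simp add: algebra_simps)
      then show ?thesis unfolding h_def 1 2 ii by (simp add: algebra_simps)
    qed
    have h_re: "re (h x) = G x" for x unfolding h_def using uniq by blast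
    have h_le: "norm (h x) \<le> b * nrm X x" if x: "x \<in> vecs X" for x
    proof (cases "h x = 0")
      case True
      then show ?thesis using x \<open>0 \<le> b\<close> by simp
    next
      case False
      define u where "u = of_real (norm (h x)) / h x"
      have "norm u = 1" using False by (simp add: u_def norm_divide)
      have "h (smul X u x) = of_real (norm (h x))"
        using h_sc[OF x, of u] False by (simp add: u_def)
      then have "norm (h x) = G (smul X u x)"
        using h_re[of "smul X u x"] uniq[of "norm (h x)" 0] by simp
      also have "\<dots> \<le> b * nrm X (smul X u x)" by (rule G(4)[OF vecs_scale[OF x]])
      finally show ?thesis using \<open>norm u = 1\<close> x by simp
    qed
    let ?h = "restrict h (vecs X)"
    have "?h \<in> vecs (dual X)" by (rule dualI[OF h_add h_sc h_le])
    moreover have "?h x = f x" if "x \<in> W" for x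
    proof -
      have "G (smul X i x) = - im (f x)" using that Wsc by (simp add: G(3) f(2) re_i)
      then have "h x = f x" unfolding h_def using G(3)[OF that] rep[of "f x"] by simp
      then show ?thesis using that W(2) by auto
    qed
    ultimately show ?thesis using h_le by (intro bexI[of _ ?h]) auto
  qed
qed

text \<open>The bound makes the functional well defined on the span, also when the entries are dependent,
  and the Hahn--Banach theorem extends it.\<close>

lemma functional_with_values:
  assumes v: "tuple X k v" and "0 \<le> b"
    and le: "\<And>x. norm (\<Sum>j<k. x j * y j) \<le> b * tnorm X k v x"
  shows "\<exists>h\<in>vecs (dual X). (\<forall>j<k. h (v j) = y j) \<and> nrm (dual X) h \<le> b"
proof -
  define f where "f z = (\<Sum>j<k. (SOME x. z = lcomb k v x) j * y j)" for z
  have fv: "f (lcomb k v x) = (\<Sum>j<k. x j * y j)" for x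
  proof -
    let ?x' = "SOME x'. lcomb k v x = lcomb k v x'"
    have "lcomb k v x = lcomb k v ?x'" by (rule someI[of _ x]) simp
    then have "tnorm X k v (\<lambda>j. ?x' j - x j) = 0" by (simp add: tnorm_def comb_diff)
    with le[of "\<lambda>j. ?x' j - x j"] have "(\<Sum>j<k. (?x' j - x j) * y j) = 0" by simp
    then show ?thesis unfolding f_def by (simp add: left_diff_distrib sum_subtractf)
  qed
  let ?W = "range (lcomb k v)"
  have "\<exists>h\<in>vecs (dual X). (\<forall>x\<in>?W. h x = f x) \<and> (\<forall>x\<in>vecs X. norm (h x) \<le> b * nrm X x)"
  proof (rule hahn_banach)
    show "subspace ?W" unfolding span_tuple[symmetric] by (rule subspace_span)
    show "?W \<subseteq> vecs X" using v by auto
    fix z w a assume "z \<in> ?W"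
    then obtain x where x: "z = lcomb k v x" by blast
    have "f (smul X a z) = f (lcomb k v (\<lambda>j. a * x j))" by (simp only: x comb_scale)
    then show "f (smul X a z) = a * f z" unfolding x fv by (simp add: sum_distrib_left mult.assoc)
    show "norm (f z) \<le> b * nrm X z" using le[of x] by (simp add: x fv tnorm_def)
    assume "w \<in> ?W"
    then obtain x' where x': "w = lcomb k v x'" by blast
    have "f (z + w) = f (lcomb k v (\<lambda>j. x j + x' j))" by (simp only: x x' comb_add)
    then show "f (z + w) = f z + f w"
      unfolding x x' fv by (simp add: distrib_right sum.distrib)
  qed (rule \<open>0 \<le> b\<close>)
  then obtain h where h: "h \<in> vecs (dual X)" "\<And>x. x \<in> ?W \<Longrightarrow> h x = f x"
    "\<And>x. x \<in> vecs X \<Longrightarrow> norm (h x) \<le> b * nrm X x" by blast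
  have "h (v j) = y j" if "j < k" for j
  proof -
    have "h (v j) = f (lcomb k v (\<lambda>l. if l = j then 1 else 0))"
      using h(2)[of "v j"] comb_unit[OF that, of v] by (metis rangeI)
    also have "\<dots> = (\<Sum>l<k. (if l = j then y l else 0))"
      unfolding fv by (intro sum.cong) auto
    finally show ?thesis using that by (simp add: sum.delta)
  qed
  with h(1,3) dual_norm_le[OF \<open>0 \<le> b\<close>, of h] show ?thesis by blast
qed

text \<open>The functional that norms \<open>x\<close> is obtained by prescribing its value on the tuple with the single
  entry \<open>x\<close>.\<close>

lemma norming_functional:
  assumes x: "x \<in> vecs X" and "0 \<le> b"
    and le: "\<And>f. f \<in> vecs (dual X) \<Longrightarrow> norm (f x) \<le> b * nrm (dual X) f"
  shows "nrm X x \<le> b"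
proof -
  have t: "tuple X 1 (\<lambda>_. x)" using x by (simp add: tuple_def)
  have "norm (\<Sum>j<1. y j * of_real (nrm X x)) \<le> 1 * tnorm X 1 (\<lambda>_. x) y" for y
    using x by (simp add: tnorm_def comb_def norm_mult)
  from functional_with_values[OF t _ this]
  obtain h where h: "h \<in> vecs (dual X)" "h x = of_real (nrm X x)" "nrm (dual X) h \<le> 1"
    by auto
  have "nrm X x = norm (h x)" using h(2) x by simp
  also have "\<dots> \<le> b * nrm (dual X) h" by (rule le[OF h(1)])
  also have "\<dots> \<le> b" using h(3) \<open>0 \<le> b\<close> by (simp add: mult_left_le)
  finally show ?thesis .
qed

end


section \<open>Linear maps on tuples\<close>

text \<open>Operators given by total functions: composition then is literally the composition of
  functions, whereas the extensional operators would have to be restricted after every step.\<close>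

definition lin_on :: "('f, 'v::ab_group_add) nspace \<Rightarrow> ('f, 'w::ab_group_add) nspace \<Rightarrow> ('v \<Rightarrow> 'w) \<Rightarrow> bool"
  where "lin_on X Y R \<longleftrightarrow> (\<forall>x\<in>vecs X. R x \<in> vecs Y) \<and>
    (\<forall>x\<in>vecs X. \<forall>y\<in>vecs X. R (x + y) = R x + R y) \<and> (\<forall>a. \<forall>x\<in>vecs X. R (smul X a x) = smul Y a (R x))"

definition near_isom ::
  "real \<Rightarrow> ('f, 'v::ab_group_add) nspace \<Rightarrow> ('f, 'w::ab_group_add) nspace \<Rightarrow> ('v \<Rightarrow> 'w) \<Rightarrow> bool"
  where "near_isom \<delta> X Y R \<longleftrightarrow> lin_on X Y R \<and>
    (\<forall>x\<in>vecs X. nrm X x \<le> (1 + \<delta>) * nrm Y (R x) \<and> nrm Y (R x) \<le> (1 + \<delta>) * nrm X x)"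

definition isom :: "('f, 'v::ab_group_add) nspace \<Rightarrow> ('f, 'w::ab_group_add) nspace \<Rightarrow> ('v \<Rightarrow> 'w) \<Rightarrow> bool"
  where "isom X Y R \<longleftrightarrow> lin_on X Y R \<and> (\<forall>x\<in>vecs X. nrm Y (R x) = nrm X x)"

lemma isom_near_isom: "isom X Y R \<Longrightarrow> near_isom 0 X Y R"
  by (simp add: isom_def near_isom_def)

lemma isomD:
  assumes "isom X Y R"
  shows "lin_on X Y R" "x \<in> vecs X \<Longrightarrow> nrm Y (R x) = nrm X x" "x \<in> vecs X \<Longrightarrow> R x \<in> vecs Y"
  using assms by (auto simp: isom_def lin_on_def)

lemma Emb_isom: "R \<in> Emb X Y \<Longrightarrow> isom X Y R"
  by (auto simp: Emb_def lin_def lin_maps_def isom_def lin_on_def)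

lemma isom_comp: "isom Y Z S \<Longrightarrow> isom X Y R \<Longrightarrow> isom X Z (S \<circ> R)"
  by (simp add: isom_def lin_on_def)

lemma near_isom_comp_isom: "isom Y Z S \<Longrightarrow> near_isom \<delta> X Y R \<Longrightarrow> near_isom \<delta> X Z (S \<circ> R)"
  by (simp add: isom_def near_isom_def lin_on_def)

lemma near_isom_mono:
  assumes "near_isom \<delta> X Y R" "\<delta> \<le> \<delta>'" "\<And>x. x \<in> vecs X \<Longrightarrow> 0 \<le> nrm X x" "\<And>y. y \<in> vecs Y \<Longrightarrow> 0 \<le> nrm Y y"
  shows "near_isom \<delta>' X Y R"
  unfolding near_isom_def
proof (intro conjI ballI)
  show "lin_on X Y R" using assms(1) by (simp add: near_isom_def)
  fix x assume x: "x \<in> vecs X"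
  then have "R x \<in> vecs Y" using assms(1) by (simp add: near_isom_def lin_on_def)
  then have "(1 + \<delta>) * nrm X x \<le> (1 + \<delta>') * nrm X x" "(1 + \<delta>) * nrm Y (R x) \<le> (1 + \<delta>') * nrm Y (R x)"
    using assms(2) assms(3)[OF x] assms(4) by (auto intro!: mult_right_mono)
  moreover have "nrm X x \<le> (1 + \<delta>) * nrm Y (R x)" "nrm Y (R x) \<le> (1 + \<delta>) * nrm X x"
    using assms(1) x by (simp_all add: near_isom_def)
  ultimately show "nrm X x \<le> (1 + \<delta>') * nrm Y (R x)" "nrm Y (R x) \<le> (1 + \<delta>') * nrm X x" by linarith+
qed

lemma Emb_delta_near_isom:
  assumes "0 \<le> \<delta>" "R \<in> Emb_delta \<delta> X Y"
  shows "near_isom \<delta> X Y R"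
proof -
  have "0 < 1 + \<delta>" using assms(1) by simp
  then show ?thesis using assms(2)
    by (auto simp: Emb_delta_def lin_def lin_maps_def near_isom_def lin_on_def pos_divide_le_eq mult.commute)
qed

context normed_nspace
begin

lemma restrict_lin: "lin_on X Y R \<Longrightarrow> restrict R (vecs X) \<in> lin X Y"
  by (auto simp: lin_def lin_maps_def lin_on_def)

lemma restrict_Emb: "isom X Y R \<Longrightarrow> restrict R (vecs X) \<in> Emb X Y"
  using restrict_lin[of Y R] by (simp add: Emb_def isom_def)

lemma restrict_Emb_delta:
  assumes "0 \<le> \<delta>" "near_isom \<delta> X Y R"
  shows "restrict R (vecs X) \<in> Emb_delta \<delta> X Y"
proof -
  have "0 < 1 + \<delta>" using assms(1) by simp
  then show ?thesis using assms(2) restrict_lin[of Y R]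
    by (simp add: Emb_delta_def near_isom_def pos_divide_le_eq mult.commute)
qed

lemma lin_on_0: "lin_on X Y R \<Longrightarrow> R 0 = 0"
proof -
  assume "lin_on X Y R"
  then have "R (0 + 0) = R 0 + R 0" unfolding lin_on_def using vecs_0 by blast
  then show ?thesis by simp
qed

lemma lin_on_diff:
  assumes "lin_on X Y R" "x \<in> vecs X" "y \<in> vecs X"
  shows "R (x - y) = R x - R y"
proof -
  have "R (x - y + y) = R (x - y) + R y"
    using assms unfolding lin_on_def by (metis vecs_diff)
  then show ?thesis by (simp add: algebra_simps)
qed

lemma lin_on_sum:
  assumes "lin_on X Y R"
  shows "(\<And>i. i \<in> I \<Longrightarrow> f i \<in> vecs X) \<Longrightarrow> R (sum f I) = (\<Sum>i\<in>I. R (f i))"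
proof (induction I rule: infinite_finite_induct)
  case (insert i I)
  then have "R (f i + sum f I) = R (f i) + R (sum f I)"
    using assms unfolding lin_on_def by (simp add: vecs_sum)
  with insert show ?case by simp
qed (use lin_on_0[OF assms] in simp_all)

lemma lin_on_comb:
  assumes "lin_on X Y R" "tuple X k v"
  shows "R (lcomb k v x) = comb (smul Y) k (R \<circ> v) x"
proof -
  have "R (lcomb k v x) = (\<Sum>j<k. R (smul X (x j) (v j)))"
    unfolding comb_def using assms(2) by (intro lin_on_sum[OF assms(1)]) (simp add: tuple_def)
  also have "\<dots> = (\<Sum>j<k. smul Y (x j) (R (v j)))"
    using assms by (intro sum.cong) (auto simp: lin_on_def tuple_def)
  finally show ?thesis by (simp add: comb_def)
qed

lemma lin_on_tuple: "lin_on X Y R \<Longrightarrow> tuple X k v \<Longrightarrow> tuple Y k (R \<circ> v)"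
  by (simp add: lin_on_def tuple_def)

lemma isom_tuple: "isom X Y R \<Longrightarrow> tuple X k v \<Longrightarrow> tuple Y k (R \<circ> v)"
  by (simp add: isom_def lin_on_tuple)

lemma isom_tnorm: "isom X Y R \<Longrightarrow> tuple X k v \<Longrightarrow> tnorm Y k (R \<circ> v) = tnorm X k v"
  by (intro ext) (simp add: tnorm_def lin_on_comb[symmetric] isom_def)

lemma near_isom_tnorm:
  "near_isom \<delta> X Y R \<Longrightarrow> tuple X k v \<Longrightarrow> near \<delta> (tnorm X k v) (tnorm Y k (R \<circ> v))"
  by (simp add: near_def tnorm_def lin_on_comb[symmetric] near_isom_def)

lemma isom_tdist:
  assumes "isom X Y R" "tuple X k v" "tuple X k w"
  shows "tdist Y k (R \<circ> v) (R \<circ> w) = tdist X k v w"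
  unfolding tdist_def
proof (rule sum.cong)
  fix j assume "j \<in> {..<k}"
  then have "v j \<in> vecs X" "w j \<in> vecs X" using assms by (auto simp: tuple_def)
  then show "nrm Y ((R \<circ> v) j - (R \<circ> w) j) = nrm X (v j - w j)"
    using assms(1) lin_on_diff[of Y R "v j" "w j"] unfolding isom_def o_def by (metis vecs_diff)
qed simp

lemma tnorm_unit: "j < k \<Longrightarrow> tnorm X k v (\<lambda>i. if i = j then 1 else 0) = nrm X (v j)"
  by (simp add: tnorm_def comb_unit)

lemma near_entry_le:
  "near \<delta> N (tnorm X k v) \<Longrightarrow> j < k \<Longrightarrow> nrm X (v j) \<le> (1 + \<delta>) * N (\<lambda>i. if i = j then 1 else 0)"
  unfolding near_def using tnorm_unit[of j k v] by metis

text \<open>A linear map on the span of a tuple is prescribed by the images of its entries.\<close>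

lemma lin_on_extend_tuple:
  assumes v: "tuple X k v" "nondeg k (tnorm X k v)" and Y: "normed_space Y" "tuple Y k w"
  shows "\<exists>R. lin_on (sub X (range (lcomb k v))) Y R \<and> (\<forall>x. R (lcomb k v x) = comb (smul Y) k w x)"
proof -
  interpret Y: normed_nspace Y using Y(1) by unfold_locales
  define R where "R z = Y.lcomb k w (SOME x. z = lcomb k v x)" for z
  have R: "R (lcomb k v x) = Y.lcomb k w x" for x
  proof -
    have "lcomb k v x = lcomb k v (SOME x'. lcomb k v x = lcomb k v x')" by (rule someI[of _ x]) simp
    then have "(SOME x'. lcomb k v x = lcomb k v x') j = x j" if "j < k" for j
      using nondeg_tuple_inj[OF v(2)] that by metis
    then show ?thesis unfolding R_def by (intro comb_cong) auto
  qed
  have "lin_on (sub X (range (lcomb k v))) Y R"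
    unfolding lin_on_def sub_simps
  proof (intro conjI ballI allI)
    fix z z' a assume "z \<in> range (lcomb k v)"
    then obtain x where x: "z = lcomb k v x" by blast
    show "R z \<in> vecs Y" unfolding x R using Y(2) by simp
    have "smul X a z = lcomb k v (\<lambda>j. a * x j)" by (simp only: x comb_scale)
    then show "R (smul X a z) = smul Y a (R z)" by (simp only: R Y.comb_scale x)
    assume "z' \<in> range (lcomb k v)"
    then obtain x' where x': "z' = lcomb k v x'" by blast
    have "z + z' = lcomb k v (\<lambda>j. x j + x' j)" by (simp only: x x' comb_add)
    then show "R (z + z') = R z + R z'" by (simp only: R Y.comb_add x x')
  qed
  with R show ?thesis by blast
qed

end


section \<open>Lipschitz extension and simultaneous Ramsey statements\<close>

text \<open>McShane's formula, the infimum of \<open>\<psi> a + d a x\<close> over \<open>a \<in> A\<close>, truncated at 1.\<close>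

lemma McShane_extension:
  fixes \<psi> :: "'a \<Rightarrow> real"
  assumes tri: "\<And>x y z. x \<in> M \<Longrightarrow> y \<in> M \<Longrightarrow> z \<in> M \<Longrightarrow> d x z \<le> d x y + d y z"
    and sym: "\<And>x y. x \<in> M \<Longrightarrow> y \<in> M \<Longrightarrow> d x y = d y x"
    and nn: "\<And>x y. x \<in> M \<Longrightarrow> y \<in> M \<Longrightarrow> 0 \<le> d x y"
    and self: "\<And>x. x \<in> M \<Longrightarrow> d x x = 0"
    and "A \<subseteq> M"
    and rng: "\<And>x. x \<in> A \<Longrightarrow> 0 \<le> \<psi> x \<and> \<psi> x \<le> 1"
    and lip: "\<And>x y. x \<in> A \<Longrightarrow> y \<in> A \<Longrightarrow> \<bar>\<psi> x - \<psi> y\<bar> \<le> d x y"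
  shows "\<exists>c. lip1 M d {0..1} dist c \<and> (\<forall>x\<in>A. c x = \<psi> x)"
proof (cases "A = {}")
  case True
  then show ?thesis
    by (intro exI[of _ "\<lambda>_. 0"]) (auto simp: lip1_def nn)
next
  case False
  define h where "h x = (INF a\<in>A. \<psi> a + d x a)" for x
  have AM: "a \<in> M" if "a \<in> A" for a using that \<open>A \<subseteq> M\<close> by blast
  have pos: "0 \<le> \<psi> a + d x a" if "x \<in> M" "a \<in> A" for x a
    using rng[OF that(2)] nn[OF that(1) AM[OF that(2)]] by linarith
  have bdd: "bdd_below ((\<lambda>a. \<psi> a + d x a) ` A)" if "x \<in> M" for x
    using pos[OF that] by (intro bdd_belowI2[of _ 0])
  have h0: "0 \<le> h x" if "x \<in> M" for x
    unfolding h_def using pos[OF that] by (intro cINF_greatest[OF False])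
  have hle: "h x \<le> \<psi> a + d x a" if "x \<in> M" "a \<in> A" for x a
    unfolding h_def by (rule cINF_lower[OF bdd[OF that(1)] that(2)])
  have hA: "h a = \<psi> a" if a: "a \<in> A" for a
  proof (rule antisym)
    show "h a \<le> \<psi> a" using hle[OF AM[OF a] a] self[OF AM[OF a]] by simp
    show "\<psi> a \<le> h a"
      unfolding h_def
    proof (rule cINF_greatest[OF False])
      fix b assume "b \<in> A"
      then show "\<psi> a \<le> \<psi> b + d a b" using lip[OF a] by (smt (verit))
    qed
  qed
  have hlip: "h x \<le> h y + d x y" if xy: "x \<in> M" "y \<in> M" for x y
  proof -
    have "h x - d x y \<le> h y"
      unfolding h_def[of y]
    proof (rule cINF_greatest[OF False])
      fix a assume a: "a \<in> A"
      show "h x - d x y \<le> \<psi> a + d y a"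
        using hle[OF xy(1) a] tri[OF xy AM[OF a]] by linarith
    qed
    then show ?thesis by simp
  qed
  define c where "c x = min 1 (h x)" for x
  have "\<bar>c x - c y\<bar> \<le> d x y" if xy: "x \<in> M" "y \<in> M" for x y
    using hlip[OF xy] hlip[OF xy(2,1)] sym[OF xy] unfolding c_def by linarith
  moreover have "0 \<le> c x \<and> c x \<le> 1" if "x \<in> M" for x using h0[OF that] by (simp add: c_def)
  moreover have "c x = \<psi> x" if "x \<in> A" for x using hA[OF that] rng[OF that] by (simp add: c_def)
  ultimately show ?thesis
    by (intro exI[of _ c]) (auto simp: lip1_def dist_real_def)
qed

context normed_nspace
begin

lemma op_dist_facts:
  assumes Z: "\<And>z. z \<in> vecs Z \<Longrightarrow> 0 \<le> nrm Z z"
    and S: "\<And>z. z \<in> vecs Z \<Longrightarrow> S z \<in> vecs X" "bounded_on Z X S"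
    and T: "\<And>z. z \<in> vecs Z \<Longrightarrow> T z \<in> vecs X" "bounded_on Z X T"
  shows "0 \<le> op_dist Z X S T"
    and "z \<in> vecs Z \<Longrightarrow> nrm X (S z - T z) \<le> op_dist Z X S T * nrm Z z"
    and "op_dist Z X S T = op_dist Z X T S"
proof -
  obtain a b where ab: "\<And>z. z \<in> vecs Z \<Longrightarrow> nrm X (S z) \<le> a * nrm Z z"
    "\<And>z. z \<in> vecs Z \<Longrightarrow> nrm X (T z) \<le> b * nrm Z z"
    using S(2) T(2) unfolding bounded_on_def by blast
  have "nrm X (S z - T z) \<le> (a + b) * nrm Z z" if "z \<in> vecs Z" for z
  proof -
    have "nrm X (S z - T z) \<le> nrm X (S z) + nrm X (T z)"
      using nrm_triangle_diff[of "S z" 0 "T z"] S(1) T(1) that nrm_minus[of "T z"] by simp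
    then show ?thesis using ab[OF that] by (simp add: algebra_simps)
  qed
  then have ex: "\<exists>c. \<forall>z\<in>vecs Z. nrm X (S z - T z) \<le> c * nrm Z z" by blast
  show "0 \<le> op_dist Z X S T" "z \<in> vecs Z \<Longrightarrow> nrm X (S z - T z) \<le> op_dist Z X S T * nrm Z z"
    unfolding op_dist_def using op_norm_bound[of Z X "\<lambda>z. S z - T z", OF ex Z] by auto
  have "(\<forall>z\<in>vecs Z. nrm X (S z - T z) \<le> c * nrm Z z) \<longleftrightarrow> (\<forall>z\<in>vecs Z. nrm X (T z - S z) \<le> c * nrm Z z)" for c
    using S(1) T(1) by (simp add: nrm_diff_commute)
  then show "op_dist Z X S T = op_dist Z X T S" by (simp add: op_dist_def op_norm_def)
qed

lemma op_dist_le: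
  "0 \<le> a \<Longrightarrow> (\<And>z. z \<in> vecs Z \<Longrightarrow> nrm X (S z - T z) \<le> a * nrm Z z) \<Longrightarrow> op_dist Z X S T \<le> a"
  unfolding op_dist_def by (rule op_norm_le)

lemma op_dist_triangle:
  assumes Z: "\<And>z. z \<in> vecs Z \<Longrightarrow> 0 \<le> nrm Z z"
    and S: "\<And>z. z \<in> vecs Z \<Longrightarrow> S z \<in> vecs X" "bounded_on Z X S"
    and T: "\<And>z. z \<in> vecs Z \<Longrightarrow> T z \<in> vecs X" "bounded_on Z X T"
    and U: "\<And>z. z \<in> vecs Z \<Longrightarrow> U z \<in> vecs X" "bounded_on Z X U"
  shows "op_dist Z X S U \<le> op_dist Z X S T + op_dist Z X T U"
proof (rule op_dist_le)
  have ST: "0 \<le> op_dist Z X S T" "\<And>z. z \<in> vecs Z \<Longrightarrow> nrm X (S z - T z) \<le> op_dist Z X S T * nrm Z z"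
    using op_dist_facts(1,2)[of Z S T] Z S T by blast+
  have TU: "0 \<le> op_dist Z X T U" "\<And>z. z \<in> vecs Z \<Longrightarrow> nrm X (T z - U z) \<le> op_dist Z X T U * nrm Z z"
    using op_dist_facts(1,2)[of Z T U] Z T U by blast+
  show "0 \<le> op_dist Z X S T + op_dist Z X T U" using ST(1) TU(1) by simp
  fix z assume z: "z \<in> vecs Z"
  have "nrm X (S z - U z) \<le> nrm X (S z - T z) + nrm X (T z - U z)"
    using S(1) T(1) U(1) z by (intro nrm_triangle_diff) auto
  with ST(2)[OF z] TU(2)[OF z]
  show "nrm X (S z - U z) \<le> (op_dist Z X S T + op_dist Z X T U) * nrm Z z"
    by (simp add: algebra_simps)
qed

lemma op_dist_self: "op_dist Z X T T = 0"
proof -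
  have "{a. 0 \<le> a \<and> (\<forall>x\<in>vecs Z. 0 \<le> a * nrm Z x)} \<noteq> {}" by (auto intro: exI[of _ 0])
  have "op_dist Z X T T \<le> 0" by (rule op_dist_le) simp_all
  moreover have "0 \<le> op_dist Z X T T"
    unfolding op_dist_def op_norm_def by (rule cInf_greatest) (auto intro: exI[of _ 0])
  ultimately show ?thesis by simp
qed

end

text \<open>Finitely many Ramsey statements about the same family of embeddings hold simultaneously:
  the space found for one of them is used as the small space for the remaining ones.\<close>

lemma combine_ramsey:
  fixes Em :: "nat \<Rightarrow> nat \<Rightarrow> 'e \<Rightarrow> bool" and pull :: "'e \<Rightarrow> 'c \<Rightarrow> 'c"
    and nice good :: "'i \<Rightarrow> nat \<Rightarrow> 'c \<Rightarrow> bool"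
  assumes comp: "\<And>N n1 n e e'. Em n1 n e \<Longrightarrow> Em N n1 e' \<Longrightarrow>
      \<exists>e''. Em N n e'' \<and> (\<forall>c. pull e'' c = pull e' (pull e c))"
    and incl: "\<And>N n. N \<le> n \<Longrightarrow> \<exists>e. Em N n e"
    and nice: "\<And>i N n e c. i \<in> Q \<Longrightarrow> Em N n e \<Longrightarrow> nice i n c \<Longrightarrow> nice i N (pull e c)"
    and good: "\<And>i N n e c. i \<in> Q \<Longrightarrow> Em N n e \<Longrightarrow> good i n c \<Longrightarrow> good i N (pull e c)"
    and single: "\<And>i N. i \<in> Q \<Longrightarrow>
      \<exists>n0. \<forall>n\<ge>n0. \<forall>c. nice i n c \<longrightarrow> (\<exists>e. Em N n e \<and> good i N (pull e c))"
    and "finite Q"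
  shows "\<exists>n0. \<forall>n\<ge>n0. \<forall>c. (\<forall>i\<in>Q. nice i n c) \<longrightarrow> (\<exists>e. Em N n e \<and> (\<forall>i\<in>Q. good i N (pull e c)))"
  using \<open>finite Q\<close> nice good single
proof (induction Q arbitrary: N rule: finite_induct)
  case empty
  then show ?case using incl by auto
next
  case (insert i Q)
  from insert.prems(3)[of i N] obtain n1 where n1:
    "\<And>n c. n1 \<le> n \<Longrightarrow> nice i n c \<Longrightarrow> \<exists>e. Em N n e \<and> good i N (pull e c)" by auto
  have "\<exists>n0. \<forall>n\<ge>n0. \<forall>c. (\<forall>i\<in>Q. nice i n c) \<longrightarrow> (\<exists>e. Em n1 n e \<and> (\<forall>i\<in>Q. good i n1 (pull e c)))"
    using insert.prems by (intro insert.IH) blast+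
  then obtain n0 where n0: "\<And>n c. n0 \<le> n \<Longrightarrow> (\<forall>i\<in>Q. nice i n c) \<Longrightarrow>
      \<exists>e. Em n1 n e \<and> (\<forall>i\<in>Q. good i n1 (pull e c))" by blast
  have "\<exists>e. Em N n e \<and> (\<forall>j\<in>insert i Q. good j N (pull e c))"
    if n: "n0 \<le> n" and c: "\<forall>j\<in>insert i Q. nice j n c" for n c
  proof -
    obtain e where e: "Em n1 n e" "\<forall>j\<in>Q. good j n1 (pull e c)" using n0[OF n] c by blast
    have "nice i n1 (pull e c)" using insert.prems(1)[of i, OF _ e(1)] c by blast
    then obtain e' where e': "Em N n1 e'" "good i N (pull e' (pull e c))" using n1 by blast
    obtain e'' where e'': "Em N n e''" "\<And>c. pull e'' c = pull e' (pull e c)"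
      using comp[OF e(1) e'(1)] by blast
    have "good j N (pull e'' c)" if "j \<in> insert i Q" for j
      unfolding e''(2) using that e'(2) e(2) insert.prems(2)[of j, OF _ e'(1)] by blast
    with e''(1) show ?thesis by blast
  qed
  then show ?case by blast
qed


section \<open>Finitely supported sequences\<close>

abbreviation coord :: "('a \<Rightarrow>\<^sub>0 'f::zero) \<Rightarrow> 'a \<Rightarrow> 'f"
  where "coord \<equiv> Poly_Mapping.lookup"

lemma lookup_fs_scale: "coord (fs_scale a x) i = a * coord x i"
  by (simp add: fs_scale_def map.rep_eq when_def)

lemma seq_space_simps [simp]:
  "vecs (seq_space \<mu>) = UNIV" "smul (seq_space \<mu>) = fs_scale" "nrm (seq_space \<mu>) = \<mu>"
  by (simp_all add: seq_space_def)

lemma fin_seq_space_simps [simp]: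
  "vecs (fin_seq_space \<mu> n) = coord_space n" "smul (fin_seq_space \<mu> n) = fs_scale"
  "nrm (fin_seq_space \<mu> n) = \<mu>" "tnorm (fin_seq_space \<mu> n) = tnorm (seq_space \<mu>)"
  "tdist (fin_seq_space \<mu> n) = tdist (seq_space \<mu>)"
  by (simp_all add: fin_seq_space_def)

lemma lookup_comb_unit: "coord (comb fs_scale n unit_vec x) i = (if i < n then x i else 0)"
proof -
  have "coord (comb fs_scale n unit_vec x) i = (\<Sum>j<n. if j = i then x j else 0)"
    unfolding comb_def lookup_sum by (intro sum.cong) (auto simp: lookup_fs_scale lookup_single when_def)
  then show ?thesis by (simp add: sum.delta)
qed

type_synonym 'f vtuple = "nat \<Rightarrow> (nat \<Rightarrow>\<^sub>0 'f)"

locale seq_setting =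
  fixes \<mu> :: "(nat \<Rightarrow>\<^sub>0 'f::real_or_complex) \<Rightarrow> real"
  assumes normed_E: "normed_space (seq_space \<mu>)"
begin

abbreviation "E \<equiv> seq_space \<mu>"
abbreviation "En \<equiv> fin_seq_space \<mu>"

sublocale E: normed_nspace "seq_space \<mu>"
  using normed_E by unfold_locales

lemma \<mu>_0 [simp]: "\<mu> 0 = 0"
  using E.nrm_0 by simp

lemma \<mu>_nonneg [simp]: "0 \<le> \<mu> x"
  using E.nrm_nonneg[of x] by simp

lemma coord_space_range: "(coord_space n :: (nat \<Rightarrow>\<^sub>0 'f) set) = range (comb fs_scale n unit_vec)"
  unfolding coord_space_def using E.span_tuple[of unit_vec n] by simp

lemma coord_space_iff: "(x :: nat \<Rightarrow>\<^sub>0 'f) \<in> coord_space n \<longleftrightarrow> (\<forall>i\<ge>n. coord x i = 0)"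
proof
  assume "x \<in> coord_space n"
  then show "\<forall>i\<ge>n. coord x i = 0"
    unfolding coord_space_range by (auto simp: lookup_comb_unit)
next
  assume *: "\<forall>i\<ge>n. coord x i = 0"
  have "x = comb fs_scale n unit_vec (coord x)"
    by (rule poly_mapping_eqI) (use * in \<open>auto simp: lookup_comb_unit\<close>)
  then show "x \<in> coord_space n" unfolding coord_space_range by (metis rangeI)
qed

lemma coord_space_comb: "(x :: nat \<Rightarrow>\<^sub>0 'f) \<in> coord_space n \<Longrightarrow> x = comb fs_scale n unit_vec (coord x)"
  by (rule poly_mapping_eqI) (auto simp: lookup_comb_unit coord_space_iff)

lemma tuple_unit: "tuple E n unit_vec"
  by (simp add: tuple_def)

lemma nondeg_unit: "nondeg n (tnorm E n unit_vec)"
proof (rule E.independent_tuple_nondeg[OF tuple_unit], intro allI impI)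
  fix x :: "nat \<Rightarrow> 'f" and j
  assume "E.lcomb n unit_vec x = 0" "j < n"
  then show "x j = 0" using lookup_comb_unit[of n x j] by simp
qed

lemma coord_space_Gr: "coord_space n \<in> Gr n E"
  using E.Gr_tuple[OF tuple_unit nondeg_unit] by (simp add: coord_space_range)

lemma En_Age: "En n \<in> Age E"
  unfolding Age_def fin_seq_space_def using coord_space_Gr by blast

lemma En_normed: "normed_space (En n)"
  using Age_normed[OF normed_E En_Age] .

lemma coord_space_mono: "n \<le> n' \<Longrightarrow> (x :: nat \<Rightarrow>\<^sub>0 'f) \<in> coord_space n \<Longrightarrow> x \<in> coord_space n'"
  by (simp add: coord_space_iff)

lemma finite_in_coord_space:
  fixes A :: "(nat \<Rightarrow>\<^sub>0 'f) set"
  assumes "finite A"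
  shows "\<exists>n. A \<subseteq> coord_space n"
  using assms
proof (induction A rule: finite_induct)
  case (insert x A)
  then obtain n where n: "A \<subseteq> coord_space n" by blast
  obtain n' where "\<forall>i. coord x i \<noteq> 0 \<longrightarrow> i < n'"
    using finite_nat_set_iff_bounded[of "{i. coord x i \<noteq> 0}"] by auto
  then have "x \<in> coord_space n'" unfolding coord_space_iff by (meson not_le)
  then have "insert x A \<subseteq> coord_space (max n n')"
    using n coord_space_mono[of n "max n n'"] coord_space_mono[of n' "max n n'"] by auto
  then show ?case by blast
qed simp

lemma comb_in_coord_space:
  fixes v :: "nat \<Rightarrow> (nat \<Rightarrow>\<^sub>0 'f)"
  assumes "\<And>j. j < k \<Longrightarrow> v j \<in> coord_space n"
  shows "comb fs_scale k v x \<in> coord_space n"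
  using assms by (simp add: coord_space_iff comb_def lookup_sum lookup_fs_scale)

lemma Gr_in_coord_space:
  assumes "U \<in> Gr r E"
  shows "\<exists>n. U \<subseteq> coord_space n"
proof -
  obtain u where u: "U = range (E.lcomb r u)" by (rule E.Gr_obtain_tuple[OF assms])
  obtain n where "u ` {..<r} \<subseteq> coord_space n" using finite_in_coord_space[of "u ` {..<r}"] by blast
  then have "u j \<in> coord_space n" if "j < r" for j using that by blast
  then have "U \<subseteq> coord_space n" unfolding u by (auto intro: comb_in_coord_space)
  then show ?thesis by blast
qed

lemma tuple_in_En: "\<exists>N. tuple (En N) k v"
proof -
  obtain n where "v ` {..<k} \<subseteq> coord_space n" using finite_in_coord_space[of "v ` {..<k}"] by blast
  then have "tuple (En n) k v" by (auto simp: tuple_def)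
  then show ?thesis by blast
qed

lemma tuple_En_mono: "tuple (En n) k v \<Longrightarrow> n \<le> n' \<Longrightarrow> tuple (En n') k v"
  by (auto simp: tuple_def intro: coord_space_mono)

lemma tuple_En_E: "tuple E k v"
  by (simp add: tuple_def)

lemma coordinate_bound: "\<exists>c>0. \<forall>x\<in>coord_space n. \<forall>i. norm (coord x i) \<le> c * \<mu> x"
proof -
  obtain c where c: "0 < c" "\<And>x j. j < n \<Longrightarrow> norm (x j) \<le> c * tnorm E n unit_vec x"
    using nondeg_unit[of n] unfolding nondeg_def by blast
  have "norm (coord x i) \<le> c * \<mu> x" if x: "x \<in> coord_space n" for x i
  proof (cases "i < n")
    case True
    have "tnorm E n unit_vec (coord x) = \<mu> x"
      using coord_space_comb[OF x] by (simp add: tnorm_def)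
    then show ?thesis using c(2)[OF True, of "coord x"] by simp
  next
    case False
    then have "coord x i = 0" using x by (simp add: coord_space_iff)
    then show ?thesis using c(1) E.nrm_nonneg[of x] by simp
  qed
  with c(1) show ?thesis by blast
qed

lemma coord_space_norm_le:
  "x \<in> coord_space n \<Longrightarrow> \<mu> x \<le> (\<Sum>a<n. norm (coord x a) * \<mu> (unit_vec a))"
  using E.nrm_comb_le[OF tuple_unit, of n "coord x"] coord_space_comb[of x n] by simp

lemma bounded_tuple_net:
  assumes A: "\<And>v. v \<in> A \<Longrightarrow> tuple (En n) k v" "\<And>v j. v \<in> A \<Longrightarrow> j < k \<Longrightarrow> \<mu> (v j) \<le> r"
    and "0 < \<epsilon>"
  shows "\<exists>B\<subseteq>A. finite B \<and> (\<forall>v\<in>A. \<exists>b\<in>B. tdist E k v b \<le> \<epsilon>)"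
proof -
  obtain c where c: "0 < c" "\<And>x i. x \<in> coord_space n \<Longrightarrow> norm (coord x i) \<le> c * \<mu> x"
    using coordinate_bound by blast
  define M where "M = (\<Sum>j<k. \<Sum>a<n. \<mu> (unit_vec a)) + 1"
  have "0 \<le> (\<Sum>j<k. \<Sum>a<n. \<mu> (unit_vec a))"
    using E.nrm_nonneg by (intro sum_nonneg) simp
  then have M: "0 < M" by (simp add: M_def)
  have bd: "norm (coord (v (fst i)) (snd i)) \<le> c * r" if "v \<in> A" "i \<in> {..<k} \<times> {..<n}" for v i
  proof -
    have "norm (coord (v (fst i)) (snd i)) \<le> c * \<mu> (v (fst i))"
      using A(1)[OF that(1)] that(2) by (intro c(2)) (auto simp: tuple_def)
    also have "\<dots> \<le> c * r" using A(2)[OF that(1)] that(2) c(1) by (intro mult_left_mono) auto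
    finally show ?thesis .
  qed
  have fin: "finite ({..<k} \<times> {..<n})" by simp
  have pos: "0 < \<epsilon> / M" using M \<open>0 < \<epsilon>\<close> by simp
  have "\<exists>B\<subseteq>A. finite B \<and> (\<forall>v\<in>A. \<exists>b\<in>B. \<forall>i\<in>{..<k} \<times> {..<n}.
      norm (coord (v (fst i)) (snd i) - coord (b (fst i)) (snd i)) < \<epsilon> / M)"
    by (rule finite_net_of_bounded_scalars[where \<phi> = "\<lambda>v i. coord (v (fst i)) (snd i)" and r = "c * r"])
      (use fin bd pos in blast)+
  then obtain B where
    B: "B \<subseteq> A" "finite B" and net: "\<And>v. v \<in> A \<Longrightarrow> \<exists>b\<in>B. \<forall>i\<in>{..<k} \<times> {..<n}.
      norm (coord (v (fst i)) (snd i) - coord (b (fst i)) (snd i)) < \<epsilon> / M" by blast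
  have "\<exists>b\<in>B. tdist E k v b \<le> \<epsilon>" if v: "v \<in> A" for v
  proof -
    obtain b where b: "b \<in> B" "\<And>j a. j < k \<Longrightarrow> a < n \<Longrightarrow> norm (coord (v j) a - coord (b j) a) < \<epsilon> / M"
      using net[OF v] by force
    have "tdist E k v b = (\<Sum>j<k. \<mu> (v j - b j))" by (simp add: tdist_def)
    also have "\<dots> \<le> (\<Sum>j<k. \<Sum>a<n. (\<epsilon> / M) * \<mu> (unit_vec a))"
    proof (rule sum_mono)
      fix j assume j: "j \<in> {..<k}"
      then have "v j \<in> coord_space n" "b j \<in> coord_space n"
        using A(1)[OF v] A(1)[of b] b(1) B(1) by (auto simp: tuple_def)
      then have "v j - b j \<in> coord_space n" by (simp add: coord_space_iff lookup_minus)
      then have "\<mu> (v j - b j) \<le> (\<Sum>a<n. norm (coord (v j - b j) a) * \<mu> (unit_vec a))"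
        by (rule coord_space_norm_le)
      also have "\<dots> \<le> (\<Sum>a<n. (\<epsilon> / M) * \<mu> (unit_vec a))"
        using b(2)[of j] j E.nrm_nonneg
        by (intro sum_mono mult_right_mono) (auto simp: lookup_minus less_imp_le)
      finally show "\<mu> (v j - b j) \<le> (\<Sum>a<n. (\<epsilon> / M) * \<mu> (unit_vec a))" .
    qed
    also have "\<dots> = (\<epsilon> / M) * (\<Sum>j<k. \<Sum>a<n. \<mu> (unit_vec a))"
      by (simp only: sum_distrib_left)
    also have "\<dots> = (\<epsilon> / M) * (M - 1)" by (simp only: M_def add_diff_cancel_right')
    also have "\<dots> \<le> (\<epsilon> / M) * M" using pos by (intro mult_left_mono) auto
    also have "\<dots> = \<epsilon>" using M by simp
    finally show ?thesis using b(1) by blast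
  qed
  with B show ?thesis by blast
qed

lemma isom_En_inclusion: "N \<le> n \<Longrightarrow> isom (En N) (En n) id"
  by (auto simp: isom_def lin_on_def coord_space_mono)

text \<open>In terms of operators: the operators from the span of \<open>t\<close> to \<open>En n\<close> with distortion \<open>1 + \<delta>\<close>.\<close>

definition nbhd :: "nat \<Rightarrow> nat \<Rightarrow> 'f vtuple \<Rightarrow> real \<Rightarrow> 'f vtuple set" where
  "nbhd k n t \<delta> = {v. tuple (En n) k v \<and> near \<delta> (tnorm E k t) (tnorm E k v)}"

lemma nbhd_isom: "isom (En N) (En n) R \<Longrightarrow> v \<in> nbhd k N t \<delta> \<Longrightarrow> R \<circ> v \<in> nbhd k n t \<delta>"
  using normed_nspace.isom_tuple[OF normed_nspace.intro[OF En_normed], of N "En n" R k v]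
    normed_nspace.isom_tnorm[OF normed_nspace.intro[OF En_normed], of N "En n" R k v]
  by (simp add: nbhd_def)

lemma nbhd_tdist: "isom (En N) (En n) R \<Longrightarrow> v \<in> nbhd k N t \<delta> \<Longrightarrow> w \<in> nbhd k N t' \<delta>' \<Longrightarrow>
    tdist E k (R \<circ> v) (R \<circ> w) = tdist E k v w"
  using normed_nspace.isom_tdist[OF normed_nspace.intro[OF En_normed], of N "En n" R k v w]
  by (simp add: nbhd_def)

end


section \<open>The Ramsey property for tuples\<close>

context seq_setting
begin

text \<open>The colourings that the Ramsey property applies to, and the almost constant ones.\<close>

definition tame :: "nat \<Rightarrow> nat \<Rightarrow> 'f vtuple \<Rightarrow> real \<Rightarrow> real \<Rightarrow> real \<Rightarrow>
    ('f vtuple \<Rightarrow> real) \<Rightarrow> bool"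
  where "tame k n t \<delta> L B \<phi> \<longleftrightarrow> (\<forall>v\<in>nbhd k n t \<delta>. 0 \<le> \<phi> v \<and> \<phi> v \<le> B) \<and>
    (\<forall>v\<in>nbhd k n t \<delta>. \<forall>w\<in>nbhd k n t \<delta>. \<bar>\<phi> v - \<phi> w\<bar> \<le> L * tdist E k v w)"

definition osc_le :: "nat \<Rightarrow> nat \<Rightarrow> 'f vtuple \<Rightarrow> real \<Rightarrow> real \<Rightarrow>
    ('f vtuple \<Rightarrow> real) \<Rightarrow> bool"
  where "osc_le k N t \<delta> \<epsilon> \<phi> \<longleftrightarrow> (\<forall>v\<in>nbhd k N t \<delta>. \<forall>w\<in>nbhd k N t \<delta>. \<bar>\<phi> v - \<phi> w\<bar> \<le> \<epsilon>)"

lemma tame_pull: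
  assumes c: "tame k n t \<delta> L B c" and R: "isom (En N) (En n) R"
  shows "tame k N t \<delta> L B (\<lambda>v. c (R \<circ> v))"
  unfolding tame_def
proof (intro conjI ballI)
  fix v assume v: "v \<in> nbhd k N t \<delta>"
  show "0 \<le> c (R \<circ> v)" "c (R \<circ> v) \<le> B"
    using c nbhd_isom[OF R v] unfolding tame_def by blast+
  fix w assume w: "w \<in> nbhd k N t \<delta>"
  have "\<bar>c (R \<circ> v) - c (R \<circ> w)\<bar> \<le> L * tdist E k (R \<circ> v) (R \<circ> w)"
    using c nbhd_isom[OF R v] nbhd_isom[OF R w] unfolding tame_def by blast
  then show "\<bar>c (R \<circ> v) - c (R \<circ> w)\<bar> \<le> L * tdist E k v w"
    by (simp only: nbhd_tdist[OF R v w])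
qed

lemma osc_le_pull: "osc_le k n t \<delta> \<epsilon> c \<Longrightarrow> isom (En N) (En n) R \<Longrightarrow> osc_le k N t \<delta> \<epsilon> (\<lambda>v. c (R \<circ> v))"
  unfolding osc_le_def using nbhd_isom by blast

end

locale ramsey_setting = seq_setting \<mu> for \<mu> :: "(nat \<Rightarrow>\<^sub>0 'f::real_or_complex) \<Rightarrow> real" +
  assumes sarp: "SARP_plus (Age (seq_space \<mu>))"
begin

text \<open>Operators from the span of \<open>t\<close> that distort the norm by at most \<open>1 + \<delta>\<close>
  correspond to the tuples in a neighbourhood of \<open>t\<close>, so this is the Ramsey property
  in coordinates. A real colouring that is only defined for small distortions extends
  to all the distortions that are admitted by the Ramsey property.\<close>

lemma ramsey_tuple:
  assumes t: "nondeg k (tnorm E k t)" and "0 < \<epsilon>" "0 \<le> L" "0 \<le> B"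
  shows "\<exists>\<delta>0>0. \<forall>\<delta>. 0 < \<delta> \<longrightarrow> \<delta> \<le> \<delta>0 \<longrightarrow> (\<forall>N. \<exists>n0. \<forall>n\<ge>n0. \<forall>\<phi>.
    tame k n t \<delta> L B \<phi> \<longrightarrow> (\<exists>R. isom (En N) (En n) R \<and> osc_le k N t \<delta> \<epsilon> (\<lambda>v. \<phi> (R \<circ> v))))"
proof -
  have tt: "tuple E k t" by (rule tuple_En_E)
  define U where "U = range (E.lcomb k t)"
  define X where "X = sub E U"
  have UG: "U \<in> Gr k E" unfolding U_def by (rule E.Gr_tuple[OF tt t])
  have XA: "X \<in> Age E" unfolding X_def Age_def using UG by blast
  have Xdim: "ndim X = k" using UG unfolding X_def ndim_def Gr_def by simp
  interpret X: normed_nspace X using Age_normed[OF normed_E XA] by unfold_locales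
  have tX: "tuple X k t" unfolding X_def U_def tuple_def using E.comb_unit[of _ k t]
    by (metis lessThan_iff rangeI sub_simps(1))
  have tnX: "tnorm X k t = tnorm E k t" by (simp add: X_def)
  have Xv: "vecs X = U" by (simp add: X_def)
  define A where "A = (\<Sum>j<k. \<mu> (t j))"
  have A0: "0 \<le> A" unfolding A_def using E.nrm_nonneg by (intro sum_nonneg) simp
  \<comment> \<open>Division by \<open>C\<close> turns the colouring into a 1-Lipschitz one with values in the unit interval.\<close>
  define C where "C = L * A + B + 1"
  have C: "0 < C" "L * A \<le> C" "B \<le> C"
    using A0 \<open>0 \<le> L\<close> \<open>0 \<le> B\<close> by (auto simp: C_def intro: add_nonneg_pos)
  have "0 < \<epsilon> / C" using \<open>0 < \<epsilon>\<close> C(1) by simp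
  from sarp[unfolded SARP_plus_def, rule_format, OF this, of k] obtain \<delta>0 where \<delta>0: "0 < \<delta>0" and
    Z0: "\<forall>X\<in>Age E. \<forall>Y\<in>Age E. ndim X = k \<longrightarrow>
     (\<exists>Z\<in>Age E. \<forall>c. lip1 (Emb_delta \<delta>0 X Z) (op_dist X Z) {0..1} dist c \<longrightarrow>
        (\<exists>\<gamma>\<in>Emb Y Z. \<forall>S\<in>compose (vecs X) \<gamma> ` Emb_delta \<delta>0 X Y.
           \<forall>S'\<in>compose (vecs X) \<gamma> ` Emb_delta \<delta>0 X Y. \<bar>c S - c S'\<bar> \<le> \<epsilon> / C))" by blast
  show ?thesis
  proof (intro exI[of _ \<delta>0] conjI allI impI \<delta>0)
    fix \<delta> :: real and N assume \<delta>: "0 < \<delta>" "\<delta> \<le> \<delta>0"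
    from Z0 XA En_Age[of N] Xdim obtain Z where ZA: "Z \<in> Age E" and
      Z: "\<And>c. lip1 (Emb_delta \<delta>0 X Z) (op_dist X Z) {0..1} dist c \<Longrightarrow>
        \<exists>\<gamma>\<in>Emb (En N) Z. \<forall>S\<in>compose (vecs X) \<gamma> ` Emb_delta \<delta>0 X (En N).
           \<forall>S'\<in>compose (vecs X) \<gamma> ` Emb_delta \<delta>0 X (En N). \<bar>c S - c S'\<bar> \<le> \<epsilon> / C" by blast
    interpret Z: normed_nspace Z using Age_normed[OF normed_E ZA] by unfold_locales
    from ZA obtain r V where V: "Z = sub E V" "V \<in> Gr r E" unfolding Age_def by blast
    obtain n0 where n0: "V \<subseteq> coord_space n0" using Gr_in_coord_space[OF V(2)] by blast
    have Zs [simp]: "smul Z = fs_scale" "nrm Z = \<mu>" "vecs Z = V" "tnorm Z = tnorm E" by (simp_all add: V(1))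
    show "\<exists>n0. \<forall>n\<ge>n0. \<forall>\<phi>. tame k n t \<delta> L B \<phi> \<longrightarrow>
        (\<exists>R. isom (En N) (En n) R \<and> osc_le k N t \<delta> \<epsilon> (\<lambda>v. \<phi> (R \<circ> v)))"
    proof (intro exI[of _ n0] allI impI)
      fix n and \<phi> :: "'f vtuple \<Rightarrow> real"
      assume n: "n0 \<le> n" and "tame k n t \<delta> L B \<phi>"
      then have rng: "\<And>v. v \<in> nbhd k n t \<delta> \<Longrightarrow> 0 \<le> \<phi> v \<and> \<phi> v \<le> B"
        and lip: "\<And>v w. v \<in> nbhd k n t \<delta> \<Longrightarrow> w \<in> nbhd k n t \<delta> \<Longrightarrow> \<bar>\<phi> v - \<phi> w\<bar> \<le> L * tdist E k v w"
        unfolding tame_def by blast+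
      have Vn: "V \<subseteq> coord_space n" using n0 coord_space_mono[OF n] by blast
      let ?M = "Emb_delta \<delta>0 X Z" and ?A = "Emb_delta \<delta> X Z"
      have Mfacts: "(\<forall>x\<in>vecs X. S x \<in> vecs Z) \<and> bounded_on X Z S \<and> lin_on X Z S" if "S \<in> ?M" for S
      proof -
        have "near_isom \<delta>0 X Z S" using Emb_delta_near_isom[OF _ that] \<delta>0 by simp
        then show ?thesis by (auto simp: near_isom_def lin_on_def bounded_on_def)
      qed
      have Anbhd: "S \<circ> t \<in> nbhd k n t \<delta>" if "S \<in> ?A" for S
      proof -
        have S: "near_isom \<delta> X Z S" using Emb_delta_near_isom[OF _ that] \<delta>(1) by simp
        then have "lin_on X Z S" by (simp add: near_isom_def)
        then have "tuple Z k (S \<circ> t)" by (rule X.lin_on_tuple[OF _ tX])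
        then have "tuple (En n) k (S \<circ> t)" using Vn by (auto simp: tuple_def)
        moreover have "near \<delta> (tnorm E k t) (tnorm E k (S \<circ> t))"
          using X.near_isom_tnorm[OF S tX] by (simp add: tnX)
        ultimately show ?thesis by (simp add: nbhd_def)
      qed
      have AM: "?A \<subseteq> ?M"
      proof
        fix S assume S: "S \<in> ?A"
        then have 1: "near_isom \<delta> X Z S" using Emb_delta_near_isom[OF _ S] \<delta>(1) by simp
        have "near_isom \<delta>0 X Z S" by (rule near_isom_mono[OF 1 \<delta>(2) X.nrm_nonneg Z.nrm_nonneg])
        from X.restrict_Emb_delta[OF _ this] \<delta>0 have "restrict S (vecs X) \<in> ?M" by simp
        moreover have "restrict S (vecs X) = S"
          using S by (auto simp: Emb_delta_def lin_def lin_maps_def)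
        ultimately show "S \<in> ?M" by simp
      qed
      have le: "\<bar>\<phi> (S \<circ> t) / C - \<phi> (S' \<circ> t) / C\<bar> \<le> op_dist X Z S S'" if S: "S \<in> ?A" and S': "S' \<in> ?A" for S S'
      proof -
        have SM: "S \<in> ?M" "S' \<in> ?M" using AM S S' by blast+
        note f = Z.op_dist_facts(1,2)[of X S S', OF X.nrm_nonneg]
        have d: "0 \<le> op_dist X Z S S'" "\<And>x. x \<in> vecs X \<Longrightarrow> nrm Z (S x - S' x) \<le> op_dist X Z S S' * nrm X x"
          using f Mfacts[OF SM(1)] Mfacts[OF SM(2)] by blast+
        have "tdist E k (S \<circ> t) (S' \<circ> t) \<le> (\<Sum>j<k. op_dist X Z S S' * \<mu> (t j))"
          unfolding tdist_def
        proof (rule sum_mono)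
          fix j assume "j \<in> {..<k}"
          then have "t j \<in> vecs X" using tX by (simp add: tuple_def)
          from d(2)[OF this] show "nrm E ((S \<circ> t) j - (S' \<circ> t) j) \<le> op_dist X Z S S' * \<mu> (t j)"
            by (simp add: X_def)
        qed
        also have "\<dots> = op_dist X Z S S' * A" by (simp add: A_def sum_distrib_left)
        finally have "L * tdist E k (S \<circ> t) (S' \<circ> t) \<le> L * (op_dist X Z S S' * A)"
          using \<open>0 \<le> L\<close> by (rule mult_left_mono)
        also have "\<dots> = op_dist X Z S S' * (L * A)" by simp
        also have "\<dots> \<le> op_dist X Z S S' * C" using C(2) d(1) by (intro mult_left_mono)
        finally have "\<bar>\<phi> (S \<circ> t) - \<phi> (S' \<circ> t)\<bar> \<le> op_dist X Z S S' * C"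
          using lip[OF Anbhd[OF S] Anbhd[OF S']] by linarith
        then show ?thesis
          using C(1) by (simp add: diff_divide_distrib[symmetric] pos_divide_le_eq)
      qed
      \<comment> \<open>The Ramsey property needs a colour for each operator of distortion \<open>1 + \<delta>0\<close>, not only \<open>1 + \<delta>\<close>.\<close>
      have "\<exists>c. lip1 ?M (op_dist X Z) {0..1} dist c \<and> (\<forall>S\<in>?A. c S = \<phi> (S \<circ> t) / C)"
      proof (rule McShane_extension[OF _ _ _ _ AM _ le])
        fix S S' S'' assume SM: "S \<in> ?M" "S' \<in> ?M" "S'' \<in> ?M"
        show "op_dist X Z S S'' \<le> op_dist X Z S S' + op_dist X Z S' S''"
          using Z.op_dist_triangle[of X S S' S'', OF X.nrm_nonneg] Mfacts[OF SM(1)] Mfacts[OF SM(2)]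
            Mfacts[OF SM(3)] by blast
      next
        fix S S' assume SM: "S \<in> ?M" "S' \<in> ?M"
        show "op_dist X Z S S' = op_dist X Z S' S" "0 \<le> op_dist X Z S S'"
          using Z.op_dist_facts(1,3)[of X S S', OF X.nrm_nonneg] Mfacts[OF SM(1)] Mfacts[OF SM(2)]
          by blast+
      next
        fix S assume "S \<in> ?A"
        from rng[OF Anbhd[OF this]] C show "0 \<le> \<phi> (S \<circ> t) / C \<and> \<phi> (S \<circ> t) / C \<le> 1"
          by (simp add: pos_divide_le_eq)
      qed (rule Z.op_dist_self)
      then obtain c where c: "lip1 ?M (op_dist X Z) {0..1} dist c" "\<And>S. S \<in> ?A \<Longrightarrow> c S = \<phi> (S \<circ> t) / C"
        by blast
      from Z[OF c(1)] obtain \<gamma> where \<gamma>: "\<gamma> \<in> Emb (En N) Z" and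
        osc: "\<And>S S'. S \<in> Emb_delta \<delta>0 X (En N) \<Longrightarrow> S' \<in> Emb_delta \<delta>0 X (En N) \<Longrightarrow>
           \<bar>c (compose (vecs X) \<gamma> S) - c (compose (vecs X) \<gamma> S')\<bar> \<le> \<epsilon> / C" by blast
      have \<gamma>i: "isom (En N) Z \<gamma>" by (rule Emb_isom[OF \<gamma>])
      then have R: "isom (En N) (En n) \<gamma>" using Vn by (auto simp: isom_def lin_on_def)
      have key: "\<exists>S\<in>Emb_delta \<delta>0 X (En N). c (compose (vecs X) \<gamma> S) = \<phi> (\<gamma> \<circ> v) / C"
        if v: "v \<in> nbhd k N t \<delta>" for v
      proof -
        have tv: "tuple (En N) k v" "near \<delta> (tnorm E k t) (tnorm E k v)" using v by (auto simp: nbhd_def)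
        obtain S where S: "lin_on X (En N) S" "\<And>x. S (E.lcomb k t x) = E.lcomb k v x"
          using E.lin_on_extend_tuple[OF tt t En_normed tv(1)] unfolding X_def U_def by auto
        have Sn: "near_isom \<delta> X (En N) S"
          unfolding near_isom_def
        proof (intro conjI S(1) ballI)
          fix x assume "x \<in> vecs X"
          then obtain y where y: "x = E.lcomb k t y" unfolding Xv U_def by blast
          have "nrm X x = tnorm E k t y" by (simp add: y X_def tnorm_def)
          moreover have "nrm (En N) (S x) = tnorm E k v y" unfolding y S(2) by (simp add: tnorm_def)
          ultimately show "nrm X x \<le> (1 + \<delta>) * nrm (En N) (S x)" "nrm (En N) (S x) \<le> (1 + \<delta>) * nrm X x"
            using tv(2) unfolding near_def by auto
        qed
        have Sn0: "near_isom \<delta>0 X (En N) S" by (rule near_isom_mono[OF Sn \<delta>(2)]) simp_all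
        let ?S = "restrict S (vecs X)"
        have in0: "?S \<in> Emb_delta \<delta>0 X (En N)" using X.restrict_Emb_delta[OF _ Sn0] \<delta>0 by simp
        have "near_isom \<delta> X Z (\<gamma> \<circ> S)" by (rule near_isom_comp_isom[OF \<gamma>i Sn])
        from X.restrict_Emb_delta[OF _ this] \<delta>(1) have "restrict (\<gamma> \<circ> S) (vecs X) \<in> ?A" by simp
        moreover have cmp: "restrict (\<gamma> \<circ> S) (vecs X) = compose (vecs X) \<gamma> ?S"
          by (auto simp: compose_def)
        ultimately have in1: "compose (vecs X) \<gamma> ?S \<in> ?A" by simp
        have eq: "(compose (vecs X) \<gamma> ?S \<circ> t) j = (\<gamma> \<circ> v) j" if "j < k" for j
        proof -
          have "t j \<in> vecs X" using tX that by (simp add: tuple_def)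
          moreover have "S (t j) = v j"
            using S(2)[of "\<lambda>l. if l = j then 1 else 0"] E.comb_unit[OF that] by simp
          ultimately show ?thesis by (simp add: compose_def)
        qed
        have g1: "compose (vecs X) \<gamma> ?S \<circ> t \<in> nbhd k n t \<delta>" by (rule Anbhd[OF in1])
        have g2: "\<gamma> \<circ> v \<in> nbhd k n t \<delta>" by (rule nbhd_isom[OF R v])
        have "tdist E k (compose (vecs X) \<gamma> ?S \<circ> t) (\<gamma> \<circ> v) = 0"
          unfolding tdist_def using eq by (intro sum.neutral) auto
        then have "\<phi> (compose (vecs X) \<gamma> ?S \<circ> t) = \<phi> (\<gamma> \<circ> v)"
          using lip[OF g1 g2] by simp
        then have "c (compose (vecs X) \<gamma> ?S) = \<phi> (\<gamma> \<circ> v) / C" using c(2)[OF in1] by simp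
        with in0 show ?thesis by blast
      qed
      have "\<bar>\<phi> (\<gamma> \<circ> v) - \<phi> (\<gamma> \<circ> w)\<bar> \<le> \<epsilon>" if v: "v \<in> nbhd k N t \<delta>" and w: "w \<in> nbhd k N t \<delta>" for v w
      proof -
        obtain S where S: "S \<in> Emb_delta \<delta>0 X (En N)" "c (compose (vecs X) \<gamma> S) = \<phi> (\<gamma> \<circ> v) / C"
          using key[OF v] by blast
        obtain S' where S': "S' \<in> Emb_delta \<delta>0 X (En N)" "c (compose (vecs X) \<gamma> S') = \<phi> (\<gamma> \<circ> w) / C"
          using key[OF w] by blast
        have "\<bar>\<phi> (\<gamma> \<circ> v) / C - \<phi> (\<gamma> \<circ> w) / C\<bar> \<le> \<epsilon> / C"
          using osc[OF S(1) S'(1)] S(2) S'(2) by simp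
        then show ?thesis
          using C(1) by (simp add: diff_divide_distrib[symmetric] divide_le_cancel)
      qed
      then have "osc_le k N t \<delta> \<epsilon> (\<lambda>v. \<phi> (\<gamma> \<circ> v))" unfolding osc_le_def by blast
      with R show "\<exists>R. isom (En N) (En n) R \<and> osc_le k N t \<delta> \<epsilon> (\<lambda>v. \<phi> (R \<circ> v))" by blast
    qed
  qed
qed

end


context seq_setting
begin

lemma nbhd_net:
  assumes "0 < \<epsilon>"
  shows "\<exists>B\<subseteq>nbhd k n t \<delta>. finite B \<and> (\<forall>v\<in>nbhd k n t \<delta>. \<exists>b\<in>B. tdist E k v b \<le> \<epsilon>)"
proof -
  define r where "r = (\<Sum>j<k. \<bar>1 + \<delta>\<bar> * \<mu> (t j))"
  have "\<mu> (v j) \<le> r" if v: "v \<in> nbhd k n t \<delta>" and j: "j < k" for v j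
  proof -
    have "\<mu> (v j) \<le> (1 + \<delta>) * tnorm E k t (\<lambda>i. if i = j then 1 else 0)"
      using E.near_entry_le[of \<delta> "tnorm E k t" k v j] v j by (simp add: nbhd_def)
    also have "\<dots> \<le> \<bar>1 + \<delta>\<bar> * \<mu> (t j)"
      using E.tnorm_unit[OF j, of t] by (intro mult_mono) auto
    also have "\<dots> \<le> r"
      unfolding r_def using j by (intro member_le_sum) auto
    finally show ?thesis .
  qed
  moreover have "tuple (En n) k v" if "v \<in> nbhd k n t \<delta>" for v using that by (simp add: nbhd_def)
  ultimately show ?thesis using \<open>0 < \<epsilon>\<close> by (intro bounded_tuple_net[where r = r])
qed

definition tame2 :: "nat \<Rightarrow> nat \<Rightarrow> 'f vtuple \<Rightarrow> 'f vtuple \<Rightarrow> real \<Rightarrow> real \<Rightarrow> real \<Rightarrow>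
    ('f vtuple \<Rightarrow> 'f vtuple \<Rightarrow> real) \<Rightarrow> bool"
  where "tame2 k n t0 t1 \<delta> L B \<phi> \<longleftrightarrow>
    (\<forall>v\<in>nbhd k n t0 \<delta>. \<forall>w\<in>nbhd k n t1 \<delta>. 0 \<le> \<phi> v w \<and> \<phi> v w \<le> B) \<and>
    (\<forall>v\<in>nbhd k n t0 \<delta>. \<forall>w\<in>nbhd k n t1 \<delta>. \<forall>v'\<in>nbhd k n t0 \<delta>. \<forall>w'\<in>nbhd k n t1 \<delta>.
       \<bar>\<phi> v w - \<phi> v' w'\<bar> \<le> L * (tdist E k v v' + tdist E k w w'))"

definition osc2_le :: "nat \<Rightarrow> nat \<Rightarrow> 'f vtuple \<Rightarrow> 'f vtuple \<Rightarrow> real \<Rightarrow> real \<Rightarrow>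
    ('f vtuple \<Rightarrow> 'f vtuple \<Rightarrow> real) \<Rightarrow> bool"
  where "osc2_le k N t0 t1 \<delta> \<epsilon> \<phi> \<longleftrightarrow>
    (\<forall>v\<in>nbhd k N t0 \<delta>. \<forall>w\<in>nbhd k N t1 \<delta>. \<forall>v'\<in>nbhd k N t0 \<delta>. \<forall>w'\<in>nbhd k N t1 \<delta>.
       \<bar>\<phi> v w - \<phi> v' w'\<bar> \<le> \<epsilon>)"

end

context ramsey_setting
begin

text \<open>The product version. The colouring of pairs is stabilised in the first variable for the
  finitely many second entries of a net in a space that is large enough to stabilise
  the second variable afterwards.\<close>

lemma ramsey_tuple_pair:
  assumes t: "nondeg k (tnorm E k t0)" "nondeg k (tnorm E k t1)" and "0 < \<epsilon>" "0 \<le> L" "0 \<le> B"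
  shows "\<exists>\<delta>0>0. \<forall>\<delta>. 0 < \<delta> \<longrightarrow> \<delta> \<le> \<delta>0 \<longrightarrow> (\<forall>N. \<exists>n0. \<forall>n\<ge>n0. \<forall>\<phi>.
    tame2 k n t0 t1 \<delta> L B \<phi> \<longrightarrow> (\<exists>R0 R1. isom (En N) (En n) R0 \<and> isom (En N) (En n) R1 \<and>
       osc2_le k N t0 t1 \<delta> \<epsilon> (\<lambda>v w. \<phi> (R0 \<circ> v) (R1 \<circ> w))))"
proof -
  have e8: "0 < \<epsilon> / 8" using \<open>0 < \<epsilon>\<close> by simp
  obtain \<delta>a where \<delta>a: "0 < \<delta>a" "\<forall>\<delta>. 0 < \<delta> \<longrightarrow> \<delta> \<le> \<delta>a \<longrightarrow> (\<forall>N. \<exists>n0. \<forall>n\<ge>n0. \<forall>\<phi>.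
      tame k n t0 \<delta> L B \<phi> \<longrightarrow> (\<exists>R. isom (En N) (En n) R \<and> osc_le k N t0 \<delta> (\<epsilon> / 8) (\<lambda>v. \<phi> (R \<circ> v))))"
    using ramsey_tuple[OF t(1) e8 \<open>0 \<le> L\<close> \<open>0 \<le> B\<close>] by blast
  obtain \<delta>b where \<delta>b: "0 < \<delta>b" "\<forall>\<delta>. 0 < \<delta> \<longrightarrow> \<delta> \<le> \<delta>b \<longrightarrow> (\<forall>N. \<exists>n0. \<forall>n\<ge>n0. \<forall>\<phi>.
      tame k n t1 \<delta> L B \<phi> \<longrightarrow> (\<exists>R. isom (En N) (En n) R \<and> osc_le k N t1 \<delta> (\<epsilon> / 8) (\<lambda>v. \<phi> (R \<circ> v))))"
    using ramsey_tuple[OF t(2) e8 \<open>0 \<le> L\<close> \<open>0 \<le> B\<close>] by blast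
  show ?thesis
  proof (intro exI[of _ "min \<delta>a \<delta>b"] conjI allI impI)
    show "0 < min \<delta>a \<delta>b" using \<delta>a(1) \<delta>b(1) by simp
    fix \<delta> :: real and N assume \<delta>: "0 < \<delta>" "\<delta> \<le> min \<delta>a \<delta>b"
    have \<delta>ab: "\<delta> \<le> \<delta>a" "\<delta> \<le> \<delta>b" using \<delta>(2) by simp_all
    obtain n1 where n1: "\<And>n \<phi>. n1 \<le> n \<Longrightarrow> tame k n t1 \<delta> L B \<phi> \<Longrightarrow>
      \<exists>R. isom (En N) (En n) R \<and> osc_le k N t1 \<delta> (\<epsilon> / 8) (\<lambda>v. \<phi> (R \<circ> v))"
      using \<delta>b(2) \<delta>(1) \<delta>ab(2) by blast
    \<comment> \<open>Passing to the net costs \<open>\<epsilon> / 16\<close> twice; added to the oscillation \<open>\<epsilon> / 8\<close> on the net this is \<open>\<epsilon> / 4\<close>.\<close>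
    define r where "r = \<epsilon> / (16 * (L + 1))"
    have r: "0 < r" "L * r \<le> \<epsilon> / 16"
      using \<open>0 < \<epsilon>\<close> \<open>0 \<le> L\<close> by (auto simp: r_def field_simps)
    obtain W where W: "W \<subseteq> nbhd k n1 t1 \<delta>" "finite W"
      "\<And>w. w \<in> nbhd k n1 t1 \<delta> \<Longrightarrow> \<exists>b\<in>W. tdist E k w b \<le> r"
      using nbhd_net[OF r(1), of k n1 t1 \<delta>] by blast
    have "\<exists>n0. \<forall>n\<ge>n0. \<forall>c. (\<forall>b\<in>W. tame k n t0 \<delta> L B (c b)) \<longrightarrow>
       (\<exists>R. isom (En N) (En n) R \<and> (\<forall>b\<in>W. osc_le k N t0 \<delta> (\<epsilon> / 8) (\<lambda>v. c b (R \<circ> v))))"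
    proof (rule combine_ramsey[where Em = "\<lambda>N n R. isom (En N) (En n) R"
          and pull = "\<lambda>R c b v. c b (R \<circ> v)" and nice = "\<lambda>b n c. tame k n t0 \<delta> L B (c b)"
          and good = "\<lambda>b n c. osc_le k n t0 \<delta> (\<epsilon> / 8) (c b)", OF _ _ _ _ _ W(2)])
      fix N n1 n R R' assume "isom (En n1) (En n) R" "isom (En N) (En n1) R'"
      from isom_comp[OF this]
      show "\<exists>R''. isom (En N) (En n) R'' \<and> (\<forall>c. (\<lambda>b v. c b (R'' \<circ> v)) = (\<lambda>b v. c b (R \<circ> (R' \<circ> v))))"
        by (intro exI[of _ "R \<circ> R'"]) (simp add: o_assoc)
    next
      fix N n :: nat assume "N \<le> n"
      then show "\<exists>R. isom (En N) (En n) R" using isom_En_inclusion by blast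
    next
      fix b and N :: nat
      show "\<exists>n0. \<forall>n\<ge>n0. \<forall>c. tame k n t0 \<delta> L B (c b) \<longrightarrow>
          (\<exists>R. isom (En N) (En n) R \<and> osc_le k N t0 \<delta> (\<epsilon> / 8) (\<lambda>v. c b (R \<circ> v)))"
        using \<delta>a(2) \<delta>(1) \<delta>ab(1) by blast
    qed (rule tame_pull osc_le_pull; assumption)+
    then obtain n0 where n0: "\<And>n c. n0 \<le> n \<Longrightarrow> (\<And>b. b \<in> W \<Longrightarrow> tame k n t0 \<delta> L B (c b)) \<Longrightarrow>
       \<exists>R. isom (En N) (En n) R \<and> (\<forall>b\<in>W. osc_le k N t0 \<delta> (\<epsilon> / 8) (\<lambda>v. c b (R \<circ> v)))" by blast
    show "\<exists>n0. \<forall>n\<ge>n0. \<forall>\<phi>. tame2 k n t0 t1 \<delta> L B \<phi> \<longrightarrow>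
      (\<exists>R0 R1. isom (En N) (En n) R0 \<and> isom (En N) (En n) R1 \<and>
         osc2_le k N t0 t1 \<delta> \<epsilon> (\<lambda>v w. \<phi> (R0 \<circ> v) (R1 \<circ> w)))"
    proof (intro exI[of _ "max n0 n1"] allI impI)
      fix n and \<phi> :: "'f vtuple \<Rightarrow> 'f vtuple \<Rightarrow> real"
      assume n: "max n0 n1 \<le> n" and "tame2 k n t0 t1 \<delta> L B \<phi>"
      then have rng: "\<And>v w. v \<in> nbhd k n t0 \<delta> \<Longrightarrow> w \<in> nbhd k n t1 \<delta> \<Longrightarrow> 0 \<le> \<phi> v w \<and> \<phi> v w \<le> B"
        and lip: "\<And>v w v' w'. v \<in> nbhd k n t0 \<delta> \<Longrightarrow> w \<in> nbhd k n t1 \<delta> \<Longrightarrow> v' \<in> nbhd k n t0 \<delta> \<Longrightarrow>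
          w' \<in> nbhd k n t1 \<delta> \<Longrightarrow> \<bar>\<phi> v w - \<phi> v' w'\<bar> \<le> L * (tdist E k v v' + tdist E k w w')"
        unfolding tame2_def by blast+
      have td0: "tdist E k v v = 0" for v by (simp add: tdist_def)
      have In1: "isom (En n1) (En n) id" using n by (intro isom_En_inclusion) simp
      have n1n: "w \<in> nbhd k n t1 \<delta>" if "w \<in> nbhd k n1 t1 \<delta>" for w
        using nbhd_isom[OF In1 that] by simp
      have "\<exists>R. isom (En N) (En n) R \<and> (\<forall>b\<in>W. osc_le k N t0 \<delta> (\<epsilon> / 8) (\<lambda>v. \<phi> (R \<circ> v) b))"
      proof (rule n0)
        fix b assume "b \<in> W"
        then have b: "b \<in> nbhd k n t1 \<delta>" using W(1) n1n by blast
        show "tame k n t0 \<delta> L B (\<lambda>v. \<phi> v b)"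
          unfolding tame_def using rng[OF _ b] lip[OF _ b _ b] by (simp add: td0)
      qed (use n in simp)
      then obtain R0 where R0: "isom (En N) (En n) R0" and
        g0: "\<And>b v v'. b \<in> W \<Longrightarrow> v \<in> nbhd k N t0 \<delta> \<Longrightarrow> v' \<in> nbhd k N t0 \<delta> \<Longrightarrow>
          \<bar>\<phi> (R0 \<circ> v) b - \<phi> (R0 \<circ> v') b\<bar> \<le> \<epsilon> / 8" unfolding osc_le_def by blast
      have g0': "\<bar>\<phi> (R0 \<circ> v) w - \<phi> (R0 \<circ> v') w\<bar> \<le> \<epsilon> / 4"
        if w: "w \<in> nbhd k n1 t1 \<delta>" and v: "v \<in> nbhd k N t0 \<delta>" "v' \<in> nbhd k N t0 \<delta>" for v v' w
      proof -
        obtain b where b: "b \<in> W" "tdist E k w b \<le> r" using W(3)[OF w] by blast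
        have bn: "b \<in> nbhd k n t1 \<delta>" using W(1) b(1) n1n by blast
        have Lb: "L * tdist E k w b \<le> \<epsilon> / 16"
          using mult_left_mono[OF b(2) \<open>0 \<le> L\<close>] r(2) by linarith
        have "\<bar>\<phi> (R0 \<circ> u) w - \<phi> (R0 \<circ> u) b\<bar> \<le> \<epsilon> / 16" if u: "u \<in> nbhd k N t0 \<delta>" for u
          using lip[OF nbhd_isom[OF R0 u] n1n[OF w] nbhd_isom[OF R0 u] bn] Lb by (simp add: td0)
        from this[OF v(1)] this[OF v(2)] g0[OF b(1) v] show ?thesis by linarith
      qed
      show "\<exists>R0 R1. isom (En N) (En n) R0 \<and> isom (En N) (En n) R1 \<and>
         osc2_le k N t0 t1 \<delta> \<epsilon> (\<lambda>v w. \<phi> (R0 \<circ> v) (R1 \<circ> w))"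
      proof (cases "nbhd k N t0 \<delta> = {}")
        case True
        with R0 show ?thesis unfolding osc2_le_def by blast
      next
        case False
        then obtain v0 where v0: "v0 \<in> nbhd k N t0 \<delta>" by blast
        have "tame k n1 t1 \<delta> L B (\<lambda>w. \<phi> (R0 \<circ> v0) w)"
          unfolding tame_def
          using rng[OF nbhd_isom[OF R0 v0] n1n] lip[OF nbhd_isom[OF R0 v0] n1n nbhd_isom[OF R0 v0] n1n]
          by (simp add: td0)
        from n1[OF order_refl this] obtain R1 where R1: "isom (En N) (En n1) R1" and
          g1: "\<And>w w'. w \<in> nbhd k N t1 \<delta> \<Longrightarrow> w' \<in> nbhd k N t1 \<delta> \<Longrightarrow>
            \<bar>\<phi> (R0 \<circ> v0) (R1 \<circ> w) - \<phi> (R0 \<circ> v0) (R1 \<circ> w')\<bar> \<le> \<epsilon> / 8" unfolding osc_le_def by blast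
        have R1n: "isom (En N) (En n) R1" using isom_comp[OF In1 R1] by simp
        have "\<bar>\<phi> (R0 \<circ> v) (R1 \<circ> w) - \<phi> (R0 \<circ> v') (R1 \<circ> w')\<bar> \<le> \<epsilon>"
          if "v \<in> nbhd k N t0 \<delta>" "w \<in> nbhd k N t1 \<delta>" "v' \<in> nbhd k N t0 \<delta>" "w' \<in> nbhd k N t1 \<delta>" for v w v' w'
          using g0'[OF nbhd_isom[OF R1 that(2)] that(1) v0] g0'[OF nbhd_isom[OF R1 that(4)] that(3) v0]
            g1[OF that(2,4)] \<open>0 < \<epsilon>\<close> by linarith
        with R0 R1n show ?thesis unfolding osc2_le_def by blast
      qed
    qed
  qed
qed

text \<open>The radius and the Lipschitz constant depend on the pair \<open>(t0, t1)\<close> alone: the Ramsey statement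
  has to be uniform in the colouring \<open>c\<close> and in \<open>n\<close>.\<close>

definition controlled ::
  "nat \<Rightarrow> ('f vtuple \<times> 'f vtuple) set \<Rightarrow>
   ('f vtuple \<Rightarrow> 'f vtuple \<Rightarrow> real) \<Rightarrow>
   ('f vtuple \<Rightarrow> 'f vtuple \<Rightarrow> real) \<Rightarrow> 'k::metric_space set \<Rightarrow> nat \<Rightarrow>
   ('f vtuple \<Rightarrow> 'f vtuple \<Rightarrow> 'k) \<Rightarrow> bool"
  where "controlled k D \<rho> L K n c \<longleftrightarrow> (\<forall>(t0, t1)\<in>D.
    \<forall>v\<in>nbhd k n t0 (\<rho> t0 t1). \<forall>w\<in>nbhd k n t1 (\<rho> t0 t1). c v w \<in> K \<and>
      (\<forall>v'\<in>nbhd k n t0 (\<rho> t0 t1). \<forall>w'\<in>nbhd k n t1 (\<rho> t0 t1).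
         dist (c v w) (c v' w') \<le> L t0 t1 * (tdist E k v v' + tdist E k w w')))"

lemma controlledD:
  assumes "controlled k D \<rho> L K n c" "(t0, t1) \<in> D" "v \<in> nbhd k n t0 (\<rho> t0 t1)" "w \<in> nbhd k n t1 (\<rho> t0 t1)"
  shows "c v w \<in> K"
    "v' \<in> nbhd k n t0 (\<rho> t0 t1) \<Longrightarrow> w' \<in> nbhd k n t1 (\<rho> t0 t1) \<Longrightarrow>
     dist (c v w) (c v' w') \<le> L t0 t1 * (tdist E k v v' + tdist E k w w')"
  using assms unfolding controlled_def by blast+

lemma controlled_pull:
  assumes c: "controlled k D \<rho> L K n c" and R: "isom (En N) (En n) R0" "isom (En N) (En n) R1"
  shows "controlled k D \<rho> L K N (\<lambda>v w. c (R0 \<circ> v) (R1 \<circ> w))"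
  unfolding controlled_def
proof clarify
  fix t0 t1 v w assume t: "(t0, t1) \<in> D" and v: "v \<in> nbhd k N t0 (\<rho> t0 t1)" and w: "w \<in> nbhd k N t1 (\<rho> t0 t1)"
  have 1: "c (R0 \<circ> v) (R1 \<circ> w) \<in> K"
    by (rule controlledD(1)[OF c t nbhd_isom[OF R(1) v] nbhd_isom[OF R(2) w]])
  have 2: "dist (c (R0 \<circ> v) (R1 \<circ> w)) (c (R0 \<circ> v') (R1 \<circ> w')) \<le> L t0 t1 * (tdist E k v v' + tdist E k w w')"
    if "v' \<in> nbhd k N t0 (\<rho> t0 t1)" "w' \<in> nbhd k N t1 (\<rho> t0 t1)" for v' w'
  proof -
    have "dist (c (R0 \<circ> v) (R1 \<circ> w)) (c (R0 \<circ> v') (R1 \<circ> w')) \<le>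
        L t0 t1 * (tdist E k (R0 \<circ> v) (R0 \<circ> v') + tdist E k (R1 \<circ> w) (R1 \<circ> w'))"
      by (rule controlledD(2)[OF c t nbhd_isom[OF R(1) v] nbhd_isom[OF R(2) w]
          nbhd_isom[OF R(1) that(1)] nbhd_isom[OF R(2) that(2)]])
    then show ?thesis
      by (simp only: nbhd_tdist[OF R(1) v that(1)] nbhd_tdist[OF R(2) w that(2)])
  qed
  show "c (R0 \<circ> v) (R1 \<circ> w) \<in> K \<and> (\<forall>v'\<in>nbhd k N t0 (\<rho> t0 t1). \<forall>w'\<in>nbhd k N t1 (\<rho> t0 t1).
      dist (c (R0 \<circ> v) (R1 \<circ> w)) (c (R0 \<circ> v') (R1 \<circ> w')) \<le> L t0 t1 * (tdist E k v v' + tdist E k w w'))"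
    using 1 2 by blast
qed

text \<open>A test \<open>(t0, t1, p, \<eta>)\<close> asks that near \<open>(t0, t1)\<close> the distance to the point \<open>p\<close> oscillates by at
  most \<open>\<eta>\<close>. Real functions suffice to control colourings in a compact space, since finitely many
  points \<open>p\<close> form a net.\<close>

definition passes ::
  "nat \<Rightarrow> ('f vtuple \<Rightarrow> 'f vtuple \<Rightarrow> real \<Rightarrow> real) \<Rightarrow> nat \<Rightarrow>
   ('f vtuple \<Rightarrow> 'f vtuple \<Rightarrow> 'k::metric_space) \<Rightarrow>
   'f vtuple \<times> 'f vtuple \<times> 'k \<times> real \<Rightarrow> bool"
  where "passes k \<delta> N c = (\<lambda>(t0, t1, p, \<eta>). osc2_le k N t0 t1 (\<delta> t0 t1 \<eta>) \<eta> (\<lambda>v w. dist (c v w) p))"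

lemma nbhd_mono: "\<delta> \<le> \<delta>' \<Longrightarrow> v \<in> nbhd k n t \<delta> \<Longrightarrow> v \<in> nbhd k n t \<delta>'"
  unfolding nbhd_def using near_mono[of \<delta> "tnorm E k t" "tnorm E k v" \<delta>'] E.tnorm_nonneg tuple_En_E by blast

text \<open>The radius \<open>\<delta>\<close> of a test depends on its pair and on \<open>\<eta>\<close>, but neither on \<open>p\<close> nor on the other
  tests, so that it stays the same when tests are added.\<close>

lemma ramsey_tests:
  assumes "bounded (K :: 'k::metric_space set)"
    and D: "\<And>t0 t1. (t0, t1) \<in> D \<Longrightarrow> nondeg k (tnorm E k t0) \<and> nondeg k (tnorm E k t1) \<and>
      0 < \<rho> t0 t1 \<and> 0 \<le> L t0 t1"
  shows "\<exists>\<delta>. (\<forall>t0 t1 \<eta>. (t0, t1) \<in> D \<longrightarrow> 0 < \<eta> \<longrightarrow> 0 < \<delta> t0 t1 \<eta> \<and> \<delta> t0 t1 \<eta> \<le> \<rho> t0 t1) \<and>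
    (\<forall>Q N. finite Q \<longrightarrow> (\<forall>(t0, t1, p, \<eta>)\<in>Q. (t0, t1) \<in> D \<and> p \<in> K \<and> 0 < \<eta>) \<longrightarrow>
      (\<exists>n0. \<forall>n\<ge>n0. \<forall>c. controlled k D \<rho> L K n c \<longrightarrow> (\<exists>R0 R1. isom (En N) (En n) R0 \<and> isom (En N) (En n) R1 \<and>
        (\<forall>q\<in>Q. passes k \<delta> N (\<lambda>v w. c (R0 \<circ> v) (R1 \<circ> w)) q))))"
proof -
  obtain d where d: "\<And>x y. x \<in> K \<Longrightarrow> y \<in> K \<Longrightarrow> dist x y \<le> d" "0 \<le> d"
    using \<open>bounded K\<close> bounded_two_points[of K]
    by (metis dist_commute dist_self equals0D order_refl zero_le_dist order_trans)
  define P where "P t0 t1 \<eta> \<delta> \<longleftrightarrow> (\<forall>N. \<exists>n0. \<forall>n\<ge>n0. \<forall>\<phi>. tame2 k n t0 t1 \<delta> (L t0 t1) d \<phi> \<longrightarrow>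
    (\<exists>R0 R1. isom (En N) (En n) R0 \<and> isom (En N) (En n) R1 \<and>
       osc2_le k N t0 t1 \<delta> \<eta> (\<lambda>v w. \<phi> (R0 \<circ> v) (R1 \<circ> w))))" for t0 t1 \<eta> \<delta>
  have "\<exists>\<delta>>0. \<delta> \<le> \<rho> t0 t1 \<and> P t0 t1 \<eta> \<delta>" if t: "(t0, t1) \<in> D" and \<eta>: "0 < \<eta>" for t0 t1 \<eta>
  proof -
    obtain \<delta>0 where \<delta>0: "0 < \<delta>0" "\<And>\<delta>. 0 < \<delta> \<Longrightarrow> \<delta> \<le> \<delta>0 \<Longrightarrow> P t0 t1 \<eta> \<delta>"
      unfolding P_def using ramsey_tuple_pair[of k t0 t1 \<eta> "L t0 t1" d] D[OF t] \<eta> d(2) by blast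
    then show ?thesis using D[OF t] by (intro exI[of _ "min \<delta>0 (\<rho> t0 t1)"]) simp
  qed
  then obtain \<delta> where \<delta>: "\<And>t0 t1 \<eta>. (t0, t1) \<in> D \<Longrightarrow> 0 < \<eta> \<Longrightarrow>
      0 < \<delta> t0 t1 \<eta> \<and> \<delta> t0 t1 \<eta> \<le> \<rho> t0 t1 \<and> P t0 t1 \<eta> (\<delta> t0 t1 \<eta>)"
    by metis
  show ?thesis
  proof (intro exI[of _ \<delta>] conjI allI impI)
    fix Q :: "('f vtuple \<times> 'f vtuple \<times> 'k \<times> real) set" and N
    assume "finite Q" and Q: "\<forall>(t0, t1, p, \<eta>)\<in>Q. (t0, t1) \<in> D \<and> p \<in> K \<and> 0 < \<eta>"
    let ?Em = "\<lambda>N n R. isom (En N) (En n) (fst R) \<and> isom (En N) (En n) (snd R)"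
    let ?pull = "\<lambda>R c v w. c (fst R \<circ> v) (snd R \<circ> w)"
    have "\<exists>n0. \<forall>n\<ge>n0. \<forall>c. (\<forall>q\<in>Q. controlled k D \<rho> L K n c) \<longrightarrow>
       (\<exists>R. ?Em N n R \<and> (\<forall>q\<in>Q. passes k \<delta> N (?pull R c) q))"
    proof (rule combine_ramsey[where Em = ?Em and pull = ?pull
          and nice = "\<lambda>q n c. controlled k D \<rho> L K n c" and good = "\<lambda>q n c. passes k \<delta> n c q",
          OF _ _ _ _ _ \<open>finite Q\<close>])
      fix N n1 n R R' assume 1: "?Em n1 n R" and 2: "?Em N n1 R'"
      show "\<exists>R''. ?Em N n R'' \<and> (\<forall>c. ?pull R'' c = ?pull R' (?pull R c))"
        using isom_comp[of "En n1" "En n" "fst R" "En N" "fst R'"] isom_comp[of "En n1" "En n" "snd R" "En N" "snd R'"] 1 2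
        by (intro exI[of _ "(fst R \<circ> fst R', snd R \<circ> snd R')"]) (simp add: o_assoc)
    next
      fix N n :: nat assume "N \<le> n"
      then show "\<exists>R. ?Em N n R" using isom_En_inclusion by (intro exI[of _ "(id, id)"]) simp
    next
      fix q N n R c assume "?Em N n R" "controlled k D \<rho> L K n c"
      then show "controlled k D \<rho> L K N (?pull R c)" using controlled_pull by blast
    next
      fix q N n R c assume R: "?Em N n R" and p: "passes k \<delta> n c q"
      show "passes k \<delta> N (?pull R c) q"
        using p nbhd_isom[of N n "fst R"] nbhd_isom[of N n "snd R"] R
        unfolding passes_def osc2_le_def by (auto simp: split_beta)
    next
      fix q and N :: nat assume "q \<in> Q"
      obtain t0 t1 p \<eta> where q: "q = (t0, t1, p, \<eta>)" by (cases q)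
      have t: "(t0, t1) \<in> D" "p \<in> K" "0 < \<eta>" using Q \<open>q \<in> Q\<close> q by auto
      let ?\<delta> = "\<delta> t0 t1 \<eta>"
      have \<delta>\<rho>: "?\<delta> \<le> \<rho> t0 t1" using \<delta>[OF t(1,3)] by blast
      obtain n0 where n0: "\<And>n \<phi>. n0 \<le> n \<Longrightarrow> tame2 k n t0 t1 ?\<delta> (L t0 t1) d \<phi> \<Longrightarrow>
        (\<exists>R0 R1. isom (En N) (En n) R0 \<and> isom (En N) (En n) R1 \<and>
          osc2_le k N t0 t1 ?\<delta> \<eta> (\<lambda>v w. \<phi> (R0 \<circ> v) (R1 \<circ> w)))"
        using \<delta>[OF t(1,3)] unfolding P_def by blast
      show "\<exists>n0. \<forall>n\<ge>n0. \<forall>c. controlled k D \<rho> L K n c \<longrightarrow> (\<exists>R. ?Em N n R \<and> passes k \<delta> N (?pull R c) q)"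
      proof (intro exI[of _ n0] allI impI)
        fix n and c :: "'f vtuple \<Rightarrow> 'f vtuple \<Rightarrow> 'k"
        assume n: "n0 \<le> n" and c: "controlled k D \<rho> L K n c"
        have "tame2 k n t0 t1 ?\<delta> (L t0 t1) d (\<lambda>v w. dist (c v w) p)"
          unfolding tame2_def
        proof (intro conjI ballI)
          fix v w assume v: "v \<in> nbhd k n t0 ?\<delta>" and w: "w \<in> nbhd k n t1 ?\<delta>"
          note vw = nbhd_mono[OF \<delta>\<rho> v] nbhd_mono[OF \<delta>\<rho> w]
          show "0 \<le> dist (c v w) p" by simp
          show "dist (c v w) p \<le> d" using controlledD(1)[OF c t(1) vw] t(2) d(1) by blast
          fix v' w' assume v': "v' \<in> nbhd k n t0 ?\<delta>" and w': "w' \<in> nbhd k n t1 ?\<delta>"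
          have "\<bar>dist (c v w) p - dist (c v' w') p\<bar> \<le> dist (c v w) (c v' w')"
            using dist_triangle[of "c v w" p "c v' w'"] dist_triangle[of "c v' w'" p "c v w"]
            by (simp add: dist_commute)
          also have "\<dots> \<le> L t0 t1 * (tdist E k v v' + tdist E k w w')"
            by (rule controlledD(2)[OF c t(1) vw nbhd_mono[OF \<delta>\<rho> v'] nbhd_mono[OF \<delta>\<rho> w']])
          finally show "\<bar>dist (c v w) p - dist (c v' w') p\<bar> \<le> L t0 t1 * (tdist E k v v' + tdist E k w w')" .
        qed
        from n0[OF n this] obtain R0 R1 where "isom (En N) (En n) R0" "isom (En N) (En n) R1"
          "osc2_le k N t0 t1 ?\<delta> \<eta> (\<lambda>v w. dist (c (R0 \<circ> v) (R1 \<circ> w)) p)" by blast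
        then show "\<exists>R. ?Em N n R \<and> passes k \<delta> N (?pull R c) q"
          by (intro exI[of _ "(R0, R1)"]) (simp add: passes_def q)
      qed
    qed
    then obtain n0 where n0: "\<And>n c. n0 \<le> n \<Longrightarrow> controlled k D \<rho> L K n c \<Longrightarrow>
       \<exists>R. ?Em N n R \<and> (\<forall>q\<in>Q. passes k \<delta> N (?pull R c) q)" by blast
    show "\<exists>n0. \<forall>n\<ge>n0. \<forall>c. controlled k D \<rho> L K n c \<longrightarrow> (\<exists>R0 R1. isom (En N) (En n) R0 \<and>
        isom (En N) (En n) R1 \<and> (\<forall>q\<in>Q. passes k \<delta> N (\<lambda>v w. c (R0 \<circ> v) (R1 \<circ> w)) q))"
    proof (intro exI[of _ n0] allI impI)
      fix n and c :: "'f vtuple \<Rightarrow> 'f vtuple \<Rightarrow> 'k"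
      assume "n0 \<le> n" "controlled k D \<rho> L K n c"
      from n0[OF this] obtain R where "?Em N n R" "\<forall>q\<in>Q. passes k \<delta> N (?pull R c) q" by blast
      then show "\<exists>R0 R1. isom (En N) (En n) R0 \<and> isom (En N) (En n) R1 \<and>
          (\<forall>q\<in>Q. passes k \<delta> N (\<lambda>v w. c (R0 \<circ> v) (R1 \<circ> w)) q)"
        by (intro exI[of _ "fst R"] exI[of _ "snd R"]) simp
    qed
  qed (use \<delta> in blast)+
qed

end


section \<open>Limits of colourings\<close>

text \<open>The functions from \<open>D\<close> to \<open>K\<close> form a compact space. If none of them were a cluster point, finitely
  many basic open sets, each eventually avoided by \<open>g\<close>, would cover this space.\<close>

lemma cluster_function:
  fixes K :: "'k::metric_space set" and g :: "'i \<Rightarrow> 'a \<Rightarrow> 'k"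
  assumes "compact K" "\<F> \<noteq> bot" and ev: "\<And>T. T \<in> D \<Longrightarrow> \<forall>\<^sub>F i in \<F>. g i T \<in> K"
  shows "\<exists>f. (\<forall>T\<in>D. f T \<in> K) \<and>
    (\<forall>B \<eta>. finite B \<longrightarrow> B \<subseteq> D \<longrightarrow> 0 < \<eta> \<longrightarrow> (\<exists>\<^sub>F i in \<F>. \<forall>T\<in>B. dist (g i T) (f T) < \<eta>))"
proof (rule ccontr)
  assume neg: "\<not> ?thesis"
  let ?X = "product_topology (\<lambda>_::'a. euclidean :: 'k topology) D"
  let ?S = "D \<rightarrow>\<^sub>E K"
  have cS: "compactin ?X ?S"
    using \<open>compact K\<close> by (simp add: compactin_PiE)
  define W where "W f B \<eta> \<longleftrightarrow> finite B \<and> B \<subseteq> D \<and> 0 < \<eta> \<and>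
    (\<forall>\<^sub>F i in \<F>. \<not> (\<forall>T\<in>B. dist (g i T) (f T) < \<eta>))" for f :: "'a \<Rightarrow> 'k" and B \<eta>
  have "\<exists>B \<eta>. W f B \<eta>"
    if "f \<in> ?S" for f
  proof -
    have "\<forall>T\<in>D. f T \<in> K" using that by auto
    with neg[unfolded not_ex de_Morgan_conj, THEN spec, of f]
    have "\<not> (\<forall>B \<eta>. finite B \<longrightarrow> B \<subseteq> D \<longrightarrow> 0 < \<eta> \<longrightarrow> (\<exists>\<^sub>F i in \<F>. \<forall>T\<in>B. dist (g i T) (f T) < \<eta>))"
      by (elim disjE) (erule (1) notE, assumption)
    then show ?thesis
      unfolding W_def frequently_def not_all not_imp not_not by (elim exE conjE) (intro exI conjI)
  qed
  then obtain B \<eta> where "\<And>f. f \<in> ?S \<Longrightarrow> W f (B f) (\<eta> f)" by metis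
  then have B: "finite (B f) \<and> B f \<subseteq> D \<and> 0 < \<eta> f \<and>
      (\<forall>\<^sub>F i in \<F>. \<not> (\<forall>T\<in>B f. dist (g i T) (f T) < \<eta> f))" if "f \<in> ?S" for f
    using that unfolding W_def by blast
  define V where "V f = (\<Pi>\<^sub>E T\<in>D. if T \<in> B f then ball (f T) (\<eta> f) else UNIV)" for f
  have Vo: "openin ?X (V f)" if "f \<in> ?S" for f
    unfolding V_def
  proof (rule product_topology_basis)
    have "{T. (if T \<in> B f then ball (f T) (\<eta> f) else UNIV) \<noteq> topspace euclidean} \<subseteq> B f" by auto
    then show "finite {T. (if T \<in> B f then ball (f T) (\<eta> f) else UNIV) \<noteq> topspace euclidean}"
      using B[OF that] finite_subset by blast
  qed auto
  have fV: "f \<in> V f" if "f \<in> ?S" for f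
    unfolding V_def using that B[OF that] by (auto simp: PiE_iff)
  have Vo': "\<And>U. U \<in> V ` ?S \<Longrightarrow> openin ?X U" using Vo by (elim imageE) simp
  have cov: "?S \<subseteq> \<Union> (V ` ?S)" using fV by (intro subsetI UN_I)
  obtain \<G> where \<G>: "finite \<G>" "\<G> \<subseteq> V ` ?S" "?S \<subseteq> \<Union> \<G>"
    using compactinD[OF cS _ cov] Vo' by metis
  from finite_subset_image[OF \<G>(1,2)] obtain A where A: "A \<subseteq> ?S" "finite A" "\<G> = V ` A"
    by (elim exE conjE)
  have A3: "?S \<subseteq> \<Union> (V ` A)" using \<G>(3) unfolding A(3) .
  have Bf: "finite (B f)" "\<forall>\<^sub>F i in \<F>. \<not> (\<forall>T\<in>B f. dist (g i T) (f T) < \<eta> f)" if "f \<in> A" for f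
    using B[OF subsetD[OF A(1) that]] by simp_all
  have BD: "T \<in> D" if "f \<in> A" "T \<in> B f" for f T
    using B[OF subsetD[OF A(1) that(1)]] that(2) by (elim conjE) (rule subsetD)
  have "\<forall>\<^sub>F i in \<F>. False"
  proof (cases "K = {}")
    case True
    have "D = {}"
    proof (rule ccontr)
      assume "D \<noteq> {}"
      then obtain T where "T \<in> D" by blast
      from ev[OF this] True show False using \<open>\<F> \<noteq> bot\<close> by (simp add: eventually_False)
    qed
    then have "(\<lambda>_. undefined) \<in> ?S" by simp
    note W = B[OF this]
    then have "B (\<lambda>_. undefined) = {}" using \<open>D = {}\<close> by blast
    with W show ?thesis by simp
  next
    case False
    then obtain k0 where k0: "k0 \<in> K" by blast
    have "\<forall>\<^sub>F i in \<F>. \<forall>f\<in>A. \<not> (\<forall>T\<in>B f. dist (g i T) (f T) < \<eta> f)"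
      using A(2) Bf(2) by (intro eventually_ball_finite ballI)
    moreover have "\<forall>\<^sub>F i in \<F>. \<forall>f\<in>A. \<forall>T\<in>B f. g i T \<in> K"
      using A(2) Bf(1) by (intro eventually_ball_finite ballI) (use ev BD in blast)+
    ultimately show ?thesis
    proof eventually_elim
      case (elim i)
      define h where "h = (\<lambda>T\<in>D. if g i T \<in> K then g i T else k0)"
      have "h \<in> ?S" using k0 by (auto simp: h_def)
      then have "h \<in> \<Union> (V ` A)" using A3 by (rule rev_subsetD)
      then obtain f where f: "f \<in> A" "h \<in> V f" by (elim UN_E)
      have "dist (g i T) (f T) < \<eta> f" if T: "T \<in> B f" for T
      proof -
        have TD: "T \<in> D" by (rule BD[OF f(1) T])
        have "h T \<in> ball (f T) (\<eta> f)" using f(2) T TD unfolding V_def by (auto simp: PiE_iff)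
        moreover have "h T = g i T" using elim(2) f(1) T TD by (simp add: h_def)
        ultimately show ?thesis by (simp add: dist_commute)
      qed
      with elim(1) f(1) show False by blast
    qed
  qed
  then show False using \<open>\<F> \<noteq> bot\<close> by (simp add: eventually_False)
qed

text \<open>The domain is a set with a distance and only a dense part of it is given through \<open>q\<close>; the value at
  a point is the limit along a sequence of members of \<open>D\<close> that converges to it.\<close>

lemma extend_from_dense:
  fixes K :: "'k::metric_space set" and f :: "'a \<Rightarrow> 'k"
  assumes "compact K"
    and tri: "\<And>x y z. x \<in> P \<Longrightarrow> y \<in> P \<Longrightarrow> z \<in> P \<Longrightarrow> \<Delta> x z \<le> \<Delta> x y + \<Delta> y z"
    and sym: "\<And>x y. x \<in> P \<Longrightarrow> y \<in> P \<Longrightarrow> \<Delta> x y = \<Delta> y x"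
    and q: "\<And>T. T \<in> D \<Longrightarrow> q T \<in> P"
    and dense: "\<And>p e. p \<in> P \<Longrightarrow> 0 < e \<Longrightarrow> \<exists>T\<in>D. \<Delta> (q T) p < e"
    and f: "\<And>T. T \<in> D \<Longrightarrow> f T \<in> K"
      "\<And>T S. T \<in> D \<Longrightarrow> S \<in> D \<Longrightarrow> dist (f T) (f S) \<le> \<Delta> (q T) (q S)"
  shows "\<exists>h. lip1 P \<Delta> K dist h \<and> (\<forall>T\<in>D. h (q T) = f T)"
proof -
  let ?r = "\<lambda>n. inverse (real (Suc n))"
  have "\<exists>T. T \<in> D \<and> \<Delta> (q T) p < ?r n" if "p \<in> P" for p n
    using dense[OF that, of "?r n"] by auto
  then obtain T where T: "\<And>p n. p \<in> P \<Longrightarrow> T p n \<in> D \<and> \<Delta> (q (T p n)) p < ?r n" by metis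
  have r0: "?r \<longlonglongrightarrow> 0" by (rule LIMSEQ_inverse_real_of_nat)
  have fT: "dist (f (T p n)) (f (T p' n')) \<le> ?r n + \<Delta> p p' + ?r n'" if p: "p \<in> P" "p' \<in> P" for p p' n n'
  proof -
    note t = T[OF p(1), of n] and t' = T[OF p(2), of n']
    have "dist (f (T p n)) (f (T p' n')) \<le> \<Delta> (q (T p n)) (q (T p' n'))" using f(2) t t' by blast
    also have "\<dots> \<le> \<Delta> (q (T p n)) p + \<Delta> p (q (T p' n'))"
      using tri q p t t' by blast
    also have "\<Delta> p (q (T p' n')) \<le> \<Delta> p p' + \<Delta> p' (q (T p' n'))"
      using tri q p t t' by blast
    also have "\<Delta> p' (q (T p' n')) = \<Delta> (q (T p' n')) p'" using sym q p t' by blast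
    finally show ?thesis using t t' by linarith
  qed
  have "\<exists>L\<in>K. (\<lambda>n. f (T p n)) \<longlonglongrightarrow> L" if p: "p \<in> P" for p
  proof -
    have cl: "\<Delta> p p \<le> 0"
    proof -
      have "\<Delta> p p \<le> 2 * e" if "0 < e" for e
      proof -
        obtain t where "t \<in> D" "\<Delta> (q t) p < e" using dense[OF p \<open>0 < e\<close>] by blast
        then show ?thesis using tri[OF p q p, of t] sym[OF p q, of t] by fastforce
      qed
      from this[of "\<Delta> p p / 4"] show ?thesis by (cases "\<Delta> p p \<le> 0") auto
    qed
    have "Cauchy (\<lambda>n. f (T p n))"
    proof (rule metric_CauchyI)
      fix e :: real assume "0 < e"
      then obtain M where M: "?r M < e / 2" using reals_Archimedean[of "e / 2"] by auto
      have "dist (f (T p n)) (f (T p n')) < e" if "M \<le> n" "M \<le> n'" for n n'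
      proof -
        have "?r n \<le> ?r M" "?r n' \<le> ?r M" using that by (simp_all add: le_imp_inverse_le)
        then show ?thesis using fT[OF p p, of n n'] cl M by linarith
      qed
      then show "\<exists>M. \<forall>m\<ge>M. \<forall>n\<ge>M. dist (f (T p m)) (f (T p n)) < e" by blast
    qed
    moreover have "\<forall>n. f (T p n) \<in> K" using f(1) T[OF p] by blast
    ultimately show ?thesis by (metis completeE[OF compact_imp_complete[OF \<open>compact K\<close>]])
  qed
  then obtain h where h: "\<And>p. p \<in> P \<Longrightarrow> h p \<in> K \<and> (\<lambda>n. f (T p n)) \<longlonglongrightarrow> h p" by metis
  have lip: "dist (h p) (h p') \<le> \<Delta> p p'" if p: "p \<in> P" "p' \<in> P" for p p'
  proof (rule LIMSEQ_le)
    show "(\<lambda>n. dist (f (T p n)) (f (T p' n))) \<longlonglongrightarrow> dist (h p) (h p')"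
      using h[OF p(1)] h[OF p(2)] by (intro tendsto_dist) auto
    have "(\<lambda>n. ?r n + \<Delta> p p' + ?r n) \<longlonglongrightarrow> 0 + \<Delta> p p' + 0" by (intro tendsto_intros r0)
    then show "(\<lambda>n. ?r n + \<Delta> p p' + ?r n) \<longlonglongrightarrow> \<Delta> p p'" by simp
    show "\<exists>N. \<forall>n\<ge>N. dist (f (T p n)) (f (T p' n)) \<le> ?r n + \<Delta> p p' + ?r n"
      using fT[OF p] by blast
  qed
  have "h (q t) = f t" if t: "t \<in> D" for t
  proof -
    have "(\<lambda>n. f (T (q t) n)) \<longlonglongrightarrow> f t"
    proof (rule metric_LIMSEQ_I)
      fix e :: real assume "0 < e"
      then obtain M where M: "?r M < e" using reals_Archimedean[of e] by auto
      have "dist (f (T (q t) n)) (f t) < e" if "M \<le> n" for n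
      proof -
        have "?r n \<le> ?r M" using that by (simp add: le_imp_inverse_le)
        moreover have "dist (f (T (q t) n)) (f t) \<le> \<Delta> (q (T (q t) n)) (q t)"
          using f(2) T[OF q[OF t]] t by blast
        ultimately show ?thesis using T[OF q[OF t], of n] M by linarith
      qed
      then show "\<exists>M. \<forall>n\<ge>M. dist (f (T (q t) n)) (f t) < e" by blast
    qed
    then show ?thesis using h[OF q[OF t]] LIMSEQ_unique by blast
  qed
  with lip h show ?thesis by (intro exI[of _ h]) (auto simp: lip1_def)
qed

text \<open>A cluster point satisfies the Lipschitz condition without the error \<open>\<eta>\<close>, and therefore factors
  through \<open>q\<close> even if \<open>q\<close> is not injective.\<close>

lemma limit_coloring:
  fixes K :: "'k::metric_space set" and g :: "'i \<Rightarrow> 'a \<Rightarrow> 'k"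
  assumes "compact K" "\<F> \<noteq> bot"
    and tri: "\<And>x y z. x \<in> P \<Longrightarrow> y \<in> P \<Longrightarrow> z \<in> P \<Longrightarrow> \<Delta> x z \<le> \<Delta> x y + \<Delta> y z"
    and sym: "\<And>x y. x \<in> P \<Longrightarrow> y \<in> P \<Longrightarrow> \<Delta> x y = \<Delta> y x"
    and q: "\<And>T. T \<in> D \<Longrightarrow> q T \<in> P"
    and dense: "\<And>p e. p \<in> P \<Longrightarrow> 0 < e \<Longrightarrow> \<exists>T\<in>D. \<Delta> (q T) p < e"
    and ev: "\<And>T. T \<in> D \<Longrightarrow> \<forall>\<^sub>F i in \<F>. g i T \<in> K"
    and lip: "\<And>T S \<eta>. T \<in> D \<Longrightarrow> S \<in> D \<Longrightarrow> 0 < \<eta> \<Longrightarrow>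
      \<forall>\<^sub>F i in \<F>. dist (g i T) (g i S) \<le> \<Delta> (q T) (q S) + \<eta>"
  shows "\<exists>h. lip1 P \<Delta> K dist h \<and>
    (\<forall>B \<eta>. finite B \<longrightarrow> B \<subseteq> D \<longrightarrow> 0 < \<eta> \<longrightarrow> (\<exists>\<^sub>F i in \<F>. \<forall>T\<in>B. dist (g i T) (h (q T)) < \<eta>))"
proof -
  obtain f where fK: "\<And>T. T \<in> D \<Longrightarrow> f T \<in> K" and
    fr: "\<And>B \<eta>. finite B \<Longrightarrow> B \<subseteq> D \<Longrightarrow> 0 < \<eta> \<Longrightarrow> \<exists>\<^sub>F i in \<F>. \<forall>T\<in>B. dist (g i T) (f T) < \<eta>"
    using cluster_function[of K \<F> D g, OF assms(1,2) ev] by blast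
  have fl: "dist (f T) (f S) \<le> \<Delta> (q T) (q S)" if TS: "T \<in> D" "S \<in> D" for T S
  proof (rule field_le_epsilon)
    fix e :: real assume "0 < e"
    then have "\<exists>\<^sub>F i in \<F>. \<forall>U\<in>{T, S}. dist (g i U) (f U) < e / 4"
      using TS by (intro fr) auto
    moreover have "\<forall>\<^sub>F i in \<F>. dist (g i T) (g i S) \<le> \<Delta> (q T) (q S) + e / 4"
      using TS \<open>0 < e\<close> by (intro lip) auto
    ultimately have "\<exists>\<^sub>F i in \<F>. (\<forall>U\<in>{T, S}. dist (g i U) (f U) < e / 4) \<and>
        dist (g i T) (g i S) \<le> \<Delta> (q T) (q S) + e / 4"
      by (rule frequently_eventually_frequently)
    then obtain i where i: "dist (g i T) (f T) < e / 4" "dist (g i S) (f S) < e / 4"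
      "dist (g i T) (g i S) \<le> \<Delta> (q T) (q S) + e / 4"
      using frequently_ex by fastforce
    have "dist (f T) (f S) \<le> dist (f T) (g i T) + dist (g i T) (g i S) + dist (g i S) (f S)"
      by (meson add_mono dist_triangle order_refl order_trans)
    then show "dist (f T) (f S) \<le> \<Delta> (q T) (q S) + e"
      using i \<open>0 < e\<close> dist_commute[of "f T" "g i T"] by linarith
  qed
  obtain h where h: "lip1 P \<Delta> K dist h" "\<And>T. T \<in> D \<Longrightarrow> h (q T) = f T"
    using extend_from_dense[of K P \<Delta> D q f, OF \<open>compact K\<close> tri sym q dense fK fl] by blast
  have "\<exists>\<^sub>F i in \<F>. \<forall>T\<in>B. dist (g i T) (h (q T)) < \<eta>" if "finite B" "B \<subseteq> D" "0 < \<eta>" for B \<eta>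
    using fr[OF that] by (rule frequently_elim1) (use that(2) h(2) in auto)
  with h(1) show ?thesis by blast
qed


section \<open>Quotients by isometric actions\<close>

text \<open>The set \<open>G\<close> only indexes maps of \<open>M\<close> that are closed under composition and inversion; elements
  of \<open>G\<close> may agree on \<open>M\<close> without being equal.\<close>

locale isometric_action =
  fixes M :: "'a set" and d :: "'a \<Rightarrow> 'a \<Rightarrow> real" and G :: "'g set" and act :: "'g \<Rightarrow> 'a \<Rightarrow> 'a"
  assumes d_nonneg: "\<And>x y. x \<in> M \<Longrightarrow> y \<in> M \<Longrightarrow> 0 \<le> d x y"
    and d_self: "\<And>x. x \<in> M \<Longrightarrow> d x x = 0"
    and d_sym: "\<And>x y. x \<in> M \<Longrightarrow> y \<in> M \<Longrightarrow> d x y = d y x"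
    and d_tri: "\<And>x y z. x \<in> M \<Longrightarrow> y \<in> M \<Longrightarrow> z \<in> M \<Longrightarrow> d x z \<le> d x y + d y z"
    and act_M: "\<And>g x. g \<in> G \<Longrightarrow> x \<in> M \<Longrightarrow> act g x \<in> M"
    and act_isometric: "\<And>g x y. g \<in> G \<Longrightarrow> x \<in> M \<Longrightarrow> y \<in> M \<Longrightarrow> d (act g x) (act g y) = d x y"
    and act_id: "\<exists>e\<in>G. \<forall>x\<in>M. act e x = x"
    and act_inv: "\<And>g. g \<in> G \<Longrightarrow> \<exists>g'\<in>G. \<forall>x\<in>M. act g' (act g x) = x"
    and act_comp: "\<And>g h. g \<in> G \<Longrightarrow> h \<in> G \<Longrightarrow> \<exists>j\<in>G. \<forall>x\<in>M. act j x = act g (act h x)"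
begin

abbreviation "oc \<equiv> orbit_closure M d G act"
abbreviation "Q \<equiv> quot M d G act"
abbreviation "qd \<equiv> quot_dist d"

lemma oc_M: "q \<in> oc p \<Longrightarrow> q \<in> M"
  by (simp add: orbit_closure_def)

lemma oc_orbit:
  assumes "p \<in> M" "g \<in> G"
  shows "act g p \<in> oc p"
proof -
  have "act g p \<in> M" using act_M assms by blast
  moreover from d_self[OF this] have "d (act g p) (act g p) < e" if "0 < e" for e using that by simp
  ultimately show ?thesis using assms(2) unfolding orbit_closure_def by blast
qed

lemma oc_self: "p \<in> M \<Longrightarrow> p \<in> oc p"
  using act_id oc_orbit by metis

lemma oc_approx: "q \<in> oc p \<Longrightarrow> 0 < e \<Longrightarrow> \<exists>g\<in>G. d (act g p) q < e"
  by (simp add: orbit_closure_def)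

lemma oc_trans:
  assumes "p \<in> M" "q \<in> oc p" "r \<in> oc q"
  shows "r \<in> oc p"
proof -
  have M: "q \<in> M" "r \<in> M" using assms oc_M by blast+
  have "\<exists>g\<in>G. d (act g p) r < e" if e: "0 < e" for e
  proof -
    obtain g where g: "g \<in> G" "d (act g p) q < e / 2" using oc_approx[OF assms(2), of "e / 2"] e by auto
    obtain h where h: "h \<in> G" "d (act h q) r < e / 2" using oc_approx[OF assms(3), of "e / 2"] e by auto
    obtain j where j: "j \<in> G" "act j p = act h (act g p)" using act_comp[OF h(1) g(1)] assms(1) by blast
    have m: "act h (act g p) \<in> M" "act h q \<in> M" "act g p \<in> M" using act_M g(1) h(1) assms(1) M by blast+
    have "d (act j p) r \<le> d (act h (act g p)) (act h q) + d (act h q) r"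
      unfolding j(2) using d_tri m M by blast
    also have "d (act h (act g p)) (act h q) = d (act g p) q" using act_isometric h(1) m M by blast
    finally show ?thesis using g(2) h(2) j(1) by (intro bexI[of _ j]) auto
  qed
  then show ?thesis using M(2) by (simp add: orbit_closure_def)
qed

lemma oc_sym:
  assumes "p \<in> M" "q \<in> oc p"
  shows "p \<in> oc q"
proof -
  have M: "q \<in> M" using assms oc_M by blast
  have "\<exists>g\<in>G. d (act g q) p < e" if e: "0 < e" for e
  proof -
    obtain g where g: "g \<in> G" "d (act g p) q < e" using oc_approx[OF assms(2) e] by auto
    obtain h where h: "h \<in> G" "act h (act g p) = p" using act_inv[OF g(1)] assms(1) by blast
    have "d (act h q) p = d (act h q) (act h (act g p))" using h(2) by simp
    also have "\<dots> = d q (act g p)" using act_isometric h(1) M act_M[OF g(1) assms(1)] by blast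
    also have "\<dots> = d (act g p) q" using d_sym M act_M[OF g(1) assms(1)] by blast
    finally show ?thesis using g(2) h(1) by (intro bexI[of _ h]) simp_all
  qed
  then show ?thesis using assms(1) by (simp add: orbit_closure_def)
qed

lemma oc_eq: "p \<in> M \<Longrightarrow> q \<in> oc p \<Longrightarrow> oc q = oc p"
  using oc_trans oc_sym oc_M by blast

lemma oc_act: "p \<in> M \<Longrightarrow> g \<in> G \<Longrightarrow> q \<in> oc p \<Longrightarrow> act g q \<in> oc p"
  using oc_trans oc_orbit oc_M by blast

lemma qd_le: "p \<in> M \<Longrightarrow> q \<in> M \<Longrightarrow> p' \<in> oc p \<Longrightarrow> q' \<in> oc q \<Longrightarrow> qd (oc p) (oc q) \<le> d p' q'"
  unfolding quot_dist_def
proof (rule cInf_lower)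
  show "bdd_below {d p' q' |p' q'. p' \<in> oc p \<and> q' \<in> oc q}"
    using d_nonneg oc_M by (auto simp: bdd_below_def intro!: exI[of _ 0])
qed blast

lemma qd_approx:
  assumes "p \<in> M" "q \<in> M" "0 < e"
  shows "\<exists>p'\<in>oc p. \<exists>q'\<in>oc q. d p' q' < qd (oc p) (oc q) + e"
proof -
  have ne: "{d p' q' |p' q'. p' \<in> oc p \<and> q' \<in> oc q} \<noteq> {}" using oc_self assms by blast
  have "Inf {d p' q' |p' q'. p' \<in> oc p \<and> q' \<in> oc q} < qd (oc p) (oc q) + e"
    using assms(3) by (simp add: quot_dist_def)
  from cInf_lessD[OF ne this] show ?thesis by blast
qed

lemma qd_sym: "qd (oc p) (oc q) = qd (oc q) (oc p)"
proof -
  have sub: "{d p' q' |p' q'. p' \<in> oc p \<and> q' \<in> oc q} \<subseteq> {d p' q' |p' q'. p' \<in> oc q \<and> q' \<in> oc p}" for p q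
  proof clarify
    fix p' q' assume *: "p' \<in> oc p" "q' \<in> oc q"
    then have "d p' q' = d q' p'" using d_sym oc_M by blast
    with * show "\<exists>p'' q''. d p' q' = d p'' q'' \<and> p'' \<in> oc q \<and> q'' \<in> oc p" by blast
  qed
  have "{d p' q' |p' q'. p' \<in> oc p \<and> q' \<in> oc q} = {d p' q' |p' q'. p' \<in> oc q \<and> q' \<in> oc p}"
    using sub[of p q] sub[of q p] by (rule subset_antisym)
  then show ?thesis by (simp add: quot_dist_def)
qed

text \<open>The representatives of the middle class in the two infima differ; an element of the group moves one
  of them almost to the other.\<close>

lemma qd_tri:
  assumes "p \<in> M" "q \<in> M" "r \<in> M"
  shows "qd (oc p) (oc r) \<le> qd (oc p) (oc q) + qd (oc q) (oc r)"
proof (rule field_le_epsilon)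
  fix e :: real assume "0 < e"
  then have e3: "0 < e / 3" by simp
  obtain p1 q1 where 1: "p1 \<in> oc p" "q1 \<in> oc q" "d p1 q1 < qd (oc p) (oc q) + e / 3"
    using qd_approx[OF assms(1,2) e3] by blast
  obtain q2 r2 where 2: "q2 \<in> oc q" "r2 \<in> oc r" "d q2 r2 < qd (oc q) (oc r) + e / 3"
    using qd_approx[OF assms(2,3) e3] by blast
  have "q1 \<in> oc q2" using oc_eq[OF assms(2) 2(1)] 1(2) by simp
  then obtain g where g: "g \<in> G" "d (act g q2) q1 < e / 3" using oc_approx e3 by blast
  have M: "p1 \<in> M" "q1 \<in> M" "q2 \<in> M" "r2 \<in> M" "act g q2 \<in> M" "act g r2 \<in> M"
    using 1 2 oc_M act_M g(1) by blast+
  have "qd (oc p) (oc r) \<le> d p1 (act g r2)"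
    using qd_le assms 1(1) oc_act[OF assms(3) g(1) 2(2)] by blast
  also have "\<dots> \<le> d p1 q1 + d q1 (act g r2)" using d_tri M by blast
  also have "d q1 (act g r2) \<le> d q1 (act g q2) + d (act g q2) (act g r2)" using d_tri M by blast
  also have "d q1 (act g q2) = d (act g q2) q1" using d_sym M by blast
  also have "d (act g q2) (act g r2) = d q2 r2" using act_isometric g(1) M by blast
  finally show "qd (oc p) (oc r) \<le> qd (oc p) (oc q) + qd (oc q) (oc r) + e"
    using 1(3) 2(3) g(2) by linarith
qed

lemma lip1_oc: "lip1 M d Q qd oc"
  unfolding lip1_def quot_def using qd_le oc_self by blast

end


section \<open>The Fraisse limit\<close>

lemma (in normed_nspace) span_Gr:
  assumes "finite A" "A \<subseteq> vecs X"
  shows "span A \<in> Gr (dim (span A)) X"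
proof -
  have "span A \<subseteq> vecs X" by (rule span_minimal[OF assms(2) subspace_vecs])
  moreover have "subspace (span A)" by (rule subspace_span)
  ultimately show ?thesis using assms(1) unfolding Gr_def by blast
qed

lemma ball_dist_le:
  assumes F: "normed_space F" and UW: "0 \<in> U" "0 \<in> W" "U \<subseteq> vecs F" "W \<subseteq> vecs F"
    and 1: "\<And>x. x \<in> U \<Longrightarrow> nrm F x \<le> 1 \<Longrightarrow> \<exists>y\<in>W. nrm F y \<le> 1 \<and> nrm F (x - y) \<le> e"
    and 2: "\<And>y. y \<in> W \<Longrightarrow> nrm F y \<le> 1 \<Longrightarrow> \<exists>x\<in>U. nrm F x \<le> 1 \<and> nrm F (x - y) \<le> e"
  shows "ball_dist F U W \<le> e"
proof -
  interpret F: normed_nspace F using F by unfold_locales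
  have z: "0 \<in> unit_ball (sub F U)" "0 \<in> unit_ball (sub F W)" using UW by (simp_all add: unit_ball_def)
  have bdd: "bdd_below ((\<lambda>y. nrm F (x - y)) ` unit_ball (sub F W))" if "x \<in> U" for x
    using that UW by (intro bdd_belowI2[of _ 0]) (auto simp: unit_ball_def subset_iff)
  have bdd': "bdd_below ((\<lambda>x. nrm F (x - y)) ` unit_ball (sub F U))" if "y \<in> W" for y
    using that UW by (intro bdd_belowI2[of _ 0]) (auto simp: unit_ball_def subset_iff)
  have "(SUP x\<in>unit_ball (sub F U). INF y\<in>unit_ball (sub F W). nrm F (x - y)) \<le> e"
  proof (rule cSUP_least)
    fix x assume "x \<in> unit_ball (sub F U)"
    then have x: "x \<in> U" "nrm F x \<le> 1" by (auto simp: unit_ball_def)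
    obtain y where y: "y \<in> W" "nrm F y \<le> 1" "nrm F (x - y) \<le> e" using 1[OF x] by blast
    have "(INF y\<in>unit_ball (sub F W). nrm F (x - y)) \<le> nrm F (x - y)"
      by (rule cINF_lower[OF bdd[OF x(1)]]) (use y in \<open>simp add: unit_ball_def\<close>)
    with y(3) show "(INF y\<in>unit_ball (sub F W). nrm F (x - y)) \<le> e" by simp
  qed (use z in blast)
  moreover have "(SUP y\<in>unit_ball (sub F W). INF x\<in>unit_ball (sub F U). nrm F (x - y)) \<le> e"
  proof (rule cSUP_least)
    fix y assume "y \<in> unit_ball (sub F W)"
    then have y: "y \<in> W" "nrm F y \<le> 1" by (auto simp: unit_ball_def)
    obtain x where x: "x \<in> U" "nrm F x \<le> 1" "nrm F (x - y) \<le> e" using 2[OF y] by blast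
    have "(INF x\<in>unit_ball (sub F U). nrm F (x - y)) \<le> nrm F (x - y)"
      by (rule cINF_lower[OF bdd'[OF y(1)]]) (use x in \<open>simp add: unit_ball_def\<close>)
    with x(3) show "(INF x\<in>unit_ball (sub F U). nrm F (x - y)) \<le> e" by simp
  qed (use z in blast)
  ultimately show ?thesis by (simp add: ball_dist_def)
qed

lemma ball_dist_sym:
  assumes F: "normed_space F" and UW: "U \<subseteq> vecs F" "W \<subseteq> vecs F"
  shows "ball_dist F U W = ball_dist F W U"
proof -
  interpret F: normed_nspace F using F by unfold_locales
  have c: "nrm F (x - y) = nrm F (y - x)" if "x \<in> unit_ball (sub F U)" "y \<in> unit_ball (sub F W)" for x y
    using that UW by (intro F.nrm_diff_commute) (auto simp: unit_ball_def)
  have "(SUP x\<in>unit_ball (sub F U). INF y\<in>unit_ball (sub F W). nrm F (x - y)) =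
      (SUP x\<in>unit_ball (sub F U). INF y\<in>unit_ball (sub F W). nrm F (y - x))"
    by (intro SUP_cong INF_cong refl) (rule c)
  moreover have "(SUP y\<in>unit_ball (sub F W). INF x\<in>unit_ball (sub F U). nrm F (x - y)) =
      (SUP y\<in>unit_ball (sub F W). INF x\<in>unit_ball (sub F U). nrm F (y - x))"
    by (intro SUP_cong INF_cong refl) (rule c)
  ultimately show ?thesis unfolding ball_dist_def by (simp add: max.commute)
qed

lemma ball_dist_less:
  assumes F: "normed_space F" and UW: "0 \<in> W" "U \<subseteq> vecs F" "W \<subseteq> vecs F"
    and lt: "ball_dist F U W < e" and x: "x \<in> U" "nrm F x \<le> 1"
  shows "\<exists>y\<in>W. nrm F y \<le> 1 \<and> nrm F (x - y) < e"
proof -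
  interpret F: normed_nspace F using F by unfold_locales
  let ?f = "\<lambda>x. INF y\<in>unit_ball (sub F W). nrm F (x - y)"
  have z: "0 \<in> unit_ball (sub F W)" using UW(1) by (simp add: unit_ball_def)
  have xb: "x \<in> unit_ball (sub F U)" using x by (simp add: unit_ball_def)
  have below: "bdd_below ((\<lambda>y. nrm F (x - y)) ` unit_ball (sub F W))" if "x \<in> U" for x
    using that UW by (intro bdd_belowI2[of _ 0]) (auto simp: unit_ball_def subset_iff)
  have bdd: "bdd_above (?f ` unit_ball (sub F U))"
  proof (rule bdd_aboveI2[of _ _ 1])
    fix y assume "y \<in> unit_ball (sub F U)"
    then have y: "y \<in> U" "nrm F (y - 0) \<le> 1" by (simp_all add: unit_ball_def)
    have "?f y \<le> nrm F (y - 0)" by (rule cINF_lower[OF below[OF y(1)] z])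
    with y(2) show "?f y \<le> 1" by simp
  qed
  have "?f x \<le> (SUP x\<in>unit_ball (sub F U). ?f x)" by (rule cSUP_upper[OF xb bdd])
  also have "\<dots> \<le> ball_dist F U W" unfolding ball_dist_def by simp
  finally have "?f x < e" using lt by simp
  then have "\<exists>y\<in>unit_ball (sub F W). nrm F (x - y) < e"
    using z below[OF x(1)] by (subst (asm) cINF_less_iff) auto
  then show ?thesis by (auto simp: unit_ball_def)
qed

text \<open>The entries are scaled into the unit ball before the distance of the unit balls is used.\<close>

lemma ball_dist_close_tuple:
  assumes F: "normed_space F" and U: "module.subspace (smul F) U" "U \<subseteq> vecs F"
    and W: "module.subspace (smul F) W" "W \<subseteq> vecs F"
    and lt: "ball_dist F U W < e" and u: "\<And>j. j < k \<Longrightarrow> u j \<in> U \<and> nrm F (u j) \<le> c" and "0 < c"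
  shows "\<exists>w. \<forall>j<k. w j \<in> W \<and> nrm F (u j - w j) \<le> c * e"
proof -
  interpret F: normed_nspace F using F by unfold_locales
  have "\<exists>w. w \<in> W \<and> nrm F (u j - w) \<le> c * e" if j: "j < k" for j
  proof -
    let ?x = "smul F (of_real (1 / c)) (u j)"
    have uj: "u j \<in> vecs F" using u[OF j] U(2) by blast
    have xU: "?x \<in> U" using F.subspace_scale[OF U(1)] u[OF j] by blast
    have "nrm F ?x = \<bar>1 / c\<bar> * nrm F (u j)" using F.nrm_scale[OF uj] by (simp add: norm_divide)
    also have "\<dots> \<le> 1" using \<open>0 < c\<close> u[OF j] by (simp add: field_simps)
    finally obtain y where y: "y \<in> W" "nrm F (?x - y) < e"
      using ball_dist_less[OF F F.subspace_0[OF W(1)] U(2) W(2) lt xU] by blast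
    let ?w = "smul F (of_real c) y"
    have "smul F (of_real c) ?x = u j"
      using F.scale_scale[of "of_real c" "of_real (1 / c)" "u j"] \<open>0 < c\<close> by (simp flip: of_real_mult)
    then have "u j - ?w = smul F (of_real c) (?x - y)" by (simp only: F.scale_right_diff_distrib)
    moreover have "?x - y \<in> vecs F" using xU y(1) U(2) W(2) by (intro F.vecs_diff) auto
    ultimately have "nrm F (u j - ?w) = c * nrm F (?x - y)" using \<open>0 < c\<close> by simp
    also have "\<dots> \<le> c * e" using y(2) \<open>0 < c\<close> by simp
    finally show ?thesis using F.subspace_scale[OF W(1) y(1)] by blast
  qed
  then show ?thesis by metis
qed


lemma banach_nspace_simps [simp]:
  "vecs (banach_nspace s) = UNIV" "smul (banach_nspace s) = s" "nrm (banach_nspace s) = norm"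
  by (simp_all add: banach_nspace_def)

locale fraisse_setting = ramsey_setting \<mu> for \<mu> :: "(nat \<Rightarrow>\<^sub>0 'f::real_or_complex) \<Rightarrow> real" +
  fixes s :: "'f \<Rightarrow> 'b::banach \<Rightarrow> 'b"
  assumes limit: "fraisse_limit (seq_space \<mu>) s"
begin

abbreviation "F \<equiv> banach_nspace s"

lemma normed_F: "normed_space F"
  using limit unfolding fraisse_limit_def Let_def by simp

sublocale F: normed_nspace "banach_nspace s"
  using normed_F by unfold_locales

lemma s_one [simp]: "s 1 x = x"
  using F.scale_one[of x] by simp

lemma fraisse_F: "fraisse F"
  using limit unfolding fraisse_limit_def Let_def by simp

lemma En_embeds: "\<exists>\<theta>. isom (En n) F \<theta>"
proof -
  have "Emb (En n) F \<noteq> {}" using limit En_Age unfolding fraisse_limit_def Let_def by blast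
  then show ?thesis using Emb_isom by blast
qed

lemma Age_dense: "U \<in> Age F \<Longrightarrow> 0 < \<epsilon> \<Longrightarrow>
    \<exists>U'\<in>Age F. (\<exists>X\<in>Age E. isometric X U') \<and> ball_dist F (vecs U) (vecs U') < \<epsilon>"
  using limit unfolding fraisse_limit_def Let_def by blast

lemma Iso_iff: "g \<in> Iso F \<longleftrightarrow> isom F F g \<and> surj g"
  by (auto simp: Iso_def Emb_def lin_def lin_maps_def isom_def lin_on_def)

lemma Iso_id: "id \<in> Iso F"
  by (simp add: Iso_iff isom_def lin_on_def)

lemma Iso_comp: "g \<in> Iso F \<Longrightarrow> h \<in> Iso F \<Longrightarrow> g \<circ> h \<in> Iso F"
  unfolding Iso_iff by (elim conjE, intro conjI) (rule isom_comp comp_surj; assumption)+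

lemma Iso_inv:
  assumes "g \<in> Iso F"
  shows "\<exists>g'\<in>Iso F. g' \<circ> g = id \<and> g \<circ> g' = id"
proof -
  have g: "lin_on F F g" "\<And>x. norm (g x) = norm x" "surj g" using assms by (auto simp: Iso_iff isom_def)
  have "inj g"
  proof (rule injI)
    fix x y assume "g x = g y"
    then have "g (x - y) = 0" using F.lin_on_diff[OF g(1), of x y] by simp
    then show "x = y" using g(2)[of "x - y"] by simp
  qed
  then have b: "\<And>x. inv g (g x) = x" "\<And>x. g (inv g x) = x" using g(3) by (simp_all add: surj_f_inv_f)
  have "lin_on F F (inv g)"
    unfolding lin_on_def
  proof (intro conjI ballI allI)
    fix x y a
    have "g (inv g x + inv g y) = x + y" using g(1) b by (simp add: lin_on_def)
    then show "inv g (x + y) = inv g x + inv g y" using b by metis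
    have "g (s a (inv g x)) = s a x" using g(1) b by (simp add: lin_on_def)
    then show "inv g (smul F a x) = smul F a (inv g x)" using b by (metis banach_nspace_simps(2))
  qed simp
  moreover have "norm (inv g x) = norm x" for x using g(2)[of "inv g x"] b by simp
  moreover have "surj (inv g)" using b by (metis surjI)
  ultimately have "inv g \<in> Iso F" by (simp add: Iso_iff isom_def)
  with b show ?thesis by (intro bexI[of _ "inv g"]) auto
qed

text \<open>The Fraisse property for the inclusion of \<open>U\<close> and another operator of small distortion.\<close>

lemma fraisse_near:
  assumes U: "U \<in> Gr r F" and "0 < \<epsilon>"
  shows "\<exists>\<delta>>0. \<forall>\<sigma>. near_isom \<delta> (sub F U) F \<sigma> \<longrightarrow> (\<exists>g\<in>Iso F. \<forall>x\<in>U. norm (g (\<sigma> x) - x) \<le> \<epsilon> * norm x)"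
proof -
  let ?U = "sub F U"
  have UA: "?U \<in> Age F" and Ud: "ndim ?U = r" using U unfolding Age_def ndim_def Gr_def by auto
  interpret U: normed_nspace ?U using Age_normed[OF normed_F UA] by unfold_locales
  from fraisse_F[unfolded fraisse_def, THEN spec, THEN mp, OF \<open>0 < \<epsilon>\<close>, THEN spec, of r]
  obtain \<delta> where \<delta>: "0 < \<delta>" and fr0: "\<forall>X\<in>Age F. ndim X = r \<longrightarrow> (\<forall>\<gamma>\<in>Emb_delta \<delta> X F. \<forall>\<eta>\<in>Emb_delta \<delta> X F.
      \<exists>g\<in>Iso F. op_dist X F (compose (vecs X) g \<eta>) \<gamma> \<le> \<epsilon>)" by (elim exE conjE)
  have fr: "\<And>\<gamma> \<eta>. \<gamma> \<in> Emb_delta \<delta> ?U F \<Longrightarrow> \<eta> \<in> Emb_delta \<delta> ?U F \<Longrightarrow>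
      \<exists>g\<in>Iso F. op_dist ?U F (compose (vecs ?U) g \<eta>) \<gamma> \<le> \<epsilon>"
    using fr0[THEN bspec, OF UA, THEN mp, OF Ud] by blast
  have "\<exists>g\<in>Iso F. \<forall>x\<in>U. norm (g (\<sigma> x) - x) \<le> \<epsilon> * norm x" if \<sigma>: "near_isom \<delta> ?U F \<sigma>" for \<sigma>
  proof -
    have "isom ?U F id" by (simp add: isom_def lin_on_def)
    then have "near_isom 0 ?U F id" by (rule isom_near_isom)
    from near_isom_mono[OF this, of \<delta>] \<delta> have i: "near_isom \<delta> ?U F id" by simp
    let ?i = "restrict id (vecs ?U)" and ?\<sigma> = "restrict \<sigma> (vecs ?U)"
    have "?i \<in> Emb_delta \<delta> ?U F" "?\<sigma> \<in> Emb_delta \<delta> ?U F"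
      using U.restrict_Emb_delta[OF _ i] U.restrict_Emb_delta[OF _ \<sigma>] \<delta> by simp_all
    from fr[OF this] obtain g where g: "g \<in> Iso F" "op_dist ?U F (compose (vecs ?U) g ?\<sigma>) ?i \<le> \<epsilon>" by blast
    have nrmle: "norm (\<sigma> x) \<le> (1 + \<delta>) * norm x" if "x \<in> U" for x
      using \<sigma> that by (simp add: near_isom_def)
    have gi: "\<And>x. norm (g x) = norm x" using g(1) by (simp add: Iso_iff isom_def)
    have b1: "bounded_on ?U F (compose (vecs ?U) g ?\<sigma>)"
      unfolding bounded_on_def using nrmle gi by (intro exI[of _ "1 + \<delta>"]) (simp add: compose_def)
    have b2: "bounded_on ?U F ?i"
      unfolding bounded_on_def by (intro exI[of _ 1]) simp
    have "norm (g (\<sigma> x) - x) \<le> \<epsilon> * norm x" if x: "x \<in> U" for x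
    proof -
      have "nrm F (compose (vecs ?U) g ?\<sigma> x - ?i x) \<le> op_dist ?U F (compose (vecs ?U) g ?\<sigma>) ?i * nrm ?U x"
        by (rule F.op_dist_facts(2)[OF _ _ b1 _ b2]) (simp_all add: x)
      also have "\<dots> \<le> \<epsilon> * nrm ?U x" using g(2) by (intro mult_right_mono) auto
      finally show ?thesis using x by (simp add: compose_def)
    qed
    with g(1) show ?thesis by blast
  qed
  with \<delta> show ?thesis by blast
qed

text \<open>The map \<open>R \<circ> R'\<^sup>-\<^sup>1\<close> is isometric on the image of \<open>R'\<close>, so \<open>fraisse_near\<close> applies to it for each
  distortion.\<close>

lemma homogeneity:
  assumes R: "isom (En n) F R" and R': "isom (En n) F R'" and "0 < \<epsilon>"
  shows "\<exists>g\<in>Iso F. \<forall>x\<in>coord_space n. norm (g (R x) - R' x) \<le> \<epsilon> * \<mu> x"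
proof -
  interpret En: normed_nspace "En n" using En_normed by unfold_locales
  have tu: "tuple (En n) n unit_vec"
    unfolding tuple_def by (simp add: coord_space_iff lookup_single when_def)
  define u u' where "u = R \<circ> unit_vec" and "u' = R' \<circ> unit_vec"
  have tF: "tuple F n u" "tuple F n u'" by (simp_all add: tuple_def)
  have tn: "tnorm F n u' = tnorm E n unit_vec" "tnorm F n u = tnorm E n unit_vec"
    using En.isom_tnorm[OF R' tu] En.isom_tnorm[OF R tu] by (simp_all add: u_def u'_def)
  have nd: "nondeg n (tnorm F n u')" using nondeg_unit tn by simp
  let ?U = "range (F.lcomb n u')"
  obtain \<sigma> where \<sigma>: "lin_on (sub F ?U) F \<sigma>" "\<And>x. \<sigma> (F.lcomb n u' x) = F.lcomb n u x"
    using F.lin_on_extend_tuple[OF tF(2) nd normed_F tF(1)] by auto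
  have ni: "near_isom \<delta> (sub F ?U) F \<sigma>" if "0 < \<delta>" for \<delta>
  proof -
    have "norm (\<sigma> x) = norm x" if x: "x \<in> ?U" for x
    proof -
      obtain y where y: "x = F.lcomb n u' y" using x by blast
      have "norm (\<sigma> x) = tnorm F n u y" unfolding y \<sigma>(2) by (simp add: tnorm_def)
      also have "\<dots> = tnorm F n u' y" by (simp add: tn)
      finally show ?thesis by (simp add: y tnorm_def)
    qed
    then have "near_isom 0 (sub F ?U) F \<sigma>" using \<sigma>(1) by (intro isom_near_isom) (simp add: isom_def)
    from near_isom_mono[OF this, of \<delta>] that show ?thesis by simp
  qed
  obtain \<delta> where "0 < \<delta>" "\<And>\<sigma>. near_isom \<delta> (sub F ?U) F \<sigma> \<Longrightarrow>
      \<exists>g\<in>Iso F. \<forall>x\<in>?U. norm (g (\<sigma> x) - x) \<le> \<epsilon> * norm x"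
    using fraisse_near[OF F.Gr_tuple[OF tF(2) nd] \<open>0 < \<epsilon>\<close>] by blast
  then obtain g where g: "g \<in> Iso F" "\<And>x. x \<in> ?U \<Longrightarrow> norm (g (\<sigma> x) - x) \<le> \<epsilon> * norm x"
    using ni by blast
  have "norm (g (R x) - R' x) \<le> \<epsilon> * \<mu> x" if x: "x \<in> coord_space n" for x
  proof -
    have e: "En.lcomb n unit_vec (coord x) = x" using coord_space_comb[OF x] by simp
    have "R x = F.lcomb n u (coord x)" "R' x = F.lcomb n u' (coord x)"
      using En.lin_on_comb[OF isomD(1)[OF R] tu, of "coord x"] En.lin_on_comb[OF isomD(1)[OF R'] tu, of "coord x"] e
      by (simp_all add: u_def u'_def)
    then have "\<sigma> (R' x) = R x" "R' x \<in> ?U" using \<sigma>(2) by simp_all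
    then show ?thesis using g(2)[of "R' x"] isomD(2)[OF R', of x] x by simp
  qed
  with g(1) show ?thesis by blast
qed

text \<open>Density of the age for the Hausdorff distance yields, for a basis of \<open>U\<close>, nearby vectors in a
  space that is isometric to a subspace of \<open>E\<close>; the map between the bases is then close to
  an isometry.\<close>

lemma near_isom_into_E:
  assumes U: "U \<in> Gr r F" and "0 < \<delta>"
  shows "\<exists>\<beta>. near_isom \<delta> (sub F U) E \<beta>"
proof -
  obtain u where u: "tuple F r u" "nondeg r (tnorm F r u)" "U = range (F.lcomb r u)"
    by (rule F.Gr_obtain_tuple[OF U])
  obtain \<eta> where \<eta>: "0 < \<eta>" "\<And>w. tuple F r w \<Longrightarrow> tdist F r u w \<le> \<eta> \<Longrightarrow> near \<delta> (tnorm F r u) (tnorm F r w)"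
    using F.near_if_close[OF u(1,2) \<open>0 < \<delta>\<close>] by blast
  define c where "c = (\<Sum>j<r. norm (u j)) + 1"
  have c: "0 < c" "\<And>j. j < r \<Longrightarrow> norm (u j) \<le> c"
  proof -
    have "0 \<le> (\<Sum>j<r. norm (u j))" by (intro sum_nonneg) simp
    then show "0 < c" by (simp add: c_def)
    fix j assume "j < r"
    then have "norm (u j) \<le> (\<Sum>j<r. norm (u j))" by (intro member_le_sum) auto
    then show "norm (u j) \<le> c" by (simp add: c_def)
  qed
  define e where "e = \<eta> / (c * (real r + 1))"
  have e: "0 < e" using \<eta>(1) c(1) by (simp add: e_def)
  have UA: "sub F U \<in> Age F" using U unfolding Age_def by blast
  from Age_dense[OF UA e] obtain U' X where U': "U' \<in> Age F" "X \<in> Age E" "isometric X U'"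
    "ball_dist F U (vecs U') < e" by auto
  interpret U': normed_nspace U' using Age_normed[OF normed_F U'(1)] by unfold_locales
  interpret X: normed_nspace X using Age_normed[OF normed_E U'(2)] by unfold_locales
  obtain T where T: "T \<in> Emb X U'" "T ` vecs X = vecs U'" using U'(3) unfolding isometric_def by blast
  obtain V where V: "U' = sub F V" using U'(1) unfolding Age_def by blast
  obtain W where W: "X = sub E W" using U'(2) unfolding Age_def by blast
  have sub: "F.subspace U" "F.subspace (vecs U')"
    using F.Gr_subspace[OF U] U'.subspace_vecs by (auto simp: V)
  have uU: "u j \<in> U" if "j < r" for j using F.comb_unit[OF that, of u] u(3) by (metis rangeI)
  obtain w where w: "\<And>j. j < r \<Longrightarrow> w j \<in> vecs U' \<and> norm (u j - w j) \<le> c * e"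
    using ball_dist_close_tuple[OF normed_F sub(1) _ sub(2) _ U'(4), of r u c] c uU by auto
  have "\<exists>x\<in>vecs X. T x = w j" if "j < r" for j
    using w[OF that] T(2) by (metis imageE)
  then obtain x where x: "\<And>j. j < r \<Longrightarrow> x j \<in> vecs X \<and> T (x j) = w j" by metis
  have tx: "tuple X r x" using x by (simp add: tuple_def)
  have "tdist F r u w \<le> (\<Sum>j<r. c * e)"
    unfolding tdist_def using w by (intro sum_mono) simp
  also have "\<dots> = \<eta> * (real r / (real r + 1))" using c(1) by (simp add: e_def)
  also have "\<dots> \<le> \<eta> * 1" using \<eta>(1) by (intro mult_left_mono) auto
  finally have "near \<delta> (tnorm F r u) (tnorm F r w)" using \<eta>(2)[of w] by (simp add: tuple_def)
  moreover have "tnorm E r x = tnorm F r w"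
  proof (intro ext)
    fix y
    have "tnorm U' r (T \<circ> x) y = tnorm X r x y"
      by (simp only: X.isom_tnorm[OF Emb_isom[OF T(1)] tx])
    moreover have "comb s r (T \<circ> x) y = comb s r w y" using x by (intro comb_cong) auto
    ultimately show "tnorm E r x y = tnorm F r w y" by (simp add: V W tnorm_def)
  qed
  ultimately have nr: "near \<delta> (tnorm F r u) (tnorm E r x)" by simp
  obtain \<beta> where \<beta>: "lin_on (sub F U) E \<beta>" "\<And>y. \<beta> (F.lcomb r u y) = E.lcomb r x y"
    using F.lin_on_extend_tuple[OF u(1,2) normed_E tuple_En_E, of x] u(3) by auto
  have "near_isom \<delta> (sub F U) E \<beta>"
    unfolding near_isom_def
  proof (intro conjI \<beta>(1) ballI)
    fix z assume "z \<in> vecs (sub F U)"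
    then obtain y where z: "z = F.lcomb r u y" using u(3) by auto
    have "nrm (sub F U) z = tnorm F r u y" by (simp add: z tnorm_def)
    moreover have "nrm E (\<beta> z) = tnorm E r x y" unfolding z \<beta>(2) by (simp add: tnorm_def)
    ultimately show "nrm (sub F U) z \<le> (1 + \<delta>) * nrm E (\<beta> z)" "nrm E (\<beta> z) \<le> (1 + \<delta>) * nrm (sub F U) z"
      using nr unfolding near_def by auto
  qed
  then show ?thesis by blast
qed

lemma near_isom_into_En:
  assumes U: "U \<in> Gr r F" and "0 < \<delta>"
  shows "\<exists>n \<beta>. near_isom \<delta> (sub F U) (En n) \<beta>"
proof -
  obtain \<beta> where \<beta>: "near_isom \<delta> (sub F U) E \<beta>" using near_isom_into_E[OF assms] by blast
  have lin: "lin_on (sub F U) E \<beta>" using \<beta> by (simp add: near_isom_def)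
  have "sub F U \<in> Age F" using U unfolding Age_def by blast
  then interpret U: normed_nspace "sub F U" using Age_normed[OF normed_F] by unfold_locales
  obtain u where u: "tuple F r u" "U = range (F.lcomb r u)" by (rule F.Gr_obtain_tuple[OF U])
  have tu: "tuple (sub F U) r u"
    unfolding tuple_def sub_simps u(2) using F.comb_unit[of _ r u] by (metis rangeI)
  obtain n where n: "tuple (En n) r (\<beta> \<circ> u)" using tuple_in_En by blast
  have "\<beta> x \<in> coord_space n" if x: "x \<in> U" for x
  proof -
    obtain y where y: "x = F.lcomb r u y" using x u(2) by blast
    have "\<beta> x = comb fs_scale r (\<beta> \<circ> u) y" using U.lin_on_comb[OF lin tu, of y] by (simp add: y)
    then show ?thesis using n by (simp add: tuple_def comb_in_coord_space)
  qed
  then have "near_isom \<delta> (sub F U) (En n) \<beta>" using \<beta> by (simp add: near_isom_def lin_on_def)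
  then show ?thesis by blast
qed

lemma isom_En_mono: "isom (En n) F S \<Longrightarrow> n' \<le> n \<Longrightarrow> isom (En n') F S"
  using isom_comp[of "En n" F S "En n'" id] isom_En_inclusion[of n' n] by simp

end


section \<open>Colourings of objects described by pairs of tuples\<close>

lemma near_trans_small:
  assumes "near \<delta>1 N N'" "near \<delta>2 N' N''" "0 \<le> \<delta>1" "0 \<le> \<delta>2" "\<delta>1 \<le> \<delta> / 3" "\<delta>2 \<le> \<delta> / 3" "\<delta>2 \<le> 1"
    "\<And>x. 0 \<le> N x" "\<And>x. 0 \<le> N'' x"
  shows "near \<delta> N N''"
proof (rule near_mono[OF near_trans[OF assms(1-4)]])
  have "\<delta>1 * \<delta>2 \<le> \<delta>1 * 1" using assms(3,7) by (intro mult_left_mono) auto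
  then show "\<delta>1 + \<delta>2 + \<delta>1 * \<delta>2 \<le> \<delta>" using assms(5,6) by linarith
qed (use assms in auto)

text \<open>Objects \<open>\<Psi> v w\<close> are given by pairs of tuples in the Fraisse limit, subject to a condition \<open>adm\<close> on
  the norms of the tuples. The condition is open, and \<open>\<Psi>\<close> is locally Lipschitz with constants that
  only depend on the norms (\<open>adm_local\<close>). The group acts through isometries of the two tuples. An
  object close to \<open>\<Psi> v w\<close> is described by tuples with norms close to those of \<open>v\<close> and \<open>w\<close>
  (\<open>\<Psi>_lift\<close>), and the objects in copies of \<open>En m\<close> have finite nets that are independent of the copies
  (\<open>\<Psi>_net\<close>). An operator on \<open>En k\<close> or a subspace is
  described by \<open>v\<close> alone.\<close>

locale coloring_family = fraisse_setting \<mu> s + isometric_action M d G act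
  for \<mu> :: "(nat \<Rightarrow>\<^sub>0 'f::real_or_complex) \<Rightarrow> real" and s :: "'f \<Rightarrow> 'b::banach \<Rightarrow> 'b"
    and M :: "'o set" and d :: "'o \<Rightarrow> 'o \<Rightarrow> real" and G :: "'g set" and act :: "'g \<Rightarrow> 'o \<Rightarrow> 'o" +
  fixes k :: nat and adm :: "((nat \<Rightarrow> 'f) \<Rightarrow> real) \<Rightarrow> ((nat \<Rightarrow> 'f) \<Rightarrow> real) \<Rightarrow> bool"
    and \<Psi> :: "(nat \<Rightarrow> 'b) \<Rightarrow> (nat \<Rightarrow> 'b) \<Rightarrow> 'o"
  assumes adm_nondeg: "\<And>N0 N1. adm N0 N1 \<Longrightarrow> nondeg k N0 \<and> nondeg k N1"
    and adm_local: "\<And>N0 N1. adm N0 N1 \<Longrightarrow> \<exists>\<delta>>0. \<exists>L\<ge>0.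
      (\<forall>N0' N1'. near \<delta> N0 N0' \<longrightarrow> near \<delta> N1 N1' \<longrightarrow> adm N0' N1') \<and>
      (\<forall>v w v' w'. near \<delta> N0 (tnorm (banach_nspace s) k v) \<longrightarrow> near \<delta> N1 (tnorm (banach_nspace s) k w) \<longrightarrow>
        near \<delta> N0 (tnorm (banach_nspace s) k v') \<longrightarrow> near \<delta> N1 (tnorm (banach_nspace s) k w') \<longrightarrow>
        d (\<Psi> v w) (\<Psi> v' w') \<le> L * (tdist (banach_nspace s) k v v' + tdist (banach_nspace s) k w w'))"
    and M_eq: "M = {\<Psi> v w | v w. adm (tnorm (banach_nspace s) k v) (tnorm (banach_nspace s) k w)}"
    and act_\<Psi>: "\<And>\<gamma>. \<gamma> \<in> G \<Longrightarrow> \<exists>g\<in>Iso (banach_nspace s). \<exists>h\<in>Iso (banach_nspace s).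
      \<forall>v w. adm (tnorm (banach_nspace s) k v) (tnorm (banach_nspace s) k w) \<longrightarrow>
        act \<gamma> (\<Psi> v w) = \<Psi> (g \<circ> v) (h \<circ> w)"
    and \<Psi>_act: "\<And>g h. g \<in> Iso (banach_nspace s) \<Longrightarrow> h \<in> Iso (banach_nspace s) \<Longrightarrow> \<exists>\<gamma>\<in>G.
      \<forall>v w. adm (tnorm (banach_nspace s) k v) (tnorm (banach_nspace s) k w) \<longrightarrow>
        act \<gamma> (\<Psi> v w) = \<Psi> (g \<circ> v) (h \<circ> w)"
    and \<Psi>_lift: "\<And>v w \<delta>. adm (tnorm (banach_nspace s) k v) (tnorm (banach_nspace s) k w) \<Longrightarrow> 0 < \<delta> \<Longrightarrow>
      \<exists>\<eta>>0. \<forall>p\<in>M. d p (\<Psi> v w) < \<eta> \<longrightarrow> (\<exists>v' w'. p = \<Psi> v' w' \<and>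
        adm (tnorm (banach_nspace s) k v') (tnorm (banach_nspace s) k w') \<and>
        near \<delta> (tnorm (banach_nspace s) k v) (tnorm (banach_nspace s) k v') \<and>
        near \<delta> (tnorm (banach_nspace s) k w) (tnorm (banach_nspace s) k w'))"
    and \<Psi>_net: "\<And>m \<eta>. 0 < \<eta> \<Longrightarrow> \<exists>B. finite B \<and>
      B \<subseteq> {(v, w). tuple (fin_seq_space \<mu> m) k v \<and> tuple (fin_seq_space \<mu> m) k w \<and>
          adm (tnorm (seq_space \<mu>) k v) (tnorm (seq_space \<mu>) k w)} \<and>
      (\<forall>v w. tuple (fin_seq_space \<mu> m) k v \<longrightarrow> tuple (fin_seq_space \<mu> m) k w \<longrightarrow>
          adm (tnorm (seq_space \<mu>) k v) (tnorm (seq_space \<mu>) k w) \<longrightarrow>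
        (\<exists>(v', w')\<in>B. \<forall>R0 R1. isom (fin_seq_space \<mu> m) (banach_nspace s) R0 \<longrightarrow>
           isom (fin_seq_space \<mu> m) (banach_nspace s) R1 \<longrightarrow>
           d (\<Psi> (R0 \<circ> v) (R1 \<circ> w)) (\<Psi> (R0 \<circ> v') (R1 \<circ> w')) \<le> \<eta>))"
begin

abbreviation "NE \<equiv> tnorm E k"
abbreviation "NF \<equiv> tnorm F k"

text \<open>The admissible pairs in \<open>En n\<close>; below, \<open>Dall\<close> consists of those in all of \<open>E\<close>.\<close>

definition AD where "AD n = {(v, w). tuple (En n) k v \<and> tuple (En n) k w \<and> adm (NE v) (NE w)}"

definition Dall where "Dall = {(v, w). adm (NE v) (NE w)}"

lemma NE_nonneg: "0 \<le> NE v x"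
  by (rule E.tnorm_nonneg[OF tuple_En_E])

lemma NF_nonneg: "0 \<le> NF v x"
  by (rule F.tnorm_nonneg) (simp add: tuple_def)

lemma Iso_NF: "g \<in> Iso F \<Longrightarrow> NF (g \<circ> v) = NF v"
  by (rule F.isom_tnorm) (auto simp: Iso_iff tuple_def)

lemma isom_NF: "isom (En n) F R \<Longrightarrow> tuple (En n) k v \<Longrightarrow> NF (R \<circ> v) = NE v"
  using normed_nspace.isom_tnorm[OF normed_nspace.intro[OF En_normed], of n F R k v] by simp

lemma isom_tdist_F: "isom (En n) F R \<Longrightarrow> tuple (En n) k v \<Longrightarrow> tuple (En n) k w \<Longrightarrow>
    tdist F k (R \<circ> v) (R \<circ> w) = tdist E k v w"
  using normed_nspace.isom_tdist[OF normed_nspace.intro[OF En_normed], of n F R k v w] by simp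

lemma \<Psi>_M: "adm (NF v) (NF w) \<Longrightarrow> \<Psi> v w \<in> M"
  unfolding M_eq by blast

lemma M_\<Psi>: "p \<in> M \<Longrightarrow> \<exists>v w. p = \<Psi> v w \<and> adm (NF v) (NF w)"
  unfolding M_eq by blast

lemma AD_\<Psi>_M:
  assumes "(v, w) \<in> AD n" "isom (En n) F S0" "isom (En n) F S1"
  shows "\<Psi> (S0 \<circ> v) (S1 \<circ> w) \<in> M"
  using assms isom_NF by (intro \<Psi>_M) (simp add: AD_def)

lemma AD_D: "(v, w) \<in> AD n \<Longrightarrow> (v, w) \<in> Dall"
  by (simp add: AD_def Dall_def)

lemma AD_mono: "(v, w) \<in> AD n \<Longrightarrow> n \<le> n' \<Longrightarrow> (v, w) \<in> AD n'"
  unfolding AD_def using tuple_En_mono by blast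

lemma D_AD: "(v, w) \<in> Dall \<Longrightarrow> tuple (En n) k v \<Longrightarrow> tuple (En n) k w \<Longrightarrow> (v, w) \<in> AD n"
  by (simp add: AD_def Dall_def)

lemma D_in_AD:
  assumes "(v, w) \<in> Dall"
  shows "\<exists>n. (v, w) \<in> AD n"
proof -
  obtain n n' where "tuple (En n) k v" "tuple (En n') k w" using tuple_in_En by meson
  then have "tuple (En (max n n')) k v" "tuple (En (max n n')) k w"
    using tuple_En_mono by (metis max.cobounded1, metis max.cobounded2)
  then show ?thesis using D_AD[OF assms] by blast
qed

text \<open>The conclusion of \<open>adm_local\<close> as a predicate, so that its constants can be chosen once for each
  pair.\<close>

definition local_bound where "local_bound N0 N1 \<delta> L \<longleftrightarrow> 0 < \<delta> \<and> 0 \<le> L \<and>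
  (\<forall>N0' N1'. near \<delta> N0 N0' \<longrightarrow> near \<delta> N1 N1' \<longrightarrow> adm N0' N1') \<and>
  (\<forall>v w v' w'. near \<delta> N0 (NF v) \<longrightarrow> near \<delta> N1 (NF w) \<longrightarrow> near \<delta> N0 (NF v') \<longrightarrow> near \<delta> N1 (NF w') \<longrightarrow>
     d (\<Psi> v w) (\<Psi> v' w') \<le> L * (tdist F k v v' + tdist F k w w'))"

lemma local_bound_ex: "adm N0 N1 \<Longrightarrow> \<exists>\<delta> L. local_bound N0 N1 \<delta> L"
  using adm_local unfolding local_bound_def by blast

lemma local_boundD:
  assumes "local_bound N0 N1 \<delta> L"
  shows "0 < \<delta>" "0 \<le> L" "near \<delta> N0 N0' \<Longrightarrow> near \<delta> N1 N1' \<Longrightarrow> adm N0' N1'"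
    "near \<delta> N0 (NF v) \<Longrightarrow> near \<delta> N1 (NF w) \<Longrightarrow> near \<delta> N0 (NF v') \<Longrightarrow> near \<delta> N1 (NF w') \<Longrightarrow>
     d (\<Psi> v w) (\<Psi> v' w') \<le> L * (tdist F k v v' + tdist F k w w')"
  using assms unfolding local_bound_def by blast+

definition size2 where "size2 v w = (\<Sum>j<k. norm (v j)) + (\<Sum>j<k. norm (w j))" for v w :: "nat \<Rightarrow> 'b"

lemma size2_nonneg: "0 \<le> size2 v w"
  unfolding size2_def by (intro add_nonneg_nonneg sum_nonneg) simp_all

text \<open>An isometry of the action moves \<open>p\<close> close to the given object, where \<open>\<Psi>_lift\<close> provides tuples; moving
  these back does not change their norms.\<close>

lemma oc_tuples:
  assumes vw: "(v, w) \<in> AD n" and S: "isom (En n) F S0" "isom (En n) F S1"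
    and p: "p \<in> oc (\<Psi> (S0 \<circ> v) (S1 \<circ> w))" and "0 < \<delta>"
  shows "\<exists>a b. p = \<Psi> a b \<and> near \<delta> (NE v) (NF a) \<and> near \<delta> (NE w) (NF b)"
proof -
  let ?x = "\<Psi> (S0 \<circ> v) (S1 \<circ> w)"
  have N: "NF (S0 \<circ> v) = NE v" "NF (S1 \<circ> w) = NE w"
    using vw S isom_NF by (simp_all add: AD_def)
  have adm: "adm (NF (S0 \<circ> v)) (NF (S1 \<circ> w))" using vw by (simp add: N AD_def)
  have xM: "?x \<in> M" by (rule \<Psi>_M[OF adm])
  have pM: "p \<in> M" by (rule oc_M[OF p])
  obtain \<eta> where \<eta>: "0 < \<eta>" "\<And>p. p \<in> M \<Longrightarrow> d p ?x < \<eta> \<Longrightarrow> \<exists>v' w'. p = \<Psi> v' w' \<and>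
      adm (NF v') (NF w') \<and> near \<delta> (NF (S0 \<circ> v)) (NF v') \<and> near \<delta> (NF (S1 \<circ> w)) (NF w')"
    using \<Psi>_lift[OF adm \<open>0 < \<delta>\<close>] by blast
  obtain \<gamma> where \<gamma>: "\<gamma> \<in> G" "d (act \<gamma> ?x) p < \<eta>" using oc_approx[OF p \<eta>(1)] by blast
  obtain \<gamma>' where \<gamma>': "\<gamma>' \<in> G" "\<And>x. x \<in> M \<Longrightarrow> act \<gamma>' (act \<gamma> x) = x" using act_inv[OF \<gamma>(1)] by blast
  obtain \<gamma>'' where \<gamma>'': "\<gamma>'' \<in> G" "\<And>x. x \<in> M \<Longrightarrow> act \<gamma>'' (act \<gamma>' x) = x" using act_inv[OF \<gamma>'(1)] by blast
  have M1: "act \<gamma> ?x \<in> M" "act \<gamma>' p \<in> M" using act_M \<gamma>(1) \<gamma>'(1) xM pM by blast+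
  have "d (act \<gamma>' p) ?x = d (act \<gamma>' p) (act \<gamma>' (act \<gamma> ?x))" using \<gamma>'(2)[OF xM] by simp
  also have "\<dots> = d p (act \<gamma> ?x)" using act_isometric \<gamma>'(1) pM M1(1) by blast
  also have "\<dots> = d (act \<gamma> ?x) p" using d_sym pM M1(1) by blast
  finally have "d (act \<gamma>' p) ?x < \<eta>" using \<gamma>(2) by simp
  from \<eta>(2)[OF M1(2) this] obtain v' w' where v': "act \<gamma>' p = \<Psi> v' w'" "adm (NF v') (NF w')"
    "near \<delta> (NF (S0 \<circ> v)) (NF v')" "near \<delta> (NF (S1 \<circ> w)) (NF w')" by blast
  obtain g h where gh: "g \<in> Iso F" "h \<in> Iso F"
    "\<And>v w. adm (NF v) (NF w) \<Longrightarrow> act \<gamma>'' (\<Psi> v w) = \<Psi> (g \<circ> v) (h \<circ> w)"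
    using act_\<Psi>[OF \<gamma>''(1)] by blast
  have "p = act \<gamma>'' (act \<gamma>' p)" using \<gamma>''(2)[OF pM] by simp
  also have "\<dots> = \<Psi> (g \<circ> v') (h \<circ> w')" unfolding v'(1) by (rule gh(3)[OF v'(2)])
  finally show ?thesis using v'(3,4) Iso_NF gh(1,2) unfolding N by metis
qed

lemma tdist_le_scaled:
  assumes "\<And>x. x \<in> U \<Longrightarrow> norm (f x - x) \<le> e * norm x" "\<And>j. j < k \<Longrightarrow> a j \<in> U"
  shows "tdist F k (f \<circ> a) a \<le> e * (\<Sum>j<k. norm (a j))"
  unfolding tdist_def sum_distrib_left using assms by (intro sum_mono) simp

text \<open>If \<open>\<sigma>0\<close> and \<open>\<sigma>1\<close> almost preserve norms on \<open>U\<close> then isometries of the whole space move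
  their values back to almost the original place, and so they move the described objects.\<close>

lemma perturb:
  assumes lb: "local_bound (NF a) (NF b) \<delta> L"
    and U: "U \<in> Gr r F" "\<And>j. j < k \<Longrightarrow> a j \<in> U" "\<And>j. j < k \<Longrightarrow> b j \<in> U"
    and \<sigma>: "near_isom \<delta> (sub F U) F \<sigma>0" "near_isom \<delta> (sub F U) F \<sigma>1"
    and g: "g \<in> Iso F" "\<And>x. x \<in> U \<Longrightarrow> norm (g (\<sigma>0 x) - x) \<le> e * norm x"
      "h \<in> Iso F" "\<And>x. x \<in> U \<Longrightarrow> norm (h (\<sigma>1 x) - x) \<le> e * norm x"
  shows "d (\<Psi> (g \<circ> \<sigma>0 \<circ> a) (h \<circ> \<sigma>1 \<circ> b)) (\<Psi> a b) \<le> L * (e * size2 a b)"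
    "adm (NF (\<sigma>0 \<circ> a)) (NF (\<sigma>1 \<circ> b))"
proof -
  have "sub F U \<in> Age F" using U(1) unfolding Age_def by blast
  then interpret U: normed_nspace "sub F U" using Age_normed[OF normed_F] by unfold_locales
  have t: "tuple (sub F U) k a" "tuple (sub F U) k b" using U(2,3) by (simp_all add: tuple_def)
  have n: "near \<delta> (NF a) (NF (\<sigma>0 \<circ> a))" "near \<delta> (NF b) (NF (\<sigma>1 \<circ> b))"
    using U.near_isom_tnorm[OF \<sigma>(1) t(1)] U.near_isom_tnorm[OF \<sigma>(2) t(2)] by simp_all
  then show "adm (NF (\<sigma>0 \<circ> a)) (NF (\<sigma>1 \<circ> b))" by (rule local_boundD(3)[OF lb])
  have n': "near \<delta> (NF a) (NF (g \<circ> \<sigma>0 \<circ> a))" "near \<delta> (NF b) (NF (h \<circ> \<sigma>1 \<circ> b))"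
    using n Iso_NF[OF g(1), of "\<sigma>0 \<circ> a"] Iso_NF[OF g(3), of "\<sigma>1 \<circ> b"] by (simp_all add: o_assoc)
  have r: "near \<delta> (NF a) (NF a)" "near \<delta> (NF b) (NF b)"
    using local_boundD(1)[OF lb] NF_nonneg by (intro near_refl; simp)+
  have "d (\<Psi> (g \<circ> \<sigma>0 \<circ> a) (h \<circ> \<sigma>1 \<circ> b)) (\<Psi> a b) \<le>
      L * (tdist F k (g \<circ> \<sigma>0 \<circ> a) a + tdist F k (h \<circ> \<sigma>1 \<circ> b) b)"
    by (rule local_boundD(4)[OF lb n' r])
  also have "\<dots> \<le> L * (e * (\<Sum>j<k. norm (a j)) + e * (\<Sum>j<k. norm (b j)))"
    using tdist_le_scaled[of U "g \<circ> \<sigma>0" e a] tdist_le_scaled[of U "h \<circ> \<sigma>1" e b] g U(2,3) local_boundD(2)[OF lb]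
    by (intro mult_left_mono add_mono) auto
  finally show "d (\<Psi> (g \<circ> \<sigma>0 \<circ> a) (h \<circ> \<sigma>1 \<circ> b)) (\<Psi> a b) \<le> L * (e * size2 a b)"
    by (simp add: size2_def distrib_left)
qed

text \<open>Isometries of the limit move one copy of \<open>En n\<close> almost to the other, pointwise and hence also for the
  described objects.\<close>

lemma oc_independent:
  assumes vw: "(v, w) \<in> AD n"
    and S: "isom (En n) F S0" "isom (En n) F S1" and S': "isom (En n) F S0'" "isom (En n) F S1'"
  shows "oc (\<Psi> (S0 \<circ> v) (S1 \<circ> w)) = oc (\<Psi> (S0' \<circ> v) (S1' \<circ> w))"
proof -
  have t: "tuple (En n) k v" "tuple (En n) k w" "adm (NE v) (NE w)" using vw by (simp_all add: AD_def)
  obtain \<delta> L where lb: "local_bound (NE v) (NE w) \<delta> L" using local_bound_ex[OF t(3)] by blast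
  note \<delta> = local_boundD(1,2)[OF lb]
  define A where "A = (\<Sum>j<k. \<mu> (v j)) + (\<Sum>j<k. \<mu> (w j))"
  have A: "0 \<le> A" unfolding A_def by (intro add_nonneg_nonneg sum_nonneg) simp_all
  have "\<exists>\<gamma>\<in>G. d (act \<gamma> (\<Psi> (S0 \<circ> v) (S1 \<circ> w))) (\<Psi> (S0' \<circ> v) (S1' \<circ> w)) < e" if e: "0 < e" for e
  proof -
    define e' where "e' = e / (L * A + 1)"
    have LA: "0 \<le> L * A" using \<delta>(2) A by simp
    have e': "0 < e'" "L * A * e' < e"
      using e LA by (simp_all add: e'_def pos_divide_less_eq add_nonneg_pos)
    obtain g where g: "g \<in> Iso F" "\<And>x. x \<in> coord_space n \<Longrightarrow> norm (g (S0 x) - S0' x) \<le> e' * \<mu> x"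
      using homogeneity[OF S(1) S'(1) e'(1)] by blast
    obtain h where h: "h \<in> Iso F" "\<And>x. x \<in> coord_space n \<Longrightarrow> norm (h (S1 x) - S1' x) \<le> e' * \<mu> x"
      using homogeneity[OF S(2) S'(2) e'(1)] by blast
    obtain \<gamma> where \<gamma>: "\<gamma> \<in> G" "\<And>v w. adm (NF v) (NF w) \<Longrightarrow> act \<gamma> (\<Psi> v w) = \<Psi> (g \<circ> v) (h \<circ> w)"
      using \<Psi>_act[OF g(1) h(1)] by blast
    have N: "NF (S0 \<circ> v) = NE v" "NF (S1 \<circ> w) = NE w" "NF (S0' \<circ> v) = NE v" "NF (S1' \<circ> w) = NE w"
      "NF (g \<circ> (S0 \<circ> v)) = NE v" "NF (h \<circ> (S1 \<circ> w)) = NE w"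
      using isom_NF t S S' Iso_NF g(1) h(1) by simp_all
    have r: "near \<delta> (NE v) (NE v)" "near \<delta> (NE w) (NE w)"
      using \<delta>(1) NE_nonneg by (intro near_refl; simp)+
    have "d (\<Psi> (g \<circ> (S0 \<circ> v)) (h \<circ> (S1 \<circ> w))) (\<Psi> (S0' \<circ> v) (S1' \<circ> w)) \<le>
        L * (tdist F k (g \<circ> (S0 \<circ> v)) (S0' \<circ> v) + tdist F k (h \<circ> (S1 \<circ> w)) (S1' \<circ> w))"
      by (rule local_boundD(4)[OF lb]) (simp_all add: N r)
    also have "\<dots> \<le> L * (e' * (\<Sum>j<k. \<mu> (v j)) + e' * (\<Sum>j<k. \<mu> (w j)))"
      unfolding tdist_def sum_distrib_left using g(2) h(2) t \<delta>(2)
      by (intro mult_left_mono add_mono sum_mono) (auto simp: tuple_def)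
    also have "\<dots> = L * A * e'" by (simp add: A_def algebra_simps)
    finally have "d (\<Psi> (g \<circ> (S0 \<circ> v)) (h \<circ> (S1 \<circ> w))) (\<Psi> (S0' \<circ> v) (S1' \<circ> w)) < e" using e'(2) by linarith
    moreover have "act \<gamma> (\<Psi> (S0 \<circ> v) (S1 \<circ> w)) = \<Psi> (g \<circ> (S0 \<circ> v)) (h \<circ> (S1 \<circ> w))"
      using t(3) by (intro \<gamma>(2)) (simp add: N)
    ultimately show ?thesis using \<gamma>(1) by (intro bexI[of _ \<gamma>]) simp_all
  qed
  then have "\<Psi> (S0' \<circ> v) (S1' \<circ> w) \<in> oc (\<Psi> (S0 \<circ> v) (S1 \<circ> w))"
    using AD_\<Psi>_M[OF vw S'] unfolding orbit_closure_def by blast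
  from oc_eq[OF AD_\<Psi>_M[OF vw S] this] show ?thesis by simp
qed

text \<open>The orbit closure of the copies of \<open>\<Psi> v w\<close>, defined by choosing a copy; \<open>cls_eq\<close> removes the
  choices.\<close>

definition cls where "cls = (\<lambda>(v, w).
  let n = (LEAST n. tuple (En n) k v \<and> tuple (En n) k w); \<theta> = (SOME \<theta>. isom (En n) F \<theta>)
  in oc (\<Psi> (\<theta> \<circ> v) (\<theta> \<circ> w)))"

lemma cls_eq:
  assumes vw: "(v, w) \<in> AD n" and S: "isom (En n) F S0" "isom (En n) F S1"
  shows "cls (v, w) = oc (\<Psi> (S0 \<circ> v) (S1 \<circ> w))"
proof -
  define n0 where "n0 = (LEAST n. tuple (En n) k v \<and> tuple (En n) k w)"
  define \<theta> where "\<theta> = (SOME \<theta>. isom (En n0) F \<theta>)"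
  have t: "tuple (En n) k v \<and> tuple (En n) k w" using vw by (simp add: AD_def)
  have "tuple (En n0) k v \<and> tuple (En n0) k w" unfolding n0_def by (rule LeastI[of _ n]) (rule t)
  then have vw0: "(v, w) \<in> AD n0" using D_AD[OF AD_D[OF vw]] by blast
  have le: "n0 \<le> n" unfolding n0_def by (rule Least_le) (rule t)
  have \<theta>: "isom (En n0) F \<theta>" unfolding \<theta>_def using En_embeds by (rule someI_ex)
  have "cls (v, w) = oc (\<Psi> (\<theta> \<circ> v) (\<theta> \<circ> w))" by (simp add: cls_def n0_def[symmetric] \<theta>_def[symmetric])
  then show ?thesis
    using oc_independent[OF vw0 \<theta> \<theta> isom_En_mono[OF S(1) le] isom_En_mono[OF S(2) le]] by simp
qed

lemma cls_quot:
  assumes "(v, w) \<in> Dall"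
  shows "cls (v, w) \<in> Q"
proof -
  obtain n where n: "(v, w) \<in> AD n" using D_in_AD[OF assms] by blast
  obtain \<theta> where \<theta>: "isom (En n) F \<theta>" using En_embeds by blast
  show ?thesis unfolding quot_def cls_eq[OF n \<theta> \<theta>] using AD_\<Psi>_M[OF n \<theta> \<theta>] by blast
qed

text \<open>The span of the tuples of an arbitrary object is moved almost isometrically into some \<open>En n\<close>; by the
  Fraisse property this moves the object to one that is close to its orbit.\<close>

lemma cls_dense:
  assumes p: "p \<in> M" and "0 < e"
  shows "\<exists>T\<in>Dall. qd (cls T) (oc p) < e"
proof -
  obtain a b where ab: "p = \<Psi> a b" "adm (NF a) (NF b)" using M_\<Psi>[OF p] by blast
  obtain \<delta> L where lb: "local_bound (NF a) (NF b) \<delta> L" using local_bound_ex[OF ab(2)] by blast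
  note \<delta> = local_boundD(1,2)[OF lb]
  define U where "U = F.span (a ` {..<k} \<union> b ` {..<k})"
  define r where "r = F.dim U"
  have U: "U \<in> Gr r F" unfolding U_def r_def by (rule F.span_Gr) simp_all
  have aU: "\<And>j. j < k \<Longrightarrow> a j \<in> U" "\<And>j. j < k \<Longrightarrow> b j \<in> U"
    unfolding U_def by (rule F.span_base, simp)+
  define e' where "e' = e / (L * size2 a b + 1)"
  have LA: "0 \<le> L * size2 a b" using \<delta>(2) size2_nonneg by simp
  have e': "0 < e'" "L * (e' * size2 a b) < e"
    using \<open>0 < e\<close> LA by (simp_all add: e'_def pos_divide_less_eq add_nonneg_pos field_simps)
  obtain \<delta>f where \<delta>f: "0 < \<delta>f" "\<And>\<sigma>. near_isom \<delta>f (sub F U) F \<sigma> \<Longrightarrow>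
      \<exists>g\<in>Iso F. \<forall>x\<in>U. norm (g (\<sigma> x) - x) \<le> e' * norm x"
    using fraisse_near[OF U e'(1)] by blast
  define \<delta>' where "\<delta>' = min \<delta> \<delta>f"
  have \<delta>': "0 < \<delta>'" "\<delta>' \<le> \<delta>" "\<delta>' \<le> \<delta>f" using \<delta>(1) \<delta>f(1) by (auto simp: \<delta>'_def)
  obtain n \<beta> where \<beta>: "near_isom \<delta>' (sub F U) (En n) \<beta>" using near_isom_into_En[OF U \<delta>'(1)] by blast
  have \<beta>\<delta>: "near_isom \<delta> (sub F U) (En n) \<beta>" by (rule near_isom_mono[OF \<beta> \<delta>'(2)]) simp_all
  have \<beta>\<delta>f: "near_isom \<delta>f (sub F U) (En n) \<beta>" by (rule near_isom_mono[OF \<beta> \<delta>'(3)]) simp_all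
  obtain \<theta> where \<theta>: "isom (En n) F \<theta>" using En_embeds by blast
  obtain g where g: "g \<in> Iso F" "\<And>x. x \<in> U \<Longrightarrow> norm (g ((\<theta> \<circ> \<beta>) x) - x) \<le> e' * norm x"
    using \<delta>f(2)[OF near_isom_comp_isom[OF \<theta> \<beta>\<delta>f]] by blast
  note pt = perturb[OF lb U aU near_isom_comp_isom[OF \<theta> \<beta>\<delta>] near_isom_comp_isom[OF \<theta> \<beta>\<delta>] g(1) g(2) g(1) g(2)]
  have tn: "tuple (En n) k (\<beta> \<circ> a)" "tuple (En n) k (\<beta> \<circ> b)"
    using \<beta> aU by (auto simp: near_isom_def lin_on_def tuple_def)
  have adm: "adm (NF (\<theta> \<circ> \<beta> \<circ> a)) (NF (\<theta> \<circ> \<beta> \<circ> b))" by (rule pt(2)) simp_all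
  then have ad: "(\<beta> \<circ> a, \<beta> \<circ> b) \<in> AD n"
    using isom_NF[OF \<theta> tn(1)] isom_NF[OF \<theta> tn(2)] tn by (simp add: AD_def o_assoc)
  obtain \<gamma> where \<gamma>: "\<gamma> \<in> G" "\<And>v w. adm (NF v) (NF w) \<Longrightarrow> act \<gamma> (\<Psi> v w) = \<Psi> (g \<circ> v) (g \<circ> w)"
    using \<Psi>_act[OF g(1) g(1)] by blast
  let ?x = "\<Psi> (\<theta> \<circ> \<beta> \<circ> a) (\<theta> \<circ> \<beta> \<circ> b)"
  have xM: "?x \<in> M" by (rule \<Psi>_M[OF adm])
  have "qd (oc ?x) (oc p) \<le> d (act \<gamma> ?x) p"
    by (rule qd_le[OF xM p oc_orbit[OF xM \<gamma>(1)] oc_self[OF p]])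
  also have "act \<gamma> ?x = \<Psi> (g \<circ> (\<theta> \<circ> \<beta>) \<circ> a) (g \<circ> (\<theta> \<circ> \<beta>) \<circ> b)" using \<gamma>(2)[OF adm] by (simp only: o_assoc)
  also have "d \<dots> p \<le> L * (e' * size2 a b)" unfolding ab(1) by (rule pt(1)) simp_all
  finally have "qd (oc ?x) (oc p) < e" using e'(2) by linarith
  moreover have "cls (\<beta> \<circ> a, \<beta> \<circ> b) = oc ?x" using cls_eq[OF ad \<theta> \<theta>] by (simp only: o_assoc)
  ultimately show ?thesis using AD_D[OF ad] by (intro bexI[of _ "(\<beta> \<circ> a, \<beta> \<circ> b)"]) simp_all
qed

text \<open>Two classes at distance \<open>r\<close> have representatives in some \<open>En n\<close> whose images under all
  isometric embeddings are at distance almost \<open>r\<close>.\<close>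

lemma close_representatives:
  assumes T: "(v, w) \<in> Dall" and S: "(v1, w1) \<in> Dall" and "0 < e" "0 < \<delta>"
  shows "\<exists>n v' w' v1' w1'. (v', w') \<in> AD n \<and> (v1', w1') \<in> AD n \<and>
    near \<delta> (NE v) (NE v') \<and> near \<delta> (NE w) (NE w') \<and> near \<delta> (NE v1) (NE v1') \<and> near \<delta> (NE w1) (NE w1') \<and>
    (\<forall>n' S0 S1. n \<le> n' \<longrightarrow> isom (En n') F S0 \<longrightarrow> isom (En n') F S1 \<longrightarrow>
       d (\<Psi> (S0 \<circ> v') (S1 \<circ> w')) (\<Psi> (S0 \<circ> v1') (S1 \<circ> w1')) \<le> qd (cls (v, w)) (cls (v1, w1)) + e)"
proof -
  obtain nT where nT: "(v, w) \<in> AD nT" using D_in_AD[OF T] by blast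
  obtain nS where nS: "(v1, w1) \<in> AD nS" using D_in_AD[OF S] by blast
  obtain \<theta>T where \<theta>T: "isom (En nT) F \<theta>T" using En_embeds by blast
  obtain \<theta>S where \<theta>S: "isom (En nS) F \<theta>S" using En_embeds by blast
  note cT = cls_eq[OF nT \<theta>T \<theta>T] and cS = cls_eq[OF nS \<theta>S \<theta>S]
  obtain \<delta>T LT where lT: "local_bound (NE v) (NE w) \<delta>T LT" using local_bound_ex[of "NE v" "NE w"] T by (auto simp: Dall_def)
  obtain \<delta>S LS where lS: "local_bound (NE v1) (NE w1) \<delta>S LS" using local_bound_ex[of "NE v1" "NE w1"] S by (auto simp: Dall_def)
  define \<delta>1 where "\<delta>1 = min (min \<delta>T \<delta>S) (\<delta> / 3)"
  have \<delta>1: "0 < \<delta>1" "\<delta>1 \<le> \<delta>T" "\<delta>1 \<le> \<delta>S" "\<delta>1 \<le> \<delta> / 3"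
    using local_boundD(1)[OF lT] local_boundD(1)[OF lS] \<open>0 < \<delta>\<close> by (auto simp: \<delta>1_def)
  have e3: "0 < e / 3" using \<open>0 < e\<close> by simp
  obtain p q where pq: "p \<in> cls (v, w)" "q \<in> cls (v1, w1)" "d p q < qd (cls (v, w)) (cls (v1, w1)) + e / 3"
    using qd_approx[OF AD_\<Psi>_M[OF nT \<theta>T \<theta>T] AD_\<Psi>_M[OF nS \<theta>S \<theta>S] e3] unfolding cT cS by blast
  obtain a b where ab: "p = \<Psi> a b" "near \<delta>1 (NE v) (NF a)" "near \<delta>1 (NE w) (NF b)"
    using oc_tuples[OF nT \<theta>T \<theta>T _ \<delta>1(1)] pq(1) unfolding cT by blast
  obtain a1 b1 where ab1: "q = \<Psi> a1 b1" "near \<delta>1 (NE v1) (NF a1)" "near \<delta>1 (NE w1) (NF b1)"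
    using oc_tuples[OF nS \<theta>S \<theta>S _ \<delta>1(1)] pq(2) unfolding cS by blast
  note nm = NE_nonneg NF_nonneg
  have admA: "adm (NF a) (NF b)"
    by (rule local_boundD(3)[OF lT near_mono[OF ab(2) \<delta>1(2) nm] near_mono[OF ab(3) \<delta>1(2) nm]])
  have admB: "adm (NF a1) (NF b1)"
    by (rule local_boundD(3)[OF lS near_mono[OF ab1(2) \<delta>1(3) nm] near_mono[OF ab1(3) \<delta>1(3) nm]])
  obtain \<delta>a La where la: "local_bound (NF a) (NF b) \<delta>a La" using local_bound_ex[OF admA] by blast
  obtain \<delta>b Lb where lb: "local_bound (NF a1) (NF b1) \<delta>b Lb" using local_bound_ex[OF admB] by blast
  define U where "U = F.span (a ` {..<k} \<union> b ` {..<k} \<union> a1 ` {..<k} \<union> b1 ` {..<k})"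
  define r where "r = F.dim U"
  have U: "U \<in> Gr r F" unfolding U_def r_def by (rule F.span_Gr) simp_all
  have inU: "\<And>j. j < k \<Longrightarrow> a j \<in> U" "\<And>j. j < k \<Longrightarrow> b j \<in> U" "\<And>j. j < k \<Longrightarrow> a1 j \<in> U" "\<And>j. j < k \<Longrightarrow> b1 j \<in> U"
    unfolding U_def by (rule F.span_base, simp)+
  define A where "A = La * size2 a b + Lb * size2 a1 b1 + 1"
  have pos: "0 \<le> La * size2 a b" "0 \<le> Lb * size2 a1 b1"
    using local_boundD(2)[OF la] local_boundD(2)[OF lb] size2_nonneg by simp_all
  define e' where "e' = e / (3 * A)"
  have "0 < A" using pos by (simp add: A_def)
  then have e': "0 < e'" using \<open>0 < e\<close> by (simp add: e'_def)
  have "e' * (La * size2 a b) \<le> e' * A" "e' * (Lb * size2 a1 b1) \<le> e' * A"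
    using e' pos by (auto simp: A_def intro!: mult_left_mono)
  moreover have "e' * A = e / 3" using \<open>0 < A\<close> by (simp add: e'_def)
  ultimately have le3: "La * (e' * size2 a b) \<le> e / 3" "Lb * (e' * size2 a1 b1) \<le> e / 3"
    by (simp_all add: mult.left_commute)
  obtain \<delta>f where \<delta>f: "0 < \<delta>f" "\<And>\<sigma>. near_isom \<delta>f (sub F U) F \<sigma> \<Longrightarrow>
      \<exists>g\<in>Iso F. \<forall>x\<in>U. norm (g (\<sigma> x) - x) \<le> e' * norm x"
    using fraisse_near[OF U e'] by blast
  define \<delta>2 where "\<delta>2 = min (min (min \<delta>a \<delta>b) (min \<delta>f (\<delta> / 3))) 1"
  have \<delta>2: "0 < \<delta>2" "\<delta>2 \<le> \<delta>a" "\<delta>2 \<le> \<delta>b" "\<delta>2 \<le> \<delta>f" "\<delta>2 \<le> \<delta> / 3" "\<delta>2 \<le> 1"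
    using local_boundD(1)[OF la] local_boundD(1)[OF lb] \<delta>f(1) \<open>0 < \<delta>\<close> by (auto simp: \<delta>2_def)
  obtain n \<beta> where \<beta>: "near_isom \<delta>2 (sub F U) (En n) \<beta>" using near_isom_into_En[OF U \<delta>2(1)] by blast
  have \<beta>m: "near_isom \<delta>' (sub F U) (En n) \<beta>" if "\<delta>2 \<le> \<delta>'" for \<delta>'
    by (rule near_isom_mono[OF \<beta> that]) simp_all
  have "sub F U \<in> Age F" using U unfolding Age_def by blast
  then interpret U: normed_nspace "sub F U" using Age_normed[OF normed_F] by unfold_locales
  have tn: "tuple (En n) k (\<beta> \<circ> x)" if "\<And>j. j < k \<Longrightarrow> x j \<in> U" for x
    using \<beta> that by (auto simp: near_isom_def lin_on_def tuple_def)
  have nr: "near \<delta>2 (NF x) (NE (\<beta> \<circ> x))" if "\<And>j. j < k \<Longrightarrow> x j \<in> U" for x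
    using U.near_isom_tnorm[OF \<beta>, of k x] that by (simp add: tuple_def)
  have ntr: "near \<delta> (NE t) (NE (\<beta> \<circ> x))" if "near \<delta>1 (NE t) (NF x)" "\<And>j. j < k \<Longrightarrow> x j \<in> U" for t x
    by (rule near_trans_small[OF that(1) nr[OF that(2)] _ _ \<delta>1(4) \<delta>2(5,6)])
      (use \<delta>1(1) \<delta>2(1) NE_nonneg in auto)
  have ad: "(\<beta> \<circ> a, \<beta> \<circ> b) \<in> AD n"
    unfolding AD_def using tn[OF inU(1)] tn[OF inU(2)]
      local_boundD(3)[OF la near_mono[OF nr[OF inU(1)] \<delta>2(2) NF_nonneg NE_nonneg]
        near_mono[OF nr[OF inU(2)] \<delta>2(2) NF_nonneg NE_nonneg]] by simp
  have ad1: "(\<beta> \<circ> a1, \<beta> \<circ> b1) \<in> AD n"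
    unfolding AD_def using tn[OF inU(3)] tn[OF inU(4)]
      local_boundD(3)[OF lb near_mono[OF nr[OF inU(3)] \<delta>2(3) NF_nonneg NE_nonneg]
        near_mono[OF nr[OF inU(4)] \<delta>2(3) NF_nonneg NE_nonneg]] by simp
  have fin: "d (\<Psi> (S0 \<circ> (\<beta> \<circ> a)) (S1 \<circ> (\<beta> \<circ> b))) (\<Psi> (S0 \<circ> (\<beta> \<circ> a1)) (S1 \<circ> (\<beta> \<circ> b1))) \<le>
      qd (cls (v, w)) (cls (v1, w1)) + e"
    if n': "n \<le> n'" and S': "isom (En n') F S0" "isom (En n') F S1" for n' S0 S1
  proof -
    have i: "isom (En n) F S0" "isom (En n) F S1" using isom_En_mono[OF S'(1) n'] isom_En_mono[OF S'(2) n'] .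
    note ni0 = near_isom_comp_isom[OF i(1) \<beta>m] and ni1 = near_isom_comp_isom[OF i(2) \<beta>m]
    obtain g where g: "g \<in> Iso F" "\<And>x. x \<in> U \<Longrightarrow> norm (g ((S0 \<circ> \<beta>) x) - x) \<le> e' * norm x"
      using \<delta>f(2)[OF ni0[OF \<delta>2(4)]] by blast
    obtain h where h: "h \<in> Iso F" "\<And>x. x \<in> U \<Longrightarrow> norm (h ((S1 \<circ> \<beta>) x) - x) \<le> e' * norm x"
      using \<delta>f(2)[OF ni1[OF \<delta>2(4)]] by blast
    obtain \<gamma> where \<gamma>: "\<gamma> \<in> G" "\<And>v w. adm (NF v) (NF w) \<Longrightarrow> act \<gamma> (\<Psi> v w) = \<Psi> (g \<circ> v) (h \<circ> w)"
      using \<Psi>_act[OF g(1) h(1)] by blast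
    note p1 = perturb[OF la U inU(1,2) ni0[OF \<delta>2(2)] ni1[OF \<delta>2(2)] g(1) g(2) h(1) h(2)]
    note p2 = perturb[OF lb U inU(3,4) ni0[OF \<delta>2(3)] ni1[OF \<delta>2(3)] g(1) g(2) h(1) h(2)]
    let ?x = "\<Psi> (S0 \<circ> \<beta> \<circ> a) (S1 \<circ> \<beta> \<circ> b)" and ?y = "\<Psi> (S0 \<circ> \<beta> \<circ> a1) (S1 \<circ> \<beta> \<circ> b1)"
    have ad1: "adm (NF (S0 \<circ> \<beta> \<circ> a)) (NF (S1 \<circ> \<beta> \<circ> b))" by (rule p1(2)) simp_all
    have ad2: "adm (NF (S0 \<circ> \<beta> \<circ> a1)) (NF (S1 \<circ> \<beta> \<circ> b1))" by (rule p2(2)) simp_all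
    have d1: "d (\<Psi> (g \<circ> (S0 \<circ> \<beta>) \<circ> a) (h \<circ> (S1 \<circ> \<beta>) \<circ> b)) (\<Psi> a b) \<le> La * (e' * size2 a b)"
      by (rule p1(1)) simp_all
    have d2: "d (\<Psi> (g \<circ> (S0 \<circ> \<beta>) \<circ> a1) (h \<circ> (S1 \<circ> \<beta>) \<circ> b1)) (\<Psi> a1 b1) \<le> Lb * (e' * size2 a1 b1)"
      by (rule p2(1)) simp_all
    have gx: "act \<gamma> ?x = \<Psi> (g \<circ> (S0 \<circ> \<beta>) \<circ> a) (h \<circ> (S1 \<circ> \<beta>) \<circ> b)"
      using \<gamma>(2)[OF ad1] by (simp only: o_assoc)
    have gy: "act \<gamma> ?y = \<Psi> (g \<circ> (S0 \<circ> \<beta>) \<circ> a1) (h \<circ> (S1 \<circ> \<beta>) \<circ> b1)"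
      using \<gamma>(2)[OF ad2] by (simp only: o_assoc)
    have M: "?x \<in> M" "?y \<in> M" "act \<gamma> ?x \<in> M" "act \<gamma> ?y \<in> M" "p \<in> M" "q \<in> M"
      using \<Psi>_M[OF ad1] \<Psi>_M[OF ad2] act_M[OF \<gamma>(1)] \<Psi>_M[OF admA] \<Psi>_M[OF admB] by (simp_all add: ab(1) ab1(1))
    have "d ?x ?y = d (act \<gamma> ?x) (act \<gamma> ?y)" using act_isometric[OF \<gamma>(1) M(1,2)] by simp
    also have "\<dots> \<le> d (act \<gamma> ?x) p + d p (act \<gamma> ?y)" by (rule d_tri[OF M(3,5,4)])
    also have "d p (act \<gamma> ?y) \<le> d p q + d q (act \<gamma> ?y)" by (rule d_tri[OF M(5,6,4)])
    also have "d q (act \<gamma> ?y) = d (act \<gamma> ?y) q" by (rule d_sym[OF M(6,4)])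
    finally have "d ?x ?y \<le> d (act \<gamma> ?x) p + d p q + d (act \<gamma> ?y) q" by (simp only: add.assoc)
    also have "d (act \<gamma> ?x) p \<le> e / 3" using d1 le3(1) unfolding gx ab(1) by linarith
    also have "d (act \<gamma> ?y) q \<le> e / 3" using d2 le3(2) unfolding gy ab1(1) by linarith
    finally have "d ?x ?y \<le> qd (cls (v, w)) (cls (v1, w1)) + e" using pq(3) by linarith
    then show ?thesis by (simp only: o_assoc)
  qed
  show ?thesis
    using ad ad1 ntr[OF ab(2) inU(1)] ntr[OF ab(3) inU(2)] ntr[OF ab1(2) inU(3)] ntr[OF ab1(3) inU(4)] fin
    by blast
qed

end


context coloring_family
begin

text \<open>A colouring of objects in the copy of \<open>En n\<close> that is given by \<open>\<theta>\<close>. It is 1-Lipschitz for the distance of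
  the objects in the limit.\<close>

definition colors where "colors n \<theta> K C \<longleftrightarrow> (\<forall>v w. (v, w) \<in> AD n \<longrightarrow> C (\<theta> \<circ> v) (\<theta> \<circ> w) \<in> K) \<and>
  (\<forall>v w v' w'. (v, w) \<in> AD n \<longrightarrow> (v', w') \<in> AD n \<longrightarrow>
     dist (C (\<theta> \<circ> v) (\<theta> \<circ> w)) (C (\<theta> \<circ> v') (\<theta> \<circ> w')) \<le> d (\<Psi> (\<theta> \<circ> v) (\<theta> \<circ> w)) (\<Psi> (\<theta> \<circ> v') (\<theta> \<circ> w')))"

definition factors where "factors m n \<theta> K \<epsilon> C \<longleftrightarrow> (\<exists>R0 R1 h. isom (En m) (En n) R0 \<and> isom (En m) (En n) R1 \<and>
  lip1 Q qd K dist h \<and> (\<forall>v w. (v, w) \<in> AD m \<longrightarrow>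
    dist (C (\<theta> \<circ> R0 \<circ> v) (\<theta> \<circ> R1 \<circ> w)) (h (oc (\<Psi> (\<theta> \<circ> R0 \<circ> v) (\<theta> \<circ> R1 \<circ> w)))) \<le> \<epsilon>))"

lemma isom_AD: "isom (En n) (En n') R0 \<Longrightarrow> isom (En n) (En n') R1 \<Longrightarrow> (v, w) \<in> AD n \<Longrightarrow> (R0 \<circ> v, R1 \<circ> w) \<in> AD n'"
  using normed_nspace.isom_tuple[OF normed_nspace.intro[OF En_normed], of n "En n'" _ k]
    normed_nspace.isom_tnorm[OF normed_nspace.intro[OF En_normed], of n "En n'" _ k]
  by (simp add: AD_def)

lemma colors_controlled:
  assumes C: "colors n \<theta> K C" and \<theta>: "isom (En n) F \<theta>"
    and \<rho>: "\<And>t0 t1. (t0, t1) \<in> Dall \<Longrightarrow> local_bound (NE t0) (NE t1) (\<rho> t0 t1) (L t0 t1)"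
  shows "controlled k Dall \<rho> L K n (\<lambda>v w. C (\<theta> \<circ> v) (\<theta> \<circ> w))"
  unfolding controlled_def
proof clarify
  fix t0 t1 v w assume t: "(t0, t1) \<in> Dall" and vw: "v \<in> nbhd k n t0 (\<rho> t0 t1)" "w \<in> nbhd k n t1 (\<rho> t0 t1)"
  note lb = \<rho>[OF t]
  have ad: "(v, w) \<in> AD n" if "v \<in> nbhd k n t0 (\<rho> t0 t1)" "w \<in> nbhd k n t1 (\<rho> t0 t1)" for v w
    using that local_boundD(3)[OF lb] by (simp add: nbhd_def AD_def)
  have "dist (C (\<theta> \<circ> v) (\<theta> \<circ> w)) (C (\<theta> \<circ> v') (\<theta> \<circ> w')) \<le> L t0 t1 * (tdist E k v v' + tdist E k w w')"
    if v': "v' \<in> nbhd k n t0 (\<rho> t0 t1)" "w' \<in> nbhd k n t1 (\<rho> t0 t1)" for v' w'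
  proof -
    have t': "tuple (En n) k v" "tuple (En n) k w" "tuple (En n) k v'" "tuple (En n) k w'"
      and nr: "near (\<rho> t0 t1) (NE t0) (NE v)" "near (\<rho> t0 t1) (NE t1) (NE w)"
        "near (\<rho> t0 t1) (NE t0) (NE v')" "near (\<rho> t0 t1) (NE t1) (NE w')"
      using vw v' by (simp_all add: nbhd_def)
    have "dist (C (\<theta> \<circ> v) (\<theta> \<circ> w)) (C (\<theta> \<circ> v') (\<theta> \<circ> w')) \<le> d (\<Psi> (\<theta> \<circ> v) (\<theta> \<circ> w)) (\<Psi> (\<theta> \<circ> v') (\<theta> \<circ> w'))"
      using C ad[OF vw] ad[OF v'] unfolding colors_def by blast
    also have "\<dots> \<le> L t0 t1 * (tdist F k (\<theta> \<circ> v) (\<theta> \<circ> v') + tdist F k (\<theta> \<circ> w) (\<theta> \<circ> w'))"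
      by (rule local_boundD(4)[OF lb]) (simp_all only: isom_NF[OF \<theta> t'(1)] isom_NF[OF \<theta> t'(2)]
          isom_NF[OF \<theta> t'(3)] isom_NF[OF \<theta> t'(4)] nr)
    finally show ?thesis
      by (simp only: isom_tdist_F[OF \<theta> t'(1,3)] isom_tdist_F[OF \<theta> t'(2,4)])
  qed
  moreover have "C (\<theta> \<circ> v) (\<theta> \<circ> w) \<in> K" using C ad[OF vw] unfolding colors_def by blast
  ultimately show "C (\<theta> \<circ> v) (\<theta> \<circ> w) \<in> K \<and> (\<forall>v'\<in>nbhd k n t0 (\<rho> t0 t1). \<forall>w'\<in>nbhd k n t1 (\<rho> t0 t1).
      dist (C (\<theta> \<circ> v) (\<theta> \<circ> w)) (C (\<theta> \<circ> v') (\<theta> \<circ> w')) \<le> L t0 t1 * (tdist E k v v' + tdist E k w w'))"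
    by blast
qed

text \<open>A colouring \<open>g\<close> on \<open>En N\<close> that is induced by a bad one, is bad on \<open>En m\<close> and passes the tests
  \<open>Ts\<close>. The bound \<open>card Ts \<le> N\<close> makes \<open>N\<close> grow with the set of tests.\<close>

definition passed where "passed m \<delta> K \<epsilon> Ts N S0 S1 g \<longleftrightarrow> m \<le> N \<and> card Ts \<le> N \<and> isom (En N) F S0 \<and> isom (En N) F S1 \<and>
  (\<forall>t0 t1 p \<eta>. (t0, t1, p, \<eta>) \<in> Ts \<longrightarrow> (t0, t1) \<in> AD N) \<and>
  (\<forall>v w. (v, w) \<in> AD N \<longrightarrow> g v w \<in> K) \<and>
  (\<forall>v w v' w'. (v, w) \<in> AD N \<longrightarrow> (v', w') \<in> AD N \<longrightarrow>
     dist (g v w) (g v' w') \<le> d (\<Psi> (S0 \<circ> v) (S1 \<circ> w)) (\<Psi> (S0 \<circ> v') (S1 \<circ> w'))) \<and>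
  (\<forall>q\<in>Ts. passes k \<delta> N g q) \<and>
  (\<forall>h. lip1 Q qd K dist h \<longrightarrow> (\<exists>v w. (v, w) \<in> AD m \<and> \<epsilon> < dist (g v w) (h (oc (\<Psi> (S0 \<circ> v) (S1 \<circ> w))))))"

lemma passedD:
  assumes "passed m \<delta> K \<epsilon> Ts N S0 S1 g"
  shows "m \<le> N" "isom (En N) F S0" "isom (En N) F S1" "(t0, t1, p, \<eta>) \<in> Ts \<Longrightarrow> (t0, t1) \<in> AD N"
    "(v, w) \<in> AD N \<Longrightarrow> g v w \<in> K"
    "(v, w) \<in> AD N \<Longrightarrow> (v', w') \<in> AD N \<Longrightarrow>
      dist (g v w) (g v' w') \<le> d (\<Psi> (S0 \<circ> v) (S1 \<circ> w)) (\<Psi> (S0 \<circ> v') (S1 \<circ> w'))"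
    "q \<in> Ts \<Longrightarrow> passes k \<delta> N g q"
    "lip1 Q qd K dist h \<Longrightarrow> \<exists>v w. (v, w) \<in> AD m \<and> \<epsilon> < dist (g v w) (h (oc (\<Psi> (S0 \<circ> v) (S1 \<circ> w))))"
    "card Ts \<le> N"
  using assms unfolding passed_def by blast+

lemma bad_colouring_passes:
  assumes bad: "\<And>n0. \<exists>n \<theta> C. n0 \<le> n \<and> isom (En n) F \<theta> \<and> colors n \<theta> K C \<and> \<not> factors m n \<theta> K \<epsilon> C"
    and \<rho>: "\<And>t0 t1. (t0, t1) \<in> Dall \<Longrightarrow> local_bound (NE t0) (NE t1) (\<rho> t0 t1) (L t0 t1)"
    and K': "K \<subseteq> K'"
    and ram: "\<And>N. \<exists>n0. \<forall>n\<ge>n0. \<forall>c. controlled k Dall \<rho> L K' n c \<longrightarrow> (\<exists>R0 R1. isom (En N) (En n) R0 \<and>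
        isom (En N) (En n) R1 \<and> (\<forall>q\<in>Ts. passes k \<delta> N (\<lambda>v w. c (R0 \<circ> v) (R1 \<circ> w)) q))"
    and Ts: "finite Ts" "\<And>t0 t1 p \<eta>. (t0, t1, p, \<eta>) \<in> Ts \<Longrightarrow> (t0, t1) \<in> Dall"
  shows "\<exists>N S0 S1 g. passed m \<delta> K \<epsilon> Ts N S0 S1 g"
proof -
  have "\<exists>N. \<forall>t0 t1 p \<eta>. (t0, t1, p, \<eta>) \<in> Ts \<longrightarrow> (t0, t1) \<in> AD N"
    using Ts
  proof (induction Ts rule: finite_induct)
    case (insert q Ts)
    then obtain N where N: "\<And>t0 t1 p \<eta>. (t0, t1, p, \<eta>) \<in> Ts \<Longrightarrow> (t0, t1) \<in> AD N" by blast
    obtain t0 t1 p \<eta> where q: "q = (t0, t1, p, \<eta>)" by (cases q)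
    have "(t0, t1) \<in> Dall" using insert.prems[of t0 t1 p \<eta>] by (simp add: q)
    then obtain n where n: "(t0, t1) \<in> AD n" using D_in_AD by blast
    have "(t0', t1') \<in> AD (max N n)" if t: "(t0', t1', p', \<eta>') \<in> insert q Ts" for t0' t1' p' \<eta>'
    proof (cases "(t0', t1', p', \<eta>') \<in> Ts")
      case True
      show ?thesis by (rule AD_mono[OF N[OF True]]) simp
    next
      case False
      then have "t0' = t0" "t1' = t1" using t q by auto
      then show ?thesis using AD_mono[OF n, of "max N n"] by simp
    qed
    then show ?case by blast
  qed simp
  then obtain N0 where N0: "\<And>t0 t1 p \<eta>. (t0, t1, p, \<eta>) \<in> Ts \<Longrightarrow> (t0, t1) \<in> AD N0" by blast
  define N where "N = max (max m (card Ts)) N0"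
  have N: "m \<le> N" "card Ts \<le> N" "\<And>t0 t1 p \<eta>. (t0, t1, p, \<eta>) \<in> Ts \<Longrightarrow> (t0, t1) \<in> AD N"
    unfolding N_def using AD_mono[OF N0] by simp_all
  obtain n0 where n0: "\<And>n c. n0 \<le> n \<Longrightarrow> controlled k Dall \<rho> L K' n c \<Longrightarrow> \<exists>R0 R1. isom (En N) (En n) R0 \<and>
        isom (En N) (En n) R1 \<and> (\<forall>q\<in>Ts. passes k \<delta> N (\<lambda>v w. c (R0 \<circ> v) (R1 \<circ> w)) q)"
    using ram[of N] by blast
  obtain n \<theta> C where n: "max m n0 \<le> n" "isom (En n) F \<theta>" "colors n \<theta> K C" "\<not> factors m n \<theta> K \<epsilon> C"
    using bad[of "max m n0"] by auto
  have "colors n \<theta> K' C" using n(3) K' unfolding colors_def by blast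
  from colors_controlled[OF this n(2) \<rho>]
  have ctl: "controlled k Dall \<rho> L K' n (\<lambda>v w. C (\<theta> \<circ> v) (\<theta> \<circ> w))" by simp
  have nn: "n0 \<le> n" using n(1) by simp
  obtain R0 R1 where R: "isom (En N) (En n) R0" "isom (En N) (En n) R1"
    "\<And>q. q \<in> Ts \<Longrightarrow> passes k \<delta> N (\<lambda>v w. C (\<theta> \<circ> (R0 \<circ> v)) (\<theta> \<circ> (R1 \<circ> w))) q"
    using n0[OF nn ctl] by blast
  let ?g = "\<lambda>v w. C (\<theta> \<circ> (R0 \<circ> v)) (\<theta> \<circ> (R1 \<circ> w))"
  have inc: "isom (En m) (En N) id" by (rule isom_En_inclusion[OF N(1)])
  have Rm: "isom (En m) (En n) R0" "isom (En m) (En n) R1"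
    using isom_comp[OF R(1) inc] isom_comp[OF R(2) inc] by simp_all
  have nf: "\<exists>v w. (v, w) \<in> AD m \<and> \<epsilon> < dist (?g v w) (h (oc (\<Psi> (\<theta> \<circ> R0 \<circ> v) (\<theta> \<circ> R1 \<circ> w))))"
    if "lip1 Q qd K dist h" for h
  proof (rule ccontr)
    assume "\<not> ?thesis"
    then have "\<forall>v w. (v, w) \<in> AD m \<longrightarrow> dist (C (\<theta> \<circ> R0 \<circ> v) (\<theta> \<circ> R1 \<circ> w))
        (h (oc (\<Psi> (\<theta> \<circ> R0 \<circ> v) (\<theta> \<circ> R1 \<circ> w)))) \<le> \<epsilon>"
      unfolding o_assoc by (meson not_le)
    then have "factors m n \<theta> K \<epsilon> C" unfolding factors_def using Rm that by blast
    then show False using n(4) by blast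
  qed
  have gK: "?g v w \<in> K" if "(v, w) \<in> AD N" for v w
    using n(3) isom_AD[OF R(1,2) that] unfolding colors_def by blast
  have gl: "dist (?g v w) (?g v' w') \<le> d (\<Psi> (\<theta> \<circ> R0 \<circ> v) (\<theta> \<circ> R1 \<circ> w)) (\<Psi> (\<theta> \<circ> R0 \<circ> v') (\<theta> \<circ> R1 \<circ> w'))"
    if "(v, w) \<in> AD N" "(v', w') \<in> AD N" for v w v' w'
    unfolding o_assoc[symmetric] using n(3) isom_AD[OF R(1,2) that(1)] isom_AD[OF R(1,2) that(2)]
    unfolding colors_def by blast
  have "passed m \<delta> K \<epsilon> Ts N (\<theta> \<circ> R0) (\<theta> \<circ> R1) ?g"
    unfolding passed_def
    by (intro conjI allI impI ballI N(1,2) isom_comp[OF n(2) R(1)] isom_comp[OF n(2) R(2)])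
      (fact N(3) gK gl R(3) nf | erule N(3) gK gl R(3) nf; assumption)+
  then show ?thesis by blast
qed

text \<open>If there were bad colourings on arbitrarily large \<open>En n\<close>, each finite set of tests would be
  passed by a bad colouring, composed with embeddings of some \<open>En N\<close>. A cluster point of these
  colourings passes all the tests, so that it only depends on the orbits; being a limit it is exactly
  1-Lipschitz on the quotient, and it approximates some of the bad colourings on \<open>En m\<close>, which
  therefore are not bad.\<close>

lemma ramsey_factor:
  fixes K :: "'k::metric_space set"
  assumes "compact K" "0 < \<epsilon>"
  shows "\<exists>n0. \<forall>n\<ge>n0. \<forall>\<theta> C. isom (En n) F \<theta> \<longrightarrow> colors n \<theta> K C \<longrightarrow> factors m n \<theta> K \<epsilon> C"
proof (rule ccontr)
  assume "\<not> ?thesis"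
  then have bad: "\<And>n0. \<exists>n \<theta> C. n0 \<le> n \<and> isom (En n) F \<theta> \<and> colors n \<theta> K C \<and> \<not> factors m n \<theta> K \<epsilon> C"
    by blast
  have "\<exists>\<rho> L. (t0, t1) \<in> Dall \<longrightarrow> local_bound (NE t0) (NE t1) \<rho> L" for t0 t1
    using local_bound_ex[of "NE t0" "NE t1"] by (auto simp: Dall_def)
  then obtain \<rho> L where \<rho>: "\<And>t0 t1. (t0, t1) \<in> Dall \<Longrightarrow> local_bound (NE t0) (NE t1) (\<rho> t0 t1) (L t0 t1)"
    by metis
  \<comment> \<open>Some tests only serve to force their pair of tuples into \<open>En N\<close>; \<open>undefined\<close> is the point in these.\<close>
  define K' where "K' = insert undefined K"
  have bK: "bounded K'" unfolding K'_def using compact_imp_bounded[OF \<open>compact K\<close>] by simp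
  have nd: "nondeg k (NE t0) \<and> nondeg k (NE t1) \<and> 0 < \<rho> t0 t1 \<and> 0 \<le> L t0 t1" if "(t0, t1) \<in> Dall" for t0 t1
    using adm_nondeg[of "NE t0" "NE t1"] local_boundD(1,2)[OF \<rho>[OF that]] that by (simp add: Dall_def)
  have "\<exists>\<delta>. (\<forall>t0 t1 \<eta>. (t0, t1) \<in> Dall \<longrightarrow> 0 < \<eta> \<longrightarrow> 0 < \<delta> t0 t1 \<eta> \<and> \<delta> t0 t1 \<eta> \<le> \<rho> t0 t1) \<and>
    (\<forall>Ts N. finite Ts \<longrightarrow> (\<forall>(t0, t1, p, \<eta>)\<in>Ts. (t0, t1) \<in> Dall \<and> p \<in> K' \<and> 0 < \<eta>) \<longrightarrow>
      (\<exists>n0. \<forall>n\<ge>n0. \<forall>c. controlled k Dall \<rho> L K' n c \<longrightarrow> (\<exists>R0 R1. isom (En N) (En n) R0 \<and> isom (En N) (En n) R1 \<and>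
        (\<forall>q\<in>Ts. passes k \<delta> N (\<lambda>v w. c (R0 \<circ> v) (R1 \<circ> w)) q))))"
    by (rule ramsey_tests[OF bK nd])
  then obtain \<delta> where \<delta>0: "\<forall>t0 t1 \<eta>. (t0, t1) \<in> Dall \<longrightarrow> 0 < \<eta> \<longrightarrow> 0 < \<delta> t0 t1 \<eta> \<and> \<delta> t0 t1 \<eta> \<le> \<rho> t0 t1"
    and ram: "\<forall>Ts N. finite Ts \<longrightarrow> (\<forall>(t0, t1, p, \<eta>)\<in>Ts. (t0, t1) \<in> Dall \<and> p \<in> K' \<and> 0 < \<eta>) \<longrightarrow>
      (\<exists>n0. \<forall>n\<ge>n0. \<forall>c. controlled k Dall \<rho> L K' n c \<longrightarrow> (\<exists>R0 R1. isom (En N) (En n) R0 \<and> isom (En N) (En n) R1 \<and>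
        (\<forall>q\<in>Ts. passes k \<delta> N (\<lambda>v w. c (R0 \<circ> v) (R1 \<circ> w)) q)))"
    by (elim exE conjE) (rule that)
  from \<delta>0 have \<delta>: "\<And>t0 t1 \<eta>. (t0, t1) \<in> Dall \<Longrightarrow> 0 < \<eta> \<Longrightarrow> 0 < \<delta> t0 t1 \<eta>" by simp
  define Tst where "Tst = {(t0, t1, p, \<eta>). (t0, t1) \<in> Dall \<and> p \<in> K' \<and> 0 < (\<eta>::real)}"
  have "\<exists>N S0 S1 g. passed m \<delta> K \<epsilon> Ts N S0 S1 g" if Ts: "finite Ts" "Ts \<subseteq> Tst" for Ts
  proof (rule bad_colouring_passes[OF bad \<rho> _ _ Ts(1)])
    show "K \<subseteq> K'" unfolding K'_def by blast
    show "\<exists>n0. \<forall>n\<ge>n0. \<forall>c. controlled k Dall \<rho> L K' n c \<longrightarrow> (\<exists>R0 R1. isom (En N) (En n) R0 \<and>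
        isom (En N) (En n) R1 \<and> (\<forall>q\<in>Ts. passes k \<delta> N (\<lambda>v w. c (R0 \<circ> v) (R1 \<circ> w)) q))" for N
      using Ts by (intro ram[THEN spec, THEN spec, THEN mp, THEN mp]) (auto simp: Tst_def)
    show "(t0, t1) \<in> Dall" if "(t0, t1, p, \<eta>) \<in> Ts" for t0 t1 p \<eta> using that Ts(2) by (auto simp: Tst_def)
  qed
  then obtain N S0 S1 g where ps: "\<And>Ts. finite Ts \<Longrightarrow> Ts \<subseteq> Tst \<Longrightarrow> passed m \<delta> K \<epsilon> Ts (N Ts) (S0 Ts) (S1 Ts) (g Ts)"
    by metis
  let ?F = "finite_subsets_at_top Tst"
  have ev1: "\<forall>\<^sub>F Ts in ?F. finite Ts \<and> Ts \<subseteq> Tst \<and> X \<subseteq> Ts" if "finite X" "X \<subseteq> Tst" for X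
    unfolding eventually_finite_subsets_at_top using that by blast
  define gg where "gg Ts T = g Ts (fst T) (snd T)" for Ts T
  have "\<exists>h. lip1 Q qd K dist h \<and>
    (\<forall>B \<eta>. finite B \<longrightarrow> B \<subseteq> Dall \<longrightarrow> 0 < \<eta> \<longrightarrow> (\<exists>\<^sub>F i in ?F. \<forall>T\<in>B. dist (gg i T) (h (cls T)) < \<eta>))"
  proof (rule limit_coloring)
    show "compact K" "?F \<noteq> bot" using \<open>compact K\<close> by simp_all
    show "qd x z \<le> qd x y + qd y z" if "x \<in> Q" "y \<in> Q" "z \<in> Q" for x y z
      using that qd_tri unfolding quot_def by blast
    show "qd x y = qd y x" if "x \<in> Q" "y \<in> Q" for x y using that qd_sym unfolding quot_def by blast
    show "cls T \<in> Q" if "T \<in> Dall" for T using cls_quot[of "fst T" "snd T"] that by simp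
    show "\<exists>T\<in>Dall. qd (cls T) p < e" if "p \<in> Q" "0 < e" for p e
      using that cls_dense unfolding quot_def by blast
  next
    fix T assume T: "T \<in> Dall"
    obtain v w where vw: "T = (v, w)" by (cases T)
    have "\<forall>\<^sub>F Ts in ?F. finite Ts \<and> Ts \<subseteq> Tst \<and> {(v, w, undefined, 1)} \<subseteq> Ts"
      using T vw by (intro ev1) (auto simp: Tst_def K'_def)
    then show "\<forall>\<^sub>F i in ?F. gg i T \<in> K"
    proof eventually_elim
      case (elim Ts)
      from elim have p: "passed m \<delta> K \<epsilon> Ts (N Ts) (S0 Ts) (S1 Ts) (g Ts)" by (intro ps) auto
      have "(v, w) \<in> AD (N Ts)" using passedD(4)[OF p] elim by blast
      then show ?case using passedD(5)[OF p] by (simp add: gg_def vw)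
    qed
  next
    fix T S :: "'f vtuple \<times> 'f vtuple" and \<eta> :: real
    assume T: "T \<in> Dall" and S: "S \<in> Dall" and \<eta>: "0 < \<eta>"
    obtain v w where vw: "T = (v, w)" by (cases T)
    obtain v1 w1 where vw1: "S = (v1, w1)" by (cases S)
    have D: "(v, w) \<in> Dall" "(v1, w1) \<in> Dall" using T S vw vw1 by simp_all
    define \<eta>' where "\<eta>' = \<eta> / 8"
    have \<eta>': "0 < \<eta>'" using \<eta> by (simp add: \<eta>'_def)
    define \<delta>' where "\<delta>' = min (\<delta> v w \<eta>') (\<delta> v1 w1 \<eta>')"
    have \<delta>': "0 < \<delta>'" "\<delta>' \<le> \<delta> v w \<eta>'" "\<delta>' \<le> \<delta> v1 w1 \<eta>'" using \<delta> D \<eta>' by (auto simp: \<delta>'_def)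
    obtain n v' w' v1' w1' where c: "(v', w') \<in> AD n" "(v1', w1') \<in> AD n"
      "near \<delta>' (NE v) (NE v')" "near \<delta>' (NE w) (NE w')" "near \<delta>' (NE v1) (NE v1')" "near \<delta>' (NE w1) (NE w1')"
      "\<And>n' S0 S1. n \<le> n' \<Longrightarrow> isom (En n') F S0 \<Longrightarrow> isom (En n') F S1 \<Longrightarrow>
        d (\<Psi> (S0 \<circ> v') (S1 \<circ> w')) (\<Psi> (S0 \<circ> v1') (S1 \<circ> w1')) \<le> qd (cls (v, w)) (cls (v1, w1)) + \<eta>'"
      using close_representatives[OF D \<eta>' \<delta>'(1)] by blast
    obtain P where P: "P \<subseteq> K" "finite P" "K \<subseteq> (\<Union>p\<in>P. ball p \<eta>')"
      using compactE_image[OF \<open>compact K\<close>, of K "\<lambda>p. ball p \<eta>'"] \<eta>' by (metis UN_I centre_in_ball open_ball subsetI)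
    have net: "\<exists>p\<in>P. dist x p < \<eta>'" if "x \<in> K" for x
    proof -
      obtain p where "p \<in> P" "x \<in> ball p \<eta>'" using P(3) \<open>x \<in> K\<close> by blast
      then show ?thesis by (intro bexI[of _ p]) (simp_all add: dist_commute)
    qed
    \<comment> \<open>The last \<open>n\<close> tests only differ in their final entry and make \<open>X\<close>, and thereby \<open>N\<close>, large enough.\<close>
    define X where "X = (\<lambda>p. (v, w, p, \<eta>')) ` P \<union> (\<lambda>p. (v1, w1, p, \<eta>')) ` P \<union>
      {(v, w, undefined, 1), (v1, w1, undefined, 1), (v', w', undefined, 1), (v1', w1', undefined, 1)} \<union>
      (\<lambda>i. (v, w, undefined, real (Suc i))) ` {..<n}"
    have "X \<subseteq> Tst" using D AD_D[OF c(1)] AD_D[OF c(2)] P(1) \<eta>' by (auto simp: X_def Tst_def K'_def)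
    moreover have fX: "finite X" using P(2) by (simp add: X_def)
    ultimately have evX: "\<forall>\<^sub>F Ts in ?F. finite Ts \<and> Ts \<subseteq> Tst \<and> X \<subseteq> Ts" by (rule ev1[rotated])
    have nX: "n \<le> card X"
    proof -
      have "card ((\<lambda>i. (v, w, undefined :: 'k, real (Suc i))) ` {..<n}) = n"
        by (subst card_image) (auto simp: inj_on_def)
      moreover have "card ((\<lambda>i. (v, w, undefined :: 'k, real (Suc i))) ` {..<n}) \<le> card X"
        by (rule card_mono[OF fX]) (unfold X_def, rule Un_upper2)
      ultimately show ?thesis by simp
    qed
    have inX: "(v, w, undefined, 1) \<in> X" "(v1, w1, undefined, 1) \<in> X"
      "(v', w', undefined, 1) \<in> X" "(v1', w1', undefined, 1) \<in> X"
      "\<And>p. p \<in> P \<Longrightarrow> (v, w, p, \<eta>') \<in> X" "\<And>p. p \<in> P \<Longrightarrow> (v1, w1, p, \<eta>') \<in> X"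
      by (simp_all add: X_def)
    from evX show "\<forall>\<^sub>F i in ?F. dist (gg i T) (gg i S) \<le> qd (cls T) (cls S) + \<eta>"
    proof eventually_elim
      case (elim Ts)
      from elim have p: "passed m \<delta> K \<epsilon> Ts (N Ts) (S0 Ts) (S1 Ts) (g Ts)" by (intro ps) auto
      from elim have XTs: "X \<subseteq> Ts" and fTs: "finite Ts" by simp_all
      let ?g = "g Ts" and ?N = "N Ts"
      have ad: "(v, w) \<in> AD ?N" "(v1, w1) \<in> AD ?N" "(v', w') \<in> AD ?N" "(v1', w1') \<in> AD ?N"
        by (rule passedD(4)[OF p subsetD[OF XTs inX(1)]] passedD(4)[OF p subsetD[OF XTs inX(2)]]
            passedD(4)[OF p subsetD[OF XTs inX(3)]] passedD(4)[OF p subsetD[OF XTs inX(4)]])+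
      have in_nb: "x \<in> nbhd k ?N t \<delta>''" if "near \<delta>' (NE t) (NE x)" "\<delta>' \<le> \<delta>''" "tuple (En ?N) k x" for t x \<delta>''
        using near_mono[OF that(1,2) NE_nonneg NE_nonneg] that(3) by (simp add: nbhd_def)
      have refl: "near \<delta>' (NE t) (NE t)" for t using \<delta>'(1) NE_nonneg by (intro near_refl; simp)
      have close: "dist (?g x y) (?g x' y') \<le> 3 * \<eta>'"
        if nb: "x \<in> nbhd k ?N x (\<delta> x y \<eta>')" "y \<in> nbhd k ?N y (\<delta> x y \<eta>')"
          "x' \<in> nbhd k ?N x (\<delta> x y \<eta>')" "y' \<in> nbhd k ?N y (\<delta> x y \<eta>')"
        and tst: "\<And>p. p \<in> P \<Longrightarrow> (x, y, p, \<eta>') \<in> Ts" and xy: "(x, y) \<in> AD ?N" for x y x' y'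
      proof -
        obtain q where q: "q \<in> P" "dist (?g x y) q < \<eta>'" using net[OF passedD(5)[OF p xy]] by blast
        have "passes k \<delta> ?N ?g (x, y, q, \<eta>')" by (rule passedD(7)[OF p tst[OF q(1)]])
        then have "\<bar>dist (?g x y) q - dist (?g x' y') q\<bar> \<le> \<eta>'"
          unfolding passes_def osc2_le_def using nb by auto
        then show ?thesis using q(2) dist_triangle2[of "?g x y" "?g x' y'" q] by linarith
      qed
      have tp: "tuple (En ?N) k v" "tuple (En ?N) k w" "tuple (En ?N) k v1" "tuple (En ?N) k w1"
        "tuple (En ?N) k v'" "tuple (En ?N) k w'" "tuple (En ?N) k v1'" "tuple (En ?N) k w1'"
        using ad by (simp_all add: AD_def)
      have 1: "dist (?g v w) (?g v' w') \<le> 3 * \<eta>'"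
        by (rule close[OF in_nb[OF refl \<delta>'(2) tp(1)] in_nb[OF refl \<delta>'(2) tp(2)] in_nb[OF c(3) \<delta>'(2) tp(5)]
              in_nb[OF c(4) \<delta>'(2) tp(6)] subsetD[OF XTs inX(5)] ad(1)])
      have 2: "dist (?g v1 w1) (?g v1' w1') \<le> 3 * \<eta>'"
        by (rule close[OF in_nb[OF refl \<delta>'(3) tp(3)] in_nb[OF refl \<delta>'(3) tp(4)] in_nb[OF c(5) \<delta>'(3) tp(7)]
              in_nb[OF c(6) \<delta>'(3) tp(8)] subsetD[OF XTs inX(6)] ad(2)])
      have "dist (?g v' w') (?g v1' w1') \<le>
          d (\<Psi> (S0 Ts \<circ> v') (S1 Ts \<circ> w')) (\<Psi> (S0 Ts \<circ> v1') (S1 Ts \<circ> w1'))"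
        by (rule passedD(6)[OF p ad(3,4)])
      also have "\<dots> \<le> qd (cls (v, w)) (cls (v1, w1)) + \<eta>'"
        using passedD(9)[OF p] card_mono[OF fTs XTs] nX by (intro c(7)[OF _ passedD(2,3)[OF p]]) linarith
      finally have 3: "dist (?g v' w') (?g v1' w1') \<le> qd (cls (v, w)) (cls (v1, w1)) + \<eta>'" .
      have "dist (?g v w) (?g v1 w1) \<le> dist (?g v w) (?g v' w') + dist (?g v' w') (?g v1' w1') + dist (?g v1' w1') (?g v1 w1)"
        by (meson add_mono dist_triangle order_refl order_trans)
      then have "dist (?g v w) (?g v1 w1) \<le> qd (cls (v, w)) (cls (v1, w1)) + 7 * \<eta>'"
        using 1 2 3 dist_commute[of "?g v1' w1'" "?g v1 w1"] by linarith
      then show ?case using \<eta> by (simp add: gg_def vw vw1 \<eta>'_def)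
    qed
  qed
  then obtain h where h: "lip1 Q qd K dist h" and fr: "\<And>B \<eta>. finite B \<Longrightarrow> B \<subseteq> Dall \<Longrightarrow> 0 < \<eta> \<Longrightarrow>
      \<exists>\<^sub>F i in ?F. \<forall>T\<in>B. dist (gg i T) (h (cls T)) < \<eta>" by blast
  have e4: "0 < \<epsilon> / 4" using \<open>0 < \<epsilon>\<close> by simp
  obtain B where B: "finite B" "B \<subseteq> AD m" and net0: "\<forall>v w. tuple (En m) k v \<longrightarrow> tuple (En m) k w \<longrightarrow>
      adm (NE v) (NE w) \<longrightarrow> (\<exists>(v', w')\<in>B. \<forall>R0 R1. isom (En m) F R0 \<longrightarrow> isom (En m) F R1 \<longrightarrow>
        d (\<Psi> (R0 \<circ> v) (R1 \<circ> w)) (\<Psi> (R0 \<circ> v') (R1 \<circ> w')) \<le> \<epsilon> / 4)"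
    by (rule exE[OF \<Psi>_net[OF e4, of m, folded AD_def]]) (elim conjE, rule that)
  have net: "\<exists>T\<in>B. \<forall>R0 R1. isom (En m) F R0 \<longrightarrow> isom (En m) F R1 \<longrightarrow>
        d (\<Psi> (R0 \<circ> v) (R1 \<circ> w)) (\<Psi> (R0 \<circ> fst T) (R1 \<circ> snd T)) \<le> \<epsilon> / 4" if "(v, w) \<in> AD m" for v w
  proof -
    from that have "tuple (En m) k v" "tuple (En m) k w" "adm (NE v) (NE w)" by (simp_all add: AD_def)
    from net0[THEN spec, THEN spec, THEN mp, THEN mp, THEN mp, OF this]
    show ?thesis by (simp only: case_prod_unfold)
  qed
  have BD: "B \<subseteq> Dall" using B(2) AD_D by auto
  have "\<exists>\<^sub>F Ts in ?F. (\<forall>T\<in>B. dist (gg Ts T) (h (cls T)) < \<epsilon> / 4) \<and> (finite Ts \<and> Ts \<subseteq> Tst \<and> {} \<subseteq> Ts)"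
    by (rule frequently_eventually_frequently[OF fr[OF B(1) BD e4] ev1]) simp_all
  then obtain Ts where Ts: "\<And>T. T \<in> B \<Longrightarrow> dist (gg Ts T) (h (cls T)) < \<epsilon> / 4" "finite Ts" "Ts \<subseteq> Tst"
    using frequently_ex by blast
  have p: "passed m \<delta> K \<epsilon> Ts (N Ts) (S0 Ts) (S1 Ts) (g Ts)" by (rule ps[OF Ts(2,3)])
  obtain v w where vw: "(v, w) \<in> AD m" "\<epsilon> < dist (g Ts v w) (h (oc (\<Psi> (S0 Ts \<circ> v) (S1 Ts \<circ> w))))"
    using passedD(8)[OF p h] by blast
  obtain T where T: "T \<in> B" "\<forall>R0 R1. isom (En m) F R0 \<longrightarrow> isom (En m) F R1 \<longrightarrow>
        d (\<Psi> (R0 \<circ> v) (R1 \<circ> w)) (\<Psi> (R0 \<circ> fst T) (R1 \<circ> snd T)) \<le> \<epsilon> / 4"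
    by (rule bexE[OF net[OF vw(1)]]) (rule that)
  obtain v' w' where T': "T = (v', w')" by (cases T)
  have v': "(v', w') \<in> B" using T(1) T' by simp
  have dl: "d (\<Psi> (R0 \<circ> v) (R1 \<circ> w)) (\<Psi> (R0 \<circ> v') (R1 \<circ> w')) \<le> \<epsilon> / 4"
    if "isom (En m) F R0" "isom (En m) F R1" for R0 R1
    using T(2)[THEN spec, THEN spec, THEN mp, THEN mp, OF that] by (simp only: T' fst_conv snd_conv)
  have v'm: "(v', w') \<in> AD m" using v' B(2) by blast
  have Sm: "isom (En m) F (S0 Ts)" "isom (En m) F (S1 Ts)"
    using isom_En_mono[OF passedD(2)[OF p] passedD(1)[OF p]] isom_En_mono[OF passedD(3)[OF p] passedD(1)[OF p]] .
  let ?x = "\<Psi> (S0 Ts \<circ> v) (S1 Ts \<circ> w)" and ?y = "\<Psi> (S0 Ts \<circ> v') (S1 Ts \<circ> w')"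
  have M: "?x \<in> M" "?y \<in> M" using AD_\<Psi>_M[OF vw(1) Sm] AD_\<Psi>_M[OF v'm Sm] .
  have "dist (g Ts v w) (g Ts v' w') \<le> d ?x ?y"
    using passedD(6)[OF p] AD_mono[OF vw(1) passedD(1)[OF p]] AD_mono[OF v'm passedD(1)[OF p]] by blast
  moreover have "dist (h (oc ?x)) (h (oc ?y)) \<le> qd (oc ?x) (oc ?y)"
    using h M unfolding lip1_def quot_def by blast
  moreover have "qd (oc ?x) (oc ?y) \<le> d ?x ?y" by (rule qd_le[OF M oc_self[OF M(1)] oc_self[OF M(2)]])
  moreover have "dist (g Ts v' w') (h (oc ?y)) < \<epsilon> / 4"
    using Ts(1)[OF v'] cls_eq[OF v'm Sm] by (simp add: gg_def)
  moreover have "dist (g Ts v w) (h (oc ?x)) \<le> dist (g Ts v w) (g Ts v' w') + dist (g Ts v' w') (h (oc ?y)) +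
      dist (h (oc ?y)) (h (oc ?x))"
    by (meson add_mono dist_triangle order_refl order_trans)
  ultimately show False
    using dl[OF Sm] vw(2) \<open>0 < \<epsilon>\<close> dist_commute[of "h (oc ?y)" "h (oc ?x)"] by linarith
qed

end


section \<open>Actions by isometries on pairs of tuples\<close>

lemma op_sub [simp]:
  "op_norm Z (sub X U) = op_norm Z X" "op_dist Z (sub X U) = op_dist Z X"
  "inv_norm Z (sub X U) = inv_norm Z X" "bounded_on Z (sub X U) = bounded_on Z X"
  by (intro ext, simp add: op_norm_def op_dist_def inv_norm_def bounded_on_def)+

context fraisse_setting
begin

text \<open>When objects are described by pairs of tuples and the group acts through isometries on these,
  it suffices to know that the action does not increase distances: the inverse maps do not either.\<close>

lemma isometric_actionI:
  assumes M_eq: "M = {\<Psi> v w | v w. adm (tnorm F k v) (tnorm F k w)}"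
    and act_\<Psi>: "\<And>\<gamma>. \<gamma> \<in> G \<Longrightarrow> \<exists>g\<in>Iso F. \<exists>h\<in>Iso F.
      \<forall>v w. adm (tnorm F k v) (tnorm F k w) \<longrightarrow> act \<gamma> (\<Psi> v w) = \<Psi> (g \<circ> v) (h \<circ> w)"
    and \<Psi>_act: "\<And>g h. g \<in> Iso F \<Longrightarrow> h \<in> Iso F \<Longrightarrow> \<exists>\<gamma>\<in>G.
      \<forall>v w. adm (tnorm F k v) (tnorm F k w) \<longrightarrow> act \<gamma> (\<Psi> v w) = \<Psi> (g \<circ> v) (h \<circ> w)"
    and d: "\<And>x y. x \<in> M \<Longrightarrow> y \<in> M \<Longrightarrow> 0 \<le> d x y" "\<And>x. x \<in> M \<Longrightarrow> d x x = 0"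
      "\<And>x y. x \<in> M \<Longrightarrow> y \<in> M \<Longrightarrow> d x y = d y x"
      "\<And>x y z. x \<in> M \<Longrightarrow> y \<in> M \<Longrightarrow> z \<in> M \<Longrightarrow> d x z \<le> d x y + d y z"
    and contract: "\<And>\<gamma> x y. \<gamma> \<in> G \<Longrightarrow> x \<in> M \<Longrightarrow> y \<in> M \<Longrightarrow> d (act \<gamma> x) (act \<gamma> y) \<le> d x y"
  shows "isometric_action M d G act"
proof -
  have N: "tnorm F k (g \<circ> v) = tnorm F k v" if "g \<in> Iso F" for g v
    by (rule F.isom_tnorm) (use that in \<open>auto simp: Iso_iff tuple_def\<close>)
  have act_M: "act \<gamma> x \<in> M" if \<gamma>: "\<gamma> \<in> G" and x: "x \<in> M" for \<gamma> x
  proof -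
    obtain v w where vw: "x = \<Psi> v w" "adm (tnorm F k v) (tnorm F k w)" using x unfolding M_eq by blast
    obtain g h where gh: "g \<in> Iso F" "h \<in> Iso F" "act \<gamma> x = \<Psi> (g \<circ> v) (h \<circ> w)"
      using act_\<Psi>[OF \<gamma>] vw by blast
    have "adm (tnorm F k (g \<circ> v)) (tnorm F k (h \<circ> w))" using vw(2) N gh(1,2) by simp
    then show ?thesis unfolding M_eq gh(3) by blast
  qed
  have act_inv: "\<exists>\<gamma>'\<in>G. \<forall>x\<in>M. act \<gamma>' (act \<gamma> x) = x" if \<gamma>: "\<gamma> \<in> G" for \<gamma>
  proof -
    obtain g h where gh: "g \<in> Iso F" "h \<in> Iso F"
      "\<And>v w. adm (tnorm F k v) (tnorm F k w) \<Longrightarrow> act \<gamma> (\<Psi> v w) = \<Psi> (g \<circ> v) (h \<circ> w)"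
      using act_\<Psi>[OF \<gamma>] by blast
    obtain g' where g': "g' \<in> Iso F" "g' \<circ> g = id" using Iso_inv[OF gh(1)] by blast
    obtain h' where h': "h' \<in> Iso F" "h' \<circ> h = id" using Iso_inv[OF gh(2)] by blast
    obtain \<gamma>' where \<gamma>': "\<gamma>' \<in> G"
      "\<And>v w. adm (tnorm F k v) (tnorm F k w) \<Longrightarrow> act \<gamma>' (\<Psi> v w) = \<Psi> (g' \<circ> v) (h' \<circ> w)"
      using \<Psi>_act[OF g'(1) h'(1)] by blast
    have "act \<gamma>' (act \<gamma> x) = x" if x: "x \<in> M" for x
    proof -
      obtain v w where vw: "x = \<Psi> v w" "adm (tnorm F k v) (tnorm F k w)" using x unfolding M_eq by blast
      have "adm (tnorm F k (g \<circ> v)) (tnorm F k (h \<circ> w))" using vw(2) N gh(1,2) by simp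
      then have "act \<gamma>' (act \<gamma> x) = \<Psi> (g' \<circ> (g \<circ> v)) (h' \<circ> (h \<circ> w))" unfolding vw(1) gh(3)[OF vw(2)] by (rule \<gamma>'(2))
      then show ?thesis unfolding o_assoc g'(2) h'(2) vw(1) by simp
    qed
    with \<gamma>'(1) show ?thesis by blast
  qed
  show ?thesis
  proof
    show "d (act \<gamma> x) (act \<gamma> y) = d x y" if \<gamma>: "\<gamma> \<in> G" and xy: "x \<in> M" "y \<in> M" for \<gamma> x y
    proof (rule antisym)
      show "d (act \<gamma> x) (act \<gamma> y) \<le> d x y" by (rule contract[OF that])
      obtain \<gamma>' where "\<gamma>' \<in> G" "\<forall>x\<in>M. act \<gamma>' (act \<gamma> x) = x" using act_inv[OF \<gamma>] by blast
      then show "d x y \<le> d (act \<gamma> x) (act \<gamma> y)"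
        using contract[of \<gamma>' "act \<gamma> x" "act \<gamma> y"] act_M[OF \<gamma>] xy by simp
    qed
    obtain e where e: "e \<in> G" "\<And>v w. adm (tnorm F k v) (tnorm F k w) \<Longrightarrow> act e (\<Psi> v w) = \<Psi> (id \<circ> v) (id \<circ> w)"
      using \<Psi>_act[OF Iso_id Iso_id] by blast
    have "act e x = x" if "x \<in> M" for x using that e(2) unfolding M_eq by auto
    with e(1) show "\<exists>e\<in>G. \<forall>x\<in>M. act e x = x" by blast
    show "\<exists>j\<in>G. \<forall>x\<in>M. act j x = act \<gamma> (act \<gamma>' x)" if \<gamma>: "\<gamma> \<in> G" "\<gamma>' \<in> G" for \<gamma> \<gamma>'
    proof -
      obtain g h where gh: "g \<in> Iso F" "h \<in> Iso F"
        "\<And>v w. adm (tnorm F k v) (tnorm F k w) \<Longrightarrow> act \<gamma> (\<Psi> v w) = \<Psi> (g \<circ> v) (h \<circ> w)"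
        using act_\<Psi>[OF \<gamma>(1)] by blast
      obtain g' h' where gh': "g' \<in> Iso F" "h' \<in> Iso F"
        "\<And>v w. adm (tnorm F k v) (tnorm F k w) \<Longrightarrow> act \<gamma>' (\<Psi> v w) = \<Psi> (g' \<circ> v) (h' \<circ> w)"
        using act_\<Psi>[OF \<gamma>(2)] by blast
      obtain j where j: "j \<in> G"
        "\<And>v w. adm (tnorm F k v) (tnorm F k w) \<Longrightarrow> act j (\<Psi> v w) = \<Psi> (g \<circ> g' \<circ> v) (h \<circ> h' \<circ> w)"
        using \<Psi>_act[OF Iso_comp[OF gh(1) gh'(1)] Iso_comp[OF gh(2) gh'(2)]] by blast
      have "act j x = act \<gamma> (act \<gamma>' x)" if x: "x \<in> M" for x
      proof -
        obtain v w where vw: "x = \<Psi> v w" "adm (tnorm F k v) (tnorm F k w)" using x unfolding M_eq by blast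
        have "adm (tnorm F k (g' \<circ> v)) (tnorm F k (h' \<circ> w))" using vw(2) N gh'(1,2) by simp
        then have "act \<gamma> (act \<gamma>' x) = \<Psi> (g \<circ> (g' \<circ> v)) (h \<circ> (h' \<circ> w))"
          unfolding vw(1) gh'(3)[OF vw(2)] by (rule gh(3))
        then show ?thesis unfolding vw(1) j(2)[OF vw(2)] by (simp only: o_assoc)
      qed
      with j(1) show ?thesis by blast
    qed
  qed (rule d act_M act_inv; assumption)+
qed

lemma image_in_Age_std:
  assumes \<theta>: "isom (En n) F \<theta>"
  shows "\<theta> ` coord_space n \<in> Gr n F" "sub F (\<theta> ` coord_space n) \<in> Age_std \<mu> F"
proof -
  interpret En: normed_nspace "En n" using En_normed by unfold_locales
  have tu: "tuple (En n) n unit_vec"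
    unfolding tuple_def by (simp add: coord_space_iff lookup_single when_def)
  have nd: "nondeg n (tnorm F n (\<theta> \<circ> unit_vec))" using En.isom_tnorm[OF \<theta> tu] nondeg_unit by simp
  have "\<theta> ` coord_space n = range (F.lcomb n (\<theta> \<circ> unit_vec))"
    unfolding coord_space_range image_image
    using En.lin_on_comb[OF isomD(1)[OF \<theta>] tu] by (simp add: image_image)
  then show G: "\<theta> ` coord_space n \<in> Gr n F" using F.Gr_tuple[OF _ nd] by (simp add: tuple_def)
  let ?X = "sub F (\<theta> ` coord_space n)"
  have "?X \<in> Age F" using G unfolding Age_def by blast
  moreover have "isom (En n) ?X \<theta>" using \<theta> by (simp add: isom_def lin_on_def)
  then have "restrict \<theta> (vecs (En n)) \<in> Emb (En n) ?X" by (rule En.restrict_Emb)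
  then have "isometric (En n) ?X" unfolding isometric_def by (intro bexI[of _ "restrict \<theta> (vecs (En n))"]) auto
  ultimately show "?X \<in> Age_std \<mu> F" unfolding Age_std_def by blast
qed

lemma isom_into_image:
  assumes "isom (En n) F \<theta>" "isom (En m) (En n) R"
  shows "restrict (\<theta> \<circ> R) (coord_space m) \<in> Emb (En m) (sub F (\<theta> ` coord_space n))"
proof -
  interpret En: normed_nspace "En m" using En_normed by unfold_locales
  have "isom (En m) (sub F (\<theta> ` coord_space n)) (\<theta> \<circ> R)"
    using assms by (simp add: isom_def lin_on_def)
  then show ?thesis using En.restrict_Emb by fastforce
qed

end


section \<open>Operators from \<open>En k\<close>\<close>

context seq_setting
begin

definition op_of :: "nat \<Rightarrow> ('f, 'v::ab_group_add) nspace \<Rightarrow> (nat \<Rightarrow> 'v) \<Rightarrow> (nat \<Rightarrow>\<^sub>0 'f) \<Rightarrow> 'v" where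
  "op_of k Y v = (\<lambda>x\<in>coord_space k. comb (smul Y) k v (coord x))"

text \<open>The single bound \<open>a\<close> is for the norm of the operator and of its inverse. Its being less than \<open>l\<close> leaves
  room for perturbations of \<open>N\<close>.\<close>

definition op_adm :: "nat \<Rightarrow> real \<Rightarrow> ((nat \<Rightarrow> 'f) \<Rightarrow> real) \<Rightarrow> bool" where
  "op_adm k l N \<longleftrightarrow> nondeg k N \<and>
    (\<exists>a>0. a < l \<and> (\<forall>x. N x \<le> a * tnorm E k unit_vec x \<and> tnorm E k unit_vec x \<le> a * N x))"

lemma unit_coord: "j < k \<Longrightarrow> (unit_vec j :: nat \<Rightarrow>\<^sub>0 'f) \<in> coord_space k"
  by (simp add: coord_space_iff lookup_single when_def)

lemma tnorm_unit_vec: "x \<in> coord_space k \<Longrightarrow> tnorm E k unit_vec (coord x) = \<mu> x"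
  using coord_space_comb[of x k] by (simp add: tnorm_def)

lemma op_of_sub [simp]: "op_of k (sub Y U) v = op_of k Y v"
  by (simp add: op_of_def)

lemma lin_op_of:
  assumes Y: "normed_space Y" and T: "T \<in> lin (En k) Y"
  shows "tuple Y k (T \<circ> unit_vec)" "T = op_of k Y (T \<circ> unit_vec)"
proof -
  interpret En: normed_nspace "En k" using En_normed by unfold_locales
  have lin: "lin_on (En k) Y T" and ext: "T \<in> extensional (coord_space k)"
    using T by (auto simp: lin_def lin_maps_def lin_on_def PiE_def)
  have tu: "tuple (En k) k unit_vec" by (simp add: tuple_def unit_coord)
  show "tuple Y k (T \<circ> unit_vec)" by (rule En.lin_on_tuple[OF lin tu])
  show "T = op_of k Y (T \<circ> unit_vec)"
  proof (rule extensionalityI[OF ext])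
    show "op_of k Y (T \<circ> unit_vec) \<in> extensional (coord_space k)" by (simp add: op_of_def)
    fix x :: "nat \<Rightarrow>\<^sub>0 'f" assume x: "x \<in> coord_space k"
    have "T (En.lcomb k unit_vec (coord x)) = comb (smul Y) k (T \<circ> unit_vec) (coord x)"
      by (rule En.lin_on_comb[OF lin tu])
    moreover have "En.lcomb k unit_vec (coord x) = x" using coord_space_comb[OF x] by simp
    ultimately show "T x = op_of k Y (T \<circ> unit_vec) x" using x by (simp add: op_of_def)
  qed
qed

lemma op_of_facts:
  assumes Y: "normed_space Y" and v: "tuple Y k v"
  shows "op_of k Y v \<in> lin (En k) Y" "op_of k Y v ` coord_space k = range (comb (smul Y) k v)"
    "bounded_on (En k) Y (op_of k Y v)"
    "x \<in> coord_space k \<Longrightarrow> nrm Y (op_of k Y v x) = tnorm Y k v (coord x)"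
proof -
  interpret Y: normed_nspace Y using Y by unfold_locales
  interpret En: normed_nspace "En k" using En_normed by unfold_locales
  have "coord (x + y) = (\<lambda>j. coord x j + coord y j)" "coord (fs_scale a x) = (\<lambda>j. a * coord x j)"
    for x y :: "nat \<Rightarrow>\<^sub>0 'f" and a by (simp_all add: fun_eq_iff lookup_add lookup_fs_scale)
  then have "lin_on (En k) Y (\<lambda>x. comb (smul Y) k v (coord x))"
    using v by (simp add: lin_on_def Y.comb_add Y.comb_scale)
  from En.restrict_lin[OF this] show "op_of k Y v \<in> lin (En k) Y" by (simp add: op_of_def)
  show "op_of k Y v ` coord_space k = range (comb (smul Y) k v)"
  proof
    show "op_of k Y v ` coord_space k \<subseteq> range (comb (smul Y) k v)" by (auto simp: op_of_def)
    show "range (comb (smul Y) k v) \<subseteq> op_of k Y v ` coord_space k"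
    proof clarify
      fix y :: "nat \<Rightarrow> 'f"
      have c: "comb fs_scale k unit_vec y \<in> coord_space k" by (simp add: coord_space_range)
      have "op_of k Y v (comb fs_scale k unit_vec y) = comb (smul Y) k v (coord (comb fs_scale k unit_vec y))"
        using c by (simp add: op_of_def)
      also have "\<dots> = comb (smul Y) k v y" by (rule comb_cong) (simp_all add: lookup_comb_unit)
      finally show "comb (smul Y) k v y \<in> op_of k Y v ` coord_space k" using c by (metis imageI)
    qed
  qed
  show "x \<in> coord_space k \<Longrightarrow> nrm Y (op_of k Y v x) = tnorm Y k v (coord x)"
    by (simp add: op_of_def tnorm_def)
  obtain c where c: "0 < c" "\<And>x i. x \<in> coord_space k \<Longrightarrow> norm (coord x i) \<le> c * \<mu> x"
    using coordinate_bound by blast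
  have "nrm Y (op_of k Y v x) \<le> (c * (\<Sum>j<k. nrm Y (v j))) * \<mu> x" if x: "x \<in> coord_space k" for x
  proof -
    have "nrm Y (op_of k Y v x) \<le> (\<Sum>j<k. norm (coord x j) * nrm Y (v j))"
      using Y.nrm_comb_le[OF v] x by (simp add: op_of_def)
    also have "\<dots> \<le> (\<Sum>j<k. (c * \<mu> x) * nrm Y (v j))"
      using c(2)[OF x] v by (intro sum_mono mult_right_mono) (auto simp: tuple_def)
    finally show ?thesis by (simp add: sum_distrib_left sum_distrib_right mult.assoc mult.left_commute mult.commute)
  qed
  then show "bounded_on (En k) Y (op_of k Y v)" unfolding bounded_on_def by auto
qed

lemma op_scaling:
  assumes Y: "normed_space Y" and T: "T \<in> lin (En k) Y" and x: "x \<in> vecs (En k)"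
  shows "smul (En k) (of_real r) x \<in> vecs (En k) \<and>
    nrm (En k) (smul (En k) (of_real r) x) = \<bar>r\<bar> * nrm (En k) x \<and>
    T (smul (En k) (of_real r) x) = smul Y (of_real r) (T x)"
proof -
  interpret En: normed_nspace "En k" using En_normed by unfold_locales
  have "T (smul (En k) (of_real r) x) = smul Y (of_real r) (T x)"
    using T x by (simp add: lin_def lin_maps_def)
  then show ?thesis using En.vecs_scale[OF x] En.nrm_scale[OF x] by simp
qed

text \<open>The members of \<open>Lk_less\<close> are the operators of the tuples with \<open>op_adm\<close>: since the domain has
  dimension \<open>k\<close>, the operators are injective and \<open>inv_norm\<close> is the norm of the inverse.\<close>

lemma Lk_less_op_of:
  assumes Y: "normed_space Y" and v: "tuple Y k v" and adm: "op_adm k l (tnorm Y k v)"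
  shows "op_of k Y v \<in> Lk_less k l (En k) Y"
proof -
  interpret Y: normed_nspace Y using Y by unfold_locales
  note T = op_of_facts[OF Y v]
  obtain a where a: "0 < a" "a < l" "\<And>x. tnorm Y k v x \<le> a * tnorm E k unit_vec x"
    "\<And>x. tnorm E k unit_vec x \<le> a * tnorm Y k v x" using adm unfolding op_adm_def by blast
  have "op_norm (En k) Y (op_of k Y v) \<le> a"
    using a(1) a(3) T(4) by (intro op_norm_le) (auto simp: tnorm_unit_vec[symmetric])
  moreover have "inv_norm (En k) Y (op_of k Y v) \<le> a"
  proof (rule inv_norm_le[OF a(1) op_scaling[OF Y T(1)] Y])
    fix x assume x: "x \<in> vecs (En k)"
    then have "nrm (En k) x \<le> a * nrm Y (op_of k Y v x)"
      using a(4)[of "coord x"] T(4)[of x] tnorm_unit_vec[of x k] by simp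
    then show "\<exists>x'\<in>vecs (En k). op_of k Y v x' = op_of k Y v x \<and> nrm (En k) x' \<le> a * nrm Y (op_of k Y v x)"
      using x by blast
  qed
  moreover have "op_of k Y v ` vecs (En k) \<in> Gr k Y"
    using Y.Gr_tuple[OF v] adm T(2) by (simp add: op_adm_def)
  ultimately show ?thesis using T(1,3) a(2) by (simp add: Lk_less_def Lk_def)
qed

lemma op_of_Lk_less:
  assumes Y: "normed_space Y" and "0 < l" and T: "T \<in> Lk_less k l (En k) Y"
  shows "\<exists>v. T = op_of k Y v \<and> tuple Y k v \<and> op_adm k l (tnorm Y k v)"
proof -
  interpret Y: normed_nspace Y using Y by unfold_locales
  interpret En: normed_nspace "En k" using En_normed by unfold_locales
  have T': "T \<in> lin (En k) Y" "bounded_on (En k) Y T" "T ` vecs (En k) \<in> Gr k Y"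
    "op_norm (En k) Y T < l" "inv_norm (En k) Y T < l"
    using T by (simp_all add: Lk_less_def Lk_def)
  define v where "v = T \<circ> unit_vec"
  have v: "tuple Y k v" "T = op_of k Y v" using lin_op_of[OF Y T'(1)] by (simp_all add: v_def)
  note f = op_of_facts[OF Y v(1), folded v(2)]
  have nd: "nondeg k (tnorm Y k v)" using Y.Gr_nondeg[OF v(1)] T'(3) f(2) by simp
  obtain c where c: "0 < c" "\<And>x j. j < k \<Longrightarrow> norm (x j) \<le> c * tnorm Y k v x"
    using nd unfolding nondeg_def by blast
  define A where "A = (\<Sum>j<k. \<mu> (unit_vec j))"
  have A: "0 \<le> A" unfolding A_def by (intro sum_nonneg) simp
  have up: "\<mu> x \<le> (c * A + 1) * nrm Y (T x)" if x: "x \<in> coord_space k" for x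
  proof -
    have n0: "0 \<le> nrm Y (T x)" using f(4)[OF x] Y.tnorm_nonneg[OF v(1)] by simp
    have "\<mu> x \<le> (\<Sum>j<k. norm (coord x j) * \<mu> (unit_vec j))" by (rule coord_space_norm_le[OF x])
    also have "\<dots> \<le> (\<Sum>j<k. (c * nrm Y (T x)) * \<mu> (unit_vec j))"
      using c(2) f(4)[OF x] by (intro sum_mono mult_right_mono) auto
    also have "\<dots> = (c * A) * nrm Y (T x)" by (simp add: A_def sum_distrib_left sum_distrib_right mult_ac)
    also have "\<dots> \<le> (c * A + 1) * nrm Y (T x)" using n0 by (intro mult_right_mono) auto
    finally show ?thesis .
  qed
  have "\<exists>a\<ge>0. a < l \<and> (\<forall>x\<in>vecs (En k). \<exists>x'\<in>vecs (En k). T x' = T x \<and> nrm (En k) x' \<le> a * nrm Y (T x))"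
  proof (rule inv_norm_less[OF T'(5) op_scaling[OF Y T'(1)] Y])
    show "T ` vecs (En k) \<subseteq> vecs Y" using T'(1) by (auto simp: lin_def lin_maps_def)
    show "0 < c * A + 1" using c(1) A by (simp add: add_nonneg_pos)
    show "\<exists>x'\<in>vecs (En k). T x' = T x \<and> nrm (En k) x' \<le> (c * A + 1) * nrm Y (T x)" if "x \<in> vecs (En k)" for x
      using up[of x] that by (intro bexI[of _ x]) simp_all
  qed
  then obtain a where a: "0 \<le> a" "a < l" "\<And>x. x \<in> coord_space k \<Longrightarrow>
      \<exists>x'\<in>coord_space k. T x' = T x \<and> \<mu> x' \<le> a * nrm Y (T x)" by auto
  have low: "\<mu> x \<le> a * nrm Y (T x)" if x: "x \<in> coord_space k" for x
  proof -
    obtain x' where x': "x' \<in> coord_space k" "T x' = T x" "\<mu> x' \<le> a * nrm Y (T x)" using a(3)[OF x] by blast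
    have "comb (smul Y) k v (coord x') = comb (smul Y) k v (coord x)"
      using x'(2) x x'(1) by (subst (asm) (1 2) v(2)) (simp add: op_of_def)
    then have "coord x' j = coord x j" if "j < k" for j using Y.nondeg_tuple_inj[OF nd _ that] by blast
    then have "x' = x" using coord_space_comb[OF x] coord_space_comb[OF x'(1)]
      by (metis comb_cong)
    then show ?thesis using x'(3) by simp
  qed
  have on: "0 \<le> op_norm (En k) Y T" "\<And>x. x \<in> coord_space k \<Longrightarrow> nrm Y (T x) \<le> op_norm (En k) Y T * \<mu> x"
    using op_norm_bound[of "En k" Y T] T'(2) by (simp_all add: bounded_on_def)
  define b where "b = max (max a (op_norm (En k) Y T)) (l / 2)"
  have b: "0 < b" "b < l" "a \<le> b" "op_norm (En k) Y T \<le> b"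
    using a(2) T'(4) \<open>0 < l\<close> by (auto simp: b_def)
  have "tnorm Y k v y \<le> b * tnorm E k unit_vec y \<and> tnorm E k unit_vec y \<le> b * tnorm Y k v y" for y
  proof -
    let ?x = "comb fs_scale k unit_vec y"
    have x: "?x \<in> coord_space k" by (simp add: coord_space_range)
    have e: "comb (smul Y) k v (coord ?x) = comb (smul Y) k v y" by (rule comb_cong) (simp_all add: lookup_comb_unit)
    have e1: "nrm Y (T ?x) = tnorm Y k v y" unfolding f(4)[OF x] unfolding tnorm_def e ..
    have e2: "tnorm E k unit_vec y = \<mu> ?x" by (simp add: tnorm_def)
    have "op_norm (En k) Y T * \<mu> ?x \<le> b * \<mu> ?x" "a * nrm Y (T ?x) \<le> b * nrm Y (T ?x)"
      using b(3,4) Y.tnorm_nonneg[OF v(1), of y] by (auto simp: e1 intro!: mult_right_mono)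
    then show ?thesis using on(2)[OF x] low[OF x] unfolding e1 e2 by linarith
  qed
  then have "op_adm k l (tnorm Y k v)" unfolding op_adm_def using nd b(1,2) by blast
  with v show ?thesis by blast
qed

end


lemma op_adm_local:
  assumes "seq_setting \<mu>" "seq_setting.op_adm \<mu> k l N"
  shows "\<exists>\<delta>>0. \<forall>N'. near \<delta> N N' \<longrightarrow> seq_setting.op_adm \<mu> k l N'"
proof -
  interpret seq_setting \<mu> by (rule assms(1))
  have nd: "nondeg k N" using assms(2) by (simp add: op_adm_def)
  obtain a where a: "0 < a" "a < l" "\<And>x. N x \<le> a * tnorm E k unit_vec x"
    "\<And>x. tnorm E k unit_vec x \<le> a * N x" using assms(2) unfolding op_adm_def by blast
  define \<delta> where "\<delta> = (l - a) / (2 * a)"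
  have \<delta>: "0 < \<delta>" "(1 + \<delta>) * a < l" using a(1,2) by (simp_all add: \<delta>_def field_simps)
  have "op_adm k l N'" if n: "near \<delta> N N'" for N'
  proof -
    have "N' x \<le> ((1 + \<delta>) * a) * tnorm E k unit_vec x \<and> tnorm E k unit_vec x \<le> ((1 + \<delta>) * a) * N' x" for x
    proof
      have "N' x \<le> (1 + \<delta>) * N x" using n by (simp add: near_def)
      also have "\<dots> \<le> (1 + \<delta>) * (a * tnorm E k unit_vec x)" using a(3) \<delta>(1) by (intro mult_left_mono) auto
      finally show "N' x \<le> ((1 + \<delta>) * a) * tnorm E k unit_vec x" by (simp add: mult.assoc)
      have "tnorm E k unit_vec x \<le> a * N x" by (rule a(4))
      also have "\<dots> \<le> a * ((1 + \<delta>) * N' x)" using n a(1) by (intro mult_left_mono) (auto simp: near_def)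
      finally show "tnorm E k unit_vec x \<le> ((1 + \<delta>) * a) * N' x" by (simp add: mult_ac)
    qed
    moreover have "0 < (1 + \<delta>) * a" using a(1) \<delta>(1) by simp
    moreover have "nondeg k N'" using nondeg_near[OF nd n] \<delta>(1) by simp
    ultimately show ?thesis using \<delta>(2) unfolding op_adm_def by blast
  qed
  with \<delta>(1) show ?thesis by blast
qed

context fraisse_setting
begin

lemma op_of_lip:
  "\<exists>c>0. \<forall>v w. op_dist (En k) F (op_of k F v) (op_of k F w) \<le> c * tdist F k v w"
proof -
  obtain c where c: "0 < c" "\<And>x i. x \<in> coord_space k \<Longrightarrow> norm (coord x i) \<le> c * \<mu> x"
    using coordinate_bound by blast
  have "op_dist (En k) F (op_of k F v) (op_of k F w) \<le> c * tdist F k v w" for v w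
  proof (rule F.op_dist_le)
    have t: "tuple F k v" "tuple F k w" by (simp_all add: tuple_def)
    show "0 \<le> c * tdist F k v w" using c(1) F.tdist_nonneg[OF t] by simp
    fix x assume "x \<in> vecs (En k)"
    then have x: "x \<in> coord_space k" by simp
    have "nrm F (F.lcomb k v (coord x) - F.lcomb k w (coord x)) \<le> (c * \<mu> x) * tdist F k v w"
      using c x by (intro F.nrm_comb_diff_le t) auto
    then show "nrm F (op_of k F v x - op_of k F w x) \<le> c * tdist F k v w * nrm (En k) x"
      using x by (simp add: op_of_def mult_ac)
  qed
  with c(1) show ?thesis by blast
qed

lemma Lk_less_F:
  assumes "0 < l"
  shows "Lk_less k l (En k) F = {op_of k F v | v w. op_adm k l (tnorm F k v) \<and> nondeg k (tnorm F k w)}"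
proof
  show "Lk_less k l (En k) F \<subseteq> {op_of k F v | v w. op_adm k l (tnorm F k v) \<and> nondeg k (tnorm F k w)}"
  proof
    fix T assume "T \<in> Lk_less k l (En k) F"
    from op_of_Lk_less[OF normed_F assms this] obtain v where
      "T = op_of k F v" "op_adm k l (tnorm F k v)" by blast
    moreover from this(2) have "nondeg k (tnorm F k v)" by (simp add: op_adm_def)
    ultimately show "T \<in> {op_of k F v | v w. op_adm k l (tnorm F k v) \<and> nondeg k (tnorm F k w)}" by blast
  qed
qed (auto intro!: Lk_less_op_of[OF normed_F] simp: tuple_def)

lemma compose_op_of:
  assumes "lin_on Y Y' g" "normed_space Y" "tuple Y k v"
  shows "compose (coord_space k) g (op_of k Y v) = op_of k Y' (g \<circ> v)"
proof -
  interpret Y: normed_nspace Y using assms(2) by unfold_locales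
  show ?thesis using Y.lin_on_comb[OF assms(1,3)] by (auto simp: compose_def op_of_def)
qed

lemma op_family:
  assumes "0 < l"
  shows "coloring_family \<mu> s (Lk_less k l (En k) F) (op_dist (En k) F) (Iso F)
     (\<lambda>g T. compose (vecs (En k)) g T) k (\<lambda>N0 N1. op_adm k l N0 \<and> nondeg k N1) (\<lambda>v w. op_of k F v)"
proof -
  let ?M = "Lk_less k l (En k) F" and ?d = "op_dist (En k) F"
  interpret En: normed_nspace "En k" using En_normed by unfold_locales
  note M_eq = Lk_less_F[OF assms, of k]
  have tF: "tuple F k v" for v by (simp add: tuple_def)
  have Mb: "bounded_on (En k) F T" "T z \<in> vecs F" if "T \<in> ?M" for T z
    using that by (simp_all add: Lk_less_def Lk_def)
  have act: "compose (vecs (En k)) g (op_of k F v) = op_of k F (g \<circ> v)" if "g \<in> Iso F" for g v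
    using compose_op_of[of F F g k v] that normed_F tF by (simp add: Iso_iff isom_def)
  have contract: "?d (compose (vecs (En k)) g x) (compose (vecs (En k)) g y) \<le> ?d x y"
    if g: "g \<in> Iso F" and xy: "x \<in> ?M" "y \<in> ?M" for g x y
  proof (rule F.op_dist_le)
    have f: "0 \<le> ?d x y" "\<And>z. z \<in> vecs (En k) \<Longrightarrow> nrm F (x z - y z) \<le> ?d x y * nrm (En k) z"
      using F.op_dist_facts(1,2)[of "En k" x y] En.nrm_nonneg Mb xy by blast+
    show "0 \<le> ?d x y" by (rule f(1))
    fix z assume z: "z \<in> vecs (En k)"
    have g': "lin_on F F g" "\<And>x. norm (g x) = norm x" using g by (simp_all add: Iso_iff isom_def)
    have "nrm F (compose (vecs (En k)) g x z - compose (vecs (En k)) g y z) = nrm F (x z - y z)"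
      using z F.lin_on_diff[OF g'(1), of "x z" "y z"] g'(2)[of "x z - y z"] by (simp add: compose_def)
    also have "\<dots> \<le> ?d x y * nrm (En k) z" by (rule f(2)[OF z])
    finally show "nrm F (compose (vecs (En k)) g x z - compose (vecs (En k)) g y z) \<le> ?d x y * nrm (En k) z" .
  qed
  have act1: "\<exists>g\<in>Iso F. \<exists>h\<in>Iso F. \<forall>v w. op_adm k l (tnorm F k v) \<and> nondeg k (tnorm F k w) \<longrightarrow>
      compose (vecs (En k)) \<gamma> (op_of k F v) = op_of k F (g \<circ> v)" if "\<gamma> \<in> Iso F" for \<gamma>
    using act[OF that] that by blast
  have act2: "\<exists>\<gamma>\<in>Iso F. \<forall>v w. op_adm k l (tnorm F k v) \<and> nondeg k (tnorm F k w) \<longrightarrow>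
      compose (vecs (En k)) \<gamma> (op_of k F v) = op_of k F (g \<circ> v)" if "g \<in> Iso F" for g
    using act[OF that] that by blast
  have ia: "isometric_action ?M ?d (Iso F) (\<lambda>g T. compose (vecs (En k)) g T)"
  proof (rule isometric_actionI[where \<Psi> = "\<lambda>v w. op_of k F v" and k = k
        and adm = "\<lambda>N0 N1. op_adm k l N0 \<and> nondeg k N1"])
    show "?M = {op_of k F v | v w. op_adm k l (tnorm F k v) \<and> nondeg k (tnorm F k w)}" by (rule M_eq)
    fix x y assume xy: "x \<in> ?M" "y \<in> ?M"
    show "0 \<le> ?d x y" "?d x y = ?d y x"
      using F.op_dist_facts(1,3)[of "En k" x y] En.nrm_nonneg Mb xy by blast+
    show "?d (compose (vecs (En k)) g x) (compose (vecs (En k)) g y) \<le> ?d x y" if "g \<in> Iso F" for g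
      by (rule contract[OF that xy])
    fix z assume z: "z \<in> ?M"
    show "?d x z \<le> ?d x y + ?d y z"
      using F.op_dist_triangle[of "En k" x y z] En.nrm_nonneg Mb xy z by blast
  qed (rule act1 act2 F.op_dist_self; assumption)+
  obtain c where c: "0 < c" "\<And>v w. ?d (op_of k F v) (op_of k F w) \<le> c * tdist F k v w"
    using op_of_lip by blast
  have td0: "0 \<le> tdist F k v w" for v w using F.tdist_nonneg tF by blast
  show ?thesis
  proof (intro coloring_family.intro coloring_family_axioms.intro ia fraisse_setting_axioms, goal_cases)
    case (1 N0 N1)
    then show ?case by (simp add: op_adm_def)
  next
    case a: (2 N0 N1)
    obtain \<delta> where \<delta>: "0 < \<delta>" "\<And>N'. near \<delta> N0 N' \<Longrightarrow> op_adm k l N'"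
      using op_adm_local[OF seq_setting_axioms] a by blast
    have "?d (op_of k F v) (op_of k F v') \<le> c * (tdist F k v v' + tdist F k w w')" for v v' w w'
    proof -
      have "c * tdist F k v v' \<le> c * (tdist F k v v' + tdist F k w w')"
        using td0[of w w'] c(1) by (intro mult_left_mono) auto
      then show ?thesis using c(2)[of v v'] by linarith
    qed
    moreover have "nondeg k N1'" if "near \<delta> N1 N1'" for N1'
      using nondeg_near[OF _ that] a \<delta>(1) by simp
    ultimately have
      "(\<forall>N0' N1'. near \<delta> N0 N0' \<longrightarrow> near \<delta> N1 N1' \<longrightarrow> op_adm k l N0' \<and> nondeg k N1') \<and>
      (\<forall>v w v' w'. near \<delta> N0 (tnorm F k v) \<longrightarrow> near \<delta> N1 (tnorm F k w) \<longrightarrow>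
        near \<delta> N0 (tnorm F k v') \<longrightarrow> near \<delta> N1 (tnorm F k w') \<longrightarrow>
        ?d (op_of k F v) (op_of k F v') \<le> c * (tdist F k v v' + tdist F k w w'))"
      using \<delta>(2) by simp
    with \<delta>(1) c(1) show ?case
      by (intro exI[of _ \<delta>] exI[of _ c] conjI) simp_all
  next
    case 3
    show ?case by (rule M_eq)
  next
    case (4 \<gamma>)
    then show ?case by (rule act1)
  next
    case (5 g h)
    then show ?case by (intro act2)
  next
    case (6 v w \<delta>)
    then have adm: "op_adm k l (tnorm F k v) \<and> nondeg k (tnorm F k w)" and "0 < \<delta>" by simp_all
    have nd: "nondeg k (tnorm F k v)" using adm by (simp add: op_adm_def)
    obtain \<eta>0 where \<eta>0: "0 < \<eta>0" "\<And>v'. tdist F k v v' \<le> \<eta>0 \<Longrightarrow> near \<delta> (tnorm F k v) (tnorm F k v')"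
      using F.near_if_close[OF tF nd \<open>0 < \<delta>\<close>] tF by blast
    define A where "A = (\<Sum>j<k. \<mu> (unit_vec j))"
    have A: "0 \<le> A" unfolding A_def by (intro sum_nonneg) simp
    define \<eta> where "\<eta> = \<eta>0 / (A + 1)"
    have \<eta>: "0 < \<eta>" "\<eta> * A \<le> \<eta>0"
      using \<eta>0(1) A by (simp_all add: \<eta>_def pos_divide_le_eq mult.commute add_nonneg_pos)
    have "\<exists>v' w'. p = op_of k F v' \<and> (op_adm k l (tnorm F k v') \<and> nondeg k (tnorm F k w')) \<and>
        near \<delta> (tnorm F k v) (tnorm F k v') \<and> near \<delta> (tnorm F k w) (tnorm F k w')"
      if p: "p \<in> ?M" and dp: "?d p (op_of k F v) < \<eta>" for p
    proof -
      obtain v' where v': "p = op_of k F v'" "op_adm k l (tnorm F k v')" using p M_eq by blast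
      have xM: "op_of k F v \<in> ?M" unfolding M_eq using adm by blast
      have "norm (v j - v' j) \<le> \<eta> * \<mu> (unit_vec j)" if j: "j < k" for j
      proof -
        have e: "op_of k F u (unit_vec j) = u j" for u
        proof -
          have "coord (unit_vec j :: nat \<Rightarrow>\<^sub>0 'f) = (\<lambda>i. if i = j then 1 else 0)"
            by (simp add: fun_eq_iff lookup_single when_def eq_commute)
          then show ?thesis using F.comb_unit[OF j, of u] unit_coord[OF j] by (simp add: op_of_def)
        qed
        have "nrm F (p (unit_vec j) - op_of k F v (unit_vec j)) \<le> ?d p (op_of k F v) * nrm (En k) (unit_vec j)"
          using F.op_dist_facts(2)[of "En k" p "op_of k F v" "unit_vec j"] En.nrm_nonneg Mb p xM unit_coord[OF j]
          by simp
        also have "\<dots> \<le> \<eta> * \<mu> (unit_vec j)" using dp by (auto intro!: mult_right_mono)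
        finally show ?thesis by (simp add: v'(1) e norm_minus_commute)
      qed
      then have "tdist F k v v' \<le> (\<Sum>j<k. \<eta> * \<mu> (unit_vec j))"
        unfolding tdist_def by (intro sum_mono) simp
      also have "\<dots> \<le> \<eta>0" using \<eta>(2) by (simp add: A_def sum_distrib_left)
      finally have "near \<delta> (tnorm F k v) (tnorm F k v')" by (rule \<eta>0(2))
      moreover have "near \<delta> (tnorm F k w) (tnorm F k w)"
        using \<open>0 < \<delta>\<close> F.tnorm_nonneg[OF tF] by (intro near_refl) simp_all
      ultimately show ?thesis using v' adm by blast
    qed
    with \<eta>(1) show ?case by blast
  next
    case (7 m \<eta>)
    note \<open>0 < \<eta>\<close>
    define A where "A = {v. tuple (En m) k v \<and> op_adm k l (tnorm E k v)}"
    define r where "r = (\<Sum>j<k. l * \<mu> (unit_vec j))"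
    have "\<mu> (v j) \<le> r" if v: "v \<in> A" and j: "j < k" for v j
    proof -
      obtain a where a: "a < l" "\<And>x. tnorm E k v x \<le> a * tnorm E k unit_vec x"
        using v unfolding A_def op_adm_def by blast
      have "\<mu> (v j) = tnorm E k v (\<lambda>i. if i = j then 1 else 0)" using E.tnorm_unit[OF j, of v] by simp
      also have "\<dots> \<le> a * \<mu> (unit_vec j)" using a(2) E.tnorm_unit[OF j, of unit_vec] by (metis seq_space_simps(3))
      also have "\<dots> \<le> l * \<mu> (unit_vec j)" using a(1) by (intro mult_right_mono) auto
      also have "\<dots> \<le> r" unfolding r_def using j \<open>0 < l\<close> by (intro member_le_sum) auto
      finally show ?thesis .
    qed
    moreover have "0 < \<eta> / c" using \<open>0 < \<eta>\<close> c(1) by simp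
    ultimately obtain B where B: "B \<subseteq> A" "finite B" "\<And>v. v \<in> A \<Longrightarrow> \<exists>b\<in>B. tdist E k v b \<le> \<eta> / c"
      using bounded_tuple_net[of A m k r "\<eta> / c"] by (auto simp: A_def)
    have "\<exists>(v', w')\<in>(\<lambda>v. (v, v)) ` B. \<forall>R0 R1. isom (En m) F R0 \<longrightarrow> isom (En m) F R1 \<longrightarrow>
           ?d (op_of k F (R0 \<circ> v)) (op_of k F (R0 \<circ> v')) \<le> \<eta>"
      if v: "tuple (En m) k v" "op_adm k l (tnorm E k v)" for v
    proof -
      obtain b where b: "b \<in> B" "tdist E k v b \<le> \<eta> / c" using B(3)[of v] v by (auto simp: A_def)
      have tb: "tuple (En m) k b" using b(1) B(1) by (auto simp: A_def)
      have "?d (op_of k F (R0 \<circ> v)) (op_of k F (R0 \<circ> b)) \<le> \<eta>" if R: "isom (En m) F R0" for R0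
      proof -
        have "tdist F k (R0 \<circ> v) (R0 \<circ> b) = tdist E k v b"
          using normed_nspace.isom_tdist[OF normed_nspace.intro[OF En_normed] R v(1) tb] by simp
        then have "?d (op_of k F (R0 \<circ> v)) (op_of k F (R0 \<circ> b)) \<le> c * (\<eta> / c)"
          using c(2)[of "R0 \<circ> v" "R0 \<circ> b"] mult_left_mono[OF b(2), of c] c(1) by simp
        then show ?thesis using c(1) by simp
      qed
      then show ?thesis using b(1) by (intro bexI[of _ "(b, b)"]) auto
    qed
    moreover have "(\<lambda>v. (v, v)) ` B \<subseteq> {(v, w). tuple (En m) k v \<and> tuple (En m) k w \<and>
        op_adm k l (tnorm E k v) \<and> nondeg k (tnorm E k w)}"
      using B(1) by (auto simp: A_def op_adm_def)
    moreover have "finite ((\<lambda>v. (v, v)) ` B)" using B(2) by simp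
    ultimately show ?case by blast
  qed
qed

end


lemma lip1_mem: "lip1 M d K d' c \<Longrightarrow> x \<in> M \<Longrightarrow> c x \<in> K"
  unfolding lip1_def by (blast dest: funcset_mem)

lemma lip1_le: "lip1 M d K d' c \<Longrightarrow> x \<in> M \<Longrightarrow> y \<in> M \<Longrightarrow> d' (c x) (c y) \<le> d x y"
  by (simp add: lip1_def)

lemma quot_eps_factorI:
  assumes "lip1 M d (quot M d G act) (quot_dist d) (orbit_closure M d G act)"
    "lip1 (quot M d G act) (quot_dist d) K dist c'"
    "\<And>x. x \<in> M0 \<Longrightarrow> j x \<in> M" "\<And>x. x \<in> M0 \<Longrightarrow> dist (c x) (c' (orbit_closure M d G act (j x))) \<le> \<epsilon>"
  shows "quot_eps_factor \<epsilon> M d G act K c M0 j"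
  using assms unfolding quot_eps_factor_def eps_factor_def by blast

context fraisse_setting
begin

lemma image_space:
  assumes \<theta>: "isom (En n) F \<theta>"
  shows "normed_space (sub F (\<theta> ` coord_space n))" "isom (En n) (sub F (\<theta> ` coord_space n)) \<theta>"
proof -
  show "normed_space (sub F (\<theta> ` coord_space n))"
    using F.normed_sub[of "\<theta> ` coord_space n"] F.Gr_subspace[OF image_in_Age_std(1)[OF \<theta>]] by blast
  show "isom (En n) (sub F (\<theta> ` coord_space n)) \<theta>" using \<theta> by (simp add: isom_def lin_on_def)
qed

lemma isom_En_tuple: "isom (En n) Y R \<Longrightarrow> tuple (En n) k v \<Longrightarrow> tuple Y k (R \<circ> v)"
  by (rule normed_nspace.isom_tuple[OF normed_nspace.intro[OF En_normed]])

lemma isom_En_tnorm: "isom (En n) Y R \<Longrightarrow> tuple (En n) k v \<Longrightarrow> tnorm Y k (R \<circ> v) = tnorm E k v"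
  using normed_nspace.isom_tnorm[OF normed_nspace.intro[OF En_normed], of n Y R k v] by simp

definition operators_factor_in where "operators_factor_in k l m K \<epsilon> X \<longleftrightarrow>
  (\<forall>c. lip1 (Lk_le k l (En k) X) (op_dist (En k) X) K dist c \<longrightarrow>
    (\<exists>R\<in>Emb (En m) X.
      quot_eps_factor \<epsilon> (Lk_less k l (En k) F) (op_dist (En k) F) (Iso F) (\<lambda>g T. compose (vecs (En k)) g T)
        K c (compose (vecs (En k)) R ` Lk_less k l (En k) (En m)) (\<lambda>T. T)))"
  for K :: "'k::metric_space set" and X :: "('f, 'b) nspace"

lemma operators_factor:
  fixes K :: "'k::metric_space set"
  assumes K: "compact K" and "0 < \<epsilon>" "0 < l"
  shows "\<exists>n0. \<forall>n\<ge>n0. \<forall>\<theta>. isom (En n) F \<theta> \<longrightarrow>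
    operators_factor_in k l m K \<epsilon> (sub F (\<theta> ` coord_space n))"
proof -
  interpret fam: coloring_family \<mu> s "Lk_less k l (En k) F" "op_dist (En k) F" "Iso F"
     "\<lambda>g T. compose (vecs (En k)) g T" k "\<lambda>N0 N1. op_adm k l N0 \<and> nondeg k N1" "\<lambda>v w. op_of k F v"
    by (rule op_family[OF \<open>0 < l\<close>])
  obtain n0 where n0: "\<And>n \<theta> C. n0 \<le> n \<Longrightarrow> isom (En n) F \<theta> \<Longrightarrow> fam.colors n \<theta> K C \<Longrightarrow> fam.factors m n \<theta> K \<epsilon> C"
    using fam.ramsey_factor[OF K \<open>0 < \<epsilon>\<close>, of m] by blast
  show ?thesis unfolding operators_factor_in_def
  proof (intro exI[of _ n0] allI impI)
    fix n \<theta> and c :: "((nat \<Rightarrow>\<^sub>0 'f) \<Rightarrow> 'b) \<Rightarrow> 'k"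
    assume n: "n0 \<le> n" and \<theta>: "isom (En n) F \<theta>"
    let ?X = "sub F (\<theta> ` coord_space n)"
    assume c: "lip1 (Lk_le k l (En k) ?X) (op_dist (En k) ?X) K dist c"
    have X: "normed_space ?X" and \<theta>X: "isom (En n) ?X \<theta>" using image_space[OF \<theta>] .
    have cK: "c T \<in> K" if "T \<in> Lk_le k l (En k) ?X" for T
      by (rule lip1_mem[OF c that])
    have cl: "dist (c T) (c S) \<le> op_dist (En k) F T S" if "T \<in> Lk_le k l (En k) ?X" "S \<in> Lk_le k l (En k) ?X" for T S
      using lip1_le[OF c that] by simp
    have inX: "op_of k F (\<theta> \<circ> v) \<in> Lk_le k l (En k) ?X" if "(v, w) \<in> fam.AD n" for v w
    proof -
      have v: "tuple (En n) k v" "op_adm k l (tnorm E k v)" using that by (simp_all add: fam.AD_def)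
      have "op_adm k l (tnorm ?X k (\<theta> \<circ> v))" using isom_En_tnorm[OF \<theta>X v(1)] v(2) by simp
      from Lk_less_op_of[OF X isom_En_tuple[OF \<theta>X v(1)] this] show ?thesis
        by (simp add: Lk_less_def Lk_le_def)
    qed
    have "fam.colors n \<theta> K (\<lambda>v w. c (op_of k F v))"
      unfolding fam.colors_def using cK cl inX by blast
    from n0[OF n \<theta> this] obtain R0 R1 h where R0: "isom (En m) (En n) R0" and
      h: "lip1 fam.Q fam.qd K dist h" and fac: "\<And>v w. (v, w) \<in> fam.AD m \<Longrightarrow>
        dist (c (op_of k F (\<theta> \<circ> R0 \<circ> v))) (h (fam.oc (op_of k F (\<theta> \<circ> R0 \<circ> v)))) \<le> \<epsilon>"
      unfolding fam.factors_def by blast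
    let ?R = "restrict (\<theta> \<circ> R0) (coord_space m)"
    have R: "?R \<in> Emb (En m) ?X" by (rule isom_into_image[OF \<theta> R0])
    have RF: "isom (En m) F ?R" using Emb_isom[OF R] by (simp add: isom_def lin_on_def)
    have "\<exists>v w. compose (vecs (En k)) ?R T = op_of k F (\<theta> \<circ> R0 \<circ> v) \<and> (v, w) \<in> fam.AD m"
      if T: "T \<in> Lk_less k l (En k) (En m)" for T
    proof -
      obtain v where v: "T = op_of k (En m) v" "tuple (En m) k v" "op_adm k l (tnorm (En m) k v)"
        using op_of_Lk_less[OF En_normed \<open>0 < l\<close> T] by blast
      have "compose (vecs (En k)) ?R T = op_of k F (?R \<circ> v)"
        unfolding v(1) using compose_op_of[OF isomD(1)[OF RF] En_normed v(2)] by simp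
      also have "\<dots> = op_of k F (\<theta> \<circ> R0 \<circ> v)"
        unfolding op_of_def using v(2) by (intro restrict_ext comb_cong) (auto simp: tuple_def)
      finally have "compose (vecs (En k)) ?R T = op_of k F (\<theta> \<circ> R0 \<circ> v)" .
      moreover have "nondeg k (tnorm E k v)" using v(3) by (simp add: op_adm_def)
      then have "(v, v) \<in> fam.AD m" using v(2,3) by (simp add: fam.AD_def)
      ultimately show ?thesis by blast
    qed
    then have M0: "\<exists>v w. T = op_of k F (\<theta> \<circ> R0 \<circ> v) \<and> (v, w) \<in> fam.AD m"
      if "T \<in> compose (vecs (En k)) ?R ` Lk_less k l (En k) (En m)" for T using that by blast
    have inM: "op_of k F (\<theta> \<circ> R0 \<circ> v) \<in> Lk_less k l (En k) F" if "(v, w) \<in> fam.AD m" for v w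
    proof -
      have i: "isom (En m) F (\<theta> \<circ> R0)" by (rule isom_comp[OF \<theta> R0])
      have v: "tuple (En m) k v" "op_adm k l (tnorm E k v)" using that by (simp_all add: fam.AD_def)
      have "op_adm k l (tnorm F k (\<theta> \<circ> R0 \<circ> v))" using isom_En_tnorm[OF i v(1)] v(2) by simp
      from Lk_less_op_of[OF normed_F isom_En_tuple[OF i v(1)] this] show ?thesis .
    qed
    have "quot_eps_factor \<epsilon> (Lk_less k l (En k) F) (op_dist (En k) F) (Iso F) (\<lambda>g T. compose (vecs (En k)) g T)
          K c (compose (vecs (En k)) ?R ` Lk_less k l (En k) (En m)) (\<lambda>T. T)"
    proof (rule quot_eps_factorI[where c' = h, OF fam.lip1_oc h])
      fix T assume "T \<in> compose (vecs (En k)) ?R ` Lk_less k l (En k) (En m)"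
      from M0[OF this] obtain v w where "T = op_of k F (\<theta> \<circ> R0 \<circ> v)" "(v, w) \<in> fam.AD m" by blast
      with fac inM show "T \<in> Lk_less k l (En k) F" "dist (c T) (h (fam.oc T)) \<le> \<epsilon>" by simp_all
    qed
    with R show "\<exists>R\<in>Emb (En m) ?X.
        quot_eps_factor \<epsilon> (Lk_less k l (En k) F) (op_dist (En k) F) (Iso F) (\<lambda>g T. compose (vecs (En k)) g T)
          K c (compose (vecs (En k)) R ` Lk_less k l (En k) (En m)) (\<lambda>T. T)" by blast
  qed
qed

end


section \<open>Subspaces\<close>

context fraisse_setting
begin

definition tspan :: "nat \<Rightarrow> (nat \<Rightarrow> 'b) \<Rightarrow> 'b set" where
  "tspan k v = range (F.lcomb k v)"

lemma tspan_0: "0 \<in> tspan k v"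
  unfolding tspan_def F.span_tuple[symmetric] by (rule F.span_zero)

lemma tuple_F: "tuple F k v"
  by (simp add: tuple_def)

lemma Gr_F: "Gr k F = {tspan k v | v w. nondeg k (tnorm F k v) \<and> nondeg k (tnorm F k w)}"
proof
  show "Gr k F \<subseteq> {tspan k v | v w. nondeg k (tnorm F k v) \<and> nondeg k (tnorm F k w)}"
  proof
    fix U assume "U \<in> Gr k F"
    then obtain v where "nondeg k (tnorm F k v)" "U = range (F.lcomb k v)" by (rule F.Gr_obtain_tuple)
    then show "U \<in> {tspan k v | v w. nondeg k (tnorm F k v) \<and> nondeg k (tnorm F k w)}"
      unfolding tspan_def by blast
  qed
  show "{tspan k v | v w. nondeg k (tnorm F k v) \<and> nondeg k (tnorm F k w)} \<subseteq> Gr k F"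
    using F.Gr_tuple[OF tuple_F] unfolding tspan_def by blast
qed

lemma tspan_Gr: "nondeg k (tnorm F k v) \<Longrightarrow> tspan k v \<in> Gr k F"
  using F.Gr_tuple[OF tuple_F] unfolding tspan_def by blast

lemma image_tspan:
  assumes "g \<in> Iso F"
  shows "g ` tspan k v = tspan k (g \<circ> v)"
proof -
  have "lin_on F F g" using assms by (simp add: Iso_iff isom_def)
  from F.lin_on_comb[OF this tuple_F] show ?thesis unfolding tspan_def image_image by simp
qed

lemma ball_dist_nonneg:
  assumes "U \<in> Gr k F" "W \<in> Gr k F"
  shows "0 \<le> ball_dist F U W"
proof (rule ccontr)
  assume "\<not> ?thesis"
  then have "ball_dist F U W < 0" by simp
  moreover have "0 \<in> U" "0 \<in> W" using assms F.Gr_subspace F.subspace_0 by blast+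
  ultimately obtain y where "nrm F (0 - y) < 0"
    using ball_dist_less[OF normed_F, of W U 0 0] by auto
  then show False by simp
qed

lemma ball_dist_triangle:
  assumes UVW: "U \<in> Gr k F" "V \<in> Gr k F" "W \<in> Gr k F"
  shows "ball_dist F U W \<le> ball_dist F U V + ball_dist F V W"
proof (rule field_le_epsilon)
  fix e :: real assume "0 < e"
  have z: "0 \<in> U" "0 \<in> V" "0 \<in> W" using UVW F.Gr_subspace F.subspace_0 by blast+
  have sub: "A \<subseteq> vecs F" for A by simp
  have lt: "ball_dist F U V < ball_dist F U V + e / 2" "ball_dist F V W < ball_dist F V W + e / 2"
    using \<open>0 < e\<close> by simp_all
  have lt': "ball_dist F V U < ball_dist F U V + e / 2" "ball_dist F W V < ball_dist F V W + e / 2"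
    using lt ball_dist_sym[OF normed_F sub sub] by metis+
  show "ball_dist F U W \<le> ball_dist F U V + ball_dist F V W + e"
  proof (rule ball_dist_le[OF normed_F z(1,3) sub sub])
    fix x assume x: "x \<in> U" "nrm F x \<le> 1"
    obtain y where y: "y \<in> V" "nrm F y \<le> 1" "nrm F (x - y) < ball_dist F U V + e / 2"
      using ball_dist_less[OF normed_F z(2) sub sub lt(1) x] by blast
    obtain w where w: "w \<in> W" "nrm F w \<le> 1" "nrm F (y - w) < ball_dist F V W + e / 2"
      using ball_dist_less[OF normed_F z(3) sub sub lt(2) y(1,2)] by blast
    have "nrm F (x - w) \<le> nrm F (x - y) + nrm F (y - w)" by (rule F.nrm_triangle_diff) simp_all
    then have "nrm F (x - w) \<le> ball_dist F U V + ball_dist F V W + e" using y(3) w(3) by linarith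
    with w show "\<exists>w\<in>W. nrm F w \<le> 1 \<and> nrm F (x - w) \<le> ball_dist F U V + ball_dist F V W + e" by blast
  next
    fix w assume w: "w \<in> W" "nrm F w \<le> 1"
    obtain y where y: "y \<in> V" "nrm F y \<le> 1" "nrm F (w - y) < ball_dist F V W + e / 2"
      using ball_dist_less[OF normed_F z(2) sub sub lt'(2) w] by blast
    obtain x where x: "x \<in> U" "nrm F x \<le> 1" "nrm F (y - x) < ball_dist F U V + e / 2"
      using ball_dist_less[OF normed_F z(1) sub sub lt'(1) y(1,2)] by blast
    have "nrm F (x - w) \<le> nrm F (x - y) + nrm F (y - w)" by (rule F.nrm_triangle_diff) simp_all
    then have "nrm F (x - w) \<le> ball_dist F U V + ball_dist F V W + e"
      using y(3) x(3) by (simp add: norm_minus_commute)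
    with x show "\<exists>x\<in>U. nrm F x \<le> 1 \<and> nrm F (x - w) \<le> ball_dist F U V + ball_dist F V W + e" by blast
  qed
qed

lemma ball_dist_self: "U \<in> Gr k F \<Longrightarrow> ball_dist F U U = 0"
proof (rule antisym)
  assume U: "U \<in> Gr k F"
  then have "0 \<in> U" using F.Gr_subspace F.subspace_0 by blast
  then show "ball_dist F U U \<le> 0" by (intro ball_dist_le[OF normed_F]) force+
  show "0 \<le> ball_dist F U U" by (rule ball_dist_nonneg[OF U U])
qed

lemma ball_dist_isometry:
  assumes g: "g \<in> Iso F" and UW: "U \<in> Gr k F" "W \<in> Gr k F"
  shows "ball_dist F (g ` U) (g ` W) \<le> ball_dist F U W"
proof (rule field_le_epsilon)
  fix e :: real assume "0 < e"
  have z: "0 \<in> U" "0 \<in> W" using UW F.Gr_subspace F.subspace_0 by blast+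
  have g': "lin_on F F g" "\<And>x. norm (g x) = norm x" using g by (simp_all add: Iso_iff isom_def)
  have gz: "0 \<in> g ` U" "0 \<in> g ` W" using z F.lin_on_0[OF g'(1)] by (metis imageI)+
  have sub: "A \<subseteq> vecs F" for A by simp
  have gd: "norm (g x - g y) = norm (x - y)" for x y
    using F.lin_on_diff[OF g'(1), of x y] g'(2)[of "x - y"] by simp
  have lt: "ball_dist F U W < ball_dist F U W + e" using \<open>0 < e\<close> by simp
  have lt': "ball_dist F W U < ball_dist F U W + e" using lt ball_dist_sym[OF normed_F sub sub] by metis
  show "ball_dist F (g ` U) (g ` W) \<le> ball_dist F U W + e"
  proof (rule ball_dist_le[OF normed_F gz sub sub])
    fix x assume x: "x \<in> g ` U" "nrm F x \<le> 1"
    then obtain u where u: "x = g u" "u \<in> U" "nrm F u \<le> 1" using g'(2) by auto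
    obtain w where w: "w \<in> W" "nrm F w \<le> 1" "nrm F (u - w) < ball_dist F U W + e"
      using ball_dist_less[OF normed_F z(2) sub sub lt u(2,3)] by blast
    then show "\<exists>y\<in>g ` W. nrm F y \<le> 1 \<and> nrm F (x - y) \<le> ball_dist F U W + e"
      unfolding u(1) by (intro bexI[of _ "g w"]) (simp_all add: g'(2) gd)
  next
    fix y assume y: "y \<in> g ` W" "nrm F y \<le> 1"
    then obtain w where w: "y = g w" "w \<in> W" "nrm F w \<le> 1" using g'(2) by auto
    obtain u where u: "u \<in> U" "nrm F u \<le> 1" "nrm F (w - u) < ball_dist F U W + e"
      using ball_dist_less[OF normed_F z(1) sub sub lt' w(2,3)] by blast
    then show "\<exists>x\<in>g ` U. nrm F x \<le> 1 \<and> nrm F (x - y) \<le> ball_dist F U W + e"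
      unfolding w(1) by (intro bexI[of _ "g u"]) (simp_all add: g'(2) gd norm_minus_commute)
  qed
qed

text \<open>The same coefficients are used for \<open>w\<close>, and the result is shrunk into the unit ball. Both steps move
  the vector by at most \<open>c * tdist F k v w\<close>, whence the factor 2.\<close>

lemma tspan_ball_close:
  assumes c: "0 < c" "\<And>x j. j < k \<Longrightarrow> norm (x j) \<le> c * tnorm F k v x" and z: "z \<in> tspan k v" "norm z \<le> 1"
  shows "\<exists>y\<in>tspan k w. norm y \<le> 1 \<and> norm (z - y) \<le> 2 * c * tdist F k v w"
proof -
  obtain a where a: "z = F.lcomb k v a" using z(1) unfolding tspan_def by blast
  define t where "t = c * tdist F k v w"
  have t: "0 \<le> t" unfolding t_def using c(1) F.tdist_nonneg[OF tuple_F tuple_F] by simp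
  let ?y = "F.lcomb k w a"
  have bd: "norm (a j) \<le> c" if "j < k" for j
  proof -
    have "norm (a j) \<le> c * norm z" using c(2)[OF that, of a] by (simp add: a tnorm_def)
    also have "\<dots> \<le> c" using z(2) c(1) by simp
    finally show ?thesis .
  qed
  have zy: "norm (z - ?y) \<le> t"
    using F.nrm_comb_diff_le[OF tuple_F tuple_F, of k a c v w] bd c(1) by (simp add: a t_def)
  have "norm ?y \<le> norm z + norm (?y - z)" using norm_triangle_sub[of ?y z] by simp
  then have ny: "norm ?y \<le> 1 + t" using zy z(2) by (simp add: norm_minus_commute)
  define q where "q = 1 / (1 + t)"
  let ?y' = "s (of_real q) ?y"
  have q: "0 < q" "q \<le> 1" "q * (1 + t) = 1" using t by (simp_all add: q_def)
  have n': "norm ?y' = q * norm ?y" using F.nrm_scale[of ?y "of_real q"] q(1) by simp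
  have "q * norm ?y \<le> q * (1 + t)" using ny q(1) by (intro mult_left_mono) auto
  then have "norm ?y' \<le> 1" unfolding n' q(3) .
  moreover have "norm (z - ?y') \<le> 2 * t"
  proof -
    have e: "?y - ?y' = s (of_real (1 - q)) ?y"
      using F.scale_left_diff_distrib[of 1 "of_real q" ?y] by simp
    have "norm (s (of_real (1 - q)) ?y) = norm (of_real (1 - q) :: 'f) * norm ?y"
      using F.nrm_scale[of ?y "of_real (1 - q)"] by simp
    also have "norm (of_real (1 - q) :: 'f) = 1 - q" unfolding norm_of_real using q by simp
    finally have "norm (?y - ?y') = (1 - q) * norm ?y" unfolding e .
    also have "\<dots> \<le> (1 - q) * (1 + t)" using ny q by (intro mult_left_mono) auto
    also have "\<dots> = t" using q(3) by (simp add: left_diff_distrib)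
    finally have "norm (?y - ?y') \<le> t" .
    then show ?thesis using zy norm_triangle_ineq[of "z - ?y" "?y - ?y'"] by simp
  qed
  moreover have "?y' \<in> tspan k w"
    using F.comb_scale[of k w "of_real q" a] unfolding tspan_def by (metis rangeI banach_nspace_simps(2))
  ultimately show ?thesis unfolding t_def by (intro bexI[of _ ?y']) (simp_all add: mult.assoc)
qed

lemma tspan_lip:
  assumes c: "0 < c" "\<And>x j. j < k \<Longrightarrow> norm (x j) \<le> c * tnorm F k v x" "\<And>x j. j < k \<Longrightarrow> norm (x j) \<le> c * tnorm F k w x"
  shows "ball_dist F (tspan k v) (tspan k w) \<le> 2 * c * tdist F k v w"
proof (rule ball_dist_le[OF normed_F tspan_0 tspan_0])
  fix x assume "x \<in> tspan k v" "nrm F x \<le> 1"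
  then show "\<exists>y\<in>tspan k w. nrm F y \<le> 1 \<and> nrm F (x - y) \<le> 2 * c * tdist F k v w"
    using tspan_ball_close[OF c(1,2)] by simp
next
  fix y assume "y \<in> tspan k w" "nrm F y \<le> 1"
  then obtain x where "x \<in> tspan k v" "norm x \<le> 1" "norm (y - x) \<le> 2 * c * tdist F k w v"
    using tspan_ball_close[OF c(1,3), of y v] by auto
  then show "\<exists>x\<in>tspan k v. nrm F x \<le> 1 \<and> nrm F (x - y) \<le> 2 * c * tdist F k v w"
    using F.tdist_commute[OF tuple_F tuple_F, of k w v] by (intro bexI[of _ x]) (simp_all add: norm_minus_commute)
qed simp_all

text \<open>A basis of \<open>U\<close> is recognised by its length.\<close>

lemma tspan_eqI:
  assumes U: "U \<in> Gr k F" and v: "nondeg k (tnorm F k v)" "\<And>j. j < k \<Longrightarrow> v j \<in> U"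
  shows "U = tspan k v"
proof (rule ccontr)
  assume ne: "U \<noteq> tspan k v"
  obtain u where u: "nondeg k (tnorm F k u)" "U = range (F.lcomb k u)" by (rule F.Gr_obtain_tuple[OF U])
  have Us: "F.subspace U" using F.Gr_subspace[OF U] by blast
  have sub: "tspan k v \<subseteq> U"
    unfolding tspan_def F.span_tuple[symmetric] by (rule F.span_minimal[OF _ Us]) (use v(2) in blast)
  then obtain z where z: "z \<in> U" "z \<notin> tspan k v" using ne by blast
  let ?V = "v ` {..<k}"
  note b = F.nondeg_basis[OF v(1)]
  have zn: "z \<notin> F.span ?V" using z(2) unfolding tspan_def F.span_tuple .
  have ind: "F.independent (insert z ?V)" by (rule F.independent_insertI[OF zn b(2)])
  have "insert z ?V \<subseteq> F.span (u ` {..<k})" using z(1) v(2) unfolding F.span_tuple u(2)[symmetric] by blast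
  from F.independent_span_bound[OF _ ind this] have "card (insert z ?V) \<le> card (u ` {..<k})" by simp
  also have "\<dots> \<le> k" using card_image_le[of "{..<k}" u] by simp
  also have "k < card (insert z ?V)"
  proof -
    have nV: "z \<notin> ?V"
    proof
      assume "z \<in> ?V"
      from F.span_base[OF this] zn show False by contradiction
    qed
    show ?thesis unfolding card_insert_disjoint[OF finite_imageI[OF finite_lessThan] nV] card_image[OF b(1)] by simp
  qed
  finally show False by simp
qed

text \<open>Two spans are close when the same members of a finite net of the unit ball are close to
  their unit balls; there are only finitely many possibilities for this set of members.\<close>

lemma tspan_net:
  fixes \<eta> :: real
  assumes "0 < \<eta>"
  shows "\<exists>B. finite B \<and>
    B \<subseteq> {(v, w). tuple (En m) k v \<and> tuple (En m) k w \<and> nondeg k (tnorm E k v) \<and> nondeg k (tnorm E k w)} \<and>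
    (\<forall>v w. tuple (En m) k v \<longrightarrow> tuple (En m) k w \<longrightarrow> nondeg k (tnorm E k v) \<and> nondeg k (tnorm E k w) \<longrightarrow>
      (\<exists>(v', w')\<in>B. \<forall>R0 R1. isom (En m) F R0 \<longrightarrow> isom (En m) F R1 \<longrightarrow>
         ball_dist F (tspan k (R0 \<circ> v)) (tspan k (R0 \<circ> v')) \<le> \<eta>))"
proof -
  interpret Em: normed_nspace "En m" using En_normed by unfold_locales
  define A where "A = {v. tuple (En m) 1 v \<and> \<mu> (v 0) \<le> 1}"
  have "\<exists>B\<subseteq>A. finite B \<and> (\<forall>v\<in>A. \<exists>b\<in>B. tdist E 1 v b \<le> \<eta> / 2)"
  proof (rule bounded_tuple_net)
    show "tuple (En m) 1 v" if "v \<in> A" for v using that by (simp add: A_def)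
    show "\<mu> (v j) \<le> 1" if "v \<in> A" "j < 1" for v j using that by (simp add: A_def)
  qed (use assms in simp)
  then obtain B where B: "finite B" "\<And>v. v \<in> A \<Longrightarrow> \<exists>b\<in>B. tdist E 1 v b \<le> \<eta> / 2" by blast
  let ?AD = "{(v, w). tuple (En m) k v \<and> tuple (En m) k w \<and> nondeg k (tnorm E k v) \<and> nondeg k (tnorm E k w)}"
  define cd where "cd T = {b\<in>B. \<exists>x. \<mu> (E.lcomb k (fst T) x) \<le> 1 \<and> \<mu> (E.lcomb k (fst T) x - b 0) \<le> \<eta> / 2}"
    for T :: "'f vtuple \<times> 'f vtuple"
  have "cd ` ?AD \<subseteq> Pow B" unfolding cd_def by blast
  then have "finite (cd ` ?AD)" using B(1) finite_subset by blast
  from finite_code_representatives[OF this] obtain B' where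
    B': "B' \<subseteq> ?AD" "finite B'" "\<And>T. T \<in> ?AD \<Longrightarrow> \<exists>T'\<in>B'. cd T = cd T'" by blast
  have half: "\<exists>y\<in>tspan k (R0 \<circ> v'). nrm F y \<le> 1 \<and> nrm F (z - y) \<le> \<eta>"
    if v: "tuple (En m) k v" "tuple (En m) k v'" and cd: "cd (v, w) = cd (v', w')" and R0: "isom (En m) F R0"
      and z: "z \<in> tspan k (R0 \<circ> v)" "nrm F z \<le> 1" for v w v' w' R0 z
  proof -
    obtain x where x: "z = F.lcomb k (R0 \<circ> v) x" using z(1) unfolding tspan_def by blast
    have zx: "z = R0 (Em.lcomb k v x)" unfolding x by (rule Em.lin_on_comb[OF isomD(1)[OF R0] v(1), symmetric])
    have cv: "Em.lcomb k v x \<in> vecs (En m)" by (rule Em.comb_vecs[OF v(1)])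
    have n1: "\<mu> (E.lcomb k v x) \<le> 1" using z(2) isomD(2)[OF R0 cv] by (simp add: zx)
    have "(\<lambda>_. E.lcomb k v x) \<in> A" using cv n1 by (simp add: A_def tuple_def)
    then obtain b where b: "b \<in> B" "\<mu> (E.lcomb k v x - b 0) \<le> \<eta> / 2" using B(2) by (auto simp: tdist_def)
    have "b \<in> cd (v, w)" unfolding cd_def using b n1 by auto
    then have "b \<in> cd (v', w')" using cd by simp
    then obtain y where y: "\<mu> (E.lcomb k v' y) \<le> 1" "\<mu> (E.lcomb k v' y - b 0) \<le> \<eta> / 2" unfolding cd_def by auto
    have cv': "Em.lcomb k v' y \<in> vecs (En m)" by (rule Em.comb_vecs[OF v(2)])
    have "\<mu> (E.lcomb k v x - E.lcomb k v' y) \<le> \<mu> (E.lcomb k v x - b 0) + \<mu> (b 0 - E.lcomb k v' y)"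
      using E.nrm_triangle_diff[of "E.lcomb k v x" "b 0" "E.lcomb k v' y"] by simp
    also have "\<mu> (b 0 - E.lcomb k v' y) = \<mu> (E.lcomb k v' y - b 0)"
      using E.nrm_diff_commute[of "b 0" "E.lcomb k v' y"] by simp
    finally have dd: "\<mu> (E.lcomb k v x - E.lcomb k v' y) \<le> \<eta>" using b(2) y(2) by linarith
    let ?y = "R0 (Em.lcomb k v' y)"
    have "?y = F.lcomb k (R0 \<circ> v') y" by (rule Em.lin_on_comb[OF isomD(1)[OF R0] v(2)])
    then have yin: "?y \<in> tspan k (R0 \<circ> v')" unfolding tspan_def by blast
    have "nrm F ?y \<le> 1" using isomD(2)[OF R0 cv'] y(1) by simp
    moreover have "nrm F (z - ?y) \<le> \<eta>"
      using Em.lin_on_diff[OF isomD(1)[OF R0] cv cv'] isomD(2)[OF R0 Em.vecs_diff[OF cv cv']] dd by (simp add: zx)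
    ultimately show ?thesis using yin by blast
  qed
  have net: "\<exists>(v', w')\<in>B'. \<forall>R0 R1. isom (En m) F R0 \<longrightarrow> isom (En m) F R1 \<longrightarrow>
         ball_dist F (tspan k (R0 \<circ> v)) (tspan k (R0 \<circ> v')) \<le> \<eta>" if vw: "(v, w) \<in> ?AD" for v w
  proof -
    obtain T' where "T' \<in> B'" "cd (v, w) = cd T'" using B'(3)[OF vw] by blast
    moreover obtain v' w' where "T' = (v', w')" by (cases T')
    ultimately have T': "(v', w') \<in> B'" "cd (v, w) = cd (v', w')" by simp_all
    have t: "tuple (En m) k v" "tuple (En m) k v'" using vw T'(1) B'(1) by auto
    have "ball_dist F (tspan k (R0 \<circ> v)) (tspan k (R0 \<circ> v')) \<le> \<eta>" if R0: "isom (En m) F R0" for R0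
    proof (rule ball_dist_le[OF normed_F tspan_0 tspan_0])
      fix x assume "x \<in> tspan k (R0 \<circ> v)" "nrm F x \<le> 1"
      from half[OF t T'(2) R0 this]
      show "\<exists>y\<in>tspan k (R0 \<circ> v'). nrm F y \<le> 1 \<and> nrm F (x - y) \<le> \<eta>" .
    next
      fix y assume "y \<in> tspan k (R0 \<circ> v')" "nrm F y \<le> 1"
      from half[OF t(2,1) T'(2)[symmetric] R0 this]
      show "\<exists>x\<in>tspan k (R0 \<circ> v). nrm F x \<le> 1 \<and> nrm F (x - y) \<le> \<eta>" by (simp add: norm_minus_commute)
    qed simp_all
    then show ?thesis using T'(1) by (intro bexI[of _ "(v', w')"]) auto
  qed
  show ?thesis
  proof (intro exI[of _ B'] conjI B'(1,2) allI impI)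
    fix v w assume "tuple (En m) k v" "tuple (En m) k w" "nondeg k (tnorm E k v) \<and> nondeg k (tnorm E k w)"
    then have "(v, w) \<in> ?AD" by simp
    then show "\<exists>(v', w')\<in>B'. \<forall>R0 R1. isom (En m) F R0 \<longrightarrow> isom (En m) F R1 \<longrightarrow>
         ball_dist F (tspan k (R0 \<circ> v)) (tspan k (R0 \<circ> v')) \<le> \<eta>" by (rule net)
  qed
qed

lemma subspace_family:
  "coloring_family \<mu> s (Gr k F) (ball_dist F) (Iso F) (\<lambda>g U. g ` U) k
     (\<lambda>N0 N1. nondeg k N0 \<and> nondeg k N1) (\<lambda>v w. tspan k v)"
proof -
  have act1: "\<exists>g\<in>Iso F. \<exists>h\<in>Iso F. \<forall>v w. nondeg k (tnorm F k v) \<and> nondeg k (tnorm F k w) \<longrightarrow>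
      \<gamma> ` tspan k v = tspan k (g \<circ> v)" if "\<gamma> \<in> Iso F" for \<gamma>
    using image_tspan[OF that] that by blast
  have act2: "\<exists>\<gamma>\<in>Iso F. \<forall>v w. nondeg k (tnorm F k v) \<and> nondeg k (tnorm F k w) \<longrightarrow>
      \<gamma> ` tspan k v = tspan k (g \<circ> v)" if "g \<in> Iso F" for g
    using image_tspan[OF that] that by blast
  have ia: "isometric_action (Gr k F) (ball_dist F) (Iso F) (\<lambda>g U. g ` U)"
  proof (rule isometric_actionI[where \<Psi> = "\<lambda>v w. tspan k v" and k = k
        and adm = "\<lambda>N0 N1. nondeg k N0 \<and> nondeg k N1"])
    fix x y assume "x \<in> Gr k F" "y \<in> Gr k F"
    then show "ball_dist F x y = ball_dist F y x"
      using F.Gr_subspace by (intro ball_dist_sym[OF normed_F]) blast+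
  qed (rule Gr_F act1 act2 ball_dist_self ball_dist_nonneg ball_dist_triangle ball_dist_isometry; assumption)+
  have nn: "0 \<le> tnorm F k v x" for v x using F.tnorm_nonneg[OF tuple_F] .
  show ?thesis
  proof (intro coloring_family.intro coloring_family_axioms.intro ia fraisse_setting_axioms, goal_cases)
    case (1 N0 N1)
    then show ?case .
  next
    case a: (2 N0 N1)
    obtain c where c: "0 < c" "\<And>x j. j < k \<Longrightarrow> norm (x j) \<le> c * N0 x" using a unfolding nondeg_def by blast
    have c2: "norm (x j) \<le> (2 * c) * tnorm F k v x" if "near 1 N0 (tnorm F k v)" "j < k" for v x j
    proof -
      have "norm (x j) \<le> c * N0 x" by (rule c(2)[OF that(2)])
      also have "\<dots> \<le> c * ((1 + 1) * tnorm F k v x)" using that(1) c(1) by (intro mult_left_mono) (auto simp: near_def)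
      finally show ?thesis by simp
    qed
    have "ball_dist F (tspan k v) (tspan k v') \<le> (4 * c) * (tdist F k v v' + tdist F k w w')"
      if "near 1 N0 (tnorm F k v)" "near 1 N0 (tnorm F k v')" for v v' w w'
    proof -
      have "ball_dist F (tspan k v) (tspan k v') \<le> 2 * (2 * c) * tdist F k v v'"
        by (rule tspan_lip) (use c(1) c2[OF that(1)] c2[OF that(2)] in simp_all)
      also have "\<dots> \<le> 2 * (2 * c) * (tdist F k v v' + tdist F k w w')"
        using c(1) F.tdist_nonneg[OF tuple_F tuple_F, of k w w'] by (intro mult_left_mono) auto
      finally show ?thesis by simp
    qed
    moreover have "nondeg k N'" if "near 1 N N'" "nondeg k N" for N N'
      using nondeg_near[OF that(2,1)] by simp
    ultimately have
      "(\<forall>N0' N1'. near 1 N0 N0' \<longrightarrow> near 1 N1 N1' \<longrightarrow> nondeg k N0' \<and> nondeg k N1') \<and>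
      (\<forall>v w v' w'. near 1 N0 (tnorm F k v) \<longrightarrow> near 1 N1 (tnorm F k w) \<longrightarrow>
        near 1 N0 (tnorm F k v') \<longrightarrow> near 1 N1 (tnorm F k w') \<longrightarrow>
        ball_dist F (tspan k v) (tspan k v') \<le> (4 * c) * (tdist F k v v' + tdist F k w w'))"
      using a by blast
    with c(1) show ?case
      by (intro exI[of _ 1] exI[of _ "4 * c"] conjI) simp_all
  next
    case 3
    show ?case by (rule Gr_F)
  next
    case (4 \<gamma>)
    then show ?case by (rule act1)
  next
    case (5 g h)
    then show ?case by (intro act2)
  next
    case (6 v w \<delta>)
    then have nd: "nondeg k (tnorm F k v) \<and> nondeg k (tnorm F k w)" and "0 < \<delta>" by simp_all
    obtain \<eta>0 where \<eta>0: "0 < \<eta>0" "\<And>v'. tdist F k v v' \<le> \<eta>0 \<Longrightarrow> near \<delta> (tnorm F k v) (tnorm F k v')"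
      using F.near_if_close[OF tuple_F _ \<open>0 < \<delta>\<close>, of k v] nd tuple_F by blast
    define c where "c = (\<Sum>j<k. norm (v j)) + 1"
    have "0 \<le> (\<Sum>j<k. norm (v j))" by (intro sum_nonneg) simp
    then have c0: "0 < c" by (simp add: c_def)
    have cv: "norm (v j) \<le> c" if "j < k" for j
    proof -
      have "norm (v j) \<le> (\<Sum>j<k. norm (v j))" using that by (intro member_le_sum) auto
      then show ?thesis by (simp add: c_def)
    qed
    define \<eta> where "\<eta> = \<eta>0 / (c * (real k + 1))"
    have \<eta>: "0 < \<eta>" using \<eta>0(1) c0 by (simp add: \<eta>_def)
    have "real k * (c * \<eta>) = \<eta>0 * (real k / (real k + 1))" using c0 by (simp add: \<eta>_def)
    also have "\<dots> \<le> \<eta>0 * 1" using \<eta>0(1) by (intro mult_left_mono) auto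
    finally have k\<eta>: "real k * (c * \<eta>) \<le> \<eta>0" by simp
    have "\<exists>v' w'. p = tspan k v' \<and> (nondeg k (tnorm F k v') \<and> nondeg k (tnorm F k w')) \<and>
        near \<delta> (tnorm F k v) (tnorm F k v') \<and> near \<delta> (tnorm F k w) (tnorm F k w')"
      if p: "p \<in> Gr k F" and dp: "ball_dist F p (tspan k v) < \<eta>" for p
    proof -
      have vG: "tspan k v \<in> Gr k F" using tspan_Gr nd by blast
      have sub: "A \<subseteq> vecs F" for A by simp
      have dp': "ball_dist F (tspan k v) p < \<eta>" using dp ball_dist_sym[OF normed_F sub sub] by metis
      have "v j \<in> tspan k v" if "j < k" for j
        unfolding tspan_def using F.comb_unit[OF that, of v] by (metis rangeI)
      then obtain v' where v': "\<And>j. j < k \<Longrightarrow> v' j \<in> p \<and> nrm F (v j - v' j) \<le> c * \<eta>"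
        using ball_dist_close_tuple[OF normed_F _ sub _ sub dp', of k v c] c0 cv
          F.Gr_subspace[OF p] F.Gr_subspace[OF vG] by auto
      have "tdist F k v v' \<le> (\<Sum>j<k. c * \<eta>)" unfolding tdist_def using v' by (intro sum_mono) auto
      also have "\<dots> \<le> \<eta>0" using k\<eta> by simp
      finally have n: "near \<delta> (tnorm F k v) (tnorm F k v')" by (rule \<eta>0(2))
      have nd': "nondeg k (tnorm F k v')" using nondeg_near[OF _ n] nd \<open>0 < \<delta>\<close> by simp
      have "p = tspan k v'" using v' by (intro tspan_eqI[OF p nd']) blast
      moreover have "near \<delta> (tnorm F k w) (tnorm F k w)"
        using \<open>0 < \<delta>\<close> nn by (intro near_refl) simp_all
      ultimately show ?thesis using n nd nd' by blast
    qed
    with \<eta> show ?case by blast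
  next
    case (7 m \<eta>)
    then show ?case by (rule tspan_net)
  qed
qed

definition subspaces_factor_in where "subspaces_factor_in k m K \<epsilon> X \<longleftrightarrow>
  (\<forall>c. lip1 (Gr k X) (ball_dist X) K dist c \<longrightarrow>
    (\<exists>V\<in>Gr m X. sub F V \<in> Age_std \<mu> F \<and>
      quot_eps_factor \<epsilon> (Gr k F) (ball_dist F) (Iso F) (\<lambda>g U. g ` U) K c (Gr k (sub F V)) (\<lambda>U. U)))"
  for K :: "'k::metric_space set" and X :: "('f, 'b) nspace"

lemma subspaces_factor:
  fixes K :: "'k::metric_space set"
  assumes K: "compact K" and "0 < \<epsilon>"
  shows "\<exists>n0. \<forall>n\<ge>n0. \<forall>\<theta>. isom (En n) F \<theta> \<longrightarrow>
    subspaces_factor_in k m K \<epsilon> (sub F (\<theta> ` coord_space n))"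
proof -
  interpret fam: coloring_family \<mu> s "Gr k F" "ball_dist F" "Iso F" "\<lambda>g U. g ` U" k
     "\<lambda>N0 N1. nondeg k N0 \<and> nondeg k N1" "\<lambda>v w. tspan k v"
    by (rule subspace_family)
  obtain n0 where n0: "\<And>n \<theta> C. n0 \<le> n \<Longrightarrow> isom (En n) F \<theta> \<Longrightarrow> fam.colors n \<theta> K C \<Longrightarrow> fam.factors m n \<theta> K \<epsilon> C"
    using fam.ramsey_factor[OF K \<open>0 < \<epsilon>\<close>, of m] by blast
  show ?thesis unfolding subspaces_factor_in_def
  proof (intro exI[of _ n0] allI impI)
    fix n \<theta> and c :: "'b set \<Rightarrow> 'k"
    assume n: "n0 \<le> n" and \<theta>: "isom (En n) F \<theta>"
    let ?X = "sub F (\<theta> ` coord_space n)"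
    assume c: "lip1 (Gr k ?X) (ball_dist ?X) K dist c"
    have sub: "A \<subseteq> vecs F" for A by simp
    interpret En: normed_nspace "En n" using En_normed by unfold_locales
    have inX: "tspan k (\<theta> \<circ> v) \<in> Gr k ?X" if "(v, w) \<in> fam.AD n" for v w
    proof -
      have v: "tuple (En n) k v" "nondeg k (tnorm E k v)" using that by (simp_all add: fam.AD_def)
      have "nondeg k (tnorm F k (\<theta> \<circ> v))" using isom_En_tnorm[OF \<theta> v(1)] v(2) by simp
      moreover have "tspan k (\<theta> \<circ> v) \<subseteq> \<theta> ` coord_space n"
      proof
        fix x assume "x \<in> tspan k (\<theta> \<circ> v)"
        then obtain y where y: "x = F.lcomb k (\<theta> \<circ> v) y" unfolding tspan_def by blast
        have "x = \<theta> (En.lcomb k v y)" unfolding y by (rule En.lin_on_comb[OF isomD(1)[OF \<theta>] v(1), symmetric])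
        then show "x \<in> \<theta> ` coord_space n" using En.comb_vecs[OF v(1), of y] by simp
      qed
      ultimately show ?thesis using Gr_sub[OF sub] tspan_Gr by blast
    qed
    have cl: "dist (c U) (c W) \<le> ball_dist F U W" if "U \<in> Gr k ?X" "W \<in> Gr k ?X" for U W
      using lip1_le[OF c that] by simp
    have "fam.colors n \<theta> K (\<lambda>v w. c (tspan k v))"
      unfolding fam.colors_def using lip1_mem[OF c] cl inX by blast
    from n0[OF n \<theta> this] obtain R0 R1 h where R0: "isom (En m) (En n) R0" and
      h: "lip1 fam.Q fam.qd K dist h" and fac: "\<And>v w. (v, w) \<in> fam.AD m \<Longrightarrow>
        dist (c (tspan k (\<theta> \<circ> R0 \<circ> v))) (h (fam.oc (tspan k (\<theta> \<circ> R0 \<circ> v)))) \<le> \<epsilon>"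
      unfolding fam.factors_def by blast
    have i: "isom (En m) F (\<theta> \<circ> R0)" by (rule isom_comp[OF \<theta> R0])
    let ?V = "(\<theta> \<circ> R0) ` coord_space m"
    note V = image_in_Age_std[OF i]
    have "?V \<subseteq> \<theta> ` coord_space n" using isomD(3)[OF R0] by (auto simp: image_iff)
    then have VX: "?V \<in> Gr m ?X" using V(1) Gr_sub[OF sub] by blast
    have "quot_eps_factor \<epsilon> (Gr k F) (ball_dist F) (Iso F) (\<lambda>g U. g ` U) K c (Gr k (sub F ?V)) (\<lambda>U. U)"
    proof (rule quot_eps_factorI[where c' = h, OF fam.lip1_oc h])
      fix U assume "U \<in> Gr k (sub F ?V)"
      then have U: "U \<in> Gr k F" "U \<subseteq> ?V" using Gr_sub[OF sub] by blast+
      then show "U \<in> Gr k F" by blast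
      obtain u where u: "nondeg k (tnorm F k u)" "U = range (F.lcomb k u)" by (rule F.Gr_obtain_tuple[OF U(1)])
      have "\<exists>x. x \<in> coord_space m \<and> u j = (\<theta> \<circ> R0) x" if "j < k" for j
      proof -
        have "u j \<in> U" unfolding u(2) using F.comb_unit[OF that, of u] by (metis rangeI)
        then show ?thesis using U(2) by blast
      qed
      then obtain v where v: "\<And>j. j < k \<Longrightarrow> v j \<in> coord_space m \<and> u j = (\<theta> \<circ> R0) (v j)" by metis
      have tv: "tuple (En m) k v" using v by (simp add: tuple_def)
      have ceq: "F.lcomb k u = F.lcomb k (\<theta> \<circ> R0 \<circ> v)" by (intro ext comb_cong) (use v in auto)
      then have "tnorm F k u = tnorm F k (\<theta> \<circ> R0 \<circ> v)" by (intro ext) (simp only: tnorm_def)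
      then have "nondeg k (tnorm E k v)" using u(1) isom_En_tnorm[OF i tv] by simp
      then have "(v, v) \<in> fam.AD m" using tv by (simp add: fam.AD_def)
      from fac[OF this] show "dist (c U) (h (fam.oc U)) \<le> \<epsilon>" by (simp only: u(2) ceq tspan_def)
    qed
    with VX V(2) show "\<exists>V\<in>Gr m ?X. sub F V \<in> Age_std \<mu> F \<and>
        quot_eps_factor \<epsilon> (Gr k F) (ball_dist F) (Iso F) (\<lambda>g U. g ` U) K c (Gr k (sub F V)) (\<lambda>U. U)" by blast
  qed
qed

end


section \<open>Weak-star operators\<close>

context normed_nspace
begin

lemma dual_scale:
  assumes f: "f \<in> vecs (dual X)"
  shows "smul (dual X) (of_real r) f \<in> vecs (dual X)"
    "nrm (dual X) (smul (dual X) (of_real r) f) = \<bar>r\<bar> * nrm (dual X) f"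
    "x \<in> vecs X \<Longrightarrow> smul (dual X) (of_real r) f x = of_real r * f x"
proof -
  have sm: "smul (dual X) b h = restrict (\<lambda>x. b * h x) (vecs X)" for b h
    by (simp add: dual_def)
  have mem: "smul (dual X) (of_real t) h \<in> vecs (dual X)" if "h \<in> vecs (dual X)" for t h
    unfolding sm
  proof (rule dualI[where b = "\<bar>t\<bar> * nrm (dual X) h"])
    show "of_real t * h (x + y) = of_real t * h x + of_real t * h y" if "x \<in> vecs X" "y \<in> vecs X" for x y
      using dualD(1)[OF \<open>h \<in> _\<close> that] by (simp add: distrib_left)
    show "of_real t * h (smul X a x) = a * (of_real t * h x)" if "x \<in> vecs X" for a x
      using dualD(2)[OF \<open>h \<in> _\<close> that] by simp
    show "norm (of_real t * h x) \<le> \<bar>t\<bar> * nrm (dual X) h * nrm X x" if "x \<in> vecs X" for x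
      using mult_left_mono[OF dualD(5)[OF \<open>h \<in> _\<close> that], of "\<bar>t\<bar>"] by (simp add: norm_mult mult.assoc)
  qed
  have le: "nrm (dual X) (smul (dual X) (of_real t) h) \<le> \<bar>t\<bar> * nrm (dual X) h" if h: "h \<in> vecs (dual X)" for t h
  proof (rule dual_norm_le)
    show "0 \<le> \<bar>t\<bar> * nrm (dual X) h" using dualD(4)[OF h] by simp
    show "norm (smul (dual X) (of_real t) h x) \<le> \<bar>t\<bar> * nrm (dual X) h * nrm X x" if "x \<in> vecs X" for x
      using mult_left_mono[OF dualD(5)[OF h that], of "\<bar>t\<bar>"] that by (simp add: sm norm_mult mult.assoc)
  qed
  show m: "smul (dual X) (of_real r) f \<in> vecs (dual X)" by (rule mem[OF f])
  show "x \<in> vecs X \<Longrightarrow> smul (dual X) (of_real r) f x = of_real r * f x" by (simp add: sm)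
  show "nrm (dual X) (smul (dual X) (of_real r) f) = \<bar>r\<bar> * nrm (dual X) f"
  proof (cases "r = 0")
    case True
    then show ?thesis using le[OF f, of r] dualD(4)[OF m] by simp
  next
    case False
    have "smul (dual X) (of_real (1 / r)) (smul (dual X) (of_real r) f) = f"
      by (rule extensionalityI[OF _ dualD(3)[OF f]]) (use False in \<open>simp_all add: sm\<close>)
    then have "nrm (dual X) f \<le> \<bar>1 / r\<bar> * nrm (dual X) (smul (dual X) (of_real r) f)"
      using le[OF m, of "1 / r"] by simp
    then show ?thesis using le[OF f, of r] False by (simp add: field_simps)
  qed
qed

text \<open>A weak-star operator: \<open>T\<^sub>0 \<circ> T\<^sub>1\<^sup>*\<close> for the operators \<open>T\<^sub>0, T\<^sub>1\<close> that map the unit vectors to \<open>v\<close> and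
  \<open>w\<close>.\<close>

definition wop :: "nat \<Rightarrow> (nat \<Rightarrow> 'v) \<Rightarrow> (nat \<Rightarrow> 'v) \<Rightarrow> ('v \<Rightarrow> 'f) \<Rightarrow> 'v" where
  "wop k v w = (\<lambda>f\<in>vecs (dual X). lcomb k v (\<lambda>j. f (w j)))"

end

text \<open>The functional with coordinates \<open>y\<close> has norm at most \<open>b\<close> for the seminorm \<open>N\<close>.\<close>

definition dominated :: "nat \<Rightarrow> ((nat \<Rightarrow> 'f::real_or_complex) \<Rightarrow> real) \<Rightarrow> (nat \<Rightarrow> 'f) \<Rightarrow> real \<Rightarrow> bool" where
  "dominated k N y b \<longleftrightarrow> 0 \<le> b \<and> (\<forall>x. norm (\<Sum>j<k. x j * y j) \<le> b * N x)"

text \<open>The identity from the dual of \<open>(\<bbbF>\<^sup>k, N1)\<close> to \<open>(\<bbbF>\<^sup>k, N0)\<close> and its inverse have norms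
  less than \<open>l\<close>.\<close>

definition wadm :: "nat \<Rightarrow> real \<Rightarrow> ((nat \<Rightarrow> 'f::real_or_complex) \<Rightarrow> real) \<Rightarrow> ((nat \<Rightarrow> 'f) \<Rightarrow> real) \<Rightarrow> bool" where
  "wadm k l N0 N1 \<longleftrightarrow> nondeg k N0 \<and> nondeg k N1 \<and>
    (\<exists>a>0. a < l \<and> (\<forall>y b. dominated k N1 y b \<longrightarrow> N0 y \<le> a * b) \<and> (\<forall>y. dominated k N1 y (a * N0 y)))"

lemma nondeg_dominated:
  assumes c: "\<And>x j. j < k \<Longrightarrow> norm (x j) \<le> c * N x" "0 \<le> c" and N: "\<And>x. 0 \<le> N x"
  shows "dominated k N y ((\<Sum>j<k. norm (y j)) * c)"
  unfolding dominated_def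
proof (intro conjI allI)
  show "0 \<le> (\<Sum>j<k. norm (y j)) * c" using c(2) by (simp add: sum_nonneg)
  fix x
  have "norm (\<Sum>j<k. x j * y j) \<le> (\<Sum>j<k. norm (x j) * norm (y j))"
    by (rule order_trans[OF norm_sum]) (simp add: norm_mult)
  also have "\<dots> \<le> (\<Sum>j<k. (c * N x) * norm (y j))" using c(1) by (intro sum_mono mult_right_mono) auto
  finally show "norm (\<Sum>j<k. x j * y j) \<le> (\<Sum>j<k. norm (y j)) * c * N x"
    by (simp add: sum_distrib_left sum_distrib_right mult_ac)
qed

context normed_nspace
begin

lemma dual_dominated:
  assumes "f \<in> vecs (dual X)" "tuple X k w"
  shows "dominated k (tnorm X k w) (\<lambda>j. f (w j)) (nrm (dual X) f)"
  unfolding dominated_def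
proof (intro conjI allI)
  show "0 \<le> nrm (dual X) f" by (rule dualD(4)[OF assms(1)])
  fix x
  show "norm (\<Sum>j<k. x j * f (w j)) \<le> nrm (dual X) f * tnorm X k w x"
    using dualD(5)[OF assms(1) comb_vecs[OF assms(2), of x]] dual_comb[OF assms, of x] by (simp add: tnorm_def)
qed

lemma dominated_dual:
  assumes "tuple X k w" "dominated k (tnorm X k w) y b"
  shows "\<exists>f\<in>vecs (dual X). (\<forall>j<k. f (w j) = y j) \<and> nrm (dual X) f \<le> b"
  using functional_with_values[OF assms(1), of b y] assms(2) unfolding dominated_def by blast

lemma wop_apply:
  assumes "f \<in> vecs (dual X)" "\<forall>j<k. f (w j) = y j"
  shows "wop k v w f = lcomb k v y" "nrm X (wop k v w f) = tnorm X k v y"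
proof -
  have "lcomb k v (\<lambda>j. f (w j)) = lcomb k v y" using assms(2) by (intro comb_cong) auto
  then show "wop k v w f = lcomb k v y" using assms(1) by (simp add: wop_def)
  then show "nrm X (wop k v w f) = tnorm X k v y" by (simp add: tnorm_def)
qed

lemma wop_self:
  assumes "f \<in> vecs (dual X)"
  shows "wop k v w f = lcomb k v (\<lambda>j. f (w j))" "nrm X (wop k v w f) = tnorm X k v (\<lambda>j. f (w j))"
  using wop_apply[OF assms, of k w "\<lambda>j. f (w j)" v] by simp_all

lemma wop_vecs: "tuple X k v \<Longrightarrow> f \<in> vecs (dual X) \<Longrightarrow> wop k v w f \<in> vecs X"
  by (simp add: wop_def)

lemma wop_image:
  assumes v: "tuple X k v" and w: "tuple X k w" "nondeg k (tnorm X k w)"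
  shows "wop k v w ` vecs (dual X) = range (lcomb k v)"
proof
  show "wop k v w ` vecs (dual X) \<subseteq> range (lcomb k v)" by (auto simp: wop_def)
  show "range (lcomb k v) \<subseteq> wop k v w ` vecs (dual X)"
  proof
    fix z assume "z \<in> range (lcomb k v)"
    then obtain y where y: "z = lcomb k v y" by blast
    obtain c where c: "0 < c" "\<And>x j. j < k \<Longrightarrow> norm (x j) \<le> c * tnorm X k w x"
      using w(2) unfolding nondeg_def by blast
    have "dominated k (tnorm X k w) y ((\<Sum>j<k. norm (y j)) * c)"
      by (rule nondeg_dominated[OF c(2)]) (use c(1) tnorm_nonneg[OF w(1)] in auto)
    from dominated_dual[OF w(1) this] obtain f where f: "f \<in> vecs (dual X)" "\<forall>j<k. f (w j) = y j" by blast
    from wop_apply(1)[OF f, of v] f(1) y show "z \<in> wop k v w ` vecs (dual X)" by (metis imageI)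
  qed
qed

lemma wop_bounded:
  assumes v: "tuple X k v" and w: "tuple X k w"
  shows "bounded_on (dual X) X (wop k v w)"
  unfolding bounded_on_def
proof (intro exI ballI)
  fix f assume f: "f \<in> vecs (dual X)"
  have "nrm X (wop k v w f) \<le> (\<Sum>j<k. norm (f (w j)) * nrm X (v j))"
    using nrm_comb_le[OF v] f by (simp add: wop_def)
  also have "\<dots> \<le> (\<Sum>j<k. (nrm (dual X) f * nrm X (w j)) * nrm X (v j))"
    using dualD(5)[OF f] v w by (intro sum_mono mult_right_mono) (auto simp: tuple_def)
  also have "\<dots> = (\<Sum>j<k. nrm X (w j) * nrm X (v j)) * nrm (dual X) f"
    by (simp add: sum_distrib_left mult_ac)
  finally show "nrm X (wop k v w f) \<le> (\<Sum>j<k. nrm X (w j) * nrm X (v j)) * nrm (dual X) f" .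
qed

lemma wop_scaling:
  assumes v: "tuple X k v" and w: "tuple X k w" and f: "f \<in> vecs (dual X)"
  shows "smul (dual X) (of_real r) f \<in> vecs (dual X) \<and>
    nrm (dual X) (smul (dual X) (of_real r) f) = \<bar>r\<bar> * nrm (dual X) f \<and>
    wop k v w (smul (dual X) (of_real r) f) = smul X (of_real r) (wop k v w f)"
proof -
  have "wop k v w (smul (dual X) (of_real r) f) = lcomb k v (\<lambda>j. of_real r * f (w j))"
    by (rule wop_apply(1)) (use dual_scale[OF f] w in \<open>auto simp: tuple_def\<close>)
  also have "\<dots> = smul X (of_real r) (wop k v w f)" using f by (simp add: comb_scale wop_def)
  finally show ?thesis using dual_scale[OF f] by blast
qed

text \<open>By the Hahn--Banach theorem the values \<open>f(w\<^sub>j)\<close> of the functionals of norm at most \<open>b\<close> are exactly the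
  \<open>y\<close> with \<open>dominated k N1 y b\<close>, where \<open>N1\<close> is the norm of \<open>w\<close>. So both norms of the operator are
  determined by the norms of the two tuples.\<close>

lemma wop_norms:
  assumes v: "tuple X k v" and w: "tuple X k w" and adm: "wadm k l (tnorm X k v) (tnorm X k w)"
  shows "op_norm (dual X) X (wop k v w) < l" "inv_norm (dual X) X (wop k v w) < l"
proof -
  obtain a where a: "0 < a" "a < l" "\<And>y b. dominated k (tnorm X k w) y b \<Longrightarrow> tnorm X k v y \<le> a * b"
    "\<And>y. dominated k (tnorm X k w) y (a * tnorm X k v y)" using adm unfolding wadm_def by blast
  have "op_norm (dual X) X (wop k v w) \<le> a"
  proof (rule op_norm_le)
    fix f assume f: "f \<in> vecs (dual X)"
    show "nrm X (wop k v w f) \<le> a * nrm (dual X) f"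
      using a(3)[OF dual_dominated[OF f w]] wop_self(2)[OF f, of k v w] by simp
  qed (use a(1) in simp)
  with a(2) show "op_norm (dual X) X (wop k v w) < l" by simp
  have "inv_norm (dual X) X (wop k v w) \<le> a"
  proof (rule inv_norm_le[OF a(1) wop_scaling[OF v w] normed])
    fix f assume f: "f \<in> vecs (dual X)"
    obtain f' where f': "f' \<in> vecs (dual X)" "\<forall>j<k. f' (w j) = f (w j)"
      "nrm (dual X) f' \<le> a * tnorm X k v (\<lambda>j. f (w j))" using dominated_dual[OF w a(4)] by blast
    show "\<exists>f'\<in>vecs (dual X). wop k v w f' = wop k v w f \<and> nrm (dual X) f' \<le> a * nrm X (wop k v w f)"
      using f' wop_apply[OF f'(1,2), of v] wop_self[OF f, of k v w] by (intro bexI[of _ f']) simp_all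
  qed
  with a(2) show "inv_norm (dual X) X (wop k v w) < l" by simp
qed

lemma wop_norms_wadm:
  assumes v: "tuple X k v" "nondeg k (tnorm X k v)" and w: "tuple X k w" "nondeg k (tnorm X k w)"
    and "0 < l" and on: "op_norm (dual X) X (wop k v w) < l" and inn: "inv_norm (dual X) X (wop k v w) < l"
  shows "wadm k l (tnorm X k v) (tnorm X k w)"
proof -
  let ?T = "wop k v w"
  have nv: "0 \<le> tnorm X k v x" and nw: "0 \<le> tnorm X k w x" for x
    by (rule tnorm_nonneg[OF v(1)], rule tnorm_nonneg[OF w(1)])
  obtain c where c: "0 < c" "\<And>x j. j < k \<Longrightarrow> norm (x j) \<le> c * tnorm X k w x"
    using w(2) unfolding nondeg_def by blast
  obtain c' where c': "0 < c'" "\<And>x j. j < k \<Longrightarrow> norm (x j) \<le> c' * tnorm X k v x"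
    using v(2) unfolding nondeg_def by blast
  have dom: "dominated k (tnorm X k w) y ((\<Sum>j<k. norm (y j)) * c)" for y
    by (rule nondeg_dominated[OF c(2)]) (use c(1) nw in auto)
  \<comment> \<open>Some bound for the inverse is needed before its norm, an infimum, can be used.\<close>
  let ?a0 = "real k * c' * c + 1"
  have pre: "\<exists>f'\<in>vecs (dual X). ?T f' = ?T f \<and> nrm (dual X) f' \<le> ?a0 * nrm X (?T f)" if f: "f \<in> vecs (dual X)" for f
  proof -
    let ?y = "\<lambda>j. f (w j)"
    obtain f' where f': "f' \<in> vecs (dual X)" "\<forall>j<k. f' (w j) = ?y j"
      "nrm (dual X) f' \<le> (\<Sum>j<k. norm (?y j)) * c" using dominated_dual[OF w(1) dom[of ?y]] by blast
    have "(\<Sum>j<k. norm (?y j)) \<le> (\<Sum>j<k. c' * tnorm X k v ?y)"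
      by (intro sum_mono c'(2)[of _ ?y]) simp
    then have "(\<Sum>j<k. norm (?y j)) * c \<le> (\<Sum>j<k. c' * tnorm X k v ?y) * c"
      using c(1) by (intro mult_right_mono) auto
    also have "\<dots> \<le> ?a0 * tnorm X k v ?y" using nv[of ?y] by (simp add: algebra_simps)
    finally show ?thesis
      using f' wop_apply[OF f'(1,2), of v] wop_self[OF f, of k v w] by (intro bexI[of _ f']) simp_all
  qed
  have a0: "0 < ?a0" using c(1) c'(1) by (simp add: add_nonneg_pos)
  have im: "?T ` vecs (dual X) \<subseteq> vecs X" using wop_vecs[OF v(1)] by blast
  have "\<exists>a\<ge>0. a < l \<and> (\<forall>f\<in>vecs (dual X). \<exists>f'\<in>vecs (dual X). ?T f' = ?T f \<and> nrm (dual X) f' \<le> a * nrm X (?T f))"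
    by (rule inv_norm_less[OF inn wop_scaling[OF v(1) w(1)] normed im a0 pre])
  then obtain a where a: "0 \<le> a" "a < l" "\<And>f. f \<in> vecs (dual X) \<Longrightarrow>
    \<exists>f'\<in>vecs (dual X). ?T f' = ?T f \<and> nrm (dual X) f' \<le> a * nrm X (?T f)" by blast
  have ob: "0 \<le> op_norm (dual X) X ?T" "\<And>f. f \<in> vecs (dual X) \<Longrightarrow> nrm X (?T f) \<le> op_norm (dual X) X ?T * nrm (dual X) f"
    using op_norm_bound[of "dual X" X ?T] wop_bounded[OF v(1) w(1)] dualD(4) unfolding bounded_on_def by blast+
  define b where "b = max (max a (op_norm (dual X) X ?T)) (l / 2)"
  have b: "0 < b" "b < l" "a \<le> b" "op_norm (dual X) X ?T \<le> b"
    using a(2) on \<open>0 < l\<close> by (auto simp: b_def)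
  have "tnorm X k v y \<le> b * r" if y: "dominated k (tnorm X k w) y r" for y r
  proof -
    obtain f where f: "f \<in> vecs (dual X)" "\<forall>j<k. f (w j) = y j" "nrm (dual X) f \<le> r"
      using dominated_dual[OF w(1) y] by blast
    have "tnorm X k v y \<le> op_norm (dual X) X ?T * nrm (dual X) f"
      using ob(2)[OF f(1)] wop_apply(2)[OF f(1,2), of v] by simp
    also have "\<dots> \<le> b * r" using b f(3) dualD(4)[OF f(1)] by (intro mult_mono) auto
    finally show ?thesis .
  qed
  moreover have "dominated k (tnorm X k w) y (b * tnorm X k v y)" for y
  proof -
    obtain f where f: "f \<in> vecs (dual X)" "\<forall>j<k. f (w j) = y j"
      using dominated_dual[OF w(1) dom[of y]] by blast
    obtain f' where f': "f' \<in> vecs (dual X)" "?T f' = ?T f" "nrm (dual X) f' \<le> a * nrm X (?T f)"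
      using a(3)[OF f(1)] by blast
    have "lcomb k v (\<lambda>j. f' (w j)) = lcomb k v y"
      using f'(2) wop_self(1)[OF f'(1), of k v w] wop_apply(1)[OF f, of v] by simp
    then have e: "f' (w j) = y j" if "j < k" for j
      using nondeg_tuple_inj[OF v(2) _ that, of "\<lambda>j. f' (w j)" y] by simp
    have le: "nrm (dual X) f' \<le> b * tnorm X k v y"
      using f'(3) wop_apply(2)[OF f, of v] mult_right_mono[OF b(3) nv[of y]] by simp
    show ?thesis unfolding dominated_def
    proof (intro conjI allI)
      show "0 \<le> b * tnorm X k v y" using b(1) nv by simp
      fix x
      have "norm (\<Sum>j<k. x j * f' (w j)) \<le> nrm (dual X) f' * tnorm X k w x"
        using dual_dominated[OF f'(1) w(1)] by (simp add: dominated_def)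
      also have "\<dots> \<le> (b * tnorm X k v y) * tnorm X k w x" by (rule mult_right_mono[OF le nw])
      finally show "norm (\<Sum>j<k. x j * y j) \<le> b * tnorm X k v y * tnorm X k w x" by (simp add: e)
    qed
  qed
  ultimately show ?thesis unfolding wadm_def using v(2) w(2) b(1,2) by blast
qed

end


lemma near_nonneg:
  assumes "near \<delta> N N'" "0 < \<delta>"
  shows "0 \<le> N x" "0 \<le> N' x"
proof -
  have *: "0 \<le> M x" if "near \<delta> M M'" for M M' :: "(nat \<Rightarrow> 'a) \<Rightarrow> real"
  proof -
    have "M x \<le> (1 + \<delta>) * M' x" "M' x \<le> (1 + \<delta>) * M x" using that by (simp_all add: near_def)
    then have "M x \<le> (1 + \<delta>) * ((1 + \<delta>) * M x)"
      using assms(2) mult_left_mono[of "M' x" "(1 + \<delta>) * M x" "1 + \<delta>"] by linarith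
    then have "0 \<le> (\<delta> * (2 + \<delta>)) * M x" by (simp add: algebra_simps)
    moreover have "0 < \<delta> * (2 + \<delta>)" using assms(2) by simp
    ultimately show ?thesis using zero_le_mult_iff[of "\<delta> * (2 + \<delta>)" "M x"] by linarith
  qed
  show "0 \<le> N x" by (rule *[OF assms(1)])
  show "0 \<le> N' x" using assms(1) by (intro *[of N' N]) (simp add: near_sym)
qed

lemma wadm_local:
  assumes "wadm k l N0 N1"
  shows "\<exists>\<delta>>0. \<delta> \<le> 1 \<and> (\<forall>N0' N1'. near \<delta> N0 N0' \<longrightarrow> near \<delta> N1 N1' \<longrightarrow> wadm k l N0' N1')"
proof -
  obtain a where nd: "nondeg k N0" "nondeg k N1" and a: "0 < a" "a < l"
    "\<And>y b. dominated k N1 y b \<Longrightarrow> N0 y \<le> a * b" "\<And>y. dominated k N1 y (a * N0 y)"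
    using assms unfolding wadm_def by blast
  define \<delta> where "\<delta> = min 1 ((l - a) / (6 * a))"
  have \<delta>: "0 < \<delta>" "\<delta> \<le> 1" "\<delta> \<le> (l - a) / (6 * a)" using a(1,2) by (auto simp: \<delta>_def)
  define a' where "a' = (1 + \<delta>) * (1 + \<delta>) * a"
  have a': "0 < a'" "a' < l"
  proof -
    show "0 < a'" using a(1) \<delta>(1) by (simp add: a'_def)
    have "\<delta> * \<delta> \<le> \<delta>" using \<delta>(1,2) by (simp add: mult_left_le)
    then have "(1 + \<delta>) * (1 + \<delta>) \<le> 1 + 3 * \<delta>" by (simp add: algebra_simps)
    then have "a' \<le> (1 + 3 * \<delta>) * a" unfolding a'_def using a(1) by (intro mult_right_mono) auto
    also have "\<dots> = a + 3 * (\<delta> * a)" by (simp add: algebra_simps)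
    also have "\<delta> * a \<le> (l - a) / 6" using \<delta>(3) a(1) by (simp add: pos_le_divide_eq mult_ac)
    also have "a + 3 * ((l - a) / 6) < l" using a(2) by (simp add: field_simps)
    finally show "a' < l" by simp
  qed
  have "wadm k l N0' N1'" if n0: "near \<delta> N0 N0'" and n1: "near \<delta> N1 N1'" for N0' N1'
  proof -
    note nn = near_nonneg[OF n0 \<delta>(1)] near_nonneg[OF n1 \<delta>(1)]
    have "N0' y \<le> a' * b" if d: "dominated k N1' y b" for y b
    proof -
      have b: "0 \<le> b" "\<And>x. norm (\<Sum>j<k. x j * y j) \<le> b * N1' x" using d by (simp_all add: dominated_def)
      have "norm (\<Sum>j<k. x j * y j) \<le> ((1 + \<delta>) * b) * N1 x" for x
      proof -
        have "b * N1' x \<le> b * ((1 + \<delta>) * N1 x)" using n1 b(1) by (intro mult_left_mono) (auto simp: near_def)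
        then show ?thesis using b(2)[of x] by (simp add: mult_ac)
      qed
      then have "dominated k N1 y ((1 + \<delta>) * b)" using b(1) \<delta>(1) by (simp add: dominated_def)
      from a(3)[OF this] have "(1 + \<delta>) * N0 y \<le> (1 + \<delta>) * (a * ((1 + \<delta>) * b))"
        using \<delta>(1) by (intro mult_left_mono) auto
      moreover have "N0' y \<le> (1 + \<delta>) * N0 y" using n0 by (simp add: near_def)
      ultimately show ?thesis by (simp add: a'_def mult_ac)
    qed
    moreover have "dominated k N1' y (a' * N0' y)" for y
      unfolding dominated_def
    proof (intro conjI allI)
      show "0 \<le> a' * N0' y" using a'(1) nn(2) by simp
      fix x
      have "norm (\<Sum>j<k. x j * y j) \<le> (a * N0 y) * N1 x" using a(4)[of y] by (simp add: dominated_def)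
      also have "\<dots> \<le> (a * ((1 + \<delta>) * N0' y)) * ((1 + \<delta>) * N1' x)"
        using n0 n1 nn a(1) \<delta>(1) by (intro mult_mono) (auto simp: near_def)
      also have "\<dots> = a' * N0' y * N1' x" by (simp add: a'_def mult_ac)
      finally show "norm (\<Sum>j<k. x j * y j) \<le> a' * N0' y * N1' x" .
    qed
    moreover have "nondeg k N0'" "nondeg k N1'"
      using nondeg_near[OF nd(1) n0] nondeg_near[OF nd(2) n1] \<delta>(1) by simp_all
    ultimately show ?thesis using a' unfolding wadm_def by blast
  qed
  with \<delta>(1,2) show ?thesis by blast
qed

context normed_nspace
begin

lemma dual_diff: "f \<in> vecs (dual X) \<Longrightarrow> x \<in> vecs X \<Longrightarrow> y \<in> vecs X \<Longrightarrow> f (x - y) = f x - f y"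
  using dualD(1)[of f "x - y" y] by simp

lemma wop_lip:
  assumes t: "tuple X k v" "tuple X k w" "tuple X k v'" "tuple X k w'"
    and L: "0 \<le> L" "\<And>j. j < k \<Longrightarrow> nrm X (w j) \<le> L" "\<And>j. j < k \<Longrightarrow> nrm X (v' j) \<le> L"
  shows "op_dist (dual X) X (wop k v w) (wop k v' w') \<le> L * (tdist X k v v' + tdist X k w w')"
proof (rule op_dist_le)
  show "0 \<le> L * (tdist X k v v' + tdist X k w w')" using L(1) tdist_nonneg t by simp
  fix f assume f: "f \<in> vecs (dual X)"
  let ?n = "nrm (dual X) f"
  have V: "v j \<in> vecs X" "w j \<in> vecs X" "v' j \<in> vecs X" "w' j \<in> vecs X" if "j < k" for j
    using t that by (simp_all add: tuple_def)
  have "wop k v w f - wop k v' w' f = (\<Sum>j<k. smul X (f (w j)) (v j - v' j) + smul X (f (w j - w' j)) (v' j))"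
    using f V by (simp add: wop_def comb_def dual_diff scale_left_diff_distrib scale_right_diff_distrib flip: sum_subtractf)
  then have "nrm X (wop k v w f - wop k v' w' f) \<le> (\<Sum>j<k. nrm X (smul X (f (w j)) (v j - v' j) + smul X (f (w j - w' j)) (v' j)))"
    using nrm_sum[of "{..<k}"] V by simp
  also have "\<dots> \<le> (\<Sum>j<k. (L * nrm X (v j - v' j) + L * nrm X (w j - w' j)) * ?n)"
  proof (rule sum_mono)
    fix j assume "j \<in> {..<k}"
    then have j: "j < k" by simp
    note V = V[OF j]
    have n0: "0 \<le> ?n" by (rule dualD(4)[OF f])
    have "nrm X (smul X (f (w j)) (v j - v' j)) \<le> (?n * nrm X (w j)) * nrm X (v j - v' j)"
      using dualD(5)[OF f V(2)] V by (simp add: mult_right_mono)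
    also have "\<dots> \<le> (?n * L) * nrm X (v j - v' j)"
      using L(2)[OF j] n0 V by (intro mult_right_mono mult_left_mono) auto
    finally have 1: "nrm X (smul X (f (w j)) (v j - v' j)) \<le> (?n * L) * nrm X (v j - v' j)" .
    have "nrm X (smul X (f (w j - w' j)) (v' j)) \<le> (?n * nrm X (w j - w' j)) * nrm X (v' j)"
      using dualD(5)[OF f vecs_diff[OF V(2,4)]] V by (simp add: mult_right_mono)
    also have "\<dots> \<le> (?n * nrm X (w j - w' j)) * L"
      using L(3)[OF j] n0 V by (intro mult_left_mono) auto
    finally have 2: "nrm X (smul X (f (w j - w' j)) (v' j)) \<le> (?n * nrm X (w j - w' j)) * L" .
    have "nrm X (smul X (f (w j)) (v j - v' j) + smul X (f (w j - w' j)) (v' j)) \<le>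
        nrm X (smul X (f (w j)) (v j - v' j)) + nrm X (smul X (f (w j - w' j)) (v' j))"
      using V by (intro nrm_triangle) simp_all
    with 1 2 show "nrm X (smul X (f (w j)) (v j - v' j) + smul X (f (w j - w' j)) (v' j)) \<le>
        (L * nrm X (v j - v' j) + L * nrm X (w j - w' j)) * ?n" by (simp add: algebra_simps)
  qed
  also have "\<dots> = L * (tdist X k v v' + tdist X k w w') * ?n"
    by (simp add: tdist_def sum.distrib sum_distrib_left sum_distrib_right distrib_left distrib_right mult_ac)
  finally show "nrm X (wop k v w f - wop k v' w' f) \<le> L * (tdist X k v v' + tdist X k w w') * ?n" .
qed

lemma dual_compose:
  assumes Y: "normed_space Y" and R: "isom X Y R" and f: "f \<in> vecs (dual Y)"
  shows "compose (vecs X) f R \<in> vecs (dual X)" "nrm (dual X) (compose (vecs X) f R) \<le> nrm (dual Y) f"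
proof -
  interpret Y: normed_nspace Y using Y by unfold_locales
  have R': "\<And>x. x \<in> vecs X \<Longrightarrow> R x \<in> vecs Y" "\<And>x y. x \<in> vecs X \<Longrightarrow> y \<in> vecs X \<Longrightarrow> R (x + y) = R x + R y"
    "\<And>a x. x \<in> vecs X \<Longrightarrow> R (smul X a x) = smul Y a (R x)" "\<And>x. x \<in> vecs X \<Longrightarrow> nrm Y (R x) = nrm X x"
    using R by (auto simp: isom_def lin_on_def)
  have b: "norm (f (R x)) \<le> nrm (dual Y) f * nrm X x" if "x \<in> vecs X" for x
    using Y.dualD(5)[OF f R'(1)[OF that]] R'(4)[OF that] by simp
  have "restrict (\<lambda>x. f (R x)) (vecs X) \<in> vecs (dual X)"
    by (rule dualI[where b = "nrm (dual Y) f"]) (use b R' Y.dualD(1,2)[OF f] in simp_all)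
  then show "compose (vecs X) f R \<in> vecs (dual X)" by (simp add: compose_def)
  show "nrm (dual X) (compose (vecs X) f R) \<le> nrm (dual Y) f"
    by (rule dual_norm_le[OF Y.dualD(4)[OF f]]) (use b in \<open>simp add: compose_def\<close>)
qed

text \<open>Conjugation by isometries acts on the two tuples.\<close>

lemma conj_wop:
  assumes Y: "normed_space Y" and R0: "isom X Y R0" and R1: "isom X Y R1" and v: "tuple X k v" and w: "tuple X k w"
  shows "conj_op X Y R0 R1 (wop k v w) = normed_nspace.wop Y k (R0 \<circ> v) (R1 \<circ> w)"
proof -
  interpret Y: normed_nspace Y using Y by unfold_locales
  show ?thesis
  proof (rule ext)
    fix f
    show "conj_op X Y R0 R1 (wop k v w) f = Y.wop k (R0 \<circ> v) (R1 \<circ> w) f"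
    proof (cases "f \<in> vecs (dual Y)")
      case True
      have "wop k v w (compose (vecs X) f R1) = lcomb k v (\<lambda>j. f (R1 (w j)))"
        by (rule wop_apply(1)[OF dual_compose(1)[OF Y R1 True]]) (use w in \<open>simp add: tuple_def compose_def\<close>)
      then show ?thesis using True lin_on_comb[OF isomD(1)[OF R0] v] by (simp add: conj_op_def Y.wop_def)
    next
      case False
      then show ?thesis by (simp add: conj_op_def Y.wop_def)
    qed
  qed
qed

lemma conj_op_contraction:
  assumes Y: "normed_space Y" and R0: "isom X Y R0" and R1: "isom X Y R1"
    and S: "\<And>f. f \<in> vecs (dual X) \<Longrightarrow> S f \<in> vecs X" "bounded_on (dual X) X S"
    and T: "\<And>f. f \<in> vecs (dual X) \<Longrightarrow> T f \<in> vecs X" "bounded_on (dual X) X T"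
  shows "op_dist (dual Y) Y (conj_op X Y R0 R1 S) (conj_op X Y R0 R1 T) \<le> op_dist (dual X) X S T"
proof -
  interpret Y: normed_nspace Y using Y by unfold_locales
  have d: "0 \<le> op_dist (dual X) X S T"
    "\<And>f. f \<in> vecs (dual X) \<Longrightarrow> nrm X (S f - T f) \<le> op_dist (dual X) X S T * nrm (dual X) f"
    using op_dist_facts(1,2)[of "dual X" S T] dualD(4) S T by blast+
  show ?thesis
  proof (rule Y.op_dist_le[OF d(1)])
    fix f assume f: "f \<in> vecs (dual Y)"
    let ?f = "compose (vecs X) f R1"
    note c = dual_compose[OF Y R1 f]
    have "nrm Y (conj_op X Y R0 R1 S f - conj_op X Y R0 R1 T f) = nrm Y (R0 (S ?f - T ?f))"
      using f lin_on_diff[OF isomD(1)[OF R0] S(1)[OF c(1)] T(1)[OF c(1)]] by (simp add: conj_op_def)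
    also have "\<dots> = nrm X (S ?f - T ?f)"
      using S(1)[OF c(1)] T(1)[OF c(1)] by (intro isomD(2)[OF R0]) simp
    also have "\<dots> \<le> op_dist (dual X) X S T * nrm (dual X) ?f" by (rule d(2)[OF c(1)])
    also have "\<dots> \<le> op_dist (dual X) X S T * nrm (dual Y) f" by (rule mult_left_mono[OF c(2) d(1)])
    finally show "nrm Y (conj_op X Y R0 R1 S f - conj_op X Y R0 R1 T f) \<le> op_dist (dual X) X S T * nrm (dual Y) f" .
  qed
qed

text \<open>The functionals of a subspace are restrictions of functionals of the same norm, so two operators
  are not further apart on the dual of the subspace than on the dual of the whole space.\<close>

lemma wop_dist_sub:
  assumes U: "subspace U" "U \<subseteq> vecs X"
    and t: "tuple (sub X U) k v" "tuple (sub X U) k w" "tuple (sub X U) k v'" "tuple (sub X U) k w'"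
  shows "op_dist (dual (sub X U)) X (normed_nspace.wop (sub X U) k v w) (normed_nspace.wop (sub X U) k v' w') \<le>
    op_dist (dual X) X (wop k v w) (wop k v' w')"
proof -
  interpret U: normed_nspace "sub X U" using normed_sub[OF U] by unfold_locales
  have tX: "tuple X k v" "tuple X k w" "tuple X k v'" "tuple X k w'" using t U(2) by (auto simp: tuple_def)
  let ?d = "op_dist (dual X) X (wop k v w) (wop k v' w')"
  have d: "0 \<le> ?d"
    "\<And>f. f \<in> vecs (dual X) \<Longrightarrow> nrm X (wop k v w f - wop k v' w' f) \<le> ?d * nrm (dual X) f"
    using op_dist_facts(1,2)[of "dual X" "wop k v w" "wop k v' w'"] dualD(4) wop_vecs[OF tX(1)] wop_vecs[OF tX(3)]
      wop_bounded[OF tX(1,2)] wop_bounded[OF tX(3,4)] by blast+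
  show ?thesis
  proof (rule op_dist_le[OF d(1)])
    fix f assume f: "f \<in> vecs (dual (sub X U))"
    obtain h where h: "h \<in> vecs (dual X)" "\<And>x. x \<in> U \<Longrightarrow> h x = f x"
      "\<And>x. x \<in> vecs X \<Longrightarrow> norm (h x) \<le> nrm (dual (sub X U)) f * nrm X x"
      using hahn_banach[OF U, of f "nrm (dual (sub X U)) f"] U.dualD[OF f] by auto
    have hn: "nrm (dual X) h \<le> nrm (dual (sub X U)) f" by (rule dual_norm_le[OF U.dualD(4)[OF f] h(3)])
    have e: "U.wop k a b f = wop k a b h" if "tuple (sub X U) k b" for a b
    proof -
      have "wop k a b h = lcomb k a (\<lambda>j. f (b j))"
        by (rule wop_apply(1)[OF h(1)]) (use that h(2) in \<open>simp add: tuple_def\<close>)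
      then show ?thesis using f by (simp add: U.wop_def)
    qed
    have "nrm X (U.wop k v w f - U.wop k v' w' f) = nrm X (wop k v w h - wop k v' w' h)"
      by (simp only: e[OF t(2)] e[OF t(4)])
    also have "\<dots> \<le> op_dist (dual X) X (wop k v w) (wop k v' w') * nrm (dual X) h" by (rule d(2)[OF h(1)])
    also have "\<dots> \<le> op_dist (dual X) X (wop k v w) (wop k v' w') * nrm (dual (sub X U)) f"
      by (rule mult_left_mono[OF hn d(1)])
    finally show "nrm X (U.wop k v w f - U.wop k v' w' f) \<le> op_dist (dual X) X (wop k v w) (wop k v' w') * nrm (dual (sub X U)) f" .
  qed
qed

end

context seq_setting
begin

lemma op_of_adjoint:
  "op_of k Y v (coord_adjoint k (op_of k Y w) f) = comb (smul Y) k v (\<lambda>j. f (op_of k Y w (unit_vec j)))"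
proof -
  let ?y = "\<lambda>j. f (op_of k Y w (unit_vec j))"
  have s: "fs_scale a (unit_vec j) = Poly_Mapping.single j a" for a :: 'f and j
    by (rule poly_mapping_eqI) (simp add: lookup_fs_scale lookup_single when_def)
  have c: "coord_adjoint k (op_of k Y w) f = comb fs_scale k unit_vec ?y"
    by (simp add: coord_adjoint_def comb_def s)
  have "op_of k Y v (comb fs_scale k unit_vec y) = comb (smul Y) k v y" for y
  proof -
    have "comb fs_scale k unit_vec y \<in> coord_space k" by (simp add: coord_space_range)
    moreover have "comb (smul Y) k v (coord (comb fs_scale k unit_vec y)) = comb (smul Y) k v y"
      by (rule comb_cong) (simp_all add: lookup_comb_unit)
    ultimately show ?thesis by (simp add: op_of_def)
  qed
  then show ?thesis unfolding c .
qed

lemma op_of_unit: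
  fixes Y :: "('f, 'w::ab_group_add) nspace"
  assumes "normed_space Y" "j < k"
  shows "op_of k Y w (unit_vec j) = w j"
proof -
  interpret Y: normed_nspace Y using assms(1) by unfold_locales
  have "coord (unit_vec j :: nat \<Rightarrow>\<^sub>0 'f) = (\<lambda>i. if i = j then 1 else 0)"
    by (simp add: fun_eq_iff lookup_single when_def eq_commute)
  then show ?thesis using Y.comb_unit[OF assms(2), of w] unit_coord[OF assms(2)] by (simp add: op_of_def)
qed

lemma wop_coord:
  fixes Y :: "('f, 'w::ab_group_add) nspace"
  assumes Y: "normed_space Y"
  shows "normed_nspace.wop Y k v w = (\<lambda>f\<in>vecs (dual Y). op_of k Y v (coord_adjoint k (op_of k Y w) f))"
proof -
  interpret Y: normed_nspace Y using Y by unfold_locales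
  have "Y.lcomb k v (\<lambda>j. f (op_of k Y w (unit_vec j))) = Y.lcomb k v (\<lambda>j. f (w j))" for f
    using op_of_unit[OF Y] by (intro comb_cong) auto
  then show ?thesis unfolding Y.wop_def op_of_adjoint by simp
qed

text \<open>The two factors through \<open>\<bbbF>\<^sup>k\<close> have rank \<open>k\<close>, so that both tuples are independent.\<close>

lemma Lkw_less_wop:
  fixes Y :: "('f, 'w::ab_group_add) nspace"
  assumes Y: "normed_space Y" and "0 < l"
  shows "Lkw_less k l Y = {normed_nspace.wop Y k v w | v w. tuple Y k v \<and> tuple Y k w \<and> wadm k l (tnorm Y k v) (tnorm Y k w)}"
proof -
  interpret Y: normed_nspace Y using Y by unfold_locales
  have rk: "op_of k Y v \<in> rank_from_coord k Y" if "tuple Y k v" "nondeg k (tnorm Y k v)" for v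
    using op_of_facts(1,2)[OF Y that(1)] Y.Gr_tuple[OF that] by (simp add: rank_from_coord_def lin_def)
  have rk': "\<exists>v. T = op_of k Y v \<and> tuple Y k v \<and> nondeg k (tnorm Y k v)" if "T \<in> rank_from_coord k Y" for T
  proof -
    have T: "T \<in> lin (En k) Y" "T ` coord_space k \<in> Gr k Y" using that by (simp_all add: rank_from_coord_def lin_def)
    note v = lin_op_of[OF Y T(1)]
    have "nondeg k (tnorm Y k (T \<circ> unit_vec))"
      by (rule Y.Gr_nondeg[OF v(1)]) (use T(2) op_of_facts(2)[OF Y v(1)] v(2) in metis)
    with v show ?thesis by blast
  qed
  show ?thesis
  proof (intro equalityI subsetI)
    fix T assume T: "T \<in> Lkw_less k l Y"
    then obtain T0 T1 where T01: "T0 \<in> rank_from_coord k Y" "T1 \<in> rank_from_coord k Y"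
      "T = (\<lambda>f\<in>vecs (dual Y). T0 (coord_adjoint k T1 f))" unfolding Lkw_less_def Lkw_def by blast
    obtain v where v: "T0 = op_of k Y v" "tuple Y k v" "nondeg k (tnorm Y k v)" using rk'[OF T01(1)] by blast
    obtain w where w: "T1 = op_of k Y w" "tuple Y k w" "nondeg k (tnorm Y k w)" using rk'[OF T01(2)] by blast
    have e: "T = Y.wop k v w" unfolding T01(3) v(1) w(1) wop_coord[OF Y] ..
    have "op_norm (dual Y) Y T < l" "inv_norm (dual Y) Y T < l" using T by (simp_all add: Lkw_less_def)
    then have "wadm k l (tnorm Y k v) (tnorm Y k w)"
      unfolding e by (rule Y.wop_norms_wadm[OF v(2,3) w(2,3) \<open>0 < l\<close>])
    with e v(2) w(2) show "T \<in> {Y.wop k v w | v w. tuple Y k v \<and> tuple Y k w \<and> wadm k l (tnorm Y k v) (tnorm Y k w)}"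
      by blast
  next
    fix T assume "T \<in> {Y.wop k v w | v w. tuple Y k v \<and> tuple Y k w \<and> wadm k l (tnorm Y k v) (tnorm Y k w)}"
    then obtain v w where T: "T = Y.wop k v w" "tuple Y k v" "tuple Y k w" "wadm k l (tnorm Y k v) (tnorm Y k w)" by blast
    have nd: "nondeg k (tnorm Y k v)" "nondeg k (tnorm Y k w)" using T(4) by (simp_all add: wadm_def)
    have "T ` vecs (dual Y) \<in> Gr k Y"
      unfolding T(1) Y.wop_image[OF T(2,3) nd(2)] by (rule Y.Gr_tuple[OF T(2) nd(1)])
    moreover have "T = (\<lambda>f\<in>vecs (dual Y). op_of k Y v (coord_adjoint k (op_of k Y w) f))"
      unfolding T(1) by (rule wop_coord[OF Y])
    then have "\<exists>T0\<in>rank_from_coord k Y. \<exists>T1\<in>rank_from_coord k Y. T = (\<lambda>f\<in>vecs (dual Y). T0 (coord_adjoint k T1 f))"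
      using rk[OF T(2) nd(1)] rk[OF T(3) nd(2)] by blast
    ultimately show "T \<in> Lkw_less k l Y"
      using Y.wop_norms[OF T(2,3,4)] by (simp add: Lkw_less_def Lkw_def T(1))
  qed
qed

end


context fraisse_setting
begin

text \<open>Let \<open>f\<^sub>j\<close> be functionals that are dual to \<open>w\<close>, so that the operator of \<open>(v, w)\<close> maps \<open>f\<^sub>j\<close> to \<open>v\<^sub>j\<close>. For
  a nearby operator \<open>p\<close> the vectors \<open>p f\<^sub>j\<close> are close to \<open>v\<^sub>j\<close>, hence a basis of the range of \<open>p\<close>;
  with respect to this basis \<open>p\<close> is described by a second tuple \<open>w'\<close>. Since the coefficients of this
  basis are controlled, each functional takes almost the same values on \<open>w'\<close> and on \<open>w\<close>.\<close>

lemma wop_lift: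
  assumes adm: "wadm k l (tnorm F k v) (tnorm F k w)" and "0 < l" "0 < \<delta>"
  shows "\<exists>\<eta>>0. \<forall>p\<in>Lkw_less k l F. op_dist (dual F) F p (F.wop k v w) < \<eta> \<longrightarrow> (\<exists>v' w'. p = F.wop k v' w' \<and>
    wadm k l (tnorm F k v') (tnorm F k w') \<and> near \<delta> (tnorm F k v) (tnorm F k v') \<and> near \<delta> (tnorm F k w) (tnorm F k w'))"
proof -
  let ?T = "F.wop k v w"
  have nd: "nondeg k (tnorm F k v)" "nondeg k (tnorm F k w)" using adm by (simp_all add: wadm_def)
  have nn: "0 \<le> tnorm F k a x" for a x by (rule F.tnorm_nonneg[OF tuple_F])
  obtain c where c: "0 < c" "\<And>x j. j < k \<Longrightarrow> norm (x j) \<le> c * tnorm F k w x"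
    using nd(2) unfolding nondeg_def by blast
  obtain c' where c': "0 < c'" "\<And>x j. j < k \<Longrightarrow> norm (x j) \<le> c' * tnorm F k v x"
    using nd(1) unfolding nondeg_def by blast
  define e where "e j = (\<lambda>i. if i = j then 1 else (0::'f))" for j :: nat
  have "\<exists>f. f \<in> vecs (dual F) \<and> (\<forall>i<k. f (w i) = e j i)" for j
  proof -
    have "dominated k (tnorm F k w) (e j) ((\<Sum>i<k. norm (e j i)) * c)"
      by (rule nondeg_dominated[OF c(2)]) (use c(1) nn in auto)
    from F.dominated_dual[OF tuple_F this] show ?thesis by blast
  qed
  then obtain f where f: "\<And>j. f j \<in> vecs (dual F)" "\<And>j. \<forall>i<k. f j (w i) = e j i" by metis
  define b where "b = (\<Sum>j<k. nrm (dual F) (f j))"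
  have b: "nrm (dual F) (f j) \<le> b" if "j < k" for j
    unfolding b_def using F.dualD(4)[OF f(1)] that by (intro member_le_sum) auto
  have b0: "0 \<le> b" unfolding b_def using F.dualD(4)[OF f(1)] by (intro sum_nonneg) auto
  have Tf: "?T (f j) = v j" if "j < k" for j
    using F.wop_apply(1)[OF f(1) f(2), of v j] F.comb_unit[OF that, of v] by (simp add: e_def)
  have mn: "0 < min \<delta> 1" using \<open>0 < \<delta>\<close> by simp
  obtain \<eta>v where \<eta>v: "0 < \<eta>v" "\<And>v'. tdist F k v v' \<le> \<eta>v \<Longrightarrow> near (min \<delta> 1) (tnorm F k v) (tnorm F k v')"
    using F.near_if_close[OF tuple_F nd(1) mn] tuple_F by blast
  obtain \<eta>w where \<eta>w: "0 < \<eta>w" "\<And>w'. tdist F k w w' \<le> \<eta>w \<Longrightarrow> near \<delta> (tnorm F k w) (tnorm F k w')"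
    using F.near_if_close[OF tuple_F nd(2) \<open>0 < \<delta>\<close>] tuple_F by blast
  define W where "W = (\<Sum>j<k. norm (w j))"
  define q where "q = real k * (2 * c' * (1 + b * W))"
  have W: "0 \<le> W" unfolding W_def by (simp add: sum_nonneg)
  have q: "0 \<le> q" unfolding q_def using c'(1) b0 W by simp
  define \<eta> where "\<eta> = min (\<eta>v / (real k * b + 1)) (\<eta>w / (q + 1))"
  have kb: "0 < real k * b + 1" "0 < q + 1" using b0 q by (simp_all add: add_nonneg_pos)
  have \<eta>: "0 < \<eta>" using \<eta>v(1) \<eta>w(1) kb by (simp add: \<eta>_def)
  have "\<eta> * (real k * b + 1) \<le> \<eta>v" "\<eta> * (q + 1) \<le> \<eta>w"
    using kb by (simp_all add: \<eta>_def pos_le_divide_eq[symmetric])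
  then have \<eta>b: "\<eta> * (real k * b) \<le> \<eta>v" "\<eta> * q \<le> \<eta>w" using \<eta> by (simp_all add: distrib_left)
  have "\<exists>v' w'. p = F.wop k v' w' \<and> wadm k l (tnorm F k v') (tnorm F k w') \<and>
      near \<delta> (tnorm F k v) (tnorm F k v') \<and> near \<delta> (tnorm F k w) (tnorm F k w')"
    if p: "p \<in> Lkw_less k l F" and dp: "op_dist (dual F) F p ?T < \<eta>" for p
  proof -
    obtain a0 a1 where a: "p = F.wop k a0 a1" "wadm k l (tnorm F k a0) (tnorm F k a1)"
      using p unfolding Lkw_less_wop[OF normed_F \<open>0 < l\<close>] by blast
    have nda: "nondeg k (tnorm F k a0)" using a(2) by (simp add: wadm_def)
    have "nrm F (p h - ?T h) \<le> op_dist (dual F) F p ?T * nrm (dual F) h" if "h \<in> vecs (dual F)" for h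
      unfolding a(1)
      by (rule F.op_dist_facts(2)[OF F.dualD(4) F.wop_vecs[OF tuple_F] F.wop_bounded[OF tuple_F tuple_F]
            F.wop_vecs[OF tuple_F] F.wop_bounded[OF tuple_F tuple_F] that])
    then have pT: "norm (p h - ?T h) \<le> \<eta> * nrm (dual F) h" if "h \<in> vecs (dual F)" for h
      using mult_right_mono[OF less_imp_le[OF dp] F.dualD(4)[OF that]] that by fastforce
    define v' where "v' j = p (f j)" for j
    have vv: "norm (v j - v' j) \<le> \<eta> * b" if "j < k" for j
    proof -
      have "norm (v j - v' j) \<le> \<eta> * nrm (dual F) (f j)"
        using pT[OF f(1)[of j]] by (simp add: v'_def Tf[OF that] norm_minus_commute)
      also have "\<dots> \<le> \<eta> * b" using b[OF that] \<eta> by (intro mult_left_mono) auto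
      finally show ?thesis .
    qed
    have "tdist F k v v' \<le> (\<Sum>j<k. \<eta> * b)" unfolding tdist_def using vv by (intro sum_mono) simp
    also have "\<dots> \<le> \<eta>v" using \<eta>b(1) by (simp add: mult_ac)
    finally have nv: "near (min \<delta> 1) (tnorm F k v) (tnorm F k v')" by (rule \<eta>v(2))
    have ndv': "nondeg k (tnorm F k v')" using nondeg_near[OF nd(1) nv] mn by simp
    have v'in: "v' j \<in> tspan k a0" for j
      unfolding v'_def a(1) F.wop_self(1)[OF f(1)] tspan_def by simp
    have "tspan k a0 = tspan k v'" by (rule tspan_eqI[OF tspan_Gr[OF nda] ndv' v'in])
    then have "\<exists>x. a0 i = F.lcomb k v' x" if "i < k" for i
      using F.comb_unit[OF that, of a0] unfolding tspan_def by (metis rangeE rangeI)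
    then obtain B where B: "\<And>i. i < k \<Longrightarrow> a0 i = F.lcomb k v' (B i)" by metis
    define w' where "w' j = F.lcomb k a1 (\<lambda>i. B i j)" for j
    note sc = F.scale_sum_right[unfolded banach_nspace_simps] F.scale_scale[unfolded banach_nspace_simps]
      F.scale_sum_left[unfolded banach_nspace_simps]
    have pw: "p h = F.wop k v' w' h" if h: "h \<in> vecs (dual F)" for h
    proof -
      have "p h = (\<Sum>i<k. s (h (a1 i)) (F.lcomb k v' (B i)))"
        unfolding a(1) F.wop_self(1)[OF h] unfolding comb_def[of _ _ a0] using B by simp
      also have "\<dots> = (\<Sum>i<k. \<Sum>j<k. s (h (a1 i) * B i j) (v' j))"
        by (simp add: comb_def sc(1,2))
      also have "\<dots> = (\<Sum>j<k. \<Sum>i<k. s (h (a1 i) * B i j) (v' j))" by (rule sum.swap)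
      also have "\<dots> = (\<Sum>j<k. s (\<Sum>i<k. B i j * h (a1 i)) (v' j))"
        by (simp add: sc(3) mult.commute)
      also have "\<dots> = F.wop k v' w' h"
        unfolding F.wop_self(1)[OF h] comb_def[of _ _ v'] w'_def F.dual_comb[OF h tuple_F] by simp
      finally show ?thesis .
    qed
    have pe: "p = F.wop k v' w'"
    proof
      fix h show "p h = F.wop k v' w' h"
        using pw[of h] by (cases "h \<in> vecs (dual F)") (simp_all add: a(1) F.wop_def)
    qed
    have c2: "norm (x j) \<le> 2 * c' * tnorm F k v' x" if "j < k" for x j
    proof -
      have "tnorm F k v x \<le> (1 + min \<delta> 1) * tnorm F k v' x" using nv by (simp add: near_def)
      also have "\<dots> \<le> 2 * tnorm F k v' x" using nn by (intro mult_right_mono) auto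
      finally have "c' * tnorm F k v x \<le> c' * (2 * tnorm F k v' x)" using c'(1) by (intro mult_left_mono) auto
      then show ?thesis using c'(2)[OF that, of x] by simp
    qed
    have ww: "norm (w' j - w j) \<le> 2 * c' * (1 + b * W) * \<eta>" if j: "j < k" for j
    proof -
      have "nrm F (w' j - w j) \<le> 2 * c' * (1 + b * W) * \<eta>"
      proof (rule F.norming_functional)
        show "0 \<le> 2 * c' * (1 + b * W) * \<eta>" using c'(1) b0 W \<eta> by simp
        fix h assume h: "h \<in> vecs (dual F)"
        let ?n = "nrm (dual F) h"
        have n0: "0 \<le> ?n" by (rule F.dualD(4)[OF h])
        let ?g = "\<lambda>j. h (w' j) - h (w j)"
        have eq: "F.lcomb k v' ?g = (p h - ?T h) + F.lcomb k (\<lambda>j. v j - v' j) (\<lambda>j. h (w j))"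
          unfolding pw[OF h] F.wop_self(1)[OF h] F.comb_diff F.comb_tuple_diff by simp
        have "norm (F.lcomb k (\<lambda>j. v j - v' j) (\<lambda>j. h (w j))) \<le> (\<Sum>j<k. norm (h (w j)) * norm (v j - v' j))"
          using F.nrm_comb_le[OF tuple_F, of k "\<lambda>j. v j - v' j"] by simp
        also have "\<dots> \<le> (\<Sum>j<k. (?n * norm (w j)) * (\<eta> * b))"
          using F.dualD(5)[OF h] vv n0 by (intro sum_mono mult_mono) auto
        also have "\<dots> = \<eta> * (b * W) * ?n" by (simp add: W_def sum_distrib_left sum_distrib_right mult_ac)
        finally have l2: "norm (F.lcomb k (\<lambda>j. v j - v' j) (\<lambda>j. h (w j))) \<le> \<eta> * (b * W) * ?n" .
        have "tnorm F k v' ?g \<le> norm (p h - ?T h) + norm (F.lcomb k (\<lambda>j. v j - v' j) (\<lambda>j. h (w j)))"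
          unfolding tnorm_def using eq norm_triangle_ineq[of "p h - ?T h"] by simp
        then have "tnorm F k v' ?g \<le> \<eta> * (1 + b * W) * ?n" using l2 pT[OF h] by (simp add: algebra_simps)
        then have "2 * c' * tnorm F k v' ?g \<le> 2 * c' * (\<eta> * (1 + b * W) * ?n)"
          using c'(1) by (intro mult_left_mono) auto
        with c2[OF j, of ?g] have "norm (h (w' j) - h (w j)) \<le> 2 * c' * (1 + b * W) * \<eta> * ?n" by (simp add: mult_ac)
        then show "norm (h (w' j - w j)) \<le> 2 * c' * (1 + b * W) * \<eta> * ?n"
          using F.dual_diff[OF h, of "w' j" "w j"] by simp
      qed simp
      then show ?thesis by simp
    qed
    have "tdist F k w w' \<le> (\<Sum>j<k. 2 * c' * (1 + b * W) * \<eta>)"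
      unfolding tdist_def using ww by (intro sum_mono) (simp add: norm_minus_commute)
    also have "\<dots> \<le> \<eta>w" using \<eta>b(2) by (simp add: q_def mult_ac)
    finally have nw: "near \<delta> (tnorm F k w) (tnorm F k w')" by (rule \<eta>w(2))
    have ndw': "nondeg k (tnorm F k w')" using nondeg_near[OF nd(2) nw] \<open>0 < \<delta>\<close> by simp
    have "op_norm (dual F) F p < l" "inv_norm (dual F) F p < l" using p by (simp_all add: Lkw_less_def)
    then have "wadm k l (tnorm F k v') (tnorm F k w')"
      unfolding pe by (rule F.wop_norms_wadm[OF tuple_F ndv' tuple_F ndw' \<open>0 < l\<close>])
    moreover have "near \<delta> (tnorm F k v) (tnorm F k v')" by (rule near_mono[OF nv _ nn nn]) simp
    ultimately show ?thesis using pe nw by blast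
  qed
  with \<eta> show ?thesis by blast
qed

text \<open>The operators on the dual of \<open>En m\<close> are described by the matrices \<open>mat v w\<close>, and these
  form a bounded set.\<close>

definition mat :: "nat \<Rightarrow> 'f vtuple \<Rightarrow> 'f vtuple \<Rightarrow> nat \<times> nat \<Rightarrow> 'f" where
  "mat k v w i = (\<Sum>j<k. coord (v j) (fst i) * coord (w j) (snd i))"

lemma coord_comb: "coord (E.lcomb k v x) a = (\<Sum>j<k. x j * coord (v j) a)"
  by (simp add: comb_def lookup_sum lookup_fs_scale)

lemma mat_bounded:
  "\<exists>r. \<forall>v w i. tuple (En m) k v \<longrightarrow> tuple (En m) k w \<longrightarrow> wadm k l (tnorm E k v) (tnorm E k w) \<longrightarrow> norm (mat k v w i) \<le> r"
proof -
  obtain c where c: "0 < c" "\<And>x i. x \<in> coord_space m \<Longrightarrow> norm (coord x i) \<le> c * \<mu> x"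
    using coordinate_bound by blast
  have "norm (mat k v w i) \<le> c * (l * c)"
    if v: "tuple (En m) k v" and w: "tuple (En m) k w" and adm: "wadm k l (tnorm E k v) (tnorm E k w)" for v w i
  proof -
    obtain a where a: "0 < a" "a < l" "\<And>y b. dominated k (tnorm E k w) y b \<Longrightarrow> tnorm E k v y \<le> a * b"
      using adm unfolding wadm_def by blast
    have inm: "E.lcomb k u x \<in> coord_space m" if "tuple (En m) k u" for u x
      using comb_in_coord_space[of k u m x] that by (simp add: tuple_def)
    let ?y = "\<lambda>j. coord (w j) (snd i)"
    have "dominated k (tnorm E k w) ?y c"
      unfolding dominated_def
    proof (intro conjI allI)
      show "0 \<le> c" using c(1) by simp
      show "norm (\<Sum>j<k. x j * ?y j) \<le> c * tnorm E k w x" for x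
        using c(2)[OF inm[OF w, of x], of "snd i"] unfolding coord_comb by (simp add: tnorm_def)
    qed
    from a(3)[OF this] have t: "tnorm E k v ?y \<le> a * c" .
    have "norm (mat k v w i) = norm (coord (E.lcomb k v ?y) (fst i))"
      unfolding coord_comb mat_def by (simp add: mult.commute)
    also have "\<dots> \<le> c * tnorm E k v ?y" using c(2)[OF inm[OF v]] by (simp add: tnorm_def)
    also have "\<dots> \<le> c * (l * c)"
    proof (rule mult_left_mono)
      have "a * c \<le> l * c" using a(2) c(1) by (intro mult_right_mono) auto
      with t show "tnorm E k v ?y \<le> l * c" by linarith
    qed (use c(1) in simp)
    finally show ?thesis .
  qed
  then show ?thesis by blast
qed

text \<open>The pair itself need not be bounded, because \<open>v\<close> can be scaled against \<open>w\<close>; the matrix is.\<close>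

lemma wop_net:
  fixes \<eta> :: real
  assumes "0 < \<eta>"
  shows "\<exists>B. finite B \<and>
    B \<subseteq> {(v, w). tuple (En m) k v \<and> tuple (En m) k w \<and> wadm k l (tnorm E k v) (tnorm E k w)} \<and>
    (\<forall>v w. tuple (En m) k v \<longrightarrow> tuple (En m) k w \<longrightarrow> wadm k l (tnorm E k v) (tnorm E k w) \<longrightarrow>
      (\<exists>(v', w')\<in>B. \<forall>R0 R1. isom (En m) F R0 \<longrightarrow> isom (En m) F R1 \<longrightarrow>
         op_dist (dual F) F (F.wop k (R0 \<circ> v) (R1 \<circ> w)) (F.wop k (R0 \<circ> v') (R1 \<circ> w')) \<le> \<eta>))"
proof -
  interpret Em: normed_nspace "En m" using En_normed by unfold_locales
  let ?A = "{(v, w). tuple (En m) k v \<and> tuple (En m) k w \<and> wadm k l (tnorm E k v) (tnorm E k w)}"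
  define S where "S = (\<Sum>a<m. \<mu> (unit_vec a))"
  have S: "0 \<le> S" unfolding S_def by (intro sum_nonneg) simp
  define \<eta>' where "\<eta>' = \<eta> / (S * S + 1)"
  have SS: "0 < S * S + 1" using S by (simp add: add_nonneg_pos)
  have \<eta>': "0 < \<eta>'" "\<eta>' * (S * S) \<le> \<eta>"
    using assms SS by (simp_all add: \<eta>'_def pos_divide_le_eq mult_left_mono)
  obtain r where r: "\<And>v w i. tuple (En m) k v \<Longrightarrow> tuple (En m) k w \<Longrightarrow> wadm k l (tnorm E k v) (tnorm E k w) \<Longrightarrow>
      norm (mat k v w i) \<le> r" using mat_bounded by blast
  have "\<exists>B\<subseteq>?A. finite B \<and> (\<forall>T\<in>?A. \<exists>T'\<in>B. \<forall>i\<in>{..<m} \<times> {..<m}.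
      norm (mat k (fst T) (snd T) i - mat k (fst T') (snd T') i) < \<eta>')"
    by (rule finite_net_of_bounded_scalars[where r = r]) (use r \<eta>'(1) in auto)
  then obtain B where B: "B \<subseteq> ?A" "finite B" "\<And>T. T \<in> ?A \<Longrightarrow> \<exists>T'\<in>B. \<forall>i\<in>{..<m} \<times> {..<m}.
      norm (mat k (fst T) (snd T) i - mat k (fst T') (snd T') i) < \<eta>'" by blast
  have value_coord: "coord (Em.wop k v w f) a = (\<Sum>b<m. mat k v w (a, b) * f (unit_vec b))"
    if w: "tuple (En m) k w" and f: "f \<in> vecs (dual (En m))" for v w f a
  proof -
    have "coord (Em.wop k v w f) a = (\<Sum>j<k. f (w j) * coord (v j) a)"
      unfolding Em.wop_self(1)[OF f] using coord_comb[of k v "\<lambda>j. f (w j)" a] by simp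
    also have "\<dots> = (\<Sum>j<k. (\<Sum>b<m. coord (w j) b * f (unit_vec b)) * coord (v j) a)"
    proof (rule sum.cong[OF refl])
      fix j assume "j \<in> {..<k}"
      then have "w j \<in> coord_space m" using w by (simp add: tuple_def)
      then have "w j = Em.lcomb m unit_vec (coord (w j))" using coord_space_comb by simp
      moreover have "tuple (En m) m unit_vec" by (simp add: tuple_def unit_coord)
      ultimately have "f (w j) = (\<Sum>b<m. coord (w j) b * f (unit_vec b))"
        using Em.dual_comb[OF f, of m unit_vec "coord (w j)"] by simp
      then show "f (w j) * coord (v j) a = (\<Sum>b<m. coord (w j) b * f (unit_vec b)) * coord (v j) a" by simp
    qed
    also have "\<dots> = (\<Sum>j<k. \<Sum>b<m. coord (v j) a * coord (w j) b * f (unit_vec b))"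
      by (simp add: sum_distrib_right sum_distrib_left mult_ac)
    also have "\<dots> = (\<Sum>b<m. mat k v w (a, b) * f (unit_vec b))"
      by (subst sum.swap) (simp add: mat_def sum_distrib_right)
    finally show ?thesis .
  qed
  have close: "op_dist (dual F) F (F.wop k (R0 \<circ> v) (R1 \<circ> w)) (F.wop k (R0 \<circ> v') (R1 \<circ> w')) \<le> \<eta>"
    if t: "tuple (En m) k v" "tuple (En m) k w" "tuple (En m) k v'" "tuple (En m) k w'"
      and R: "isom (En m) F R0" "isom (En m) F R1"
      and M: "\<And>i. i \<in> {..<m} \<times> {..<m} \<Longrightarrow> norm (mat k v w i - mat k v' w' i) < \<eta>'" for v w v' w' R0 R1
  proof -
    have "op_dist (dual (En m)) (En m) (Em.wop k v w) (Em.wop k v' w') \<le> \<eta>' * (S * S)"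
    proof (rule Em.op_dist_le)
      show "0 \<le> \<eta>' * (S * S)" using \<eta>'(1) S by simp
      fix f assume f: "f \<in> vecs (dual (En m))"
      let ?n = "nrm (dual (En m)) f"
      let ?D = "Em.wop k v w f - Em.wop k v' w' f"
      have D: "?D \<in> coord_space m" using Em.vecs_diff[OF Em.wop_vecs[OF t(1) f] Em.wop_vecs[OF t(3) f]] by simp
      have fu: "norm (f (unit_vec b)) \<le> ?n * \<mu> (unit_vec b)" if "b < m" for b
        using Em.dualD(5)[OF f, of "unit_vec b"] unit_coord[OF that] by simp
      have cD: "norm (coord ?D a) \<le> \<eta>' * S * ?n" if a: "a < m" for a
      proof -
        have "coord ?D a = (\<Sum>b<m. (mat k v w (a, b) - mat k v' w' (a, b)) * f (unit_vec b))"
          by (simp add: lookup_minus value_coord[OF t(2) f] value_coord[OF t(4) f] left_diff_distrib sum_subtractf)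
        then have "norm (coord ?D a) \<le> (\<Sum>b<m. norm (mat k v w (a, b) - mat k v' w' (a, b)) * norm (f (unit_vec b)))"
          using norm_sum[of "\<lambda>b. (mat k v w (a, b) - mat k v' w' (a, b)) * f (unit_vec b)" "{..<m}"]
          by (simp add: norm_mult)
        also have "\<dots> \<le> (\<Sum>b<m. \<eta>' * (?n * \<mu> (unit_vec b)))"
          using M a fu \<eta>'(1) by (intro sum_mono mult_mono) (auto intro: less_imp_le)
        also have "\<dots> = \<eta>' * S * ?n" by (simp add: S_def sum_distrib_left sum_distrib_right mult_ac)
        finally show ?thesis .
      qed
      have "\<mu> ?D \<le> (\<Sum>a<m. norm (coord ?D a) * \<mu> (unit_vec a))" by (rule coord_space_norm_le[OF D])
      also have "\<dots> \<le> (\<Sum>a<m. (\<eta>' * S * ?n) * \<mu> (unit_vec a))"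
        using cD by (intro sum_mono mult_right_mono) auto
      also have "\<dots> = \<eta>' * (S * S) * ?n" by (simp add: S_def sum_distrib_left sum_distrib_right mult_ac)
      finally show "nrm (En m) ?D \<le> \<eta>' * (S * S) * ?n" by simp
    qed
    moreover have "op_dist (dual F) F (F.wop k (R0 \<circ> v) (R1 \<circ> w)) (F.wop k (R0 \<circ> v') (R1 \<circ> w')) \<le>
        op_dist (dual (En m)) (En m) (Em.wop k v w) (Em.wop k v' w')"
      unfolding Em.conj_wop[OF normed_F R t(1,2), symmetric] Em.conj_wop[OF normed_F R t(3,4), symmetric]
      by (rule Em.conj_op_contraction[OF normed_F R Em.wop_vecs[OF t(1)] Em.wop_bounded[OF t(1,2)]
            Em.wop_vecs[OF t(3)] Em.wop_bounded[OF t(3,4)]])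
    ultimately show ?thesis using \<eta>'(2) by linarith
  qed
  show ?thesis
  proof (intro exI[of _ B] conjI B(1,2) allI impI)
    fix v w assume vw: "tuple (En m) k v" "tuple (En m) k w" "wadm k l (tnorm E k v) (tnorm E k w)"
    then have "(v, w) \<in> ?A" by simp
    from B(3)[OF this] obtain T' where T': "T' \<in> B" "\<And>i. i \<in> {..<m} \<times> {..<m} \<Longrightarrow>
      norm (mat k v w i - mat k (fst T') (snd T') i) < \<eta>'" by auto
    obtain v' w' where e: "T' = (v', w')" by (cases T')
    have t: "tuple (En m) k v'" "tuple (En m) k w'" using T'(1) B(1) e by auto
    have "\<forall>R0 R1. isom (En m) F R0 \<longrightarrow> isom (En m) F R1 \<longrightarrow>
         op_dist (dual F) F (F.wop k (R0 \<circ> v) (R1 \<circ> w)) (F.wop k (R0 \<circ> v') (R1 \<circ> w')) \<le> \<eta>"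
      using close[OF vw(1,2) t] T'(2) unfolding e by simp
    then show "\<exists>(v', w')\<in>B. \<forall>R0 R1. isom (En m) F R0 \<longrightarrow> isom (En m) F R1 \<longrightarrow>
         op_dist (dual F) F (F.wop k (R0 \<circ> v) (R1 \<circ> w)) (F.wop k (R0 \<circ> v') (R1 \<circ> w')) \<le> \<eta>"
      using T'(1) e by blast
  qed
qed

lemma Lkw_less_F:
  assumes "0 < l"
  shows "Lkw_less k l F = {F.wop k v w | v w. wadm k l (tnorm F k v) (tnorm F k w)}"
  unfolding Lkw_less_wop[OF normed_F assms] using tuple_F by blast

lemma weak_star_family:
  assumes "0 < l"
  shows "coloring_family \<mu> s (Lkw_less k l F) (op_dist (dual F) F) (Iso F \<times> Iso F)
     (\<lambda>(g, h) T. conj_op F F g h T) k (wadm k l) (F.wop k)"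
proof -
  let ?M = "Lkw_less k l F" and ?d = "op_dist (dual F) F" and ?act = "\<lambda>(g, h) T. conj_op F F g h T"
  note M_eq = Lkw_less_F[OF assms, of k]
  have Mb: "f \<in> vecs (dual F) \<Longrightarrow> T f \<in> vecs F" "bounded_on (dual F) F T" if TM: "T \<in> ?M" for T f
  proof -
    obtain v w where T: "T = F.wop k v w" using TM unfolding M_eq by blast
    show "f \<in> vecs (dual F) \<Longrightarrow> T f \<in> vecs F" by simp
    show "bounded_on (dual F) F T" unfolding T by (rule F.wop_bounded[OF tuple_F tuple_F])
  qed
  have act: "?act (g, h) (F.wop k v w) = F.wop k (g \<circ> v) (h \<circ> w)" if "g \<in> Iso F" "h \<in> Iso F" for g h v w
    using F.conj_wop[OF normed_F _ _ tuple_F tuple_F, of g h k v w] that by (simp add: Iso_iff)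
  have act1: "\<exists>g\<in>Iso F. \<exists>h\<in>Iso F. \<forall>v w. wadm k l (tnorm F k v) (tnorm F k w) \<longrightarrow>
      ?act \<gamma> (F.wop k v w) = F.wop k (g \<circ> v) (h \<circ> w)" if \<gamma>: "\<gamma> \<in> Iso F \<times> Iso F" for \<gamma>
  proof -
    obtain g h where "\<gamma> = (g, h)" "g \<in> Iso F" "h \<in> Iso F" using \<gamma> by blast
    then show ?thesis using act by blast
  qed
  have act2: "\<exists>\<gamma>\<in>Iso F \<times> Iso F. \<forall>v w. wadm k l (tnorm F k v) (tnorm F k w) \<longrightarrow>
      ?act \<gamma> (F.wop k v w) = F.wop k (g \<circ> v) (h \<circ> w)" if "g \<in> Iso F" "h \<in> Iso F" for g h
    using act[OF that] that by (intro bexI[of _ "(g, h)"]) auto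
  have contract: "?d (?act \<gamma> x) (?act \<gamma> y) \<le> ?d x y" if \<gamma>: "\<gamma> \<in> Iso F \<times> Iso F" and xy: "x \<in> ?M" "y \<in> ?M" for \<gamma> x y
  proof -
    obtain g h where gh: "\<gamma> = (g, h)" "isom F F g" "isom F F h" using \<gamma> by (auto simp: Iso_iff)
    show ?thesis unfolding gh(1) prod.case
      by (rule F.conj_op_contraction[OF normed_F gh(2,3) Mb[OF xy(1)] Mb[OF xy(2)]])
  qed
  have ia: "isometric_action ?M ?d (Iso F \<times> Iso F) ?act"
  proof (rule isometric_actionI[where \<Psi> = "F.wop k" and k = k and adm = "wadm k l"])
    show "?M = {F.wop k v w | v w. wadm k l (tnorm F k v) (tnorm F k w)}" by (rule M_eq)
    fix x y assume xy: "x \<in> ?M" "y \<in> ?M"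
    show "0 \<le> ?d x y" "?d x y = ?d y x"
      using F.op_dist_facts(1,3)[OF F.dualD(4) Mb[OF xy(1)] Mb[OF xy(2)]] by blast+
    fix z assume z: "z \<in> ?M"
    show "?d x z \<le> ?d x y + ?d y z"
      by (rule F.op_dist_triangle[OF F.dualD(4) Mb[OF xy(1)] Mb[OF xy(2)] Mb[OF z]])
  qed (rule act1 act2 contract F.op_dist_self; assumption)+
  show ?thesis
  proof (intro coloring_family.intro coloring_family_axioms.intro ia fraisse_setting_axioms, goal_cases)
    case (1 N0 N1)
    then show ?case by (simp add: wadm_def)
  next
    case a: (2 N0 N1)
    obtain \<delta> where \<delta>: "0 < \<delta>" "\<delta> \<le> 1"
      "\<And>N0' N1'. near \<delta> N0 N0' \<Longrightarrow> near \<delta> N1 N1' \<Longrightarrow> wadm k l N0' N1'" using wadm_local[OF a] by blast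
    define u where "u j = (\<lambda>i. if i = j then 1 else (0::'f))" for j :: nat
    define L where "L = (\<Sum>j<k. 2 * \<bar>N0 (u j)\<bar> + 2 * \<bar>N1 (u j)\<bar>)"
    have L: "2 * \<bar>N0 (u j)\<bar> + 2 * \<bar>N1 (u j)\<bar> \<le> L" if "j < k" for j
      unfolding L_def using that by (intro member_le_sum) auto
    have L0: "0 \<le> L" unfolding L_def by (intro sum_nonneg) simp
    have entry: "nrm F (v j) \<le> 2 * \<bar>N (u j)\<bar>" if "near \<delta> N (tnorm F k v)" "j < k" for N v j
    proof -
      have "nrm F (v j) \<le> (1 + \<delta>) * N (u j)" using F.near_entry_le[OF that] by (simp only: u_def)
      also have "\<dots> \<le> (1 + \<delta>) * \<bar>N (u j)\<bar>" using \<delta>(1) by (intro mult_left_mono) auto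
      also have "\<dots> \<le> 2 * \<bar>N (u j)\<bar>" using \<delta>(2) by (intro mult_right_mono) auto
      finally show ?thesis .
    qed
    have lip: "?d (F.wop k v w) (F.wop k v' w') \<le> L * (tdist F k v v' + tdist F k w w')"
      if n: "near \<delta> N1 (tnorm F k w)" "near \<delta> N0 (tnorm F k v')" for v w v' w'
    proof (rule F.wop_lip[OF tuple_F tuple_F tuple_F tuple_F L0])
      fix j assume j: "j < k"
      show "nrm F (w j) \<le> L" "nrm F (v' j) \<le> L"
        using entry[OF n(1) j] entry[OF n(2) j] L[OF j] by linarith+
    qed
    show ?case
    proof (rule exI[of _ \<delta>], intro exI[of _ L] conjI \<delta>(1) L0 allI impI)
      fix N0' N1' assume "near \<delta> N0 N0'" "near \<delta> N1 N1'"
      then show "wadm k l N0' N1'" by (rule \<delta>(3))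
    next
      fix v w v' w' assume "near \<delta> N1 (tnorm F k w)" "near \<delta> N0 (tnorm F k v')"
      then show "?d (F.wop k v w) (F.wop k v' w') \<le> L * (tdist F k v v' + tdist F k w w')" by (rule lip)
    qed
  next
    case 3
    show ?case by (rule M_eq)
  next
    case (4 \<gamma>)
    then show ?case by (rule act1)
  next
    case (5 g h)
    then show ?case by (rule act2)
  next
    case (6 v w \<delta>)
    then show ?case using wop_lift[OF _ assms] by blast
  next
    case (7 m \<eta>)
    then show ?case by (rule wop_net)
  qed
qed

definition weak_star_factor_in where "weak_star_factor_in k l m K \<epsilon> X \<longleftrightarrow>
  (\<forall>c. lip1 (Lkw_le k l X) (op_dist (dual X) X) K dist c \<longrightarrow>
    (\<exists>R0\<in>Emb (En m) X. \<exists>R1\<in>Emb (En m) X.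
      quot_eps_factor \<epsilon> (Lkw_less k l F) (op_dist (dual F) F) (Iso F \<times> Iso F) (\<lambda>(g, h) T. conj_op F F g h T)
        K c (conj_op (En m) X R0 R1 ` Lkw_less k l (En m))
        (conj_op X F (\<lambda>x. x) (\<lambda>x. x))))"
  for K :: "'k::metric_space set" and X :: "('f, 'b) nspace"

lemma weak_star_factor:
  fixes K :: "'k::metric_space set"
  assumes K: "compact K" and "0 < \<epsilon>" "0 < l"
  shows "\<exists>n0. \<forall>n\<ge>n0. \<forall>\<theta>. isom (En n) F \<theta> \<longrightarrow>
    weak_star_factor_in k l m K \<epsilon> (sub F (\<theta> ` coord_space n))"
proof -
  interpret fam: coloring_family \<mu> s "Lkw_less k l F" "op_dist (dual F) F" "Iso F \<times> Iso F"
     "\<lambda>(g, h) T. conj_op F F g h T" k "wadm k l" "F.wop k"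
    by (rule weak_star_family[OF \<open>0 < l\<close>])
  obtain n0 where n0: "\<And>n \<theta> C. n0 \<le> n \<Longrightarrow> isom (En n) F \<theta> \<Longrightarrow> fam.colors n \<theta> K C \<Longrightarrow> fam.factors m n \<theta> K \<epsilon> C"
    using fam.ramsey_factor[OF K \<open>0 < \<epsilon>\<close>, of m] by blast
  show ?thesis unfolding weak_star_factor_in_def
  proof (intro exI[of _ n0] allI impI)
    fix n \<theta> and c :: "(('b \<Rightarrow> 'f) \<Rightarrow> 'b) \<Rightarrow> 'k"
    assume n: "n0 \<le> n" and \<theta>: "isom (En n) F \<theta>"
    let ?U = "\<theta> ` coord_space n"
    let ?X = "sub F ?U"
    assume c: "lip1 (Lkw_le k l ?X) (op_dist (dual ?X) ?X) K dist c"
    have X: "normed_space ?X" and \<theta>X: "isom (En n) ?X \<theta>" using image_space[OF \<theta>] .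
    interpret X: normed_nspace ?X using X by unfold_locales
    interpret Em: normed_nspace "En m" using En_normed by unfold_locales
    have U: "F.subspace ?U" "?U \<subseteq> vecs F"
      using F.Gr_subspace[OF image_in_Age_std(1)[OF \<theta>]] by blast+
    have iX: "isom ?X F (\<lambda>x. x)" by (simp add: isom_def lin_on_def)
    have AD: "tuple ?X k (\<theta> \<circ> v)" "tuple ?X k (\<theta> \<circ> w)" "X.wop k (\<theta> \<circ> v) (\<theta> \<circ> w) \<in> Lkw_le k l ?X"
      if vw: "(v, w) \<in> fam.AD n" for v w
    proof -
      have v: "tuple (En n) k v" "tuple (En n) k w" "wadm k l (tnorm E k v) (tnorm E k w)"
        using vw by (simp_all add: fam.AD_def)
      show t: "tuple ?X k (\<theta> \<circ> v)" "tuple ?X k (\<theta> \<circ> w)"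
        by (rule isom_En_tuple[OF \<theta>X v(1)], rule isom_En_tuple[OF \<theta>X v(2)])
      have "wadm k l (tnorm ?X k (\<theta> \<circ> v)) (tnorm ?X k (\<theta> \<circ> w))"
        unfolding isom_En_tnorm[OF \<theta>X v(1)] isom_En_tnorm[OF \<theta>X v(2)] by (rule v(3))
      with t have "X.wop k (\<theta> \<circ> v) (\<theta> \<circ> w) \<in> Lkw_less k l ?X"
        unfolding Lkw_less_wop[OF X \<open>0 < l\<close>] by blast
      then show "X.wop k (\<theta> \<circ> v) (\<theta> \<circ> w) \<in> Lkw_le k l ?X" by (simp add: Lkw_less_def Lkw_le_def)
    qed
    have "fam.colors n \<theta> K (\<lambda>v w. c (X.wop k v w))"
      unfolding fam.colors_def
    proof (intro conjI allI impI)
      fix v w assume vw: "(v, w) \<in> fam.AD n"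
      show "c (X.wop k (\<theta> \<circ> v) (\<theta> \<circ> w)) \<in> K" by (rule lip1_mem[OF c AD(3)[OF vw]])
      fix v' w' assume vw': "(v', w') \<in> fam.AD n"
      have "dist (c (X.wop k (\<theta> \<circ> v) (\<theta> \<circ> w))) (c (X.wop k (\<theta> \<circ> v') (\<theta> \<circ> w'))) \<le>
          op_dist (dual ?X) F (X.wop k (\<theta> \<circ> v) (\<theta> \<circ> w)) (X.wop k (\<theta> \<circ> v') (\<theta> \<circ> w'))"
        using lip1_le[OF c AD(3)[OF vw] AD(3)[OF vw']] by simp
      also have "\<dots> \<le> op_dist (dual F) F (F.wop k (\<theta> \<circ> v) (\<theta> \<circ> w)) (F.wop k (\<theta> \<circ> v') (\<theta> \<circ> w'))"
        by (rule F.wop_dist_sub[OF U AD(1,2)[OF vw] AD(1,2)[OF vw']])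
      finally show "dist (c (X.wop k (\<theta> \<circ> v) (\<theta> \<circ> w))) (c (X.wop k (\<theta> \<circ> v') (\<theta> \<circ> w'))) \<le>
          op_dist (dual F) F (F.wop k (\<theta> \<circ> v) (\<theta> \<circ> w)) (F.wop k (\<theta> \<circ> v') (\<theta> \<circ> w'))" .
    qed
    from n0[OF n \<theta> this] obtain R0 R1 h where R: "isom (En m) (En n) R0" "isom (En m) (En n) R1" and
      h: "lip1 fam.Q fam.qd K dist h" and fac: "\<And>v w. (v, w) \<in> fam.AD m \<Longrightarrow>
        dist (c (X.wop k (\<theta> \<circ> R0 \<circ> v) (\<theta> \<circ> R1 \<circ> w))) (h (fam.oc (F.wop k (\<theta> \<circ> R0 \<circ> v) (\<theta> \<circ> R1 \<circ> w)))) \<le> \<epsilon>"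
      unfolding fam.factors_def by blast
    let ?R0 = "restrict (\<theta> \<circ> R0) (coord_space m)" and ?R1 = "restrict (\<theta> \<circ> R1) (coord_space m)"
    have RE: "?R0 \<in> Emb (En m) ?X" "?R1 \<in> Emb (En m) ?X"
      by (rule isom_into_image[OF \<theta> R(1)], rule isom_into_image[OF \<theta> R(2)])
    have "quot_eps_factor \<epsilon> (Lkw_less k l F) (op_dist (dual F) F) (Iso F \<times> Iso F) (\<lambda>(g, h) T. conj_op F F g h T)
          K c (conj_op (En m) ?X ?R0 ?R1 ` Lkw_less k l (En m)) (conj_op ?X F (\<lambda>x. x) (\<lambda>x. x))"
    proof (rule quot_eps_factorI[where c' = h, OF fam.lip1_oc h])
      fix S assume "S \<in> conj_op (En m) ?X ?R0 ?R1 ` Lkw_less k l (En m)"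
      then obtain v w where S: "S = conj_op (En m) ?X ?R0 ?R1 (Em.wop k v w)" and
        v: "tuple (En m) k v" "tuple (En m) k w" "wadm k l (tnorm E k v) (tnorm E k w)"
        unfolding Lkw_less_wop[OF En_normed \<open>0 < l\<close>] by auto
      have AD: "(v, w) \<in> fam.AD m" using v by (simp add: fam.AD_def)
      let ?v = "\<theta> \<circ> R0 \<circ> v" and ?w = "\<theta> \<circ> R1 \<circ> w"
      have wc: "X.wop k (?R0 \<circ> v) (?R1 \<circ> w) = X.wop k ?v ?w"
        unfolding X.wop_def using v(1,2) by (intro restrict_ext comb_cong) (auto simp: tuple_def)
      have Sv: "S = X.wop k ?v ?w"
        unfolding S Em.conj_wop[OF X Emb_isom[OF RE(1)] Emb_isom[OF RE(2)] v(1,2)] wc ..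
      have "isom (En m) ?X (\<theta> \<circ> R0)" "isom (En m) ?X (\<theta> \<circ> R1)"
        using isom_comp[OF \<theta>X R(1)] isom_comp[OF \<theta>X R(2)] .
      then have t: "tuple ?X k ?v" "tuple ?X k ?w" using isom_En_tuple v(1,2) by blast+
      have jS: "conj_op ?X F (\<lambda>x. x) (\<lambda>x. x) S = F.wop k ?v ?w"
        unfolding Sv X.conj_wop[OF normed_F iX iX t] by (simp add: comp_def)
      have i: "isom (En m) F (\<theta> \<circ> R0)" "isom (En m) F (\<theta> \<circ> R1)"
        using isom_comp[OF \<theta> R(1)] isom_comp[OF \<theta> R(2)] .
      show "conj_op ?X F (\<lambda>x. x) (\<lambda>x. x) S \<in> Lkw_less k l F"
        unfolding jS by (rule fam.AD_\<Psi>_M[OF AD i])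
      show "dist (c S) (h (fam.oc (conj_op ?X F (\<lambda>x. x) (\<lambda>x. x) S))) \<le> \<epsilon>"
        unfolding jS unfolding Sv by (rule fac[OF AD])
    qed
    with RE show "\<exists>R0\<in>Emb (En m) ?X. \<exists>R1\<in>Emb (En m) ?X.
        quot_eps_factor \<epsilon> (Lkw_less k l F) (op_dist (dual F) F) (Iso F \<times> Iso F) (\<lambda>(g, h) T. conj_op F F g h T)
          K c (conj_op (En m) ?X R0 R1 ` Lkw_less k l (En m)) (conj_op ?X F (\<lambda>x. x) (\<lambda>x. x))" by blast
  qed
qed

end


section \<open>A common copy for the three kinds of objects\<close>

context fraisse_setting
begin

lemma common_copy:
  fixes K :: "'k::metric_space set"
  assumes "compact K" "0 < \<epsilon>" "0 < l"
  shows "\<exists>X\<in>Age_std \<mu> F. operators_factor_in k l m K \<epsilon> X \<and> subspaces_factor_in k m K \<epsilon> X \<and>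
    weak_star_factor_in k l m K \<epsilon> X"
proof -
  obtain n1 where n1: "\<And>n \<theta>. n1 \<le> n \<Longrightarrow> isom (En n) F \<theta> \<Longrightarrow>
      operators_factor_in k l m K \<epsilon> (sub F (\<theta> ` coord_space n))"
    using operators_factor[OF assms, of k m] by blast
  obtain n2 where n2: "\<And>n \<theta>. n2 \<le> n \<Longrightarrow> isom (En n) F \<theta> \<Longrightarrow>
      subspaces_factor_in k m K \<epsilon> (sub F (\<theta> ` coord_space n))"
    using subspaces_factor[OF assms(1,2), of k m] by blast
  obtain n3 where n3: "\<And>n \<theta>. n3 \<le> n \<Longrightarrow> isom (En n) F \<theta> \<Longrightarrow>
      weak_star_factor_in k l m K \<epsilon> (sub F (\<theta> ` coord_space n))"
    using weak_star_factor[OF assms, of k m] by blast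
  define n where "n = max n1 (max n2 n3)"
  obtain \<theta> where \<theta>: "isom (En n) F \<theta>" using En_embeds by blast
  show ?thesis
    by (rule bexI[OF _ image_in_Age_std(2)[OF \<theta>]]) (intro conjI n1[OF _ \<theta>] n2[OF _ \<theta>] n3[OF _ \<theta>]; simp add: n_def)
qed

end


theorem corollary3p10:
  fixes \<mu> :: "(nat \<Rightarrow>\<^sub>0 'f::real_or_complex) \<Rightarrow> real"
    and s :: "'f \<Rightarrow> 'b::banach \<Rightarrow> 'b"
    and F :: "('f, 'b) nspace"
    and k m :: nat
    and \<epsilon> l :: real
    and K :: "'k::metric_space set"
  assumes "normed_space (seq_space \<mu>)"
    and "SARP_plus (Age (seq_space \<mu>))"
    and "fraisse_limit (seq_space \<mu>) s"
    and "F = banach_nspace s"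
    and "amalgamation_class (Age_std \<mu> F)"
    and "\<epsilon> > 0"
    and "l > 1"
    and "compact K"
  shows "\<exists>X\<in>Age_std \<mu> F.
    (\<forall>c. lip1 (Lk_le k l (fin_seq_space \<mu> k) X) (op_dist (fin_seq_space \<mu> k) X) K dist c \<longrightarrow>
      (\<exists>R\<in>Emb (fin_seq_space \<mu> m) X.
        quot_eps_factor \<epsilon>
          (Lk_less k l (fin_seq_space \<mu> k) F) (op_dist (fin_seq_space \<mu> k) F)
          (Iso F) (\<lambda>g T. compose (vecs (fin_seq_space \<mu> k)) g T)
          K c
          (compose (vecs (fin_seq_space \<mu> k)) R ` Lk_less k l (fin_seq_space \<mu> k) (fin_seq_space \<mu> m))
          (\<lambda>T. T))) \<and>
    (\<forall>c. lip1 (Gr k X) (ball_dist X) K dist c \<longrightarrow>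
      (\<exists>V\<in>Gr m X. sub F V \<in> Age_std \<mu> F \<and>
        quot_eps_factor \<epsilon>
          (Gr k F) (ball_dist F)
          (Iso F) (\<lambda>g U. g ` U)
          K c
          (Gr k (sub F V))
          (\<lambda>U. U))) \<and>
    (\<forall>c. lip1 (Lkw_le k l X) (op_dist (dual X) X) K dist c \<longrightarrow>
      (\<exists>R\<^sub>0\<in>Emb (fin_seq_space \<mu> m) X. \<exists>R\<^sub>1\<in>Emb (fin_seq_space \<mu> m) X.
        quot_eps_factor \<epsilon>
          (Lkw_less k l F) (op_dist (dual F) F)
          (Iso F \<times> Iso F) (\<lambda>(g, h) T. conj_op F F g h T)
          K c
          (conj_op (fin_seq_space \<mu> m) X R\<^sub>0 R\<^sub>1 ` Lkw_less k l (fin_seq_space \<mu> m))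
          (conj_op X F (\<lambda>x. x) (\<lambda>x. x))))"
proof -
  interpret fraisse_setting \<mu> s
    using assms(1-3) by (intro fraisse_setting.intro ramsey_setting.intro ramsey_setting_axioms.intro
        seq_setting.intro fraisse_setting_axioms.intro)
  have "0 < l" using assms(7) by simp
  from common_copy[OF assms(8,6) this, of k m] show ?thesis
    unfolding assms(4) operators_factor_in_def subspaces_factor_in_def weak_star_factor_in_def .
qed

end
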